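(* Let $\Delta\subset\mathbb{R}^n$ be a regular convex polytope whose vertices lie in $\mathbb{Z}^n$ and such that $0$ lies in the interior of $\Delta$. Write $\Delta=\{x: x\cdot u_i+a_i\ge 0,\ i=1,\dots,m\}$, where $m$ is the number of facets, the $u_i$ are primitive lattice vectors and the $a_i$ are positive integers. For $t>0$ and $h=(h_1,\dots,h_m)$ near $0$ let $\Delta_{t,h}=\{x: x\cdot u_i+ta_i+h_i\ge 0,\ i=1,\dots,m\}$. Let $f\in S^r$ be a polyhomogeneous symbol of order $r$, and for $N\in\mathbb{Z}_+$ set $$p(N,f):=\sum_{\ell\in N\cdot\Delta\cap\mathbb{Z}^n}f(\ell),\qquad \tilde{p}(t,h,f):=\int_{\Delta_{t,h}}f(x)\,dx,$$ so that $\tilde p(N,0,f)=\int_{N\cdot\Delta}f(x)\,dx$. Then $p(N,f)-\tilde{p}(N,0,f)$ is a symbol in $N$ and there is a constant $C$ such that it has the asymptotic expansion $$p(N,f)-\tilde{p}(N,0,f)\sim \left.\left(\mathrm{Todd}\left(\frac{\partial}{\partial h}\right)-\mathrm{Id}\right)\tilde{p}(N,h,f)\right|_{h=0}+C,$$ where $\mathrm{Todd}(\partial/\partial h)=\sum_\gamma b_\gamma(\partial/\partial h)^\gamma$ and $\sum_\gamma b_\gamma x^\gamma$ is the Taylor expansion at the origin of $\mathrm{Todd}(x)=\prod_{i=1}^m \frac{x_i}{1-e^{-x_i}}$.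
   Context: A convex lattice polytope $\Delta\subset\mathbb{R}^n$ is regular if the local cone at each vertex can be transformed by an integral unimodular affine transformation into a neighborhood of the origin in the standard orthant $\mathbb{R}^n_+$. A smooth $f$ on $\mathbb{R}^n$ is a symbol of order $r$ if for every multi-index $a$ there is $C_a$ with $|\partial^a f(x)|\le C_a(1+|x|)^{r-|a|}$. A symbol $f_\ell$ is homogeneous of degree $\ell$ if it is a symbol of order $\ell$ and $f_\ell(tx)=t^\ell f_\ell(x)$ for $\|x\|$ sufficiently large and $t\ge1$. $S^r$ denotes the polyhomogeneous symbols of order $r$: smooth $f$ with $f\sim\sum_{\ell\le r}f_\ell$ over a discrete sequence of exponents $\ell$ tending to $-\infty$, with each $f_\ell$ homogeneous of degree $\ell$, meaning that for every $j$, $f(x)-\sum_{\ell=j}^r f_\ell(x)=o(\|x\|^j)$ as $\|x\|\to\infty$. The asymptotic expansion in $N$ is understood term by term: the full infinite-order operator is applied to each homogeneous component $f_\ell$, each order in $N$ receives only finitely many contributions, and the expansion is an asymptotic series in powers of $N$, not an equality. *)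

theory Defs
  imports "HOL-Analysis.Analysis" "HOL-Library.Landau_Symbols"
begin

definition partial_deriv ::
    "'n::finite \<Rightarrow> (real^'n \<Rightarrow> 'b::real_normed_vector) \<Rightarrow> real^'n \<Rightarrow> 'b" where
  "partial_deriv i f x = vector_derivative (\<lambda>s. f (x + s *\<^sub>R axis i 1)) (at 0)"

text \<open>The coordinates are differentiated in some fixed but unspecified order, which is
  immaterial wherever the function is smooth. The value at a point depends only on the
  germ of the function there.\<close>

definition multi_deriv ::
    "('n::finite \<Rightarrow> nat) \<Rightarrow> (real^'n \<Rightarrow> 'b::real_normed_vector) \<Rightarrow> real^'n \<Rightarrow> 'b" where
  "multi_deriv \<alpha> f =
     foldr (\<lambda>i. partial_deriv i ^^ \<alpha> i) (SOME xs. distinct xs \<and> set xs = UNIV) f"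

abbreviation multi_order :: "('n::finite \<Rightarrow> nat) \<Rightarrow> nat" where
  "multi_order \<alpha> \<equiv> (\<Sum>i\<in>UNIV. \<alpha> i)"

primrec times_cont_diff :: "nat \<Rightarrow> (real^'n \<Rightarrow> 'b::real_normed_vector) \<Rightarrow> bool" where
  "times_cont_diff 0 f \<longleftrightarrow> continuous_on UNIV f"
| "times_cont_diff (Suc k) f \<longleftrightarrow>
     f differentiable_on UNIV \<and> (\<forall>i. times_cont_diff k (partial_deriv i f))"

definition smooth :: "(real^'n \<Rightarrow> 'b::real_normed_vector) \<Rightarrow> bool" where
  "smooth f \<longleftrightarrow> (\<forall>k. times_cont_diff k f)"

definition symbol :: "real \<Rightarrow> (real^'n \<Rightarrow> complex) \<Rightarrow> bool" where
  "symbol r f \<longleftrightarrow> smooth f \<and>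
     (\<forall>\<alpha>. \<exists>C. \<forall>x. norm (multi_deriv \<alpha> f x)
                     \<le> C * (1 + norm x) powr (r - real (multi_order \<alpha>)))"

definition homogeneous_symbol :: "real \<Rightarrow> (real^'n \<Rightarrow> complex) \<Rightarrow> bool" where
  "homogeneous_symbol l f \<longleftrightarrow> symbol l f \<and>
     (\<exists>R. \<forall>x t. R \<le> norm x \<longrightarrow> 1 \<le> t \<longrightarrow> f (t *\<^sub>R x) = of_real (t powr l) * f x)"

text \<open>The exponents are a strictly decreasing sequence \<open>e\<close> tending to minus infinity, and
  \<open>F k\<close> is the component of degree \<open>e k\<close>. Finite expansions are included, since
  the zero function is homogeneous of every degree.\<close>

definition polyhomogeneous_expansion ::
    "real \<Rightarrow> (real^'n \<Rightarrow> complex) \<Rightarrow> (nat \<Rightarrow> real) \<Rightarrow> (nat \<Rightarrow> real^'n \<Rightarrow> complex) \<Rightarrow> bool" where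
  "polyhomogeneous_expansion r f e F \<longleftrightarrow>
     e 0 \<le> r \<and> (\<forall>k. e (Suc k) < e k) \<and> filterlim e at_bot sequentially \<and>
     (\<forall>k. homogeneous_symbol (e k) (F k)) \<and>
     (\<forall>j::real. (\<lambda>x. f x - (\<Sum>k\<in>{k. j \<le> e k}. F k x))
                  \<in> o[at_infinity](\<lambda>x. of_real (norm x powr j)))"

definition polyhomogeneous :: "real \<Rightarrow> (real^'n \<Rightarrow> complex) set" where
  "polyhomogeneous r = {f. smooth f \<and> (\<exists>e F. polyhomogeneous_expansion r f e F)}"

text \<open>A function on the positive integers is a symbol if it is the restriction of a symbol
  (of some order) on the real line, here \<open>real^1\<close>.\<close>

definition symbol_in_N :: "(nat \<Rightarrow> complex) \<Rightarrow> bool" where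
  "symbol_in_N g \<longleftrightarrow>
     (\<exists>s. \<exists>G :: real^1 \<Rightarrow> complex. symbol s G \<and> (\<forall>N>0. G (vec (real N)) = g N))"

definition int_lattice :: "(real^'n) set" where
  "int_lattice = {x. \<forall>i. x $ i \<in> \<int>}"

definition primitive_vector :: "real^'n \<Rightarrow> bool" where
  "primitive_vector v \<longleftrightarrow> v \<in> int_lattice \<and>
     (\<forall>w\<in>int_lattice. \<forall>k::int. v = of_int k *\<^sub>R w \<longrightarrow> \<bar>k\<bar> = 1)"

definition unimodular_affine :: "(real^'n \<Rightarrow> real^'n) \<Rightarrow> bool" where
  "unimodular_affine T \<longleftrightarrow>
     (\<exists>A b. (\<forall>i j. A $ i $ j \<in> \<int>) \<and> \<bar>det A\<bar> = 1 \<and> b \<in> int_lattice \<and>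
            T = (\<lambda>x. A *v x + b))"

definition orthant :: "(real^'n) set" where
  "orthant = {x. \<forall>i. 0 \<le> x $ i}"

definition regular_lattice_polytope :: "(real^'n) set \<Rightarrow> bool" where
  "regular_lattice_polytope P \<longleftrightarrow>
     polytope P \<and>
     (\<forall>v. v extreme_point_of P \<longrightarrow> v \<in> int_lattice) \<and>
     (\<forall>v. v extreme_point_of P \<longrightarrow>
        (\<exists>T U. unimodular_affine T \<and> T v = 0 \<and> open U \<and> v \<in> U \<and>
               openin (top_of_set orthant) (T ` (P \<inter> U))))"

definition lattice_sum :: "(real^'n) set \<Rightarrow> nat \<Rightarrow> (real^'n \<Rightarrow> complex) \<Rightarrow> complex" where
  "lattice_sum P N f = (\<Sum>l \<in> (\<lambda>x. real N *\<^sub>R x) ` P \<inter> int_lattice. f l)"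

definition shifted_polytope ::
    "('m \<Rightarrow> real^'n) \<Rightarrow> ('m::finite \<Rightarrow> int) \<Rightarrow> real \<Rightarrow> real^'m \<Rightarrow> (real^'n) set" where
  "shifted_polytope u a t h = {x. \<forall>i. 0 \<le> x \<bullet> u i + t * of_int (a i) + h $ i}"

definition polytope_integral ::
    "('m \<Rightarrow> real^'n) \<Rightarrow> ('m::finite \<Rightarrow> int) \<Rightarrow> real \<Rightarrow> real^'m \<Rightarrow> (real^'n \<Rightarrow> complex) \<Rightarrow> complex"
    where
  "polytope_integral u a t h f = integral (shifted_polytope u a t h) f"

definition todd :: "real^'m::finite \<Rightarrow> real" where
  "todd x = (\<Prod>i\<in>UNIV. if x $ i = 0 then 1 else x $ i / (1 - exp (- (x $ i))))"

definition todd_coeff :: "('m::finite \<Rightarrow> nat) \<Rightarrow> real" where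
  "todd_coeff \<gamma> = multi_deriv \<gamma> todd 0 / (\<Prod>i\<in>UNIV. fact (\<gamma> i))"

definition todd_minus_id_coeff :: "('m::finite \<Rightarrow> nat) \<Rightarrow> real" where
  "todd_minus_id_coeff \<gamma> = todd_coeff \<gamma> - (if \<gamma> = (\<lambda>_. 0) then 1 else 0)"

text \<open>If \<open>F k\<close> is homogeneous of degree \<open>e k\<close> and \<open>\<gamma>\<close> is nonzero, then the
  \<open>\<gamma>\<close>-derivative at \<open>h = 0\<close> of the integral of \<open>F k\<close> is, for large \<open>N\<close>,
  a constant times \<open>N\<close> to the power \<open>e k + n - |\<gamma>|\<close>, because only the values of
  \<open>F k\<close> near the boundary of the dilated polytope enter. (For \<open>\<gamma> = 0\<close> the
  coefficient vanishes.) Hence the terms of order at least \<open>K\<close> in \<open>N\<close> are those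
  indexed by the following set, which is finite when \<open>e\<close> tends to minus infinity.\<close>

definition todd_terms ::
    "'n::finite itself \<Rightarrow> (nat \<Rightarrow> real) \<Rightarrow> real \<Rightarrow> (nat \<times> ('m::finite \<Rightarrow> nat)) set" where
  "todd_terms _ e K = {(k, \<gamma>). K \<le> e k + real CARD('n) - real (multi_order \<gamma>)}"

definition todd_partial_sum ::
    "('m \<Rightarrow> real^'n) \<Rightarrow> ('m::finite \<Rightarrow> int) \<Rightarrow> (nat \<Rightarrow> real) \<Rightarrow>
     (nat \<Rightarrow> real^'n \<Rightarrow> complex) \<Rightarrow> real \<Rightarrow> nat \<Rightarrow> complex" where
  "todd_partial_sum u a e F K N =
     (\<Sum>(k, \<gamma>) \<in> todd_terms TYPE('n) e K.
        of_real (todd_minus_id_coeff \<gamma>) *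
        multi_deriv \<gamma> (\<lambda>h. polytope_integral u a (real N) h (F k)) 0)"

definition has_todd_expansion ::
    "(nat \<Rightarrow> complex) \<Rightarrow> ('m \<Rightarrow> real^'n) \<Rightarrow> ('m::finite \<Rightarrow> int) \<Rightarrow> (nat \<Rightarrow> real) \<Rightarrow>
     (nat \<Rightarrow> real^'n \<Rightarrow> complex) \<Rightarrow> complex \<Rightarrow> bool" where
  "has_todd_expansion g u a e F C \<longleftrightarrow>
     (\<forall>K::real. (\<lambda>N. g N - (todd_partial_sum u a e F K N + C))
                  \<in> o[sequentially](\<lambda>N. of_real (real N powr K)))"

end

theory Submission
  imports Defs
begin

text \<open>For \<open>\<psi>\<close> smooth, a partition of unity reduces the sum of \<open>\<psi>(l / N)\<close> over the lattice points of
  \<open>N \<cdot> \<Delta>\<close> to unimodular cones. The integral of \<open>\<psi>\<close> over a shifted cone is a function of the shifts, and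
  by Taylor's formula \<open>Todd(\<partial>/\<partial>h)\<close>, truncated at order \<open>M\<close>, turns it into a telescoping sum over the
  lattice translates up to \<open>O(N^-(M+1))\<close>.

  A component \<open>F\<close> of degree \<open>l\<close> splits as \<open>F(x) = \<kappa>_N(x) + N^l \<psi>(x / N)\<close> with \<open>\<kappa>_N\<close> supported well inside
  \<open>N \<cdot> \<Delta>\<close>. The defect \<open>c(N)\<close> of the truncated formula for \<open>\<kappa>_N\<close> satisfies \<open>c(pN) - c(N) = O(N^-s)\<close> for
  every \<open>p\<close>; comparing \<open>c(N)\<close> and \<open>c(N')\<close> with \<open>c(N N')\<close> shows that \<open>c\<close> converges at rate \<open>N^-s\<close>. The
  limits, together with that of the remainder of the expansion of \<open>f\<close>, add up to \<open>C\<close>, which does not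
  depend on the expansion because homogeneous components are unique near infinity.

  The resulting expansion in powers of \<open>N\<close> is realised by a symbol on the line by Borel summation; the
  rapidly decreasing error at the integers is interpolated by translates of a bump.\<close>

section \<open>Partial derivatives and smooth functions\<close>

text \<open>The obstacle is the origin: \<open>F\<close> is homogeneous only far out, so rescaling
  by \<open>N\<close> concentrates its inner part at a point instead of producing one fixed smooth
  function. The inner part \<open>\<kappa>_N\<close> stays away from the facets, hence its shift
  derivatives vanish and \<open>c(N)\<close> is just lattice sum minus integral, a quantity that is
  the same at level \<open>N\<close> and at level \<open>p N\<close>. Thus
  \<open>c(p N) - c(N)\<close> is the defect at level \<open>p N\<close> of
  \<open>\<kappa>_(pN) - \<kappa>_N\<close>, and this difference is a combination of two dilates of
  fixed smooth functions. Only differences are ever estimated, so \<open>C\<close> is obtained as a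
  limit and not by a formula.

  Integrality and positivity of the \<open>a i\<close> enter through \<open>a i \<ge> 1\<close>: it
  leaves room around the origin for the inner part, and it bounds shifted polytopes by slightly
  dilated ones.

  On cones, operators in different shift variables are exchanged one by one. The intermediate
  functions depend on \<open>N\<close>, so every derivative bound has to be uniform in
  \<open>N\<close>. The integral over a cone is identified with an iterated antiderivative because
  both are limits of the same Riemann sums.\<close>

lemma has_derivative_line:
  assumes "(f has_derivative f') (at (x + s *\<^sub>R v))"
  shows "((\<lambda>s. f (x + s *\<^sub>R v)) has_vector_derivative f' v) (at s)"
proof -
  have "((\<lambda>s. x + s *\<^sub>R v) has_derivative (\<lambda>t. t *\<^sub>R v)) (at s)"
    by (auto intro!: derivative_eq_intros)
  from has_derivative_compose[OF this assms]
  have "((\<lambda>s. f (x + s *\<^sub>R v)) has_derivative (\<lambda>t. f' (t *\<^sub>R v))) (at s)" .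
  moreover have "(\<lambda>t. f' (t *\<^sub>R v)) = (\<lambda>t. t *\<^sub>R f' v)"
    using has_derivative_bounded_linear[OF assms]
    by (simp add: linear_cmul bounded_linear.linear)
  ultimately show ?thesis by (simp add: has_vector_derivative_def)
qed

lemma partial_deriv_eq:
  assumes "(f has_derivative f') (at x)"
  shows "partial_deriv i f x = f' (axis i 1)"
  unfolding partial_deriv_def
  using has_derivative_line[of f f' x 0 "axis i 1"] assms
  by (simp add: vector_derivative_at)

lemma has_derivative_partial_deriv:
  fixes f :: "real^'n \<Rightarrow> 'b::real_normed_vector"
  assumes "f differentiable (at x)"
  shows "(f has_derivative (\<lambda>v. \<Sum>i\<in>UNIV. v $ i *\<^sub>R partial_deriv i f x)) (at x)"
proof -
  obtain f' where f': "(f has_derivative f') (at x)"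
    using assms by (auto simp: differentiable_def)
  have lin: "linear f'" using f' by (simp add: bounded_linear.linear has_derivative_bounded_linear)
  have "f' v = (\<Sum>i\<in>UNIV. v $ i *\<^sub>R partial_deriv i f x)" for v
  proof -
    have "f' v = f' (\<Sum>i\<in>UNIV. v $ i *\<^sub>R axis i 1)"
      by (metis basis_expansion scalar_mult_eq_scaleR)
    also have "\<dots> = (\<Sum>i\<in>UNIV. v $ i *\<^sub>R f' (axis i 1))"
      by (simp add: linear_sum[OF lin] linear_cmul[OF lin])
    finally show ?thesis by (simp add: partial_deriv_eq[OF f'])
  qed
  then have "f' = (\<lambda>v. \<Sum>i\<in>UNIV. v $ i *\<^sub>R partial_deriv i f x)" by auto
  with f' show ?thesis by simp
qed

lemma partial_deriv_line:
  assumes "f differentiable (at (x + s *\<^sub>R axis i 1))"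
  shows "((\<lambda>s. f (x + s *\<^sub>R axis i 1)) has_vector_derivative partial_deriv i f (x + s *\<^sub>R axis i 1)) (at s)"
proof -
  obtain f' where f': "(f has_derivative f') (at (x + s *\<^sub>R axis i 1))"
    using assms by (auto simp: differentiable_def)
  show ?thesis using has_derivative_line[OF f'] partial_deriv_eq[OF f'] by simp
qed

lemma times_cont_diff_imp_continuous: "times_cont_diff k f \<Longrightarrow> continuous_on UNIV f"
  by (cases k) (auto intro: differentiable_imp_continuous_on)

lemma times_cont_diff_Suc: "times_cont_diff (Suc k) f \<Longrightarrow> times_cont_diff k f"
  by (induction k arbitrary: f) (auto intro: differentiable_imp_continuous_on)

lemma times_cont_diff_SucI:
  assumes "\<And>x. (f has_derivative f' x) (at x)"
    and "\<And>i. times_cont_diff k (\<lambda>x. f' x (axis i 1))"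
  shows "times_cont_diff (Suc k) f"
proof -
  have "partial_deriv i f = (\<lambda>x. f' x (axis i 1))" for i
    using assms(1) partial_deriv_eq by blast
  moreover have "f differentiable_on UNIV"
    using assms(1) differentiable_def by (auto simp: differentiable_on_def)
  ultimately show ?thesis using assms(2) by simp
qed

lemma times_cont_diff_SucD:
  assumes "times_cont_diff (Suc k) f"
  shows "f differentiable (at x)" "times_cont_diff k (partial_deriv i f)"
    "(f has_derivative (\<lambda>v. \<Sum>i\<in>UNIV. v $ i *\<^sub>R partial_deriv i f x)) (at x)"
  using assms has_derivative_partial_deriv[of f x] by (auto simp: differentiable_on_def)

lemma sum_axis_scaleR [simp]:
  "(\<Sum>j\<in>UNIV. (axis i 1 :: real^'n) $ j *\<^sub>R g j) = (g i :: 'b::real_vector)"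
proof -
  have "(\<Sum>j\<in>UNIV. (axis i 1 :: real^'n) $ j *\<^sub>R g j) = (\<Sum>j\<in>UNIV. if j = i then g j else 0)"
    by (intro sum.cong) (auto simp: axis_def)
  then show ?thesis by simp
qed

lemma times_cont_diff_const: "times_cont_diff k (\<lambda>x. c)"
proof (induction k arbitrary: c)
  case (Suc k)
  have "times_cont_diff k (\<lambda>x::real^'a. 0::'b)" by (rule Suc)
  then show ?case by (intro times_cont_diff_SucI[where f' = "\<lambda>_ _. 0"]) (auto intro!: derivative_eq_intros)
qed auto

lemma times_cont_diff_add:
  "times_cont_diff k f \<Longrightarrow> times_cont_diff k g \<Longrightarrow> times_cont_diff k (\<lambda>x. f x + g x)"
proof (induction k arbitrary: f g)
  case (Suc k)
  note f = times_cont_diff_SucD[OF Suc.prems(1)] and g = times_cont_diff_SucD[OF Suc.prems(2)]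
  show ?case
    by (rule times_cont_diff_SucI, rule has_derivative_add[OF f(3) g(3)])
      (simp add: Suc.IH f g)
qed (auto intro: continuous_intros)

lemma times_cont_diff_linear:
  assumes "bounded_linear T"
  shows "times_cont_diff k f \<Longrightarrow> times_cont_diff k (\<lambda>x. T (f x))"
proof (induction k arbitrary: f)
  case 0
  then show ?case by (simp add: bounded_linear.continuous_on[OF assms])
next
  case (Suc k)
  note f = times_cont_diff_SucD[OF Suc.prems]
  show ?case
    by (rule times_cont_diff_SucI, rule bounded_linear.has_derivative[OF assms f(3)])
      (simp add: Suc.IH f)
qed

lemma times_cont_diff_bilinear:
  assumes "bounded_bilinear T"
  shows "times_cont_diff k f \<Longrightarrow> times_cont_diff k g \<Longrightarrow> times_cont_diff k (\<lambda>x. T (f x) (g x))"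
proof (induction k arbitrary: f g)
  case 0
  then show ?case by (simp add: bounded_bilinear.continuous_on[OF assms])
next
  case (Suc k)
  note f = times_cont_diff_SucD[OF Suc.prems(1)] and g = times_cont_diff_SucD[OF Suc.prems(2)]
  have fg: "times_cont_diff k f" "times_cont_diff k g" using Suc.prems times_cont_diff_Suc by blast+
  show ?case
    by (rule times_cont_diff_SucI, rule bounded_bilinear.FDERIV[OF assms f(3) g(3)])
      (simp, intro times_cont_diff_add Suc.IH f g fg)
qed

lemma times_cont_diff_sum:
  "(\<And>i. i \<in> I \<Longrightarrow> times_cont_diff k (f i)) \<Longrightarrow> times_cont_diff k (\<lambda>x. \<Sum>i\<in>I. f i x)"
  by (induction I rule: infinite_finite_induct) (auto intro: times_cont_diff_const times_cont_diff_add)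

lemma times_cont_diff_affine:
  fixes L :: "real^'n \<Rightarrow> real^'p" and f :: "real^'p \<Rightarrow> 'b::real_normed_vector"
  assumes "linear L"
  shows "times_cont_diff k f \<Longrightarrow> times_cont_diff k (\<lambda>x. f (L x + c))"
proof (induction k arbitrary: f)
  case 0
  have "continuous_on UNIV (\<lambda>x. L x + c)"
    using assms by (intro continuous_intros) (auto intro: linear_continuous_on linear_conv_bounded_linear[THEN iffD1])
  then show ?case using 0 by (auto intro: continuous_on_compose2[of UNIV f])
next
  case (Suc k)
  note f = times_cont_diff_SucD[OF Suc.prems]
  have L: "((\<lambda>x. L x + c) has_derivative L) (at x)" for x
    using assms by (auto intro!: derivative_eq_intros simp: linear_conv_bounded_linear bounded_linear_imp_has_derivative)
  show ?case
  proof (rule times_cont_diff_SucI)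
    show "((\<lambda>x. f (L x + c)) has_derivative (\<lambda>v. \<Sum>i\<in>UNIV. L v $ i *\<^sub>R partial_deriv i f (L x + c))) (at x)" for x
      using has_derivative_compose[OF L f(3)] .
    show "times_cont_diff k (\<lambda>x. \<Sum>j\<in>UNIV. L (axis i 1) $ j *\<^sub>R partial_deriv j f (L x + c))" for i
      by (intro times_cont_diff_sum times_cont_diff_linear[OF bounded_linear_scaleR_right] Suc.IH f)
  qed
qed

lemma smooth_imp_differentiable: "smooth f \<Longrightarrow> f differentiable (at x)"
  using times_cont_diff_SucD(1)[of 0 f] by (simp add: smooth_def)

lemma smooth_has_derivative: 
  "smooth f \<Longrightarrow> (f has_derivative (\<lambda>v. \<Sum>i\<in>UNIV. v $ i *\<^sub>R partial_deriv i f x)) (at x)"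
  using has_derivative_partial_deriv smooth_imp_differentiable by blast

lemma smooth_partial_deriv: "smooth f \<Longrightarrow> smooth (partial_deriv i f)"
  using times_cont_diff_SucD(2) unfolding smooth_def by blast

lemma smooth_imp_continuous_on: "smooth f \<Longrightarrow> continuous_on S f"
  unfolding smooth_def using times_cont_diff_imp_continuous continuous_on_subset by blast

lemma smooth_const: "smooth (\<lambda>x. c)"
  by (simp add: smooth_def times_cont_diff_const)

lemma smooth_add: "smooth f \<Longrightarrow> smooth g \<Longrightarrow> smooth (\<lambda>x. f x + g x)"
  by (simp add: smooth_def times_cont_diff_add)

lemma smooth_linear: "bounded_linear T \<Longrightarrow> smooth f \<Longrightarrow> smooth (\<lambda>x. T (f x))"
  by (simp add: smooth_def times_cont_diff_linear)

lemma smooth_diff: "smooth f \<Longrightarrow> smooth g \<Longrightarrow> smooth (\<lambda>x. f x - g x)"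
  using smooth_add[of f "\<lambda>x. - g x"] smooth_linear[OF bounded_linear_minus[OF bounded_linear_ident], of g]
  by simp

lemma smooth_mult:
  fixes f :: "real^'n \<Rightarrow> 'b::real_normed_algebra"
  shows "smooth f \<Longrightarrow> smooth g \<Longrightarrow> smooth (\<lambda>x. f x * g x)"
  by (simp add: smooth_def times_cont_diff_bilinear bounded_bilinear_mult)

lemma smooth_cmult:
  fixes f :: "real^'n \<Rightarrow> 'b::real_normed_algebra"
  shows "smooth f \<Longrightarrow> smooth (\<lambda>x. c * f x)"
  by (intro smooth_mult smooth_const)

lemma smooth_sum: "(\<And>i. i \<in> I \<Longrightarrow> smooth (f i)) \<Longrightarrow> smooth (\<lambda>x. \<Sum>i\<in>I. f i x)"
  by (simp add: smooth_def times_cont_diff_sum)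

lemma smooth_prod:
  fixes f :: "'i \<Rightarrow> real^'n \<Rightarrow> 'b::{real_normed_algebra,comm_ring_1}"
  shows "(\<And>i. i \<in> I \<Longrightarrow> smooth (f i)) \<Longrightarrow> smooth (\<lambda>x. \<Prod>i\<in>I. f i x)"
  by (induction I rule: infinite_finite_induct) (auto intro: smooth_const smooth_mult)

lemma smooth_affine:
  fixes L :: "real^'n \<Rightarrow> real^'p"
  shows "linear L \<Longrightarrow> smooth f \<Longrightarrow> smooth (\<lambda>x. f (L x + c))"
  by (simp add: smooth_def times_cont_diff_affine)

lemma smooth_translate: "smooth f \<Longrightarrow> smooth (\<lambda>x. f (x + c))" for f :: "real^'n \<Rightarrow> 'b::real_normed_vector"
  using smooth_affine[of "\<lambda>x. x" f c] by (simp add: linear_id[unfolded id_def])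

lemma smooth_scale: "smooth f \<Longrightarrow> smooth (\<lambda>x. f (c *\<^sub>R x))" for f :: "real^'n \<Rightarrow> 'b::real_normed_vector"
  using smooth_affine[of "\<lambda>x. c *\<^sub>R x" f 0] by (simp add: linear_scale_self)

text \<open>Serves families given by a formula with parameters, such as antiderivatives or a factor
  times a power, where differentiating a member yields a member with other parameters.\<close>

lemma smooth_coinduct:
  assumes "f \<in> S" and "\<And>g. g \<in> S \<Longrightarrow> g differentiable_on UNIV \<and> (\<forall>i. partial_deriv i g \<in> S)"
  shows "smooth f"
proof -
  have "g \<in> S \<Longrightarrow> times_cont_diff k g" for k g
    by (induction k arbitrary: g) (use assms(2) differentiable_imp_continuous_on in auto)
  then show ?thesis using assms(1) by (simp add: smooth_def)
qed

lemma partial_deriv_const [simp]: "partial_deriv i (\<lambda>x. c) = (\<lambda>x. 0)"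
  by (intro ext partial_deriv_eq[THEN trans]) (auto intro!: derivative_eq_intros)

lemma partial_deriv_add:
  "smooth f \<Longrightarrow> smooth g \<Longrightarrow> partial_deriv i (\<lambda>x. f x + g x) = (\<lambda>x. partial_deriv i f x + partial_deriv i g x)"
  by (rule ext, rule trans[OF partial_deriv_eq[OF has_derivative_add[OF smooth_has_derivative smooth_has_derivative]]]) auto

lemma partial_deriv_linear:
  "bounded_linear T \<Longrightarrow> smooth f \<Longrightarrow> partial_deriv i (\<lambda>x. T (f x)) = (\<lambda>x. T (partial_deriv i f x))"
  by (rule ext, rule trans[OF partial_deriv_eq[OF bounded_linear.has_derivative[OF _ smooth_has_derivative]]]) auto

lemma partial_deriv_diff:
  assumes "smooth f" "smooth g"
  shows "partial_deriv i (\<lambda>x. f x - g x) = (\<lambda>x. partial_deriv i f x - partial_deriv i g x)"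
  by (rule ext, rule trans[OF partial_deriv_eq[OF has_derivative_diff[OF smooth_has_derivative smooth_has_derivative]]])
    (use assms in auto)

lemma partial_deriv_sum:
  "(\<And>j. j \<in> I \<Longrightarrow> smooth (f j)) \<Longrightarrow> partial_deriv i (\<lambda>x. \<Sum>j\<in>I. f j x) = (\<lambda>x. \<Sum>j\<in>I. partial_deriv i (f j) x)"
  by (induction I rule: infinite_finite_induct) (auto simp: partial_deriv_add smooth_sum)

lemma partial_deriv_affine:
  fixes L :: "real^'n \<Rightarrow> real^'p"
  assumes "linear L" "smooth f"
  shows "partial_deriv i (\<lambda>x. f (L x + c)) = (\<lambda>x. \<Sum>j\<in>UNIV. L (axis i 1) $ j *\<^sub>R partial_deriv j f (L x + c))"
proof
  fix x
  have L: "((\<lambda>x. L x + c) has_derivative L) (at x)"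
    using assms by (auto intro!: derivative_eq_intros simp: linear_conv_bounded_linear bounded_linear_imp_has_derivative)
  show "partial_deriv i (\<lambda>x. f (L x + c)) x = (\<Sum>j\<in>UNIV. L (axis i 1) $ j *\<^sub>R partial_deriv j f (L x + c))"
    using partial_deriv_eq[OF has_derivative_compose[OF L smooth_has_derivative[OF assms(2)]]] .
qed

lemma partial_deriv_translate:
  fixes f :: "real^'n \<Rightarrow> 'b::real_normed_vector"
  shows "smooth f \<Longrightarrow> partial_deriv i (\<lambda>x. f (x + c)) = (\<lambda>x. partial_deriv i f (x + c))"
  using partial_deriv_affine[of "\<lambda>x. x" f i c] by (simp add: linear_id[unfolded id_def])

lemma partial_deriv_scale:
  fixes f :: "real^'n \<Rightarrow> 'b::real_normed_vector"
  assumes "smooth f"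
  shows "partial_deriv i (\<lambda>x. f (c *\<^sub>R x)) = (\<lambda>x. c *\<^sub>R partial_deriv i f (c *\<^sub>R x))"
proof -
  have "partial_deriv i (\<lambda>x. f (c *\<^sub>R x)) = (\<lambda>x. \<Sum>j\<in>UNIV. (c *\<^sub>R axis i 1) $ j *\<^sub>R partial_deriv j f (c *\<^sub>R x))"
    using partial_deriv_affine[of "\<lambda>x. c *\<^sub>R x" f i 0] assms by (simp add: linear_scale_self)
  also have "\<dots> = (\<lambda>x. c *\<^sub>R (\<Sum>j\<in>UNIV. (axis i 1 :: real^'n) $ j *\<^sub>R partial_deriv j f (c *\<^sub>R x)))"
    by (simp only: scaleR_sum_right vector_scaleR_component scaleR_scaleR real_scaleR_def)
  finally show ?thesis by simp
qed

lemma partial_deriv_cong_open: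
  assumes "open U" "\<And>x. x \<in> U \<Longrightarrow> f x = g x" "x \<in> U"
  shows "partial_deriv i f x = partial_deriv i g x"
proof -
  have "eventually (\<lambda>s. x + s *\<^sub>R axis i 1 \<in> U) (nhds (0::real))"
  proof -
    have "open ((\<lambda>s::real. x + s *\<^sub>R axis i 1) -` U)"
      by (intro open_vimage assms(1) continuous_intros)
    then show ?thesis unfolding eventually_nhds using assms(3) by (intro exI[of _ "(\<lambda>s::real. x + s *\<^sub>R axis i 1) -` U"]) auto
  qed
  then have "eventually (\<lambda>s. f (x + s *\<^sub>R axis i 1) = g (x + s *\<^sub>R axis i 1)) (nhds 0)"
    by (rule eventually_mono) (use assms in auto)
  then show ?thesis unfolding partial_deriv_def
    by (intro vector_derivative_cong_eq) auto
qed

lemma multi_deriv_cong_open: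
  assumes "open U" "\<And>x. x \<in> U \<Longrightarrow> f x = g x" "x \<in> U"
  shows "multi_deriv \<alpha> f x = multi_deriv \<alpha> g x"
proof -
  have 1: "\<forall>x\<in>U. (partial_deriv i ^^ k) f x = (partial_deriv i ^^ k) g x" if "\<forall>x\<in>U. f x = g x" 
    for f g :: "real^'a \<Rightarrow> 'b" and i k
    using that by (induction k) (auto intro: partial_deriv_cong_open[OF assms(1)])
  have "\<forall>x\<in>U. foldr (\<lambda>i. partial_deriv i ^^ \<alpha> i) xs f x = foldr (\<lambda>i. partial_deriv i ^^ \<alpha> i) xs g x" for xs
    by (induction xs) (use assms(2) 1 in auto)
  then show ?thesis using assms(3) by (simp add: multi_deriv_def)
qed

text \<open>The mean value theorem along \<open>i\<close>, applied to the difference in direction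
  \<open>j\<close>, and then along \<open>j\<close>. The second difference is symmetric in
  \<open>i\<close> and \<open>j\<close>, so both mixed derivatives can be read off from it as
  \<open>h\<close> shrinks.\<close>

lemma mixed_difference_mean_value:
  fixes f :: "real^'n \<Rightarrow> real"
  assumes "smooth f" "h > 0"
  shows "\<exists>p. dist p x \<le> 2 * h \<and>
    f (x + h *\<^sub>R axis i 1 + h *\<^sub>R axis j 1) - f (x + h *\<^sub>R axis i 1) - f (x + h *\<^sub>R axis j 1) + f x
      = h * (h * partial_deriv j (partial_deriv i f) p)"
proof -
  define \<phi> where "\<phi> = (\<lambda>s. f ((x + h *\<^sub>R axis j 1) + s *\<^sub>R axis i 1) - f (x + s *\<^sub>R axis i 1))"
  have sm: "smooth (partial_deriv i f)" using assms smooth_partial_deriv by blast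
  have "(\<phi> has_real_derivative
      partial_deriv i f ((x + h *\<^sub>R axis j 1) + s *\<^sub>R axis i 1) - partial_deriv i f (x + s *\<^sub>R axis i 1)) (at s)" for s
    unfolding \<phi>_def has_real_derivative_iff_has_vector_derivative
    using assms(1) by (intro has_vector_derivative_diff partial_deriv_line smooth_imp_differentiable)
  from MVT2[OF assms(2), of \<phi>, OF this]
  obtain s where s: "0 < s" "s < h" "\<phi> h - \<phi> 0 = h * (partial_deriv i f ((x + h *\<^sub>R axis j 1) + s *\<^sub>R axis i 1)
      - partial_deriv i f (x + s *\<^sub>R axis i 1))" by auto
  have "((\<lambda>t. partial_deriv i f (x + s *\<^sub>R axis i 1 + t *\<^sub>R axis j 1)) has_real_derivative
      partial_deriv j (partial_deriv i f) (x + s *\<^sub>R axis i 1 + t *\<^sub>R axis j 1)) (at t)" for t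
    unfolding has_real_derivative_iff_has_vector_derivative
    using sm by (intro partial_deriv_line smooth_imp_differentiable)
  from MVT2[OF assms(2), of "\<lambda>t. partial_deriv i f (x + s *\<^sub>R axis i 1 + t *\<^sub>R axis j 1)", OF this]
  obtain t where t: "0 < t" "t < h" "partial_deriv i f (x + s *\<^sub>R axis i 1 + h *\<^sub>R axis j 1)
      - partial_deriv i f (x + s *\<^sub>R axis i 1)
      = h * partial_deriv j (partial_deriv i f) (x + s *\<^sub>R axis i 1 + t *\<^sub>R axis j 1)" by auto
  have "x + s *\<^sub>R axis i 1 + t *\<^sub>R axis j 1 - x = s *\<^sub>R axis i 1 + t *\<^sub>R axis j 1" by simp
  then have "dist (x + s *\<^sub>R axis i 1 + t *\<^sub>R axis j 1) x \<le> norm (s *\<^sub>R axis i 1 :: real^'n) + norm (t *\<^sub>R axis j 1 :: real^'n)"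
    by (simp only: dist_norm norm_triangle_ineq)
  also have "\<dots> \<le> 2 * h" using s t by simp
  finally show ?thesis
    using s(3) t(3) by (intro exI[of _ "x + s *\<^sub>R axis i 1 + t *\<^sub>R axis j 1"])
      (simp add: \<phi>_def algebra_simps)
qed

text \<open>For each small step the symmetric second difference gives one point for either order of
  differentiation at which the two mixed derivatives agree; both points tend to \<open>x\<close>.
  The mean value theorem confines this to real values; the complex case splits into real and
  imaginary parts.\<close>

lemma partial_deriv_commute_real:
  fixes f :: "real^'n \<Rightarrow> real"
  assumes "smooth f"
  shows "partial_deriv i (partial_deriv j f) x = partial_deriv j (partial_deriv i f) x"
proof -
  define h where "h = (\<lambda>k. 1 / real (Suc k))"
  have hp: "h k > 0" for k by (simp add: h_def)
  have h0: "(\<lambda>k. 2 * h k) \<longlonglongrightarrow> 0"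
    using LIMSEQ_inverse_real_of_nat unfolding h_def 
    by (intro tendsto_mult_right_zero) (simp add: inverse_eq_divide)
  have "\<exists>p q. dist p x \<le> 2 * h k \<and> dist q x \<le> 2 * h k
     \<and> partial_deriv j (partial_deriv i f) p = partial_deriv i (partial_deriv j f) q" for k
  proof -
    define D where "D = (\<lambda>i j. f (x + h k *\<^sub>R axis i 1 + h k *\<^sub>R axis j 1) - f (x + h k *\<^sub>R axis i 1) - f (x + h k *\<^sub>R axis j 1) + f x)"
    have D: "D i j = D j i" by (simp add: D_def add.commute add.left_commute)
    obtain p where p: "dist p x \<le> 2 * h k" "D i j = h k * (h k * partial_deriv j (partial_deriv i f) p)"
      using mixed_difference_mean_value[OF assms hp[of k], where x=x and i=i and j=j] unfolding D_def by blast
    obtain q where q: "dist q x \<le> 2 * h k" "D j i = h k * (h k * partial_deriv i (partial_deriv j f) q)"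
      using mixed_difference_mean_value[OF assms hp[of k], where x=x and i=j and j=i] unfolding D_def by blast
    have "partial_deriv j (partial_deriv i f) p = partial_deriv i (partial_deriv j f) q"
      using p(2) q(2) D hp[of k] by simp
    then show ?thesis using p(1) q(1) by blast
  qed
  then obtain p q where pq: "\<And>k. dist (p k) x \<le> 2 * h k" "\<And>k. dist (q k) x \<le> 2 * h k"
     "\<And>k. partial_deriv j (partial_deriv i f) (p k) = partial_deriv i (partial_deriv j f) (q k)"
    by metis
  have "p \<longlonglongrightarrow> x" "q \<longlonglongrightarrow> x"
    by (rule metric_tendsto_imp_tendsto[OF h0]; use pq(1,2) hp in \<open>simp add: less_imp_le\<close>)+
  moreover have "isCont (partial_deriv j (partial_deriv i f)) x" "isCont (partial_deriv i (partial_deriv j f)) x"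
    using assms smooth_partial_deriv smooth_imp_continuous_on[of _ UNIV] by (metis continuous_on_eq_continuous_at open_UNIV UNIV_I)+
  ultimately have "(\<lambda>k. partial_deriv j (partial_deriv i f) (p k)) \<longlonglongrightarrow> partial_deriv j (partial_deriv i f) x"
    "(\<lambda>k. partial_deriv i (partial_deriv j f) (q k)) \<longlonglongrightarrow> partial_deriv i (partial_deriv j f) x"
    by (auto intro: isCont_tendsto_compose)
  then show ?thesis using pq(3) LIMSEQ_unique by auto
qed

lemma partial_deriv_commute:
  fixes f :: "real^'n \<Rightarrow> complex"
  assumes "smooth f"
  shows "partial_deriv i (partial_deriv j f) = partial_deriv j (partial_deriv i f)"
proof
  fix x
  have "T (partial_deriv i (partial_deriv j f) x) = T (partial_deriv j (partial_deriv i f) x)"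
    if T: "bounded_linear T" for T :: "complex \<Rightarrow> real"
    using partial_deriv_commute_real[OF smooth_linear[OF T assms], of i j x]
    by (simp add: partial_deriv_linear T assms smooth_partial_deriv)
  from this[OF bounded_linear_Re] this[OF bounded_linear_Im]
  show "partial_deriv i (partial_deriv j f) x = partial_deriv j (partial_deriv i f) x"
    by (simp add: complex_eq_iff)
qed

text \<open>Lists of directions permit induction on the number of derivatives, one at a time;
  \<open>multi_deriv_eq\<close> translates back to multi-indices.\<close>

abbreviation iter_deriv :: "'n::finite list \<Rightarrow> (real^'n \<Rightarrow> 'b::real_normed_vector) \<Rightarrow> real^'n \<Rightarrow> 'b" where
  "iter_deriv ds f \<equiv> foldr partial_deriv ds f"

lemma smooth_iter_deriv: "smooth f \<Longrightarrow> smooth (iter_deriv ds f)"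
  by (induction ds) (auto intro: smooth_partial_deriv)

lemma iter_deriv_const_0 [simp]: "iter_deriv ds (\<lambda>x. 0) = (\<lambda>x. 0)"
  by (induction ds) auto

lemma iter_deriv_add:
  "smooth f \<Longrightarrow> smooth g \<Longrightarrow> iter_deriv ds (\<lambda>x. f x + g x) = (\<lambda>x. iter_deriv ds f x + iter_deriv ds g x)"
  by (induction ds) (auto simp: partial_deriv_add smooth_iter_deriv)

lemma iter_deriv_diff:
  "smooth f \<Longrightarrow> smooth g \<Longrightarrow> iter_deriv ds (\<lambda>x. f x - g x) = (\<lambda>x. iter_deriv ds f x - iter_deriv ds g x)"
  by (induction ds) (auto simp: partial_deriv_diff smooth_iter_deriv)

lemma iter_deriv_linear:
  "bounded_linear T \<Longrightarrow> smooth f \<Longrightarrow> iter_deriv ds (\<lambda>x. T (f x)) = (\<lambda>x. T (iter_deriv ds f x))"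
  by (induction ds) (auto simp: partial_deriv_linear smooth_iter_deriv)

lemmas iter_deriv_scaleR = iter_deriv_linear[OF bounded_linear_scaleR_right]
lemmas smooth_scaleR = smooth_linear[OF bounded_linear_scaleR_right]

lemma iter_deriv_sum:
  "(\<And>j. j \<in> I \<Longrightarrow> smooth (f j)) \<Longrightarrow> iter_deriv ds (\<lambda>x. \<Sum>j\<in>I. f j x) = (\<lambda>x. \<Sum>j\<in>I. iter_deriv ds (f j) x)"
  by (induction ds) (auto simp: partial_deriv_sum smooth_iter_deriv)

lemma iter_deriv_translate:
  fixes f :: "real^'n \<Rightarrow> 'b::real_normed_vector"
  shows "smooth f \<Longrightarrow> iter_deriv ds (\<lambda>x. f (x + c)) = (\<lambda>x. iter_deriv ds f (x + c))"
  by (induction ds) (auto simp: partial_deriv_translate smooth_iter_deriv)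

lemma iter_deriv_translate_minus:
  fixes f :: "real^'n \<Rightarrow> 'b::real_normed_vector"
  shows "smooth f \<Longrightarrow> iter_deriv ds (\<lambda>x. f (x - c)) = (\<lambda>x. iter_deriv ds f (x - c))"
  using iter_deriv_translate[of f ds "-c"] by simp

lemma smooth_translate_minus:
  fixes f :: "real^'n \<Rightarrow> 'b::real_normed_vector"
  shows "smooth f \<Longrightarrow> smooth (\<lambda>x. f (x - c))"
  using smooth_translate[of f "-c"] by simp

lemma iter_deriv_cong_open:
  assumes "open U" "\<And>x. x \<in> U \<Longrightarrow> f x = g x" "x \<in> U"
  shows "iter_deriv ds f x = iter_deriv ds g x"
proof -
  have "\<forall>x\<in>U. iter_deriv ds f x = iter_deriv ds g x"
  proof (induction ds)
    case (Cons d ds)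
    then show ?case using partial_deriv_cong_open[OF assms(1), of "iter_deriv ds f" "iter_deriv ds g"] by simp
  qed (use assms(2) in auto)
  then show ?thesis using assms(3) by blast
qed

lemma iter_deriv_partial_commute:
  fixes f :: "real^'n \<Rightarrow> complex"
  shows "smooth f \<Longrightarrow> iter_deriv ds (partial_deriv i f) = partial_deriv i (iter_deriv ds f)"
  by (induction ds) (auto simp: partial_deriv_commute smooth_iter_deriv)

lemma iter_deriv_commute:
  fixes f :: "real^'n \<Rightarrow> complex"
  shows "smooth f \<Longrightarrow> iter_deriv ds (iter_deriv es f) = iter_deriv es (iter_deriv ds f)"
  by (induction es) (auto simp: iter_deriv_partial_commute smooth_iter_deriv)

text \<open>The same choice term as inside \<open>multi_deriv\<close>, so that both refer to one
  order of the coordinates.\<close>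

definition coord_list :: "'n::finite list" where
  "coord_list = (SOME xs. distinct xs \<and> set xs = UNIV)"

lemma coord_list: "distinct (coord_list :: 'n list)" "set (coord_list :: 'n::finite list) = UNIV"
proof -
  have "\<exists>xs::'n list. distinct xs \<and> set xs = UNIV"
    using finite_distinct_list[of "UNIV::'n set"] by auto
  then have "distinct (coord_list :: 'n list) \<and> set (coord_list :: 'n list) = UNIV"
    unfolding coord_list_def by (rule someI_ex)
  then show "distinct (coord_list :: 'n list)" "set (coord_list :: 'n::finite list) = UNIV" by auto
qed

definition multi_list :: "('n::finite \<Rightarrow> nat) \<Rightarrow> 'n list" where
  "multi_list \<alpha> = concat (map (\<lambda>i. replicate (\<alpha> i) i) coord_list)"

lemma multi_deriv_eq: "multi_deriv \<alpha> f = iter_deriv (multi_list \<alpha>) f"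
proof -
  have "foldr (\<lambda>i. partial_deriv i ^^ \<alpha> i) xs f = iter_deriv (concat (map (\<lambda>i. replicate (\<alpha> i) i) xs)) f" for xs
    by (induction xs) simp_all
  then show ?thesis by (simp add: multi_deriv_def multi_list_def coord_list_def)
qed

lemma length_multi_list: "length (multi_list \<alpha>) = multi_order \<alpha>"
proof -
  have "length (multi_list \<alpha>) = sum_list (map \<alpha> coord_list)"
    by (simp add: multi_list_def length_concat o_def)
  then show ?thesis by (simp add: sum_list_distinct_conv_sum_set coord_list)
qed

section \<open>The Todd series and the Euler-Maclaurin formula in one variable\<close>

definition todd_fps :: "real fps" where
  "todd_fps = fps_X / (1 - fps_exp (-1))"

text \<open>The divisor has subdegree at most 1, so it divides \<open>fps_X\<close> and the quotient
  of power series is exact.\<close>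

lemma todd_fps_mult: "todd_fps * (1 - fps_exp (-1)) = fps_X"
proof -
  have "fps_nth (1 - fps_exp (-1) :: real fps) 1 \<noteq> 0" by (simp add: fps_exp_def)
  then have "(1 - fps_exp (-1) :: real fps) \<noteq> 0" "subdegree (1 - fps_exp (-1) :: real fps) \<le> 1"
    by (auto intro: subdegree_leI)
  then have "(1 - fps_exp (-1) :: real fps) dvd fps_X"
    by (subst fps_dvd_iff) auto
  then show ?thesis unfolding todd_fps_def by (rule dvd_div_mult_self)
qed

text \<open>The coefficients of \<open>1 - exp (- x)\<close>. Formally,
  \<open>G x - G (x - s)\<close> is the sum of \<open>todd_c k * s ^ k\<close> times the
  \<open>k\<close>-th derivative of \<open>G\<close> at \<open>x\<close>.\<close>

definition todd_c :: "nat \<Rightarrow> real" where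
  "todd_c k = (if k = 0 then 0 else - ((-1) ^ k / fact k))"

text \<open>The coefficient form of \<open>todd_fps_mult\<close>: the Todd operator turns a backward
  difference into a first derivative.\<close>

lemma todd_convolution: "(\<Sum>i\<le>k. fps_nth todd_fps i * todd_c (k - i)) = (if k = 1 then 1 else 0)"
proof -
  have "fps_nth (1 - fps_exp (-1) :: real fps) = todd_c"
    by (auto simp: todd_c_def fun_eq_iff)
  then have "(\<Sum>i\<le>k. fps_nth todd_fps i * todd_c (k - i)) = fps_nth (todd_fps * (1 - fps_exp (-1))) k"
    by (simp add: fps_mult_nth atLeast0AtMost)
  then show ?thesis by (simp add: todd_fps_mult fps_X_def)
qed

lemma todd_fps_0: "fps_nth todd_fps 0 = 1"
  using todd_convolution[of 1] by (simp add: todd_c_def)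

lemma vector_derivative_bound:
  fixes f :: "real \<Rightarrow> 'b::real_normed_vector"
  assumes "\<And>x. x \<in> {a..b} \<Longrightarrow> (f has_vector_derivative f' x) (at x)"
    and "\<And>x. x \<in> {a..b} \<Longrightarrow> norm (f' x) \<le> B" and "a \<le> b"
  shows "norm (f b - f a) \<le> B * (b - a)"
proof -
  have "norm (f b - f a) \<le> B * norm (b - a)"
  proof (rule differentiable_bound[of "{a..b}"])
    show "(f has_derivative (\<lambda>t. t *\<^sub>R f' x)) (at x within {a..b})" if "x \<in> {a..b}" for x
      using assms(1)[OF that] unfolding has_vector_derivative_def by (rule has_derivative_at_withinI)
    show "onorm (\<lambda>t. t *\<^sub>R f' x) \<le> B" if "x \<in> {a..b}" for x
      using assms(2)[OF that] by (intro onorm_le) (simp add: mult.commute[of B] mult_left_mono)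
  qed (use assms in auto)
  then show ?thesis using assms(3) by simp
qed

text \<open>Induction on the order: as a function of the step length, the remainder has as
  derivative, up to sign, the remainder of one order less for the next member of the tower
  \<open>G\<close>. The sharper factor \<open>1 / fact n\<close> is given up, since only the power
  of \<open>s\<close> matters.\<close>

lemma taylor_bound:
  fixes G :: "nat \<Rightarrow> real \<Rightarrow> 'b::real_normed_vector"
  assumes "\<And>k x. (G k has_vector_derivative G (Suc k) x) (at x)"
    and "\<And>y. x - s \<le> y \<Longrightarrow> y \<le> x \<Longrightarrow> norm (G n y) \<le> B" and "0 \<le> s"
  shows "norm (G 0 (x - s) - (\<Sum>k<n. ((- s) ^ k / fact k) *\<^sub>R G k x)) \<le> B * s ^ n"
  using assms
proof (induction n arbitrary: G s)
  case 0
  then show ?case by simp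
next
  case (Suc n)
  have B0: "B \<ge> 0" using Suc.prems(2)[of x] Suc.prems(3) by (meson norm_ge_zero order.trans diff_le_eq le_add_same_cancel1 order_refl)
  define r where "r = (\<lambda>\<tau>. G 0 (x - \<tau>) - (\<Sum>k<Suc n. ((- \<tau>) ^ k / fact k) *\<^sub>R G k x))"
  define r' where "r' = (\<lambda>\<tau>. - (G 1 (x - \<tau>) - (\<Sum>k<n. ((- \<tau>) ^ k / fact k) *\<^sub>R G (Suc k) x)))"
  have der: "(r has_vector_derivative r' \<tau>) (at \<tau>)" for \<tau>
  proof -
    have 1: "((\<lambda>\<tau>. G 0 (x - \<tau>)) has_vector_derivative (-1) *\<^sub>R G 1 (x - \<tau>)) (at \<tau>)"
    proof -
      have "((\<lambda>\<tau>. x - \<tau>) has_vector_derivative -1) (at \<tau>)"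
        by (auto intro!: derivative_eq_intros)
      from vector_diff_chain_at[OF this Suc.prems(1)] show ?thesis by (simp add: o_def)
    qed
    have 2: "((\<lambda>\<tau>. ((- \<tau>) ^ Suc k / fact (Suc k)) *\<^sub>R G (Suc k) x) has_vector_derivative
          (- ((- \<tau>) ^ k / fact k)) *\<^sub>R G (Suc k) x) (at \<tau>)" for k
    proof -
      have "((\<lambda>\<tau>. (- \<tau>) ^ Suc k / fact (Suc k)) has_real_derivative - ((- \<tau>) ^ k / fact k)) (at \<tau>)"
      proof -
        have "((\<lambda>\<tau>. (- \<tau>) ^ Suc k / fact (Suc k)) has_real_derivative (real (Suc k) * (- \<tau>) ^ k * (-1)) / fact (Suc k)) (at \<tau>)"
          by (rule derivative_eq_intros refl | simp)+
        moreover have "(real (Suc k) * (- \<tau>) ^ k * (-1)) / fact (Suc k) = - ((- \<tau>) ^ k / fact k)"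
          by (simp del: of_nat_Suc)
        ultimately show ?thesis by simp
      qed
      from has_vector_derivative_scaleR[OF this has_vector_derivative_const[of "G (Suc k) x"]]
      show ?thesis by simp
    qed
    have "((\<lambda>\<tau>. G 0 (x - \<tau>) - (G 0 x + (\<Sum>k<n. ((- \<tau>) ^ Suc k / fact (Suc k)) *\<^sub>R G (Suc k) x)))
       has_vector_derivative (-1) *\<^sub>R G 1 (x - \<tau>) - (0 + (\<Sum>k<n. (- ((- \<tau>) ^ k / fact k)) *\<^sub>R G (Suc k) x))) (at \<tau>)"
      by (intro has_vector_derivative_diff has_vector_derivative_add has_vector_derivative_sum 1 2 has_vector_derivative_const)
    moreover have "r = (\<lambda>\<tau>. G 0 (x - \<tau>) - (G 0 x + (\<Sum>k<n. ((- \<tau>) ^ Suc k / fact (Suc k)) *\<^sub>R G (Suc k) x)))"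
      unfolding r_def by (subst sum.lessThan_Suc_shift) simp
    moreover have "r' \<tau> = (-1) *\<^sub>R G 1 (x - \<tau>) - (0 + (\<Sum>k<n. (- ((- \<tau>) ^ k / fact k)) *\<^sub>R G (Suc k) x))"
      by (simp add: r'_def sum_negf)
    ultimately show ?thesis by simp
  qed
  have bnd: "norm (r' \<tau>) \<le> B * s ^ n" if "\<tau> \<in> {0..s}" for \<tau>
  proof -
    have "norm (G (Suc 0) (x - \<tau>) - (\<Sum>k<n. ((- \<tau>) ^ k / fact k) *\<^sub>R G (Suc k) x)) \<le> B * \<tau> ^ n"
      using Suc.IH[of "\<lambda>k. G (Suc k)" \<tau>] Suc.prems(1,2) that by auto
    also have "\<dots> \<le> B * s ^ n" using that B0 by (intro mult_left_mono power_mono) auto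
    finally show ?thesis unfolding r'_def by (simp only: norm_minus_cancel One_nat_def)
  qed
  have r0: "r 0 = 0" unfolding r_def by (subst sum.lessThan_Suc_shift) simp
  have "norm (r s - r 0) \<le> B * s ^ n * (s - 0)"
    by (rule vector_derivative_bound[OF der bnd Suc.prems(3)])
  then show ?case using r0 by (simp add: r_def mult.commute mult.left_commute)
qed

text \<open>Expanding each difference by Taylor's formula gives a double sum over
  \<open>j + k < M + 2\<close>; collected along its diagonals it is the convolution in
  \<open>todd_convolution\<close>, of which only the term \<open>s *\<^sub>R G 1 x\<close>
  survives.\<close>

lemma todd_step:
  fixes G :: "nat \<Rightarrow> real \<Rightarrow> 'b::real_normed_vector"
  assumes "\<And>k x. (G k has_vector_derivative G (Suc k) x) (at x)"
    and "\<And>y. x - s \<le> y \<Longrightarrow> y \<le> x \<Longrightarrow> norm (G (M + 2) y) \<le> B" and "0 \<le> s"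
  shows "norm ((\<Sum>j\<le>M. (fps_nth todd_fps j * s ^ j) *\<^sub>R (G j x - G j (x - s))) - s *\<^sub>R G 1 x)
     \<le> (\<Sum>j\<le>M. \<bar>fps_nth todd_fps j\<bar>) * B * s ^ (M + 2)"
proof -
  let ?b = "fps_nth todd_fps"
  \<comment> \<open>The length \<open>M + 2 - j\<close> makes every remainder end at the same
    derivative \<open>G (M + 2)\<close>, and the missing powers of \<open>s\<close> are supplied by
    the factor \<open>s ^ j\<close>.\<close>
  define \<rho> where "\<rho> j = G j (x - s) - (\<Sum>k<M+2-j. ((- s) ^ k / fact k) *\<^sub>R G (j + k) x)" for j
  have \<rho>: "norm (\<rho> j) \<le> B * s ^ (M + 2 - j)" if "j \<le> M" for j
    using taylor_bound[of "\<lambda>k. G (j + k)" x s "M + 2 - j" B] assms that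
    by (auto simp: \<rho>_def)
  have diff: "G j x - G j (x - s) = (\<Sum>k<M+2-j. (todd_c k * s ^ k) *\<^sub>R G (j + k) x) - \<rho> j" if "j \<le> M" for j
  proof -
    have "M + 2 - j = Suc (M + 1 - j)" using that by simp
    then show ?thesis unfolding \<rho>_def
      by (simp add: sum.lessThan_Suc_shift todd_c_def power_minus[of s] sum_negf[symmetric] del: sum.lessThan_Suc)
  qed
  let ?T = "\<lambda>j k. (?b j * todd_c k * s ^ (j + k)) *\<^sub>R G (j + k) x"
  have "(\<Sum>j\<le>M. (?b j * s ^ j) *\<^sub>R (\<Sum>k<M+2-j. (todd_c k * s ^ k) *\<^sub>R G (j + k) x)) = (\<Sum>j\<le>M. \<Sum>k<M+2-j. ?T j k)"
    by (simp add: scaleR_sum_right power_add mult_ac)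
  \<comment> \<open>Completes the index set to a full triangle: for \<open>j = M + 1\<close> only
    \<open>k = 0\<close> occurs, and \<open>todd_c 0 = 0\<close>.\<close>
  also have "\<dots> = (\<Sum>j<M+2. \<Sum>k<M+2-j. ?T j k)"
  proof -
    have ext: "sum h {..M} = sum h {..<M+2}" if "h (M + 1) = 0" for h :: "nat \<Rightarrow> 'b"
    proof -
      have "{..<M+2} = insert (M+1) {..M}" by auto
      then show ?thesis using that by simp
    qed
    show ?thesis by (rule ext) (simp add: todd_c_def)
  qed
  also have "\<dots> = (\<Sum>(j,k)\<in>{(j,k). j + k < M + 2}. ?T j k)"
  proof -
    have "{(j,k). j + k < M + 2} = Sigma {..<M+2} (\<lambda>j. {..<M+2-j})" by auto
    then show ?thesis by (simp only:) (rule sum.Sigma, auto)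
  qed
  also have "\<dots> = (\<Sum>l<M+2. \<Sum>i\<le>l. ?T i (l - i))"
    by (rule sum.triangle_reindex)
  also have "\<dots> = (\<Sum>l<M+2. (if l = 1 then s ^ l *\<^sub>R G l x else 0))"
  proof (intro sum.cong refl)
    fix l
    have "(\<Sum>i\<le>l. ?T i (l - i)) = (\<Sum>i\<le>l. (?b i * todd_c (l - i)) *\<^sub>R (s ^ l *\<^sub>R G l x))"
      by (intro sum.cong) auto
    also have "\<dots> = (if l = 1 then s ^ l *\<^sub>R G l x else 0)"
      by (simp only: scaleR_sum_left[symmetric] todd_convolution) simp
    finally show "(\<Sum>i\<le>l. ?T i (l - i)) = (if l = 1 then s ^ l *\<^sub>R G l x else 0)" .
  qed
  also have "\<dots> = s *\<^sub>R G 1 x" by (simp add: sum.delta)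
  finally have main: "(\<Sum>j\<le>M. (?b j * s ^ j) *\<^sub>R (\<Sum>k<M+2-j. (todd_c k * s ^ k) *\<^sub>R G (j + k) x)) = s *\<^sub>R G 1 x" .
  have "(\<Sum>j\<le>M. (?b j * s ^ j) *\<^sub>R (G j x - G j (x - s))) - s *\<^sub>R G 1 x = - (\<Sum>j\<le>M. (?b j * s ^ j) *\<^sub>R \<rho> j)"
  proof -
    have "(\<Sum>j\<le>M. (?b j * s ^ j) *\<^sub>R (G j x - G j (x - s))) =
      (\<Sum>j\<le>M. (?b j * s ^ j) *\<^sub>R (\<Sum>k<M+2-j. (todd_c k * s ^ k) *\<^sub>R G (j + k) x) - (?b j * s ^ j) *\<^sub>R \<rho> j)"
      by (intro sum.cong refl) (simp add: diff scaleR_diff_right)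
    then show ?thesis by (simp only: sum_subtractf main) simp
  qed
  then have "norm ((\<Sum>j\<le>M. (?b j * s ^ j) *\<^sub>R (G j x - G j (x - s))) - s *\<^sub>R G 1 x) = norm (\<Sum>j\<le>M. (?b j * s ^ j) *\<^sub>R \<rho> j)"
    by simp
  also have "\<dots> \<le> (\<Sum>j\<le>M. \<bar>?b j\<bar> * (B * s ^ (M + 2)))"
  proof (rule sum_norm_le)
    fix j assume j: "j \<in> {..M}"
    have "norm ((?b j * s ^ j) *\<^sub>R \<rho> j) \<le> (\<bar>?b j\<bar> * s ^ j) * (B * s ^ (M + 2 - j))"
      using \<rho>[of j] j assms(3) by (simp add: abs_mult mult_left_mono)
    also have "\<dots> = \<bar>?b j\<bar> * (B * (s ^ j * s ^ (M + 2 - j)))" by (simp add: mult_ac)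
    also have "s ^ j * s ^ (M + 2 - j) = s ^ (M + 2)" using j by (simp flip: power_add)
    finally show "norm ((?b j * s ^ j) *\<^sub>R \<rho> j) \<le> \<bar>?b j\<bar> * (B * s ^ (M + 2))" .
  qed
  also have "\<dots> = (\<Sum>j\<le>M. \<bar>?b j\<bar>) * (B * s ^ (M + 2))" by (rule sum_distrib_right[symmetric])
  finally show ?thesis by (simp only: mult.assoc)
qed

text \<open>Adds \<open>todd_step\<close> over \<open>Z\<close> consecutive steps; the differences
  telescope down to a point where the whole tower vanishes. With \<open>Z\<close> of size
  \<open>1 / s\<close> one power of \<open>s\<close> is lost.\<close>

lemma todd_telescope:
  fixes G :: "nat \<Rightarrow> real \<Rightarrow> 'b::real_normed_vector"
  assumes "\<And>k x. (G k has_vector_derivative G (Suc k) x) (at x)"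
    and "\<And>y. y \<le> x \<Longrightarrow> norm (G (M + 2) y) \<le> B" and "0 \<le> s"
    and "\<And>j. G j (x - real Z * s) = 0"
  shows "norm ((\<Sum>j\<le>M. (fps_nth todd_fps j * s ^ j) *\<^sub>R G j x) - s *\<^sub>R (\<Sum>z<Z. G 1 (x - real z * s)))
     \<le> real Z * ((\<Sum>j\<le>M. \<bar>fps_nth todd_fps j\<bar>) * B * s ^ (M + 2))"
proof -
  let ?c = "\<lambda>j. fps_nth todd_fps j * s ^ j"
  let ?R = "\<lambda>y. (\<Sum>j\<le>M. ?c j *\<^sub>R (G j y - G j (y - s))) - s *\<^sub>R G 1 y"
  have tel: "G j x = (\<Sum>z<Z. G j (x - real z * s) - G j (x - real z * s - s))" for j
  proof -
    have "(\<Sum>z<n. G j (x - real z * s) - G j (x - real z * s - s)) = G j x - G j (x - real n * s)" for n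
      by (induction n) (auto simp: algebra_simps)
    then show ?thesis using assms(4) by simp
  qed
  have "(\<Sum>j\<le>M. ?c j *\<^sub>R G j x) - s *\<^sub>R (\<Sum>z<Z. G 1 (x - real z * s))
     = (\<Sum>z<Z. ?R (x - real z * s))"
  proof -
    have "(\<Sum>j\<le>M. ?c j *\<^sub>R G j x) = (\<Sum>j\<le>M. \<Sum>z<Z. ?c j *\<^sub>R (G j (x - real z * s) - G j (x - real z * s - s)))"
      by (subst tel) (simp add: scaleR_sum_right)
    also have "\<dots> = (\<Sum>z<Z. \<Sum>j\<le>M. ?c j *\<^sub>R (G j (x - real z * s) - G j (x - real z * s - s)))"
      by (rule sum.swap)
    finally show ?thesis by (simp only: sum_subtractf scaleR_sum_right)
  qed
  also have "norm \<dots> \<le> (\<Sum>z<Z. (\<Sum>j\<le>M. \<bar>fps_nth todd_fps j\<bar>) * B * s ^ (M + 2))"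
  proof (rule sum_norm_le)
    fix z
    have "real z * s \<ge> 0" using assms(3) by simp
    then show "norm (?R (x - real z * s)) \<le> (\<Sum>j\<le>M. \<bar>fps_nth todd_fps j\<bar>) * B * s ^ (M + 2)"
      by (intro todd_step assms(1,2,3)) linarith+
  qed
  finally show ?thesis by simp
qed

section \<open>Euler--Maclaurin formula on the orthant\<close>

definition todd_op :: "nat \<Rightarrow> nat \<Rightarrow> 'm::finite \<Rightarrow> (real^'m \<Rightarrow> complex) \<Rightarrow> real^'m \<Rightarrow> complex" where
  "todd_op M N i \<Psi> = (\<lambda>h. \<Sum>j\<le>M. (fps_nth todd_fps j * (1 / real N) ^ j) *\<^sub>R iter_deriv (replicate j i) \<Psi> h)"

text \<open>In effect an infinite sum over translates: for \<open>h $ i \<le> 0\<close> the omitted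
  ones have \<open>i\<close>-th coordinate at most \<open>- (B + 1)\<close>, below the support bound
  \<open>- B\<close> of the functions considered.\<close>

definition sum_op :: "nat \<Rightarrow> nat \<Rightarrow> 'm::finite \<Rightarrow> (real^'m \<Rightarrow> complex) \<Rightarrow> real^'m \<Rightarrow> complex" where
  "sum_op B N i \<Psi> = (\<lambda>h. (1 / real N) *\<^sub>R (\<Sum>z<N * (B + 1). partial_deriv i \<Psi> (h - (real z / real N) *\<^sub>R axis i 1)))"

lemma smooth_todd_op: "smooth \<Psi> \<Longrightarrow> smooth (todd_op M N i \<Psi>)"
  unfolding todd_op_def by (intro smooth_sum smooth_scaleR smooth_iter_deriv)

lemma smooth_sum_op: "smooth \<Psi> \<Longrightarrow> smooth (sum_op B N i \<Psi>)"
  unfolding sum_op_def by (intro smooth_sum smooth_scaleR smooth_translate_minus smooth_partial_deriv)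

lemma iter_deriv_todd_op:
  assumes "smooth \<Psi>"
  shows "iter_deriv ds (todd_op M N i \<Psi>) = todd_op M N i (iter_deriv ds \<Psi>)"
  unfolding todd_op_def using assms
  by (subst iter_deriv_sum)
    (simp_all only: iter_deriv_scaleR smooth_iter_deriv smooth_scaleR iter_deriv_commute[of _ ds])

lemma iter_deriv_sum_op:
  assumes "smooth \<Psi>"
  shows "iter_deriv ds (sum_op B N i \<Psi>) = sum_op B N i (iter_deriv ds \<Psi>)"
  unfolding sum_op_def using assms
  by (subst iter_deriv_scaleR, intro smooth_sum smooth_translate_minus smooth_partial_deriv, assumption)
    (simp add: iter_deriv_sum smooth_translate_minus smooth_partial_deriv iter_deriv_translate_minus iter_deriv_partial_commute)

lemma todd_op_0 [simp]: "todd_op M N i (\<lambda>x. 0) = (\<lambda>x. 0)"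
  by (simp add: todd_op_def del: foldr_replicate)

lemma sum_op_0 [simp]: "sum_op B N i (\<lambda>x. 0) = (\<lambda>x. 0)"
  by (simp add: sum_op_def)

lemma open_halfspace_component: "open {h::real^'m::finite. h $ i < c}"
  by (intro open_Collect_less continuous_intros)

lemma iter_deriv_halfspace_zero:
  assumes "\<And>h. h $ i < c \<Longrightarrow> \<Psi> h = 0" "h $ i < c"
  shows "iter_deriv ds \<Psi> h = 0"
  using iter_deriv_cong_open[OF open_halfspace_component[of i c], of \<Psi> "\<lambda>_. 0" h ds] assms by simp

text \<open>This is \<open>todd_telescope\<close> on the line through \<open>h\<close> in direction
  \<open>i\<close>, with step \<open>1 / N\<close> and \<open>N * (B + 1)\<close> steps; the number
  of steps turns the exponent \<open>M + 2\<close> into \<open>M + 1\<close>.\<close>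

lemma todd_op_minus_sum_op:
  assumes sm: "smooth \<Psi>" and N: "N \<ge> 1" and z: "\<And>h. h $ i < - real B \<Longrightarrow> \<Psi> h = 0"
    and C: "\<And>h. (\<forall>i. h $ i \<le> 0) \<Longrightarrow> norm (iter_deriv (replicate (M + 2) i) \<Psi> h) \<le> C"
    and h: "\<forall>i. h $ i \<le> 0"
  shows "norm (todd_op M N i \<Psi> h - sum_op B N i \<Psi> h)
    \<le> (real B + 1) * (\<Sum>j\<le>M. \<bar>fps_nth todd_fps j\<bar>) * C * (1 / real N) ^ (M + 1)"
proof -
  define G where "G k t = iter_deriv (replicate k i) \<Psi> (h + t *\<^sub>R axis i 1)" for k t
  have "(G k has_vector_derivative G (Suc k) x) (at x)" for k x
    unfolding G_def using partial_deriv_line[OF smooth_imp_differentiable[OF smooth_iter_deriv[OF sm]]]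
    by (simp del: foldr_replicate)
  moreover have "norm (G (M + 2) y) \<le> C" if "y \<le> 0" for y
    unfolding G_def using that h by (intro C) (auto simp: axis_def add_nonpos_nonpos)
  moreover have "G j (0 - real (N * (B + 1)) * (1 / real N)) = 0" for j
    unfolding G_def
  proof (rule iter_deriv_halfspace_zero[where i = i and c = "- real B"])
    \<comment> \<open>The steps cover the length \<open>B + 1\<close>, one unit more than the
      support bound, which makes the inequality strict.\<close>
    show "(h + (0 - real (N * (B + 1)) * (1 / real N)) *\<^sub>R axis i 1) $ i < - real B"
    proof -
      have "real (N * (B + 1)) * (1 / real N) = real B + 1" using N by (simp add: field_simps)
      then show ?thesis using h[rule_format, of i] by (simp add: axis_def)
    qed
  qed (use z in auto)
  ultimately have "norm ((\<Sum>j\<le>M. (fps_nth todd_fps j * (1 / real N) ^ j) *\<^sub>R G j 0)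
      - (1 / real N) *\<^sub>R (\<Sum>z<N * (B + 1). G 1 (0 - real z * (1 / real N))))
     \<le> real (N * (B + 1)) * ((\<Sum>j\<le>M. \<bar>fps_nth todd_fps j\<bar>) * C * (1 / real N) ^ (M + 2))"
    by (intro todd_telescope) auto
  also have "(\<Sum>j\<le>M. (fps_nth todd_fps j * (1 / real N) ^ j) *\<^sub>R G j 0) = todd_op M N i \<Psi> h"
    by (simp add: G_def todd_op_def del: foldr_replicate)
  also have "(1 / real N) *\<^sub>R (\<Sum>z<N * (B + 1). G 1 (0 - real z * (1 / real N))) = sum_op B N i \<Psi> h"
    by (simp add: G_def sum_op_def)
  also have "real (N * (B + 1)) * ((\<Sum>j\<le>M. \<bar>fps_nth todd_fps j\<bar>) * C * (1 / real N) ^ (M + 2))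
     = (real B + 1) * (\<Sum>j\<le>M. \<bar>fps_nth todd_fps j\<bar>) * C * (1 / real N) ^ (M + 1)"
    using N by (simp add: power_add power2_eq_square field_simps)
  finally show ?thesis .
qed

text \<open>This class is stable under the one-variable Todd and summation operators, so they can be exchanged
  for each other one variable at a time, with errors uniform in \<open>N\<close>. \<open>J\<close> is the set of facets that are
  active locally.\<close>

definition em_family :: "'m set \<Rightarrow> nat \<Rightarrow> (nat \<Rightarrow> real^'m::finite \<Rightarrow> complex) \<Rightarrow> bool" where
  "em_family J B \<Psi> \<longleftrightarrow>
     (\<forall>N. smooth (\<Psi> N)) \<and>
     (\<forall>N. \<forall>i\<in>J. \<forall>h. h $ i < - real B \<longrightarrow> \<Psi> N h = 0) \<and>
     (\<forall>N. \<forall>i. i \<notin> J \<longrightarrow> partial_deriv i (\<Psi> N) = (\<lambda>h. 0)) \<and>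
     (\<forall>ds. \<exists>C. \<forall>N\<ge>1. \<forall>h. (\<forall>i. h $ i \<le> 0) \<longrightarrow> norm (iter_deriv ds (\<Psi> N) h) \<le> C)"

lemma em_familyD:
  assumes "em_family J B \<Psi>"
  shows "smooth (\<Psi> N)" "i \<in> J \<Longrightarrow> h $ i < - real B \<Longrightarrow> \<Psi> N h = 0"
    "i \<notin> J \<Longrightarrow> partial_deriv i (\<Psi> N) = (\<lambda>h. 0)"
    "\<exists>C. \<forall>N\<ge>1. \<forall>h. (\<forall>i. h $ i \<le> 0) \<longrightarrow> norm (iter_deriv ds (\<Psi> N) h) \<le> C"
  using assms unfolding em_family_def by blast+

lemma em_family_add:
  assumes "em_family J B \<Phi>" "em_family J B \<Psi>"
  shows "em_family J B (\<lambda>N h. \<Phi> N h + \<Psi> N h)"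
  unfolding em_family_def
proof (intro conjI allI ballI impI)
  note \<Phi> = em_familyD[OF assms(1)] and \<Psi> = em_familyD[OF assms(2)]
  show "smooth (\<lambda>h. \<Phi> N h + \<Psi> N h)" for N by (intro smooth_add \<Phi> \<Psi>)
  show "\<Phi> N h + \<Psi> N h = 0" if "i \<in> J" "h $ i < - real B" for N i h using \<Phi>(2) \<Psi>(2) that by simp
  show "partial_deriv i (\<lambda>h. \<Phi> N h + \<Psi> N h) = (\<lambda>h. 0)" if "i \<notin> J" for N i
    using \<Phi>(1,3) \<Psi>(1,3) that by (simp add: partial_deriv_add)
  fix ds
  obtain C D where "\<forall>N\<ge>1. \<forall>h. (\<forall>i. h $ i \<le> 0) \<longrightarrow> norm (iter_deriv ds (\<Phi> N) h) \<le> C"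
    "\<forall>N\<ge>1. \<forall>h. (\<forall>i. h $ i \<le> 0) \<longrightarrow> norm (iter_deriv ds (\<Psi> N) h) \<le> D"
    using \<Phi>(4) \<Psi>(4) by metis
  then show "\<exists>C. \<forall>N\<ge>1. \<forall>h. (\<forall>i. h $ i \<le> 0) \<longrightarrow> norm (iter_deriv ds (\<lambda>h. \<Phi> N h + \<Psi> N h) h) \<le> C"
    using \<Phi>(1) \<Psi>(1)
    by (intro exI[of _ "C + D"]) (auto simp: iter_deriv_add intro!: norm_triangle_mono)
qed

text \<open>The powers of \<open>1 / N\<close> are at most 1, so finitely many uniformly bounded
  derivatives give a uniformly bounded combination.\<close>

lemma em_family_todd_op:
  assumes "em_family J B \<Psi>"
  shows "em_family J B (\<lambda>N. todd_op M N i (\<Psi> N))"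
  unfolding em_family_def
proof (intro conjI allI ballI impI)
  note \<Psi> = em_familyD[OF assms(1)]
  show "smooth (todd_op M N i (\<Psi> N))" for N by (intro smooth_todd_op \<Psi>)
  show "todd_op M N i (\<Psi> N) h = 0" if "k \<in> J" "h $ k < - real B" for N k h
  proof -
    have "iter_deriv ds (\<Psi> N) h = 0" for ds
      using iter_deriv_halfspace_zero[OF \<Psi>(2)[OF that(1)] that(2)] .
    then show ?thesis unfolding todd_op_def by (simp del: foldr_replicate)
  qed
  show "partial_deriv k (todd_op M N i (\<Psi> N)) = (\<lambda>h. 0)" if "k \<notin> J" for N k
    using iter_deriv_todd_op[OF \<Psi>(1), of "[k]" M N i N] \<Psi>(3)[OF that] by simp
  fix ds
  have "\<forall>j. \<exists>C. \<forall>N\<ge>1. \<forall>h. (\<forall>i. h $ i \<le> 0) \<longrightarrow> norm (iter_deriv (replicate j i @ ds) (\<Psi> N) h) \<le> C"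
    using \<Psi>(4) by blast
  then obtain C where C: "\<And>j N h. N \<ge> 1 \<Longrightarrow> (\<forall>i. h $ i \<le> 0) \<Longrightarrow> norm (iter_deriv (replicate j i @ ds) (\<Psi> N) h) \<le> C j"
    by metis
  show "\<exists>C. \<forall>N\<ge>1. \<forall>h. (\<forall>i. h $ i \<le> 0) \<longrightarrow> norm (iter_deriv ds (todd_op M N i (\<Psi> N)) h) \<le> C"
  proof (intro exI[of _ "\<Sum>j\<le>M. \<bar>fps_nth todd_fps j\<bar> * C j"] allI impI)
    fix N h assume N: "1 \<le> (N::nat)" and h: "\<forall>i. (h::real^'a) $ i \<le> 0"
    show "norm (iter_deriv ds (todd_op M N i (\<Psi> N)) h) \<le> (\<Sum>j\<le>M. \<bar>fps_nth todd_fps j\<bar> * C j)"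
      unfolding iter_deriv_todd_op[OF \<Psi>(1)] unfolding todd_op_def
    proof (rule sum_norm_le)
      fix j
      have "(1 / real N) ^ j \<le> 1" using N by (intro power_le_one) auto
      then have "\<bar>fps_nth todd_fps j * (1 / real N) ^ j\<bar> \<le> \<bar>fps_nth todd_fps j\<bar>"
        by (simp add: abs_mult mult_left_le)
      moreover have "norm (iter_deriv (replicate j i) (iter_deriv ds (\<Psi> N)) h) \<le> C j"
        using C[OF N h, of j] by (simp del: foldr_replicate)
      ultimately show "norm ((fps_nth todd_fps j * (1 / real N) ^ j) *\<^sub>R iter_deriv (replicate j i) (iter_deriv ds (\<Psi> N)) h)
          \<le> \<bar>fps_nth todd_fps j\<bar> * C j"
        unfolding norm_scaleR by (intro mult_mono) auto
    qed
  qed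
qed

text \<open>The weight \<open>1 / N\<close> compensates the \<open>N * (B + 1)\<close> summands. The
  translates only lower coordinates, which is why bounds on nonpositive \<open>h\<close>
  suffice.\<close>

lemma em_family_sum_op:
  assumes "em_family J B \<Psi>"
  shows "em_family J B (\<lambda>N. sum_op B N i (\<Psi> N))"
  unfolding em_family_def
proof (intro conjI allI ballI impI)
  note \<Psi> = em_familyD[OF assms(1)]
  show "smooth (sum_op B N i (\<Psi> N))" for N by (intro smooth_sum_op \<Psi>)
  have le: "(h - (real z / real N) *\<^sub>R axis i 1) $ k \<le> h $ k" for h :: "real^'a" and z N k
    by (auto simp: axis_def)
  show "sum_op B N i (\<Psi> N) h = 0" if "k \<in> J" "h $ k < - real B" for N k h
  proof -
    have "partial_deriv i (\<Psi> N) (h - (real z / real N) *\<^sub>R axis i 1) = 0" for z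
    proof -
      have "(h - (real z / real N) *\<^sub>R axis i 1) $ k < - real B"
        using le[where h=h and z=z and N=N and k=k] that(2) by simp
      from iter_deriv_halfspace_zero[OF \<Psi>(2)[OF that(1)] this, where ds = "[i]"] show ?thesis by simp
    qed
    then show ?thesis unfolding sum_op_def by simp
  qed
  show "partial_deriv k (sum_op B N i (\<Psi> N)) = (\<lambda>h. 0)" if "k \<notin> J" for N k
    using iter_deriv_sum_op[OF \<Psi>(1), of "[k]" B N i N] \<Psi>(3)[OF that] by simp
  fix ds
  obtain C where C: "\<And>N h. N \<ge> 1 \<Longrightarrow> (\<forall>i. h $ i \<le> 0) \<Longrightarrow> norm (iter_deriv (i # ds) (\<Psi> N) h) \<le> C"
    using \<Psi>(4) by metis
  show "\<exists>C. \<forall>N\<ge>1. \<forall>h. (\<forall>i. h $ i \<le> 0) \<longrightarrow> norm (iter_deriv ds (sum_op B N i (\<Psi> N)) h) \<le> C"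
  proof (intro exI[of _ "(real B + 1) * C"] allI impI)
    fix N h assume N: "1 \<le> (N::nat)" and h: "\<forall>i. (h::real^'a) $ i \<le> 0"
    have "norm (\<Sum>z<N * (B + 1). partial_deriv i (iter_deriv ds (\<Psi> N)) (h - (real z / real N) *\<^sub>R axis i 1)) \<le> (\<Sum>z<N * (B + 1). C)"
    proof (rule sum_norm_le)
      fix z
      show "norm (partial_deriv i (iter_deriv ds (\<Psi> N)) (h - (real z / real N) *\<^sub>R axis i 1)) \<le> C"
      proof -
        have "\<forall>k. (h - (real z / real N) *\<^sub>R axis i 1) $ k \<le> 0"
          using h le[where h=h and z=z and N=N] order.trans by blast
        from C[OF N this] show ?thesis by simp
      qed
    qed
    then show "norm (iter_deriv ds (sum_op B N i (\<Psi> N)) h) \<le> (real B + 1) * C"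
      unfolding iter_deriv_sum_op[OF \<Psi>(1)] unfolding sum_op_def using N by (simp add: field_simps)
  qed
qed

text \<open>The error of one exchange, scaled by its expected size, is again in the class. Operators
  in further directions can therefore be applied to it without losing the rate.\<close>

lemma em_family_op_diff:
  assumes "em_family J B \<Psi>" "i \<in> J"
  shows "em_family J B (\<lambda>N h. real N ^ (M + 1) *\<^sub>R (todd_op M N i (\<Psi> N) h - sum_op B N i (\<Psi> N) h))"
  unfolding em_family_def
proof (intro conjI allI ballI impI)
  note \<Psi> = em_familyD[OF assms(1)]
  note T = em_familyD[OF em_family_todd_op[OF assms(1)]]
  note S = em_familyD[OF em_family_sum_op[OF assms(1)]]
  let ?D = "\<lambda>N h. real N ^ (M + 1) *\<^sub>R (todd_op M N i (\<Psi> N) h - sum_op B N i (\<Psi> N) h)"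
  show "smooth (?D N)" for N
    by (intro smooth_scaleR smooth_diff smooth_todd_op smooth_sum_op \<Psi>)
  show "?D N h = 0" if "k \<in> J" "h $ k < - real B" for N k h
    using T(2)[OF that, of M N i] S(2)[OF that, of N i] by simp
  have it: "iter_deriv ds (?D N) = (\<lambda>h. real N ^ (M + 1) *\<^sub>R (todd_op M N i (iter_deriv ds (\<Psi> N)) h - sum_op B N i (iter_deriv ds (\<Psi> N)) h))" for ds N
    by (subst iter_deriv_scaleR, intro smooth_diff smooth_todd_op smooth_sum_op \<Psi>)
      (simp add: iter_deriv_diff smooth_todd_op smooth_sum_op \<Psi>(1) iter_deriv_todd_op iter_deriv_sum_op)
  show "partial_deriv k (?D N) = (\<lambda>h. 0)" if "k \<notin> J" for N k
    using it[of "[k]" N] \<Psi>(3)[OF that] by simp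
  fix ds
  obtain C where C: "\<And>N h. N \<ge> 1 \<Longrightarrow> (\<forall>i. h $ i \<le> 0) \<Longrightarrow> norm (iter_deriv (replicate (M + 2) i @ ds) (\<Psi> N) h) \<le> C"
    using \<Psi>(4) by metis
  show "\<exists>C. \<forall>N\<ge>1. \<forall>h. (\<forall>i. h $ i \<le> 0) \<longrightarrow> norm (iter_deriv ds (?D N) h) \<le> C"
  proof (intro exI[of _ "(real B + 1) * (\<Sum>j\<le>M. \<bar>fps_nth todd_fps j\<bar>) * C"] allI impI)
    fix N h assume N: "1 \<le> (N::nat)" and h: "\<forall>i. (h::real^'a) $ i \<le> 0"
    have "norm (todd_op M N i (iter_deriv ds (\<Psi> N)) h - sum_op B N i (iter_deriv ds (\<Psi> N)) h)
      \<le> (real B + 1) * (\<Sum>j\<le>M. \<bar>fps_nth todd_fps j\<bar>) * C * (1 / real N) ^ (M + 1)"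
    proof (rule todd_op_minus_sum_op[OF smooth_iter_deriv[OF \<Psi>(1)] N _ _ h])
      show "iter_deriv ds (\<Psi> N) h = 0" if "h $ i < - real B" for h
        using iter_deriv_halfspace_zero[OF \<Psi>(2)[OF assms(2)] that] .
      show "norm (iter_deriv (replicate (M + 2) i) (iter_deriv ds (\<Psi> N)) h) \<le> C" if "\<forall>i. h $ i \<le> 0" for h
        using C[OF N that] by (simp del: foldr_replicate)
    qed
    then have "real N ^ (M + 1) * norm (todd_op M N i (iter_deriv ds (\<Psi> N)) h - sum_op B N i (iter_deriv ds (\<Psi> N)) h)
      \<le> real N ^ (M + 1) * ((real B + 1) * (\<Sum>j\<le>M. \<bar>fps_nth todd_fps j\<bar>) * C * (1 / real N) ^ (M + 1))"
      by (intro mult_left_mono) auto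
    also have "\<dots> = (real B + 1) * (\<Sum>j\<le>M. \<bar>fps_nth todd_fps j\<bar>) * C"
      using N by (simp add: power_one_over field_simps)
    finally show "norm (iter_deriv ds (?D N) h) \<le> (real B + 1) * (\<Sum>j\<le>M. \<bar>fps_nth todd_fps j\<bar>) * C"
      unfolding it by simp
  qed
qed

text \<open>Directions outside \<open>J\<close> are left alone: the functions do not depend on them,
  and there the Todd operator is the identity as well.\<close>

definition step_op :: "'m set \<Rightarrow> nat \<Rightarrow> nat \<Rightarrow> 'm::finite \<Rightarrow> (real^'m \<Rightarrow> complex) \<Rightarrow> real^'m \<Rightarrow> complex" where
  "step_op J B N i \<Psi> = (if i \<in> J then sum_op B N i \<Psi> else \<Psi>)"

lemma em_family_step_op: "em_family J B \<Psi> \<Longrightarrow> em_family J B (\<lambda>N. step_op J B N i (\<Psi> N))"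
  by (cases "i \<in> J") (simp_all add: step_op_def em_family_sum_op)

lemma em_family_zero: "em_family J B (\<lambda>N h. 0)"
  by (auto simp: em_family_def smooth_const)

lemma todd_op_trivial:
  assumes "partial_deriv i \<Psi> = (\<lambda>h. 0)"
  shows "todd_op M N i \<Psi> = \<Psi>"
proof
  fix h
  have "iter_deriv (replicate j i) \<Psi> h = (if j = 0 then \<Psi> h else 0)" for j
  proof (cases j)
    case (Suc k)
    have "replicate j i = replicate k i @ [i]" by (simp add: Suc replicate_append_same)
    then show ?thesis using Suc assms by (simp del: foldr_replicate)
  qed simp
  then have "todd_op M N i \<Psi> h = (\<Sum>j\<le>M. if j = 0 then \<Psi> h else 0)"
    unfolding todd_op_def by (intro sum.cong refl) (auto simp: todd_fps_0 simp del: foldr_replicate)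
  then show "todd_op M N i \<Psi> h = \<Psi> h" by simp
qed

lemma em_family_op_diff':
  assumes "em_family J B \<Psi>"
  shows "em_family J B (\<lambda>N h. real N ^ (M + 1) *\<^sub>R (todd_op M N i (\<Psi> N) h - step_op J B N i (\<Psi> N) h))"
  using em_family_op_diff[OF assms, of i M] em_familyD(3)[OF assms, of i] em_family_zero
  by (cases "i \<in> J") (auto simp: step_op_def todd_op_trivial)

lemma step_op_scale_diff:
  assumes "smooth \<Phi>" "smooth \<Psi>"
  shows "step_op J B N i (\<lambda>h. c *\<^sub>R (\<Phi> h - \<Psi> h)) = (\<lambda>h. c *\<^sub>R (step_op J B N i \<Phi> h - step_op J B N i \<Psi> h))"
proof -
  have "partial_deriv i (\<lambda>h. c *\<^sub>R (\<Phi> h - \<Psi> h)) = (\<lambda>h. c *\<^sub>R (partial_deriv i \<Phi> h - partial_deriv i \<Psi> h))"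
    using iter_deriv_scaleR[of "\<lambda>h. \<Phi> h - \<Psi> h" "[i]" c] smooth_diff[OF assms] partial_deriv_diff[OF assms] by simp
  then show ?thesis
    by (auto simp: step_op_def sum_op_def scaleR_sum_right scaleR_diff_right sum_subtractf mult.commute)
qed

lemma em_family_foldr_todd_op:
  "em_family J B \<Psi> \<Longrightarrow> em_family J B (\<lambda>N. foldr (todd_op M N) xs (\<Psi> N))"
  by (induction xs) (auto intro: em_family_todd_op)

lemma em_family_foldr_step_op:
  "em_family J B \<Psi> \<Longrightarrow> em_family J B (\<lambda>N. foldr (step_op J B N) xs (\<Psi> N))"
  by (induction xs) (auto intro: em_family_step_op)

text \<open>With \<open>T'\<close> and \<open>S'\<close> the two operators in the new direction and
  \<open>T\<close>, \<open>S\<close> the products so far,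
  \<open>T' T - S' S = (T' - S') T + S' (T - S)\<close>. The first summand is covered by
  \<open>em_family_op_diff'\<close>, the second by the induction hypothesis.\<close>

lemma em_family_foldr_diff:
  assumes "em_family J B \<Psi>"
  shows "em_family J B (\<lambda>N h. real N ^ (M + 1) *\<^sub>R (foldr (todd_op M N) xs (\<Psi> N) h - foldr (step_op J B N) xs (\<Psi> N) h))"
proof (induction xs)
  case Nil
  show ?case by (simp add: em_family_zero)
next
  case (Cons i xs)
  note T = em_family_foldr_todd_op[OF assms, of M xs] and S = em_family_foldr_step_op[OF assms, of xs]
  show ?case
    using em_family_add[OF em_family_op_diff'[OF T, of M i] em_family_step_op[OF Cons.IH, of i]]
    unfolding step_op_scale_diff[OF em_familyD(1)[OF T] em_familyD(1)[OF S]]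
    by (simp flip: scaleR_add_right)
qed

text \<open>Expanding the product of the one-variable operators gives a box of multi-indices with
  all entries at most \<open>M\<close>; the cut by total order is made in
  \<open>euler_maclaurin_orthant\<close>.\<close>

lemma foldr_todd_op:
  assumes "smooth \<Psi>" "distinct xs"
  shows "foldr (todd_op M N) xs \<Psi> h =
    (\<Sum>\<gamma>\<in>{\<gamma>. (\<forall>i\<in>set xs. \<gamma> i \<le> M) \<and> (\<forall>i. i \<notin> set xs \<longrightarrow> \<gamma> i = 0)}.
      (\<Prod>i\<in>set xs. fps_nth todd_fps (\<gamma> i) * (1 / real N) ^ \<gamma> i) *\<^sub>R iter_deriv (concat (map (\<lambda>i. replicate (\<gamma> i) i) xs)) \<Psi> h)"
  using assms(2)
proof (induction xs arbitrary: h)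
  case Nil
  have "{\<gamma>. \<forall>i::'a. \<gamma> i = (0::nat)} = {\<lambda>_. 0}" by auto
  then show ?case by simp
next
  case (Cons i xs)
  let ?A = "\<lambda>xs. {\<gamma>. (\<forall>i\<in>set xs. \<gamma> i \<le> M) \<and> (\<forall>i. i \<notin> set xs \<longrightarrow> \<gamma> i = 0)}"
  let ?c = "\<lambda>\<gamma> i. fps_nth todd_fps (\<gamma> i) * (1 / real N) ^ \<gamma> i"
  let ?D = "\<lambda>xs \<gamma>. iter_deriv (concat (map (\<lambda>i. replicate (\<gamma> i) i) xs)) \<Psi>"
  have i: "i \<notin> set xs" using Cons.prems by simp
  have IH: "foldr (todd_op M N) xs \<Psi> = (\<lambda>h. \<Sum>\<gamma>\<in>?A xs. (\<Prod>i\<in>set xs. ?c \<gamma> i) *\<^sub>R ?D xs \<gamma> h)"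
    using Cons by auto
  have "foldr (todd_op M N) (i # xs) \<Psi> h =
     (\<Sum>j\<le>M. (fps_nth todd_fps j * (1 / real N) ^ j) *\<^sub>R
       iter_deriv (replicate j i) (\<lambda>h. \<Sum>\<gamma>\<in>?A xs. (\<Prod>i\<in>set xs. ?c \<gamma> i) *\<^sub>R ?D xs \<gamma> h) h)"
    by (simp add: IH todd_op_def)
  also have "\<dots> = (\<Sum>j\<le>M. \<Sum>\<gamma>\<in>?A xs. (fps_nth todd_fps j * (1 / real N) ^ j * (\<Prod>i\<in>set xs. ?c \<gamma> i)) *\<^sub>R
       iter_deriv (replicate j i) (?D xs \<gamma>) h)"
    by (simp add: iter_deriv_sum iter_deriv_scaleR smooth_scaleR smooth_iter_deriv assms(1) scaleR_sum_right del: foldr_replicate foldr_append)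
  also have "\<dots> = (\<Sum>(j,\<gamma>)\<in>{..M} \<times> ?A xs. (fps_nth todd_fps j * (1 / real N) ^ j * (\<Prod>i\<in>set xs. ?c \<gamma> i)) *\<^sub>R
       iter_deriv (replicate j i) (?D xs \<gamma>) h)"
    by (rule sum.cartesian_product)
  also have "\<dots> = (\<Sum>\<gamma>\<in>?A (i # xs). (\<Prod>i\<in>set (i # xs). ?c \<gamma> i) *\<^sub>R ?D (i # xs) \<gamma> h)"
  \<comment> \<open>A multi-index on \<open>i # xs\<close> is its value at \<open>i\<close> together
    with the same multi-index reset to 0 there.\<close>
  proof (rule sum.reindex_bij_witness[where i = "\<lambda>\<gamma>. (\<gamma> i, \<gamma>(i := 0))" and j = "\<lambda>(j, \<gamma>). \<gamma>(i := j)"])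
    fix p assume p: "p \<in> {..M} \<times> ?A xs"
    obtain j \<gamma> where [simp]: "p = (j, \<gamma>)" by (cases p)
    show "((case p of (j, \<gamma>) \<Rightarrow> \<gamma>(i := j)) i, (case p of (j, \<gamma>) \<Rightarrow> \<gamma>(i := j))(i := 0)) = p"
      using p i by (auto simp: fun_eq_iff)
    show "(case p of (j, \<gamma>) \<Rightarrow> \<gamma>(i := j)) \<in> ?A (i # xs)"
      using p i by auto
    have 1: "concat (map (\<lambda>k. replicate ((\<gamma>(i := j)) k) k) (i # xs)) = replicate j i @ concat (map (\<lambda>i. replicate (\<gamma> i) i) xs)"
    proof -
      have "map (\<lambda>k. replicate ((\<gamma>(i := j)) k) k) xs = map (\<lambda>i. replicate (\<gamma> i) i) xs"
        by (rule map_cong) (use i in auto)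
      then show ?thesis by (simp only: list.map concat.simps fun_upd_same)
    qed
    have 2: "(\<Prod>k\<in>set (i # xs). ?c (\<gamma>(i := j)) k) = ?c (\<gamma>(i := j)) i * (\<Prod>k\<in>set xs. ?c \<gamma> k)"
    proof -
      have "(\<Prod>k\<in>set xs. ?c (\<gamma>(i := j)) k) = (\<Prod>k\<in>set xs. ?c \<gamma> k)"
        using i by (intro prod.cong) auto
      then show ?thesis using i by simp
    qed
    show "(\<Prod>k\<in>set (i # xs). ?c (case p of (j, \<gamma>) \<Rightarrow> \<gamma>(i := j)) k) *\<^sub>R ?D (i # xs) (case p of (j, \<gamma>) \<Rightarrow> \<gamma>(i := j)) h
      = (case p of (j, \<gamma>) \<Rightarrow> (fps_nth todd_fps j * (1 / real N) ^ j * (\<Prod>i\<in>set xs. ?c \<gamma> i)) *\<^sub>R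
       iter_deriv (replicate j i) (?D xs \<gamma>) h)"
      by (simp only: \<open>p = (j, \<gamma>)\<close> prod.case 1 2) (simp only: foldr_append o_apply fun_upd_same)
  next
    fix \<gamma> assume g: "\<gamma> \<in> ?A (i # xs)"
    show "(case (\<gamma> i, \<gamma>(i := 0)) of (j, \<gamma>) \<Rightarrow> \<gamma>(i := j)) = \<gamma>" by simp
    have "(\<gamma>(i := 0)) k \<le> M" if "k \<in> set xs" for k using g that by simp
    moreover have "(\<gamma>(i := 0)) k = 0" if "k \<notin> set xs" for k using g that by simp
    moreover have "\<gamma> i \<le> M" using g by simp
    ultimately show "(\<gamma> i, \<gamma>(i := 0)) \<in> {..M} \<times> ?A xs" by blast
  qed
  finally show ?case .
qed

text \<open>Each active direction contributes one derivative, one factor \<open>1 / N\<close> and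
  one summation variable; an inactive one contributes nothing, so its summation variable is pinned
  to 0.\<close>

lemma foldr_step_op:
  assumes "smooth \<Psi>" "distinct xs"
  shows "foldr (step_op J B N) xs \<Psi> h = (1 / real N) ^ card (J \<inter> set xs) *\<^sub>R
    (\<Sum>z\<in>{z. (\<forall>i. if i \<in> J \<inter> set xs then z i < N * (B + 1) else z i = 0)}.
      iter_deriv (filter (\<lambda>i. i \<in> J) xs) \<Psi> (h - (1 / real N) *\<^sub>R (\<chi> i. real (z i))))"
  using assms(2)
proof (induction xs arbitrary: h)
  case Nil
  have "{z. \<forall>i::'a. z i = (0::nat)} = {\<lambda>_. 0}" by auto
  then show ?case by (simp add: zero_vec_def[symmetric])
next
  case (Cons i xs)
  let ?A = "\<lambda>xs. {z. (\<forall>i. if i \<in> J \<inter> set xs then z i < N * (B + 1) else z i = (0::nat))}"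
  let ?D = "iter_deriv (filter (\<lambda>i. i \<in> J) xs) \<Psi>"
  let ?v = "\<lambda>z. (1 / real N) *\<^sub>R (\<chi> i. real (z i)) :: real^'a"
  have i: "i \<notin> set xs" using Cons.prems by simp
  have IH: "foldr (step_op J B N) xs \<Psi> = (\<lambda>h. (1 / real N) ^ card (J \<inter> set xs) *\<^sub>R (\<Sum>z\<in>?A xs. ?D (h - ?v z)))"
    using Cons by auto
  show ?case
  proof (cases "i \<in> J")
    case False
    have "J \<inter> set (i # xs) = J \<inter> set xs" using False by auto
    moreover have "filter (\<lambda>i. i \<in> J) (i # xs) = filter (\<lambda>i. i \<in> J) xs" using False by simp
    moreover have "foldr (step_op J B N) (i # xs) \<Psi> = foldr (step_op J B N) xs \<Psi>"
      using False by (simp add: step_op_def[of J B N i])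
    ultimately show ?thesis by (simp only: IH)
  next
    case True
    have c: "card (J \<inter> set (i # xs)) = Suc (card (J \<inter> set xs))"
      using True i by simp
    let ?g = "\<lambda>h. (1 / real N) ^ card (J \<inter> set xs) *\<^sub>R (\<Sum>z\<in>?A xs. ?D (h - ?v z))"
    have pd: "partial_deriv i ?g = (\<lambda>h. (1 / real N) ^ card (J \<inter> set xs) *\<^sub>R (\<Sum>z\<in>?A xs. partial_deriv i ?D (h - ?v z)))"
    proof -
      have "partial_deriv i ?g = (\<lambda>h. (1 / real N) ^ card (J \<inter> set xs) *\<^sub>R partial_deriv i (\<lambda>h. \<Sum>z\<in>?A xs. ?D (h - ?v z)) h)"
        by (intro partial_deriv_linear[OF bounded_linear_scaleR_right] smooth_sum smooth_translate_minus smooth_iter_deriv assms(1))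
      also have "partial_deriv i (\<lambda>h. \<Sum>z\<in>?A xs. ?D (h - ?v z)) = (\<lambda>h. \<Sum>z\<in>?A xs. partial_deriv i (\<lambda>h. ?D (h - ?v z)) h)"
        by (intro partial_deriv_sum smooth_translate_minus smooth_iter_deriv assms(1))
      also have "(\<lambda>z. partial_deriv i (\<lambda>h. ?D (h - ?v z))) = (\<lambda>z h. partial_deriv i ?D (h - ?v z))"
        using iter_deriv_translate_minus[OF smooth_iter_deriv[OF assms(1)], of "[i]"] by simp
      finally show ?thesis .
    qed
    have "foldr (step_op J B N) (i # xs) \<Psi> h = sum_op B N i ?g h"
      using True by (simp add: step_op_def IH)
    also have "\<dots> = (1 / real N) *\<^sub>R (\<Sum>k<N * (B + 1). (1 / real N) ^ card (J \<inter> set xs) *\<^sub>R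
        (\<Sum>z\<in>?A xs. partial_deriv i ?D (h - (real k / real N) *\<^sub>R axis i 1 - ?v z)))"
      unfolding sum_op_def pd ..
    also have "\<dots> = (1 / real N) ^ card (J \<inter> set (i # xs)) *\<^sub>R
        (\<Sum>(k,z)\<in>{..<N * (B + 1)} \<times> ?A xs. partial_deriv i ?D (h - (real k / real N) *\<^sub>R axis i 1 - ?v z))"
      unfolding c by (simp only: scaleR_sum_right[symmetric] scaleR_scaleR power_Suc sum.cartesian_product)
    also have "(\<Sum>(k,z)\<in>{..<N * (B + 1)} \<times> ?A xs. partial_deriv i ?D (h - (real k / real N) *\<^sub>R axis i 1 - ?v z))
       = (\<Sum>z\<in>?A (i # xs). iter_deriv (filter (\<lambda>i. i \<in> J) (i # xs)) \<Psi> (h - ?v z))"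
    proof (rule sum.reindex_bij_witness[where i = "\<lambda>z. (z i, z(i := 0))" and j = "\<lambda>(k, z). z(i := k)"])
      fix p assume p: "p \<in> {..<N * (B + 1)} \<times> ?A xs"
      obtain k z where [simp]: "p = (k, z)" by (cases p)
      have zi: "z i = 0" using p i by (auto dest: spec[of _ i])
      show "((case p of (k, z) \<Rightarrow> z(i := k)) i, (case p of (k, z) \<Rightarrow> z(i := k))(i := 0)) = p"
        using zi by (auto simp: fun_eq_iff)
      have "if l \<in> J \<inter> set (i # xs) then (z(i := k)) l < N * (B + 1) else (z(i := k)) l = 0" for l
        using p i True by (cases "l = i") (auto dest: spec[of _ l] split: if_splits)
      then show "(case p of (k, z) \<Rightarrow> z(i := k)) \<in> ?A (i # xs)"
        unfolding \<open>p = (k, z)\<close> prod.case mem_Collect_eq by (intro allI)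
      have "?v (z(i := k)) = (real k / real N) *\<^sub>R axis i 1 + ?v z"
        using zi by (auto simp: vec_eq_iff axis_def)
      then have hv: "h - ?v (z(i := k)) = h - (real k / real N) *\<^sub>R axis i 1 - ?v z" by (simp only: diff_diff_add)
      show "iter_deriv (filter (\<lambda>i. i \<in> J) (i # xs)) \<Psi> (h - ?v (case p of (k, z) \<Rightarrow> z(i := k)))
        = (case p of (k, z) \<Rightarrow> partial_deriv i ?D (h - (real k / real N) *\<^sub>R axis i 1 - ?v z))"
        unfolding \<open>p = (k, z)\<close> prod.case hv using True by simp
    next
      fix z assume z: "z \<in> ?A (i # xs)"
      show "(case (z i, z(i := 0)) of (k, z) \<Rightarrow> z(i := k)) = z" by auto
      have "z i < N * (B + 1)" using z True by (auto dest: spec[of _ i])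
      moreover have "z(i := 0) \<in> ?A xs" using z i True by (auto split: if_splits)
      ultimately show "(z i, z(i := 0)) \<in> {..<N * (B + 1)} \<times> ?A xs" by auto
    qed
    finally show ?thesis .
  qed
qed

lemma finite_bounded_functions: "finite {\<gamma>::'m::finite \<Rightarrow> nat. \<forall>i. \<gamma> i \<le> M}"
proof -
  have "{\<gamma>::'m \<Rightarrow> nat. \<forall>i. \<gamma> i \<le> M} = Pi\<^sub>E UNIV (\<lambda>_. {..M})" by (auto simp: PiE_def Pi_def)
  then show ?thesis by (simp add: finite_PiE)
qed

lemma multi_order_le_subset: "{\<gamma>::'m::finite \<Rightarrow> nat. multi_order \<gamma> \<le> M} \<subseteq> {\<gamma>. \<forall>i. \<gamma> i \<le> M}"
proof clarify
  fix \<gamma> :: "'m \<Rightarrow> nat" and i assume "multi_order \<gamma> \<le> M"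
  moreover have "\<gamma> i \<le> multi_order \<gamma>" by (rule member_le_sum) auto
  ultimately show "\<gamma> i \<le> M" by linarith
qed

lemma finite_multi_order_le: "finite {\<gamma>::'m::finite \<Rightarrow> nat. multi_order \<gamma> \<le> M}"
  using finite_subset[OF multi_order_le_subset finite_bounded_functions] .

text \<open>Evaluates \<open>em_family_foldr_diff\<close> over all coordinates at
  \<open>h = 0\<close> and discards the terms of the box whose total order exceeds
  \<open>M\<close>.\<close>

theorem euler_maclaurin_orthant:
  fixes \<Psi> :: "real^'m::finite \<Rightarrow> complex"
  assumes "em_family J B (\<lambda>N. \<Psi>)"
  shows "\<exists>C. \<forall>N\<ge>1. norm (
      (\<Sum>\<gamma> | multi_order \<gamma> \<le> M. ((\<Prod>i\<in>UNIV. fps_nth todd_fps (\<gamma> i)) * (1 / real N) ^ multi_order \<gamma>) *\<^sub>R multi_deriv \<gamma> \<Psi> 0)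
    - (1 / real N) ^ card J *\<^sub>R
      (\<Sum>z\<in>{z. (\<forall>i. if i \<in> J then z i < N * (B + 1) else z i = 0)}.
        iter_deriv (filter (\<lambda>i. i \<in> J) coord_list) \<Psi> (- ((1 / real N) *\<^sub>R (\<chi> i. real (z i))))))
    \<le> C * (1 / real N) ^ (M + 1)"
proof -
  note \<Psi> = em_familyD(1)[OF assms]
  let ?A = "{\<gamma>::'m \<Rightarrow> nat. \<forall>i. \<gamma> i \<le> M}"
  let ?b = "\<lambda>\<gamma>. \<Prod>i\<in>UNIV. fps_nth todd_fps (\<gamma> i)"
  let ?f = "\<lambda>N \<gamma>. (?b \<gamma> * (1 / real N) ^ multi_order \<gamma>) *\<^sub>R multi_deriv \<gamma> \<Psi> 0"
  let ?S = "\<lambda>N. (1 / real N) ^ card J *\<^sub>R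
      (\<Sum>z\<in>{z. (\<forall>i. if i \<in> J then z i < N * (B + 1) else z i = 0)}.
        iter_deriv (filter (\<lambda>i. i \<in> J) coord_list) \<Psi> (- ((1 / real N) *\<^sub>R (\<chi> i. real (z i)))))"
  have T: "foldr (todd_op M N) coord_list \<Psi> 0 = (\<Sum>\<gamma>\<in>?A. ?f N \<gamma>)" for N
    unfolding foldr_todd_op[OF \<Psi> coord_list(1)] multi_deriv_eq multi_list_def
    by (simp add: coord_list(2) prod.distrib power_sum)
  have S: "foldr (step_op J B N) coord_list \<Psi> 0 = ?S N" for N
    unfolding foldr_step_op[OF \<Psi> coord_list(1)] by (simp add: coord_list(2))
  obtain C1 where C1': "\<forall>N\<ge>1. \<forall>h. (\<forall>i. h $ i \<le> 0) \<longrightarrow> norm (iter_deriv [] (\<lambda>h. real N ^ (M + 1) *\<^sub>R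
      (foldr (todd_op M N) coord_list \<Psi> h - foldr (step_op J B N) coord_list \<Psi> h)) h) \<le> C1"
    using em_familyD(4)[OF em_family_foldr_diff[OF assms, of M coord_list], of "[]"] by blast
  have C1: "norm (real N ^ (M + 1) *\<^sub>R (foldr (todd_op M N) coord_list \<Psi> 0 - foldr (step_op J B N) coord_list \<Psi> 0)) \<le> C1"
    if "N \<ge> 1" for N
    using C1'[rule_format, OF that, of 0] by simp
  \<comment> \<open>Bounds the discarded terms: each carries at least the power \<open>M + 1\<close>
    of \<open>1 / N\<close>, the order of the error itself.\<close>
  define C2 where "C2 = (\<Sum>\<gamma>\<in>?A - {\<gamma>. multi_order \<gamma> \<le> M}. \<bar>?b \<gamma>\<bar> * norm (multi_deriv \<gamma> \<Psi> 0))"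
  show ?thesis
  proof (intro exI[of _ "C1 + C2"] allI impI)
    fix N :: nat assume N: "N \<ge> 1"
    have "real N ^ (M + 1) * norm ((\<Sum>\<gamma>\<in>?A. ?f N \<gamma>) - ?S N) \<le> C1"
      using C1[OF N] unfolding T S norm_scaleR by simp
    then have 1: "norm ((\<Sum>\<gamma>\<in>?A. ?f N \<gamma>) - ?S N) \<le> C1 * (1 / real N) ^ (M + 1)"
      using N by (simp add: power_one_over field_simps)
    have "norm (\<Sum>\<gamma>\<in>?A - {\<gamma>. multi_order \<gamma> \<le> M}. ?f N \<gamma>) \<le> (\<Sum>\<gamma>\<in>?A - {\<gamma>. multi_order \<gamma> \<le> M}. \<bar>?b \<gamma>\<bar> * norm (multi_deriv \<gamma> \<Psi> 0) * (1 / real N) ^ (M + 1))"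
    proof (rule sum_norm_le)
      fix \<gamma> assume "\<gamma> \<in> ?A - {\<gamma>. multi_order \<gamma> \<le> M}"
      then have "(1 / real N) ^ multi_order \<gamma> \<le> (1 / real N) ^ (M + 1)"
        using N by (intro power_decreasing) auto
      then have "\<bar>?b \<gamma>\<bar> * norm (multi_deriv \<gamma> \<Psi> 0) * (1 / real N) ^ multi_order \<gamma> \<le> \<bar>?b \<gamma>\<bar> * norm (multi_deriv \<gamma> \<Psi> 0) * (1 / real N) ^ (M + 1)"
        by (intro mult_left_mono) auto
      then show "norm (?f N \<gamma>) \<le> \<bar>?b \<gamma>\<bar> * norm (multi_deriv \<gamma> \<Psi> 0) * (1 / real N) ^ (M + 1)"
        by (simp add: abs_mult mult_ac)
    qed
    also have "\<dots> = C2 * (1 / real N) ^ (M + 1)" by (simp only: C2_def sum_distrib_right)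
    finally have 2: "norm (\<Sum>\<gamma>\<in>?A - {\<gamma>. multi_order \<gamma> \<le> M}. ?f N \<gamma>) \<le> C2 * (1 / real N) ^ (M + 1)" .
    have "(\<Sum>\<gamma>\<in>?A. ?f N \<gamma>) = (\<Sum>\<gamma>\<in>?A - {\<gamma>. multi_order \<gamma> \<le> M}. ?f N \<gamma>) + (\<Sum>\<gamma> | multi_order \<gamma> \<le> M. ?f N \<gamma>)"
      by (rule sum.subset_diff[OF multi_order_le_subset finite_bounded_functions])
    then have "(\<Sum>\<gamma> | multi_order \<gamma> \<le> M. ?f N \<gamma>) - ?S N = ((\<Sum>\<gamma>\<in>?A. ?f N \<gamma>) - ?S N) - (\<Sum>\<gamma>\<in>?A - {\<gamma>. multi_order \<gamma> \<le> M}. ?f N \<gamma>)"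
      by simp
    then show "norm ((\<Sum>\<gamma> | multi_order \<gamma> \<le> M. ?f N \<gamma>) - ?S N) \<le> (C1 + C2) * (1 / real N) ^ (M + 1)"
      using norm_triangle_ineq4[of "(\<Sum>\<gamma>\<in>?A. ?f N \<gamma>) - ?S N" "\<Sum>\<gamma>\<in>?A - {\<gamma>. multi_order \<gamma> \<le> M}. ?f N \<gamma>"] 1 2
      by (simp only: distrib_right)
  qed
qed

section \<open>Integrals over shifted cones\<close>

text \<open>The antiderivative in coordinate \<open>j\<close> that vanishes far to the left. For
  functions vanishing where \<open>\<eta> $ j < - B\<close> the finite interval already contains
  everything, and it is empty when \<open>\<eta> $ j + B < 0\<close>.\<close>

definition antideriv :: "real \<Rightarrow> 'n::finite \<Rightarrow> (real^'n \<Rightarrow> complex) \<Rightarrow> real^'n \<Rightarrow> complex" where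
  "antideriv B j X \<eta> = integral {0..\<eta> $ j + B} (\<lambda>s. X (\<eta> - s *\<^sub>R axis j 1))"

definition left_supported :: "real \<Rightarrow> (real^'n::finite \<Rightarrow> complex) \<Rightarrow> bool" where
  "left_supported B X \<longleftrightarrow> smooth X \<and> (\<forall>\<eta> j. \<eta> $ j < - B \<longrightarrow> X \<eta> = 0)"

text \<open>Lengthening the interval only adds points where \<open>X\<close> vanishes. A fixed upper
  limit, valid for all nearby \<open>\<eta>\<close>, is what differentiation under the integral sign
  requires.\<close>

lemma antideriv_eq:
  assumes "left_supported B X" "\<eta> $ j + B \<le> L"
  shows "antideriv B j X \<eta> = integral {0..L} (\<lambda>s. X (\<eta> - s *\<^sub>R axis j 1))"
proof -
  have "integral {0..L} (\<lambda>s. X (\<eta> - s *\<^sub>R axis j 1))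
    = integral {0..L} (\<lambda>s. if s \<in> {0..\<eta> $ j + B} then X (\<eta> - s *\<^sub>R axis j 1) else 0)"
  proof (rule integral_cong)
    fix s assume s: "s \<in> {0..L}"
    have "X (\<eta> - s *\<^sub>R axis j 1) = 0" if "s > \<eta> $ j + B"
    proof -
      have "(\<eta> - s *\<^sub>R axis j 1) $ j < - B" using that by (simp add: axis_def)
      then show ?thesis using assms(1) unfolding left_supported_def by blast
    qed
    then show "X (\<eta> - s *\<^sub>R axis j 1) = (if s \<in> {0..\<eta> $ j + B} then X (\<eta> - s *\<^sub>R axis j 1) else 0)"
      using s by auto
  qed
  also have "\<dots> = integral ({0..\<eta> $ j + B} \<inter> {0..L}) (\<lambda>s. X (\<eta> - s *\<^sub>R axis j 1))"
    by (rule integral_restrict_Int)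
  also have "{0..\<eta> $ j + B} \<inter> {0..L} = {0..\<eta> $ j + B}" using assms(2) by auto
  finally show ?thesis by (simp add: antideriv_def)
qed

lemma left_supported_partial_deriv:
  assumes "left_supported B X"
  shows "left_supported B (partial_deriv i X)"
  unfolding left_supported_def
proof (intro conjI allI impI)
  show "smooth (partial_deriv i X)" using assms by (simp add: left_supported_def smooth_partial_deriv)
  show "partial_deriv i X \<eta> = 0" if "\<eta> $ j < - B" for \<eta> j
    using iter_deriv_halfspace_zero[of j "-B" X \<eta> "[i]"] assms that unfolding left_supported_def by auto
qed

text \<open>The Leibniz rule on a half space \<open>U\<close> around \<open>\<eta>\<close>, on which
  one upper limit \<open>L\<close> serves all points; there is no boundary term because the
  integrand vanishes at the far end.\<close>

lemma antideriv_has_derivative: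
  assumes "left_supported B X"
  shows "(antideriv B j X has_derivative (\<lambda>v. \<Sum>i\<in>UNIV. v $ i *\<^sub>R antideriv B j (partial_deriv i X) \<eta>)) (at \<eta>)"
proof -
  have sm: "smooth X" using assms by (simp add: left_supported_def)
  \<comment> \<open>Strictly larger than \<open>\<eta> $ j + B\<close>, so that
    \<open>\<eta>\<close> lies in the open set where \<open>L\<close> is a valid limit.\<close>
  define L where "L = \<bar>\<eta> $ j + B\<bar> + 1"
  define U where "U = {x::real^'a. x $ j < L - B}"
  define D where "D x = Blinfun (\<lambda>v. \<Sum>i\<in>UNIV. v $ i *\<^sub>R partial_deriv i X x)" for x
  have D: "blinfun_apply (D x) = (\<lambda>v. \<Sum>i\<in>UNIV. v $ i *\<^sub>R partial_deriv i X x)" for x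
    unfolding D_def
    by (rule bounded_linear_Blinfun_apply[OF has_derivative_bounded_linear[OF smooth_has_derivative[OF sm]]])
  have oU: "open U" unfolding U_def by (rule open_halfspace_component)
  have \<eta>U: "\<eta> \<in> U" unfolding U_def L_def by auto
  have cD: "continuous_on UNIV D"
  proof (rule continuous_on_blinfun_componentwise)
    show "continuous_on UNIV (\<lambda>x. D x b)" for b
      unfolding D by (intro continuous_intros smooth_imp_continuous_on smooth_partial_deriv sm)
  qed
  have cline: "continuous_on S (\<lambda>s. X (x - s *\<^sub>R axis j 1))" if "smooth X" for X :: "real^'a \<Rightarrow> complex" and x S
    by (rule continuous_on_compose2[OF smooth_imp_continuous_on[OF that, of UNIV]]) (auto intro!: continuous_intros)
  have lb: "((\<lambda>x. integral (cbox 0 L) (\<lambda>s. X (x - s *\<^sub>R axis j 1))) has_derivative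
      blinfun_apply (integral (cbox 0 L) (\<lambda>s. D (\<eta> - s *\<^sub>R axis j 1)))) (at \<eta> within U)"
  proof (rule leibniz_rule)
    show "((\<lambda>x. X (x - t *\<^sub>R axis j 1)) has_derivative blinfun_apply (D (x - t *\<^sub>R axis j 1))) (at x within U)" for x t
      unfolding D
    proof (rule has_derivative_at_withinI, rule has_derivative_compose[OF _ smooth_has_derivative[OF sm]])
      show "((\<lambda>x. x - t *\<^sub>R axis j 1) has_derivative (\<lambda>x. x)) (at x)"
        by (auto intro!: derivative_eq_intros)
    qed
    show "(\<lambda>s. X (x - s *\<^sub>R axis j 1)) integrable_on cbox 0 L" for x
      by (intro integrable_continuous cline sm)
    show "continuous_on (U \<times> cbox 0 L) (\<lambda>(x, t). D (x - t *\<^sub>R axis j 1))"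
      unfolding split_beta
      by (rule continuous_on_compose2[OF cD]) (auto intro!: continuous_intros)
    show "convex U"
    proof -
      have "U = {x. inner (axis j 1) x < L - B}" by (auto simp: U_def inner_axis inner_commute)
      then show ?thesis by (simp add: convex_halfspace_lt)
    qed
  qed (rule \<eta>U)
  have int: "blinfun_apply (integral (cbox 0 L) (\<lambda>s. D (\<eta> - s *\<^sub>R axis j 1))) v
      = (\<Sum>i\<in>UNIV. v $ i *\<^sub>R antideriv B j (partial_deriv i X) \<eta>)" for v
  proof -
    have "(\<lambda>s. D (\<eta> - s *\<^sub>R axis j 1)) integrable_on cbox 0 L"
      by (rule integrable_continuous, rule continuous_on_compose2[OF cD]) (auto intro!: continuous_intros)
    then have "blinfun_apply (integral (cbox 0 L) (\<lambda>s. D (\<eta> - s *\<^sub>R axis j 1))) v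
       = integral (cbox 0 L) (\<lambda>s. \<Sum>i\<in>UNIV. v $ i *\<^sub>R partial_deriv i X (\<eta> - s *\<^sub>R axis j 1))"
      by (simp add: blinfun_apply_integral D)
    also have "\<dots> = (\<Sum>i\<in>UNIV. integral (cbox 0 L) (\<lambda>s. v $ i *\<^sub>R partial_deriv i X (\<eta> - s *\<^sub>R axis j 1)))"
      by (intro integral_sum integrable_continuous continuous_intros cline smooth_partial_deriv sm) auto
    also have "\<dots> = (\<Sum>i\<in>UNIV. v $ i *\<^sub>R integral {0..L} (\<lambda>s. partial_deriv i X (\<eta> - s *\<^sub>R axis j 1)))"
      by simp
    also have "\<dots> = (\<Sum>i\<in>UNIV. v $ i *\<^sub>R antideriv B j (partial_deriv i X) \<eta>)"
      by (subst antideriv_eq[OF left_supported_partial_deriv[OF assms], of \<eta> j L]) (auto simp: L_def)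
    finally show ?thesis .
  qed
  have "((\<lambda>x. integral (cbox 0 L) (\<lambda>s. X (x - s *\<^sub>R axis j 1))) has_derivative
      (\<lambda>v. \<Sum>i\<in>UNIV. v $ i *\<^sub>R antideriv B j (partial_deriv i X) \<eta>)) (at \<eta>)"
    using lb unfolding at_within_open[OF \<eta>U oU] ext[of "blinfun_apply _", OF int] .
  then show ?thesis
  proof (rule has_derivative_transform_within_open[OF _ oU \<eta>U])
    show "integral (cbox 0 L) (\<lambda>s. X (x - s *\<^sub>R axis j 1)) = antideriv B j X x" if "x \<in> U" for x
      using antideriv_eq[OF assms, of x j L] that by (simp add: U_def)
  qed
qed

lemma partial_deriv_antideriv:
  assumes "left_supported B X"
  shows "partial_deriv i (antideriv B j X) = antideriv B j (partial_deriv i X)"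
  by (rule ext, subst partial_deriv_eq[OF antideriv_has_derivative[OF assms]]) simp

text \<open>By \<open>antideriv_has_derivative\<close> the partial derivatives of an antiderivative
  are antiderivatives of functions of the same class, so smoothness follows by coinduction.\<close>

lemma left_supported_antideriv:
  assumes "left_supported B X"
  shows "left_supported B (antideriv B j X)"
  unfolding left_supported_def
proof (intro conjI allI impI)
  show "smooth (antideriv B j X)"
  proof (rule smooth_coinduct[where S = "{antideriv B j Y | Y. left_supported B Y}"])
    show "antideriv B j X \<in> {antideriv B j Y | Y. left_supported B Y}" using assms by blast
    fix g assume "g \<in> {antideriv B j Y | Y. left_supported B Y}"
    then obtain Y where Y: "g = antideriv B j Y" "left_supported B Y" by auto
    have "g differentiable_on UNIV"
      using antideriv_has_derivative[OF Y(2)] unfolding Y(1) differentiable_on_def differentiable_def by blast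
    then show "g differentiable_on UNIV \<and> (\<forall>i. partial_deriv i g \<in> {antideriv B j Y | Y. left_supported B Y})"
      using partial_deriv_antideriv[OF Y(2)] left_supported_partial_deriv[OF Y(2)] unfolding Y(1) by blast
  qed
  fix \<eta> :: "real^'a" and i assume \<eta>: "\<eta> $ i < - B"
  have "integral {0..\<eta> $ j + B} (\<lambda>s. X (\<eta> - s *\<^sub>R axis j 1)) = integral {0..\<eta> $ j + B} (\<lambda>s. 0)"
  proof (rule integral_cong)
    fix s assume s: "s \<in> {0..\<eta> $ j + B}"
    have "(\<eta> - s *\<^sub>R axis j 1) $ i < - B" using s \<eta> by (auto simp: axis_def)
    then show "X (\<eta> - s *\<^sub>R axis j 1) = 0" using assms unfolding left_supported_def by blast
  qed
  then show "antideriv B j X \<eta> = 0" by (simp add: antideriv_def)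
qed

text \<open>The fundamental theorem of calculus along the line; at distance \<open>L\<close> the
  point has left the support, so only the value at \<open>\<eta>\<close> remains.\<close>

lemma antideriv_partial_deriv:
  assumes "left_supported B X"
  shows "antideriv B j (partial_deriv j X) = X"
proof
  fix \<eta> :: "real^'a"
  have sm: "smooth X" using assms by (simp add: left_supported_def)
  define L where "L = \<bar>\<eta> $ j + B\<bar> + 1"
  have "((\<lambda>s. - partial_deriv j X (\<eta> - s *\<^sub>R axis j 1)) has_integral
      X (\<eta> - L *\<^sub>R axis j 1) - X (\<eta> - 0 *\<^sub>R axis j 1)) {0..L}"
  proof (rule fundamental_theorem_of_calculus)
    show "0 \<le> L" by (simp add: L_def)
    fix s
    have "((\<lambda>t. X (\<eta> + t *\<^sub>R axis j 1)) has_vector_derivative partial_deriv j X (\<eta> + (-s) *\<^sub>R axis j 1)) (at (- s))"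
      by (rule partial_deriv_line[OF smooth_imp_differentiable[OF sm]])
    moreover have "(uminus has_vector_derivative -1) (at s)"
      by (auto intro!: derivative_eq_intros)
    ultimately have "((\<lambda>t. X (\<eta> + t *\<^sub>R axis j 1)) \<circ> uminus has_vector_derivative (-1) *\<^sub>R partial_deriv j X (\<eta> + (-s) *\<^sub>R axis j 1)) (at s)"
      by (intro vector_diff_chain_at)
    then show "((\<lambda>s. X (\<eta> - s *\<^sub>R axis j 1)) has_vector_derivative - partial_deriv j X (\<eta> - s *\<^sub>R axis j 1)) (at s within {0..L})"
      by (simp add: o_def has_vector_derivative_at_within)
  qed
  moreover have "X (\<eta> - L *\<^sub>R axis j 1) = 0"
  proof -
    have "(\<eta> - L *\<^sub>R axis j 1) $ j < - B" by (simp add: L_def axis_def)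
    then show ?thesis using assms unfolding left_supported_def by blast
  qed
  ultimately have "((\<lambda>s. - partial_deriv j X (\<eta> - s *\<^sub>R axis j 1)) has_integral - X \<eta>) {0..L}"
    by simp
  from has_integral_neg[OF this] have "((\<lambda>s. partial_deriv j X (\<eta> - s *\<^sub>R axis j 1)) has_integral X \<eta>) {0..L}"
    by simp
  then have "integral {0..L} (\<lambda>s. partial_deriv j X (\<eta> - s *\<^sub>R axis j 1)) = X \<eta>" by (rule integral_unique)
  then show "antideriv B j (partial_deriv j X) \<eta> = X \<eta>"
    by (subst antideriv_eq[OF left_supported_partial_deriv[OF assms], of \<eta> j L]) (auto simp: L_def)
qed

lemma iter_deriv_perm:
  fixes f :: "real^'n::finite \<Rightarrow> complex"
  assumes "smooth f"
  shows "mset xs = mset ys \<Longrightarrow> iter_deriv xs f = iter_deriv ys f"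
proof (induction xs arbitrary: ys)
  case (Cons x xs)
  then have "x \<in> set ys" by (metis list.set_intros(1) mset_eq_setD)
  then obtain as bs where ys: "ys = as @ x # bs" by (meson split_list)
  have "iter_deriv ys f = iter_deriv as (partial_deriv x (iter_deriv bs f))" by (simp add: ys)
  also have "\<dots> = partial_deriv x (iter_deriv (as @ bs) f)"
    by (simp add: iter_deriv_partial_commute smooth_iter_deriv assms)
  also have "iter_deriv (as @ bs) f = iter_deriv xs f"
    using Cons.IH[of "as @ bs"] Cons.prems ys by simp
  finally show ?case by simp
qed auto

lemma left_supported_foldr: "left_supported B X \<Longrightarrow> left_supported B (foldr (antideriv B) js X)"
  by (induction js) (auto intro: left_supported_antideriv)

lemma iter_deriv_antideriv:
  "left_supported B X \<Longrightarrow> iter_deriv is (antideriv B j X) = antideriv B j (iter_deriv is X) \<and> left_supported B (iter_deriv is X)"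
  by (induction "is") (auto simp: partial_deriv_antideriv left_supported_partial_deriv)

lemma iter_deriv_foldr_antideriv:
  assumes "left_supported B X"
  shows "iter_deriv js (foldr (antideriv B) js X) = X"
proof (induction js)
  case (Cons j js)
  note L = left_supported_foldr[OF assms, of js]
  have "iter_deriv (j # js) (foldr (antideriv B) (j # js) X) = partial_deriv j (antideriv B j (iter_deriv js (foldr (antideriv B) js X)))"
    using iter_deriv_antideriv[OF L] by simp
  then show ?case
    using Cons.IH partial_deriv_antideriv[OF assms, of j j] antideriv_partial_deriv[OF assms] by simp
qed simp

text \<open>A cone has \<open>n\<close> facets among the \<open>m\<close> of the polytope:
  \<open>\<iota> j\<close> is the facet whose shift moves the \<open>j\<close>-th wall of the cone,
  and \<open>c\<close> is the unshifted position of the walls.\<close>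

lemma smooth_pullback:
  fixes \<Phi> :: "real^'n::finite \<Rightarrow> 'b::real_normed_vector" and \<iota> :: "'n \<Rightarrow> 'm::finite"
  shows "smooth \<Phi> \<Longrightarrow> smooth (\<lambda>h. \<Phi> ((\<chi> j. h $ \<iota> j) + c))"
  by (rule smooth_affine) (auto intro!: linearI simp: vec_eq_iff)

lemma partial_deriv_pullback:
  fixes \<Phi> :: "real^'n::finite \<Rightarrow> 'b::real_normed_vector" and \<iota> :: "'n \<Rightarrow> 'm::finite"
  assumes "smooth \<Phi>" "inj \<iota>"
  shows "partial_deriv (\<iota> j) (\<lambda>h. \<Phi> ((\<chi> j. h $ \<iota> j) + c)) = (\<lambda>h. partial_deriv j \<Phi> ((\<chi> j. h $ \<iota> j) + c))"
    and "i \<notin> range \<iota> \<Longrightarrow> partial_deriv i (\<lambda>h. \<Phi> ((\<chi> j. h $ \<iota> j) + c)) = (\<lambda>h. 0)"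
proof -
  have lin: "linear (\<lambda>h::real^'m. \<chi> j. h $ \<iota> j)" by (auto intro!: linearI simp: vec_eq_iff)
  note pd = partial_deriv_affine[OF lin assms(1), of _ c]
  show "partial_deriv (\<iota> j) (\<lambda>h. \<Phi> ((\<chi> j. h $ \<iota> j) + c)) = (\<lambda>h. partial_deriv j \<Phi> ((\<chi> j. h $ \<iota> j) + c))"
  proof -
    have "((\<chi> j. (axis (\<iota> k) 1 :: real^'m) $ \<iota> j) :: real^'n) = axis k 1" for k
      using assms(2) by (auto simp: vec_eq_iff axis_def inj_eq)
    then show ?thesis by (simp add: pd)
  qed
  show "partial_deriv i (\<lambda>h. \<Phi> ((\<chi> j. h $ \<iota> j) + c)) = (\<lambda>h. 0)" if "i \<notin> range \<iota>"
  proof -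
    have "((\<chi> j. (axis i 1 :: real^'m) $ \<iota> j) :: real^'n) = 0"
      using that by (auto simp: vec_eq_iff axis_def)
    then show ?thesis by (simp add: pd)
  qed
qed

lemma iter_deriv_pullback:
  fixes \<Phi> :: "real^'n::finite \<Rightarrow> 'b::real_normed_vector" and \<iota> :: "'n \<Rightarrow> 'm::finite"
  assumes "smooth \<Phi>" "inj \<iota>"
  shows "iter_deriv (map \<iota> js) (\<lambda>h. \<Phi> ((\<chi> j. h $ \<iota> j) + c)) = (\<lambda>h. iter_deriv js \<Phi> ((\<chi> j. h $ \<iota> j) + c))"
  by (induction js) (auto simp: partial_deriv_pullback assms smooth_iter_deriv)

lemma iter_deriv_pullback_0:
  fixes \<Phi> :: "real^'n::finite \<Rightarrow> 'b::real_normed_vector" and \<iota> :: "'n \<Rightarrow> 'm::finite"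
  assumes "smooth \<Phi>" "inj \<iota>" "\<not> set is \<subseteq> range \<iota>"
  shows "iter_deriv is (\<lambda>h. \<Phi> ((\<chi> j. h $ \<iota> j) + c)) = (\<lambda>h. 0)"
proof -
  \<comment> \<open>Isolates the innermost direction outside \<open>range \<iota>\<close>: the
    derivatives in \<open>bs\<close> are taken first and leave a pullback, which the derivative
    along \<open>i\<close> annihilates.\<close>
  obtain as i bs where s: "is = as @ i # bs" "i \<notin> range \<iota>" "set bs \<subseteq> range \<iota>"
  proof -
    have "\<exists>x\<in>set is. x \<notin> range \<iota>" using assms(3) by auto
    from split_list_last_prop[OF this] show ?thesis using that by blast
  qed
  from s(3) obtain js where "bs = map \<iota> js" by (metis ex_map_conv subsetD rangeE)
  then show ?thesis
    using iter_deriv_pullback[OF assms(1,2), of js c] partial_deriv_pullback(2)[OF smooth_iter_deriv[OF assms(1)] assms(2) s(2)]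
    by (simp add: s(1))
qed

lemma left_supported_bounded:
  assumes "left_supported B X"
  shows "\<exists>C. \<forall>\<eta>. (\<forall>j. \<eta> $ j \<le> K) \<longrightarrow> norm (X \<eta>) \<le> C"
proof -
  have "compact (X ` cbox (\<chi> i. - B) (\<chi> i. K))"
    using assms by (intro compact_continuous_image smooth_imp_continuous_on compact_cbox) (simp add: left_supported_def)
  then obtain C where C: "\<And>\<eta>. \<eta> \<in> cbox (\<chi> i. - B) (\<chi> i. K) \<Longrightarrow> norm (X \<eta>) \<le> C"
    using compact_imp_bounded bounded_iff by (metis imageI)
  have "norm (X \<eta>) \<le> max C 0" if "\<forall>j. \<eta> $ j \<le> K" for \<eta>
  proof (cases "\<exists>j. \<eta> $ j < - B")
    case True
    then show ?thesis using assms by (auto simp: left_supported_def)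
  next
    case False
    then have "norm (X \<eta>) \<le> C" using that by (intro C) (auto simp: mem_box_cart not_less)
    then show ?thesis by simp
  qed
  then show ?thesis by blast
qed

text \<open>For nonpositive shifts the argument stays below the largest entry of \<open>c\<close>,
  and left support bounds every derivative there. The translation by \<open>c\<close> moves the
  support bound, hence the natural number \<open>B'\<close>.\<close>

lemma em_family_pullback:
  fixes \<Phi> :: "real^'n::finite \<Rightarrow> complex" and \<iota> :: "'n \<Rightarrow> 'm::finite"
  assumes "left_supported B \<Phi>" "inj \<iota>" "\<And>j. B + c $ j \<le> real B'"
  shows "em_family (range \<iota>) B' (\<lambda>N h. \<Phi> ((\<chi> j. h $ \<iota> j) + c))"
  unfolding em_family_def
proof (intro conjI allI ballI impI)
  have sm: "smooth \<Phi>" using assms by (simp add: left_supported_def)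
  show "smooth (\<lambda>h::real^'m. \<Phi> ((\<chi> j. h $ \<iota> j) + c))" by (rule smooth_pullback[OF sm])
  show "\<Phi> ((\<chi> j. h $ \<iota> j) + c) = 0" if "i \<in> range \<iota>" "h $ i < - real B'" for i and h :: "real^'m"
  proof -
    obtain j where j: "i = \<iota> j" using \<open>i \<in> range \<iota>\<close> by auto
    have "((\<chi> j. h $ \<iota> j) + c) $ j < - B" using that(2) assms(3)[of j] by (simp add: j)
    then show ?thesis using assms(1) unfolding left_supported_def by blast
  qed
  show "partial_deriv i (\<lambda>h::real^'m. \<Phi> ((\<chi> j. h $ \<iota> j) + c)) = (\<lambda>h. 0)" if "i \<notin> range \<iota>" for i
    using partial_deriv_pullback(2)[OF sm assms(2) that] .
  fix ds :: "'m list"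
  show "\<exists>C. \<forall>N::nat\<ge>1. \<forall>h::real^'m. (\<forall>i. h $ i \<le> 0) \<longrightarrow> norm (iter_deriv ds (\<lambda>h. \<Phi> ((\<chi> j. h $ \<iota> j) + c)) h) \<le> C"
  proof (cases "set ds \<subseteq> range \<iota>")
    case False
    then show ?thesis using iter_deriv_pullback_0[OF sm assms(2) False, of c] by auto
  next
    case True
    then obtain js where js: "ds = map \<iota> js" by (metis ex_map_conv subsetD rangeE)
    have "left_supported B (iter_deriv js \<Phi>)"
      using assms(1) by (induction js) (auto intro: left_supported_partial_deriv)
    from left_supported_bounded[OF this, of "Max (range (\<lambda>j. c $ j))"]
    obtain C where C: "\<And>\<eta>. (\<forall>j. \<eta> $ j \<le> Max (range (\<lambda>j. c $ j))) \<Longrightarrow> norm (iter_deriv js \<Phi> \<eta>) \<le> C" by blast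
    have "norm (iter_deriv js \<Phi> ((\<chi> j. h $ \<iota> j) + c)) \<le> C" if "\<forall>i. h $ i \<le> 0" for h :: "real^'m"
    proof (rule C, rule allI)
      fix j
      have "c $ j \<le> Max (range (\<lambda>j. c $ j))" by (intro Max_ge) auto
      then show "((\<chi> j. h $ \<iota> j) + c) $ j \<le> Max (range (\<lambda>j. c $ j))" using that[rule_format, of "\<iota> j"]
        unfolding vector_add_component vec_lambda_beta by linarith
    qed
    then show ?thesis unfolding js iter_deriv_pullback[OF sm assms(2)] by blast
  qed
qed

section \<open>Riemann sums over scaled lattices\<close>

definition grid_cell :: "real^'n \<Rightarrow> nat \<Rightarrow> ('n::finite \<Rightarrow> int) \<Rightarrow> (real^'n) set" where
  "grid_cell p N z = {x. \<forall>i. \<lfloor>real N * (x $ i - p $ i)\<rfloor> = z i}"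

text \<open>The lower corner of the half-open cube \<open>grid_cell p N z\<close> of side
  \<open>1 / N\<close>.\<close>

definition grid_point :: "real^'n \<Rightarrow> nat \<Rightarrow> ('n::finite \<Rightarrow> int) \<Rightarrow> real^'n" where
  "grid_point p N z = p + (1 / real N) *\<^sub>R (\<chi> i. of_int (z i))"

lemma grid_cell_bounds:
  assumes "N \<ge> 1"
  shows "grid_cell p N z = {x. \<forall>i. grid_point p N z $ i \<le> x $ i \<and> x $ i < grid_point p N z $ i + 1 / real N}"
proof -
  have "\<lfloor>real N * (x $ i - p $ i)\<rfloor> = z i \<longleftrightarrow>
     grid_point p N z $ i \<le> x $ i \<and> x $ i < grid_point p N z $ i + 1 / real N" for x i
    using assms unfolding floor_eq_iff by (simp add: grid_point_def field_simps)
  then show ?thesis by (simp add: grid_cell_def)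
qed

lemma grid_cell_sets [measurable]: "grid_cell p N z \<in> sets borel"
proof -
  have "grid_cell p N z = (\<Inter>i\<in>UNIV. {x. real_of_int (z i) \<le> real N * (x $ i - p $ i)} \<inter> {x. real N * (x $ i - p $ i) < real_of_int (z i) + 1})"
    unfolding grid_cell_def floor_eq_iff by auto
  moreover have "{x. real_of_int (z i) \<le> real N * (x $ i - p $ i)} \<in> sets borel" for i
    by (intro borel_closed closed_Collect_le continuous_intros)
  moreover have "{x. real N * (x $ i - p $ i) < real_of_int (z i) + 1} \<in> sets borel" for i
    by (intro borel_open open_Collect_less continuous_intros)
  ultimately show ?thesis by auto
qed

lemma measure_grid_cell:
  fixes p :: "real^'n::finite"
  assumes N: "N \<ge> 1"
  shows "emeasure lborel (grid_cell p N z) < \<infinity>" "measure lborel (grid_cell p N z) = (1 / real N) ^ CARD('n)"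
proof -
  let ?a = "grid_point p N z" and ?b = "\<chi> i. grid_point p N z $ i + 1 / real N"
  have le: "\<forall>b\<in>Basis. ?a \<bullet> b \<le> ?b \<bullet> b" by (auto simp: Basis_vec_def inner_axis)
  have e: "emeasure lborel (cbox ?a ?b) = emeasure lborel (box ?a ?b)"
    using le by (simp add: emeasure_lborel_cbox_eq emeasure_lborel_box_eq)
  have "box ?a ?b \<subseteq> grid_cell p N z" "grid_cell p N z \<subseteq> cbox ?a ?b"
    unfolding grid_cell_bounds[OF N] by (auto simp: mem_box_cart less_imp_le)
  then have "emeasure lborel (box ?a ?b) \<le> emeasure lborel (grid_cell p N z)"
    "emeasure lborel (grid_cell p N z) \<le> emeasure lborel (cbox ?a ?b)"
    by (auto intro!: emeasure_mono)
  then have eq: "emeasure lborel (grid_cell p N z) = emeasure lborel (cbox ?a ?b)" using e by simp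
  then show "emeasure lborel (grid_cell p N z) < \<infinity>" using emeasure_lborel_cbox_finite[of ?a ?b] by simp
  have ne: "cbox ?a ?b \<noteq> {}" by (auto simp: interval_ne_empty_cart)
  have "measure lborel (grid_cell p N z) = measure lborel (cbox ?a ?b)" using eq by (simp add: measure_def)
  also have "\<dots> = (\<Prod>i\<in>UNIV. ?b $ i - ?a $ i)" by (rule content_cbox_cart[OF ne])
  finally show "measure lborel (grid_cell p N z) = (1 / real N) ^ CARD('n)" by simp
qed

lemma finite_grid:
  fixes p :: "real^'n::finite"
  assumes N: "N \<ge> 1"
  shows "finite {z. \<forall>i. \<bar>grid_point p N z $ i\<bar> \<le> K}"
proof -
  have "{z. \<forall>i. \<bar>grid_point p N z $ i\<bar> \<le> K} \<subseteq> Pi\<^sub>E UNIV (\<lambda>i. {\<lfloor>real N * (- K - p $ i)\<rfloor>..\<lceil>real N * (K - p $ i)\<rceil>})"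
  proof (rule subsetI)
    fix z assume z: "z \<in> {z. \<forall>i. \<bar>grid_point p N z $ i\<bar> \<le> K}"
    have "\<lfloor>real N * (- K - p $ i)\<rfloor> \<le> z i \<and> z i \<le> \<lceil>real N * (K - p $ i)\<rceil>" for i
    proof -
    from z have "\<forall>i. \<bar>grid_point p N z $ i\<bar> \<le> K" by simp
    then have "\<bar>p $ i + real_of_int (z i) / real N\<bar> \<le> K" by (simp add: grid_point_def)
    then have "- K - p $ i \<le> real_of_int (z i) / real N" "real_of_int (z i) / real N \<le> K - p $ i" by linarith+
    then have "real N * (- K - p $ i) \<le> real_of_int (z i)" "real_of_int (z i) \<le> real N * (K - p $ i)"
      using N by (simp_all add: field_simps)
    then show "\<lfloor>real N * (- K - p $ i)\<rfloor> \<le> z i \<and> z i \<le> \<lceil>real N * (K - p $ i)\<rceil>"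
      by linarith
    qed
    then show "z \<in> Pi\<^sub>E UNIV (\<lambda>i. {\<lfloor>real N * (- K - p $ i)\<rfloor>..\<lceil>real N * (K - p $ i)\<rceil>})"
      by (simp add: PiE_UNIV_domain)
  qed
  then show ?thesis by (rule finite_subset) (simp add: finite_PiE)
qed

lemma bounded_support_bound:
  fixes g :: "real^'n::finite \<Rightarrow> complex"
  assumes "continuous_on UNIV g" "\<And>x. g x \<noteq> 0 \<Longrightarrow> \<forall>i. \<bar>x $ i\<bar> \<le> K"
  obtains C where "C \<ge> 0" "\<And>x. norm (g x) \<le> C"
proof -
  have "compact (g ` cbox (\<chi> i. - K) (\<chi> i. K))"
    using assms by (intro compact_continuous_image compact_cbox continuous_on_subset[OF assms(1)]) auto
  then obtain C where C: "\<And>x. x \<in> cbox (\<chi> i. - K) (\<chi> i. K) \<Longrightarrow> norm (g x) \<le> C"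
    using compact_imp_bounded bounded_iff by (metis imageI)
  have "norm (g x) \<le> max C 0" for x
  proof (cases "g x = 0")
    case False
    then have "\<forall>i. - K \<le> x $ i \<and> x $ i \<le> K" using assms(2)[of x] by (auto simp: abs_le_iff minus_le_iff)
    then have "norm (g x) \<le> C" by (intro C) (auto simp: mem_box_cart)
    then show ?thesis by simp
  qed simp
  then show ?thesis using that[of "max C 0"] by simp
qed

text \<open>Dominated convergence for functions that are constant on the grid cells: they converge
  off the frontier of \<open>P\<close>, which is negligible because \<open>P\<close> is convex. The
  condition on \<open>g\<close> in the index set keeps it finite even when \<open>P\<close> is
  unbounded.\<close>

theorem riemann_sum_convex:
  fixes P :: "(real^'n::finite) set" and g :: "real^'n \<Rightarrow> complex"
  assumes P: "convex P" "closed P" and g: "continuous_on UNIV g" "\<And>x. g x \<noteq> 0 \<Longrightarrow> \<forall>i. \<bar>x $ i\<bar> \<le> K"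
  shows "(\<lambda>N. (1 / real N) ^ CARD('n) *\<^sub>R (\<Sum>z | grid_point p N z \<in> P \<and> g (grid_point p N z) \<noteq> 0. g (grid_point p N z)))
    \<longlonglongrightarrow> integral P g"
    and "g integrable_on P"
proof -
  obtain C where C: "C \<ge> 0" "\<And>x. norm (g x) \<le> C" using bounded_support_bound[OF g] by blast
  define H where "H x = indicator P x *\<^sub>R g x" for x
  \<comment> \<open>A majorant: the box is widened by 1 because a point and the corner of its cell
    differ by at most \<open>1 / N \<le> 1\<close> in every coordinate.\<close>
  define w where "w x = indicator (cbox (\<chi> i. - (K + 1)) (\<chi> i. K + 1)) x *\<^sub>R C" for x :: "real^'n"
  \<comment> \<open>The value of \<open>H\<close> at the corner of the cell that contains
    \<open>x\<close>.\<close>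
  define G where "G N x = H (grid_point p N (\<lambda>i. \<lfloor>real N * (x $ i - p $ i)\<rfloor>))" for N x
  let ?Z = "\<lambda>N. {z. grid_point p N z \<in> P \<and> g (grid_point p N z) \<noteq> 0}"
  have fin: "finite (?Z N)" if "N \<ge> 1" for N
    using g(2) by (intro finite_subset[OF _ finite_grid[OF that, of p K]]) auto
  have Gsum: "G N x = (\<Sum>z\<in>?Z N. indicator (grid_cell p N z) x *\<^sub>R g (grid_point p N z))" if N: "N \<ge> 1" for N x
  proof -
    let ?z = "\<lambda>i. \<lfloor>real N * (x $ i - p $ i)\<rfloor>"
    have ind: "indicator (grid_cell p N z) x = (if z = ?z then 1 else 0 :: real)" for z
    proof -
      have "x \<in> grid_cell p N z \<longleftrightarrow> z = ?z" unfolding grid_cell_def fun_eq_iff by (simp add: eq_commute)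
      then show ?thesis by (simp add: indicator_def)
    qed
    have "(\<Sum>z\<in>?Z N. indicator (grid_cell p N z) x *\<^sub>R g (grid_point p N z))
      = (\<Sum>z\<in>?Z N. if z = ?z then g (grid_point p N z) else 0)"
      by (intro sum.cong refl) (simp add: ind)
    also have "\<dots> = (if ?z \<in> ?Z N then g (grid_point p N ?z) else 0)"
      using fin[OF N] by (rule sum.delta)
    also have "\<dots> = G N x" by (simp add: G_def H_def indicator_def)
    finally show ?thesis ..
  qed
  have intG: "integral\<^sup>L lborel (G N) = (1 / real N) ^ CARD('n) *\<^sub>R (\<Sum>z\<in>?Z N. g (grid_point p N z))"
    and measG: "G N \<in> borel_measurable lborel" if N: "N \<ge> 1" for N
  proof -
    have i: "integrable lborel (\<lambda>x. indicator (grid_cell p N z) x *\<^sub>R g (grid_point p N z))" for z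
      using measure_grid_cell(1)[OF N, of p z] by (intro integrable_indicator) auto
    have "integral\<^sup>L lborel (G N) = (\<Sum>z\<in>?Z N. integral\<^sup>L lborel (\<lambda>x. indicator (grid_cell p N z) x *\<^sub>R g (grid_point p N z)))"
      unfolding Gsum[OF N] by (rule Bochner_Integration.integral_sum[OF i])
    also have "\<dots> = (\<Sum>z\<in>?Z N. (1 / real N) ^ CARD('n) *\<^sub>R g (grid_point p N z))"
      using measure_grid_cell[OF N, of p] by (intro sum.cong refl) (simp add: less_top)
    finally show "integral\<^sup>L lborel (G N) = (1 / real N) ^ CARD('n) *\<^sub>R (\<Sum>z\<in>?Z N. g (grid_point p N z))"
      by (simp add: scaleR_sum_right)
    show "G N \<in> borel_measurable lborel" unfolding Gsum[OF N] by measurable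
  qed
  have Hm: "H \<in> borel_measurable lborel"
  proof -
    have [measurable]: "P \<in> sets borel" using P(2) by (rule borel_closed)
    have [measurable]: "g \<in> borel_measurable borel" by (rule borel_measurable_continuous_onI[OF g(1)])
    show ?thesis unfolding H_def by measurable
  qed
  have wi: "integrable lborel w"
    unfolding w_def by (intro integrable_indicator emeasure_lborel_cbox_finite) auto
  have near: "norm (grid_point p N (\<lambda>i. \<lfloor>real N * (x $ i - p $ i)\<rfloor>) - x) \<le> CARD('n) * (1 / real N)"
    and near': "\<bar>grid_point p N (\<lambda>i. \<lfloor>real N * (x $ i - p $ i)\<rfloor>) $ i - x $ i\<bar> \<le> 1 / real N" if N: "N \<ge> 1" for N x i
  proof -
    show *: "\<bar>grid_point p N (\<lambda>i. \<lfloor>real N * (x $ i - p $ i)\<rfloor>) $ i - x $ i\<bar> \<le> 1 / real N" for i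
    proof -
      have "x \<in> grid_cell p N (\<lambda>i. \<lfloor>real N * (x $ i - p $ i)\<rfloor>)" by (simp add: grid_cell_def)
      then show ?thesis unfolding grid_cell_bounds[OF N] mem_Collect_eq abs_le_iff by (auto dest!: spec[of _ i])
    qed
    show "norm (grid_point p N (\<lambda>i. \<lfloor>real N * (x $ i - p $ i)\<rfloor>) - x) \<le> CARD('n) * (1 / real N)"
    proof -
      have "norm (grid_point p N (\<lambda>i. \<lfloor>real N * (x $ i - p $ i)\<rfloor>) - x)
        \<le> (\<Sum>i\<in>UNIV. \<bar>(grid_point p N (\<lambda>i. \<lfloor>real N * (x $ i - p $ i)\<rfloor>) - x) $ i\<bar>)"
        by (rule norm_le_l1_cart)
      also have "\<dots> \<le> (\<Sum>i\<in>(UNIV::'n set). 1 / real N)"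
        using * by (intro sum_mono) (simp only: vector_minus_component)
      finally show ?thesis by simp
    qed
  qed
  have bnd: "norm (G N x) \<le> w x" if N: "N \<ge> 1" for N x
  proof (cases "G N x = 0")
    case True
    then show ?thesis using C(1) by (simp add: w_def)
  next
    case False
    let ?q = "grid_point p N (\<lambda>i. \<lfloor>real N * (x $ i - p $ i)\<rfloor>)"
    have q: "g ?q \<noteq> 0" using False by (auto simp: G_def H_def)
    have "- (K + 1) \<le> x $ i \<and> x $ i \<le> K + 1" for i
    proof -
      have "1 / real N \<le> 1" using N by simp
      then show ?thesis using near'[OF N, of x i] g(2)[OF q, rule_format, of i] by linarith
    qed
    then have "x \<in> cbox (\<chi> i. - (K + 1)) (\<chi> i. K + 1)" unfolding mem_box_cart vec_lambda_beta by blast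
    then show ?thesis using C(2)[of ?q] False by (simp add: w_def G_def H_def indicator_def split: if_splits)
  qed
  have lim: "(\<lambda>N. G (Suc N) x) \<longlonglongrightarrow> H x" if "x \<notin> frontier P" for x
  proof -
    let ?q = "\<lambda>N. grid_point p (Suc N) (\<lambda>i. \<lfloor>real (Suc N) * (x $ i - p $ i)\<rfloor>)"
    have lim0: "(\<lambda>N. real CARD('n) * (1 / real (Suc N))) \<longlonglongrightarrow> 0"
      using LIMSEQ_inverse_real_of_nat by (intro tendsto_mult_right_zero) (simp add: inverse_eq_divide)
    have le: "dist (?q N) x \<le> dist (real CARD('n) * (1 / real (Suc N))) 0" for N
    proof -
      have "dist (?q N) x \<le> real CARD('n) * (1 / real (Suc N))"
        unfolding dist_norm by (rule near) simp
      also have "\<dots> \<le> dist (real CARD('n) * (1 / real (Suc N))) 0"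
        unfolding dist_real_def by simp
      finally show ?thesis .
    qed
    have q: "?q \<longlonglongrightarrow> x"
      by (rule metric_tendsto_imp_tendsto[OF lim0 always_eventually]) (rule allI, rule le)
    show ?thesis
    proof (cases "x \<in> P")
      case True
      then have "x \<in> interior P" using that P(2) by (simp add: frontier_def)
      then have "eventually (\<lambda>N. ?q N \<in> interior P) sequentially"
        using topological_tendstoD[OF q open_interior] by blast
      then have "eventually (\<lambda>N. g (?q N) = G (Suc N) x) sequentially"
        by (rule eventually_mono) (use interior_subset in \<open>auto simp: G_def H_def indicator_def\<close>)
      moreover have "(\<lambda>N. g (?q N)) \<longlonglongrightarrow> g x"
      proof (rule isCont_tendsto_compose[OF _ q])
        show "isCont g x" using g(1) continuous_on_eq_continuous_at[OF open_UNIV] by blast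
      qed
      ultimately have "(\<lambda>N. G (Suc N) x) \<longlonglongrightarrow> g x" by (rule Lim_transform_eventually[rotated])
      then show ?thesis using True by (simp add: H_def)
    next
      case False
      then have "x \<in> - P" "open (- P)" using P(2) by auto
      then have "eventually (\<lambda>N. ?q N \<in> - P) sequentially"
        using topological_tendstoD[OF q] by blast
      then have "eventually (\<lambda>N. 0 = G (Suc N) x) sequentially"
        by (rule eventually_mono) (auto simp: G_def H_def)
      from Lim_transform_eventually[OF tendsto_const this] show ?thesis using False by (simp add: H_def)
    qed
  qed
  have AE: "AE x in lborel. (\<lambda>N. G (Suc N) x) \<longlonglongrightarrow> H x"
  proof (rule AE_I')
    have "frontier P \<in> null_sets lebesgue"
      using negligible_convex_frontier[OF P(1)] negligible_iff_null_sets by blast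
    moreover have "frontier P \<in> sets lborel" by (simp add: frontier_def P)
    ultimately show "frontier P \<in> null_sets lborel" by (simp add: null_sets_completion_iff)
  qed (use lim in auto)
  have bndAE: "AE x in lborel. norm (G (Suc N) x) \<le> w x" for N using bnd[of "Suc N"] by simp
  have Hi: "integrable lborel H"
    by (rule integrable_dominated_convergence[OF Hm measG wi AE bndAE]) auto
  have conv: "(\<lambda>N. integral\<^sup>L lborel (G (Suc N))) \<longlonglongrightarrow> integral\<^sup>L lborel H"
    by (rule integral_dominated_convergence[OF Hm measG wi AE bndAE]) auto
  have si: "set_integrable lborel P g" using Hi unfolding set_integrable_def H_def[abs_def] .
  have "integral\<^sup>L lborel H = integral P g"
    using set_borel_integral_eq_integral(2)[OF si] unfolding set_lebesgue_integral_def H_def[abs_def] .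
  then have "(\<lambda>N. (1 / real (Suc N)) ^ CARD('n) *\<^sub>R (\<Sum>z\<in>?Z (Suc N). g (grid_point p (Suc N) z))) \<longlonglongrightarrow> integral P g"
    using conv intG[of "Suc _"] by simp
  then show "(\<lambda>N. (1 / real N) ^ CARD('n) *\<^sub>R (\<Sum>z\<in>?Z N. g (grid_point p N z))) \<longlonglongrightarrow> integral P g"
    by (rule LIMSEQ_imp_Suc)
  show "g integrable_on P" using set_borel_integral_eq_integral(1)[OF si] .
qed

section \<open>Lattice points and integrals of unimodular cones\<close>

lemma int_matrix_vector_mult:
  fixes A :: "real^'n::finite^'m::finite"
  assumes "\<forall>i j. A $ i $ j \<in> \<int>" "y \<in> int_lattice"
  shows "A *v y \<in> int_lattice"
  using assms unfolding int_lattice_def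
  by (auto simp: matrix_vector_mult_def intro!: Ints_sum Ints_mult)

lemma int_lattice_scale: "y \<in> int_lattice \<Longrightarrow> real N *\<^sub>R y \<in> int_lattice"
  by (auto simp: int_lattice_def)

lemma int_lattice_add: "x \<in> int_lattice \<Longrightarrow> y \<in> int_lattice \<Longrightarrow> x + y \<in> int_lattice"
  by (auto simp: int_lattice_def)

lemma int_lattice_minus: "y \<in> int_lattice \<Longrightarrow> - y \<in> int_lattice"
  by (auto simp: int_lattice_def)

lemma int_lattice_diff: "x \<in> int_lattice \<Longrightarrow> y \<in> int_lattice \<Longrightarrow> x - y \<in> int_lattice"
  by (auto simp: int_lattice_def)

lemma int_lattice_of_int: "(\<chi> i. real_of_int (y i)) \<in> int_lattice"
  by (auto simp: int_lattice_def)

lemma int_lattice_floor: "y \<in> int_lattice \<Longrightarrow> (\<chi> i. real_of_int \<lfloor>y $ i\<rfloor>) = y"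
  by (auto simp: int_lattice_def vec_eq_iff)

lemma convex_shifted_cone:
  fixes A :: "real^'n::finite^'m::finite"
  shows "convex {x. \<forall>j. 0 \<le> (A *v x) $ j + c $ j}"
proof (rule convexI, clarify)
  fix x y :: "real^'n" and u v :: real and j
  assume h: "\<forall>j. 0 \<le> (A *v x) $ j + c $ j" "\<forall>j. 0 \<le> (A *v y) $ j + c $ j" "0 \<le> u" "0 \<le> v" "u + v = 1"
  have "(A *v (u *\<^sub>R x + v *\<^sub>R y)) $ j + c $ j = u * ((A *v x) $ j + c $ j) + v * ((A *v y) $ j + c $ j)"
  proof -
    have "c $ j = u * c $ j + v * c $ j" using h(5) by (metis distrib_right mult_1)
    then show ?thesis by (simp add: matrix_vector_right_distrib matrix_vector_mult_scaleR algebra_simps)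
  qed
  then show "0 \<le> (A *v (u *\<^sub>R x + v *\<^sub>R y)) $ j + c $ j"
    using h by (simp add: mult_nonneg_nonneg)
qed

lemma closed_shifted_cone:
  fixes A :: "real^'n::finite^'m::finite"
  shows "closed {x. \<forall>j. 0 \<le> (A *v x) $ j + c $ j}"
proof -
  have "closed {x. 0 \<le> (A *v x) $ j + c $ j}" for j
    by (intro closed_Collect_le continuous_intros linear_continuous_on) (simp add: linear_conv_bounded_linear[symmetric])
  then show ?thesis by (intro closed_Collect_all)
qed

text \<open>Since \<open>A\<close> and \<open>A'\<close> are inverse integer matrices,
  \<open>z\<close> maps to the lattice vector \<open>A' z\<close> bijectively, and the nonnegative
  \<open>z\<close> become the grid points of the cone with apex \<open>- (A' *v c)\<close>.\<close>

lemma cone_sum: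
  fixes A A' :: "real^'n::finite^'n" and \<iota> :: "'n \<Rightarrow> 'm::finite" and B' N :: nat
  assumes A: "\<forall>i j. A $ i $ j \<in> \<int>" "\<forall>i j. A' $ i $ j \<in> \<int>" "A ** A' = mat 1" "A' ** A = mat 1"
    and \<iota>: "inj \<iota>" and N: "N \<ge> 1"
    and van: "\<And>\<eta> j. \<eta> $ j < - B \<Longrightarrow> \<psi> (A' *v (- \<eta>)) = (0::complex)"
    and B': "\<And>j. B + c $ j \<le> real B'"
  shows "(\<Sum>z\<in>{z. \<forall>i. if i \<in> range \<iota> then z i < N * (B' + 1) else z i = 0}.
           \<psi> (A' *v (- (c - (1 / real N) *\<^sub>R (\<chi> j. real (z (\<iota> j)))))))
     = (\<Sum>y | grid_point (- (A' *v c)) N y \<in> {x. \<forall>j. 0 \<le> (A *v x) $ j + c $ j} \<and> \<psi> (grid_point (- (A' *v c)) N y) \<noteq> 0.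
           \<psi> (grid_point (- (A' *v c)) N y))"
proof -
  let ?Z = "{z::'m \<Rightarrow> nat. \<forall>i. if i \<in> range \<iota> then z i < N * (B' + 1) else z i = 0}"
  let ?v = "\<lambda>z::'m \<Rightarrow> nat. (\<chi> j. real (z (\<iota> j))) :: real^'n"
  let ?X = "\<lambda>z. \<psi> (A' *v (- (c - (1 / real N) *\<^sub>R ?v z)))"
  let ?p = "- (A' *v c)"
  let ?f = "\<lambda>z i. \<lfloor>(A' *v ?v z) $ i\<rfloor>"
  let ?g = "\<lambda>y i. if i \<in> range \<iota> then nat \<lfloor>(A *v (\<chi> k. real_of_int (y k))) $ (inv \<iota> i)\<rfloor> else 0"
  let ?Y = "{y. grid_point ?p N y \<in> {x. \<forall>j. 0 \<le> (A *v x) $ j + c $ j} \<and> \<psi> (grid_point ?p N y) \<noteq> 0}"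
  have AA': "A *v (A' *v x) = x" "A' *v (A *v x) = x" for x
    using A(3,4) by (simp_all add: matrix_vector_mul_assoc)
  have gp: "grid_point ?p N y = A' *v (- (c - (1 / real N) *\<^sub>R w))" if "(\<chi> i. real_of_int (y i)) = A' *v w" for y w
    by (simp add: grid_point_def that algebra_simps matrix_vector_mult_scaleR)
  have finZ: "finite ?Z"
  proof (rule finite_subset[OF _ finite_bounded_functions[of "N * (B' + 1)"]], rule subsetI, unfold mem_Collect_eq, rule allI)
    fix z :: "'m \<Rightarrow> nat" and i assume "\<forall>i. if i \<in> range \<iota> then z i < N * (B' + 1) else z i = 0"
    from this[rule_format, of i] show "z i \<le> N * (B' + 1)" by (simp split: if_splits)
  qed
  have fY: "(\<chi> i. real_of_int (?f z i)) = A' *v ?v z" for z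
    by (intro int_lattice_floor int_matrix_vector_mult A) (simp add: int_lattice_def)
  have "(\<Sum>z\<in>?Z. ?X z) = (\<Sum>z\<in>{z\<in>?Z. ?X z \<noteq> 0}. ?X z)"
    using finZ by (intro sum.mono_neutral_right) auto
  also have "\<dots> = (\<Sum>y\<in>?Y. \<psi> (grid_point ?p N y))"
  proof (rule sum.reindex_bij_witness[where i = ?g and j = ?f])
    fix z assume z: "z \<in> {z\<in>?Z. ?X z \<noteq> 0}"
    have g: "grid_point ?p N (?f z) = A' *v (- (c - (1 / real N) *\<^sub>R ?v z))" by (rule gp[OF fY])
    show "\<psi> (grid_point ?p N (?f z)) = ?X z" by (simp only: g)
    show "?g (?f z) = z"
      using z by (auto simp: fun_eq_iff fY AA' \<iota>)
    have "(A *v grid_point ?p N (?f z)) $ j + c $ j = real (z (\<iota> j)) / real N" for j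
      unfolding g AA' by simp
    then show "?f z \<in> ?Y" using z g by simp
  next
    fix y assume y: "y \<in> ?Y"
    let ?y = "(\<chi> i. real_of_int (y i)) :: real^'n"
    have yA: "?y = A' *v (A *v ?y)" by (simp add: AA')
    have Ay: "A *v ?y \<in> int_lattice" by (intro int_matrix_vector_mult A) (simp add: int_lattice_def)
    have g: "grid_point ?p N y = A' *v (- (c - (1 / real N) *\<^sub>R (A *v ?y)))" by (rule gp[OF yA])
    have "0 \<le> (A *v grid_point ?p N y) $ j + c $ j" for j using y by blast
    then have pos: "0 \<le> (A *v ?y) $ j" for j
      unfolding g AA' using N by (auto simp: zero_le_divide_iff)
    have v: "?v (?g y) = A *v ?y"
      using pos int_lattice_floor[OF Ay] \<iota> by (simp add: vec_eq_iff)
    have "?f (?g y) i = y i" for i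
      unfolding v AA' by simp
    then show "?f (?g y) = y" by blast
    have X: "?X (?g y) = \<psi> (grid_point ?p N y)" unfolding v g ..
    have "\<psi> (grid_point ?p N y) \<noteq> 0" using y by blast
    then have X0: "?X (?g y) \<noteq> 0" using X by simp
    \<comment> \<open>A nonzero summand lies to the right of the support bound, which limits
      \<open>z\<close> to \<open>N * B'\<close>; the index range of the left side therefore misses
      nothing.\<close>
    have "?g y (\<iota> j) < N * (B' + 1)" for j
    proof -
      have "\<not> (c - (1 / real N) *\<^sub>R ?v (?g y)) $ j < - B" using van X0 by blast
      then have "real (?g y (\<iota> j)) / real N \<le> real B'" using B'[of j] by (simp add: not_less)
      then have "real (?g y (\<iota> j)) \<le> real (N * B')" using N by (simp add: field_simps)
      then have "?g y (\<iota> j) \<le> N * B'" by (simp only: of_nat_le_iff)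
      also have "N * B' < N * (B' + 1)" using N by simp
      finally show ?thesis .
    qed
    then have "?g y \<in> ?Z" by auto
    then show "?g y \<in> {z\<in>?Z. ?X z \<noteq> 0}" using X0 by blast
  qed
  finally show ?thesis .
qed

text \<open>In the coordinates \<open>\<eta> = - A x\<close> the cone becomes the set of all
  \<open>\<eta>\<close> below \<open>c\<close>, suited to antiderivatives from the left. The support
  of \<open>\<psi>\<close> is bounded, and \<open>B\<close> dominates every row of \<open>A\<close>
  on it.\<close>

lemma left_supported_reflect:
  fixes A A' :: "real^'n::finite^'n" and \<psi> :: "real^'n \<Rightarrow> complex"
  assumes "A ** A' = mat 1" "smooth \<psi>" "\<And>x. \<psi> x \<noteq> 0 \<Longrightarrow> \<forall>i. \<bar>x $ i\<bar> \<le> K"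
  obtains B where "left_supported B (\<lambda>\<eta>. \<psi> (A' *v (- \<eta>)))"
proof -
  define B where "B = (\<Sum>j\<in>UNIV. \<Sum>i\<in>UNIV. \<bar>A $ j $ i\<bar> * \<bar>K\<bar>)"
  have "\<psi> (A' *v (- \<eta>)) = 0" if "\<eta> $ j < - B" for \<eta> j
  proof (rule ccontr)
    assume "\<psi> (A' *v (- \<eta>)) \<noteq> 0"
    then have k: "\<bar>(A' *v (- \<eta>)) $ i\<bar> \<le> K" for i using assms(3) by blast
    have "A *v (A' *v (- \<eta>)) = - \<eta>" using assms(1) by (simp add: matrix_vector_mul_assoc)
    then have "- \<eta> $ j = (A *v (A' *v (- \<eta>))) $ j" by simp
    also have "\<dots> = (\<Sum>i\<in>UNIV. A $ j $ i * (A' *v (- \<eta>)) $ i)"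
      unfolding matrix_vector_mult_def[of A] by (simp only: vec_lambda_beta)
    also have "\<dots> \<le> (\<Sum>i\<in>UNIV. \<bar>A $ j $ i\<bar> * \<bar>K\<bar>)"
    proof (rule sum_mono)
      fix i
      have "A $ j $ i * (A' *v (- \<eta>)) $ i \<le> \<bar>A $ j $ i\<bar> * \<bar>(A' *v (- \<eta>)) $ i\<bar>"
        by (metis abs_ge_self abs_mult)
      also have "\<dots> \<le> \<bar>A $ j $ i\<bar> * \<bar>K\<bar>" using k[of i] by (intro mult_left_mono) auto
      finally show "A $ j $ i * (A' *v (- \<eta>)) $ i \<le> \<bar>A $ j $ i\<bar> * \<bar>K\<bar>" .
    qed
    also have "\<dots> \<le> B" unfolding B_def
      by (rule member_le_sum) (auto intro!: sum_nonneg)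
    finally show False using that by simp
  qed
  moreover have "smooth (\<lambda>\<eta>. \<psi> (A' *v (- \<eta>)))"
  proof -
    have "linear (\<lambda>\<eta>. A' *v (- \<eta>))"
      by (intro linearI) (simp_all only: minus_add_distrib matrix_vector_right_distrib scaleR_minus_right[symmetric] matrix_vector_mult_scaleR)
    from smooth_affine[OF this assms(2), of 0] show ?thesis by simp
  qed
  ultimately show ?thesis using that unfolding left_supported_def by blast
qed

text \<open>The Riemann sums over grid points of the cone converge to the integral by
  \<open>riemann_sum_convex\<close> and to the iterated antiderivative by
  \<open>euler_maclaurin_orthant\<close> with \<open>M = 0\<close>.\<close>

theorem integral_unimodular_cone:
  fixes A A' :: "real^'n::finite^'n" and \<psi> :: "real^'n \<Rightarrow> complex"
  assumes A: "\<forall>i j. A $ i $ j \<in> \<int>" "\<forall>i j. A' $ i $ j \<in> \<int>" "A ** A' = mat 1" "A' ** A = mat 1"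
    and \<psi>: "smooth \<psi>" "\<And>x. \<psi> x \<noteq> 0 \<Longrightarrow> \<forall>i. \<bar>x $ i\<bar> \<le> K"
    and B: "left_supported B (\<lambda>\<eta>. \<psi> (A' *v (- \<eta>)))"
  shows "integral {x. \<forall>j. 0 \<le> (A *v x) $ j + c $ j} \<psi> = foldr (antideriv B) coord_list (\<lambda>\<eta>. \<psi> (A' *v (- \<eta>))) c"
proof -
  let ?X = "\<lambda>\<eta>. \<psi> (A' *v (- \<eta>))"
  let ?\<Phi> = "foldr (antideriv B) coord_list ?X"
  let ?P = "{x. \<forall>j. 0 \<le> (A *v x) $ j + c $ j}"
  let ?S = "\<lambda>N. (1 / real N) ^ CARD('n) *\<^sub>R (\<Sum>y | grid_point (- (A' *v c)) N y \<in> ?P \<and> \<psi> (grid_point (- (A' *v c)) N y) \<noteq> 0.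
           \<psi> (grid_point (- (A' *v c)) N y))"
  obtain B' :: nat where B': "\<And>j. B + c $ j \<le> real B'"
  proof -
    obtain B' :: nat where "Max (range (\<lambda>j. B + c $ j)) \<le> real B'" using real_arch_simple by blast
    then show ?thesis using that[of B'] Max_ge[of "range (\<lambda>j. B + c $ j)"] by (meson finite_imageI finite order.trans rangeI)
  qed
  have ls: "left_supported B ?\<Phi>" by (rule left_supported_foldr[OF B])
  define \<Psi> where "\<Psi> = (\<lambda>h::real^'n. ?\<Phi> ((\<chi> j. h $ id j) + c))"
  have em: "em_family (range (id::'n \<Rightarrow> 'n)) B' (\<lambda>N. \<Psi>)"
    unfolding \<Psi>_def by (rule em_family_pullback[OF ls _ B']) simp
  have \<Psi>: "\<Psi> = (\<lambda>h. ?\<Phi> (h + c))" by (simp add: \<Psi>_def)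
  have der: "iter_deriv coord_list \<Psi> = (\<lambda>h. ?X (h + c))"
    unfolding \<Psi> using ls by (subst iter_deriv_translate) (simp_all only: left_supported_def iter_deriv_foldr_antideriv[OF B])
  have sum: "(\<Sum>z\<in>{z. \<forall>i. if i \<in> range (id::'n \<Rightarrow> 'n) then z i < N * (B' + 1) else z i = 0}.
        iter_deriv (filter (\<lambda>i. i \<in> range id) coord_list) \<Psi> (- ((1 / real N) *\<^sub>R (\<chi> i. real (z i)))))
     = (\<Sum>y | grid_point (- (A' *v c)) N y \<in> ?P \<and> \<psi> (grid_point (- (A' *v c)) N y) \<noteq> 0.
           \<psi> (grid_point (- (A' *v c)) N y))" if "N \<ge> 1" for N
  proof -
    have f: "filter (\<lambda>i. i \<in> range id) coord_list = (coord_list :: 'n list)" by simp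
    have "(\<Sum>z\<in>{z. \<forall>i. if i \<in> range (id::'n \<Rightarrow> 'n) then z i < N * (B' + 1) else z i = 0}.
        iter_deriv coord_list \<Psi> (- ((1 / real N) *\<^sub>R (\<chi> i. real (z i)))))
      = (\<Sum>z\<in>{z. \<forall>i. if i \<in> range (id::'n \<Rightarrow> 'n) then z i < N * (B' + 1) else z i = 0}.
           \<psi> (A' *v (- (c - (1 / real N) *\<^sub>R (\<chi> j. real (z (id j)))))))"
      unfolding der by (intro sum.cong refl) (simp only: id_apply uminus_add_conv_diff)
    then show ?thesis unfolding f
      using cone_sum[OF A inj_on_id that, of B \<psi> c B'] B B' unfolding left_supported_def by simp
  qed
  obtain C where C: "\<forall>N\<ge>1. norm (
      (\<Sum>\<gamma> | multi_order \<gamma> \<le> 0. ((\<Prod>i\<in>UNIV. fps_nth todd_fps (\<gamma> i)) * (1 / real N) ^ multi_order \<gamma>) *\<^sub>R multi_deriv \<gamma> \<Psi> 0)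
    - (1 / real N) ^ card (range (id::'n \<Rightarrow> 'n)) *\<^sub>R
      (\<Sum>z\<in>{z. (\<forall>i. if i \<in> range (id::'n \<Rightarrow> 'n) then z i < N * (B' + 1) else z i = 0)}.
        iter_deriv (filter (\<lambda>i. i \<in> range id) coord_list) \<Psi> (- ((1 / real N) *\<^sub>R (\<chi> i. real (z i))))))
    \<le> C * (1 / real N) ^ (0 + 1)"
    using euler_maclaurin_orthant[OF em, of 0] by blast
  \<comment> \<open>At order 0 the truncated Todd operator is the identity, since its constant
    coefficient is 1.\<close>
  have \<gamma>0: "(\<Sum>\<gamma> | multi_order \<gamma> \<le> 0. ((\<Prod>i\<in>UNIV. fps_nth todd_fps (\<gamma> i)) * (1 / real N) ^ multi_order \<gamma>) *\<^sub>R multi_deriv \<gamma> \<Psi> 0) = ?\<Phi> c" for N :: nat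
  proof -
    have "{\<gamma>::'n \<Rightarrow> nat. multi_order \<gamma> \<le> 0} = {\<lambda>_. 0}" by (auto simp: fun_eq_iff)
    moreover have "multi_deriv (\<lambda>_. 0) \<Psi> 0 = \<Psi> 0"
      using length_multi_list[of "\<lambda>_::'n. 0"] by (simp add: multi_deriv_eq)
    ultimately show ?thesis by (simp add: todd_fps_0 \<Psi>)
  qed
  have bound: "norm (?S N - ?\<Phi> c) \<le> norm (1 / real N) * C" if "N \<ge> 1" for N
  proof -
    have "norm (?\<Phi> c - ?S N) \<le> C * (1 / real N)"
      using C[rule_format, OF that] unfolding \<gamma>0 sum[OF that] by simp
    then show ?thesis by (simp add: norm_minus_commute mult.commute)
  qed
  have "(\<lambda>N. ?S N - ?\<Phi> c) \<longlonglongrightarrow> 0"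
  proof (rule tendsto_0_le[where f = "\<lambda>N. 1 / real N" and K = C])
    show "(\<lambda>N. 1 / real N) \<longlonglongrightarrow> 0" using lim_1_over_n by simp
    show "\<forall>\<^sub>F N in sequentially. norm (?S N - ?\<Phi> c) \<le> norm (1 / real N) * C"
      unfolding eventually_sequentially using bound by blast
  qed
  then have "?S \<longlonglongrightarrow> ?\<Phi> c" by (simp add: LIM_zero_iff)
  moreover have "?S \<longlonglongrightarrow> integral ?P \<psi>"
    by (rule riemann_sum_convex(1)[OF convex_shifted_cone closed_shifted_cone smooth_imp_continuous_on[OF \<psi>(1)] \<psi>(2)])
  ultimately show ?thesis using LIMSEQ_unique by blast
qed

text \<open>As a function of the shifts, the integral is a pullback of an iterated antiderivative,
  whose mixed derivative over the active facets gives back \<open>\<psi>\<close>. Thus the sum in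
  \<open>euler_maclaurin_orthant\<close> is a sum of values of \<open>\<psi>\<close>.\<close>

theorem euler_maclaurin_cone:
  fixes A A' :: "real^'n::finite^'n" and \<psi> :: "real^'n \<Rightarrow> complex" and \<iota> :: "'n \<Rightarrow> 'm::finite"
  assumes A: "\<forall>i j. A $ i $ j \<in> \<int>" "\<forall>i j. A' $ i $ j \<in> \<int>" "A ** A' = mat 1" "A' ** A = mat 1"
    and \<psi>: "smooth \<psi>" "\<And>x. \<psi> x \<noteq> 0 \<Longrightarrow> \<forall>i. \<bar>x $ i\<bar> \<le> K"
    and \<iota>: "inj \<iota>" and c: "c \<in> int_lattice"
  defines "\<Psi> \<equiv> \<lambda>h::real^'m. integral {x. \<forall>j. 0 \<le> (A *v x) $ j + c $ j + h $ \<iota> j} \<psi>"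
  shows "smooth \<Psi>"
    and "\<exists>C. \<forall>N\<ge>1. norm (
      (\<Sum>\<gamma> | multi_order \<gamma> \<le> M. ((\<Prod>i\<in>UNIV. fps_nth todd_fps (\<gamma> i)) * (1 / real N) ^ multi_order \<gamma>) *\<^sub>R multi_deriv \<gamma> \<Psi> 0)
    - (1 / real N) ^ CARD('n) *\<^sub>R
      (\<Sum>l | l \<in> int_lattice \<and> (\<forall>j. 0 \<le> (A *v ((1 / real N) *\<^sub>R l)) $ j + c $ j) \<and> \<psi> ((1 / real N) *\<^sub>R l) \<noteq> 0. \<psi> ((1 / real N) *\<^sub>R l)))
    \<le> C * (1 / real N) ^ (M + 1)"
proof -
  let ?X = "\<lambda>\<eta>. \<psi> (A' *v (- \<eta>))"
  let ?P = "{x. \<forall>j. 0 \<le> (A *v x) $ j + c $ j}"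
  let ?p = "- (A' *v c)"
  obtain B where B: "left_supported B ?X" using left_supported_reflect[OF A(3) \<psi>] by blast
  let ?\<Phi> = "foldr (antideriv B) coord_list ?X"
  have ls: "left_supported B ?\<Phi>" by (rule left_supported_foldr[OF B])
  then have sm: "smooth ?\<Phi>" by (simp add: left_supported_def)
  have \<Psi>: "\<Psi> = (\<lambda>h. ?\<Phi> ((\<chi> j. h $ \<iota> j) + c))"
  proof
    fix h
    have "{x. \<forall>j. 0 \<le> (A *v x) $ j + c $ j + h $ \<iota> j} = {x. \<forall>j. 0 \<le> (A *v x) $ j + ((\<chi> j. h $ \<iota> j) + c) $ j}"
      by (simp add: add_ac)
    then have "\<Psi> h = integral {x. \<forall>j. 0 \<le> (A *v x) $ j + ((\<chi> j. h $ \<iota> j) + c) $ j} \<psi>"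
      by (simp only: \<Psi>_def)
    also have "\<dots> = ?\<Phi> ((\<chi> j. h $ \<iota> j) + c)"
      by (rule integral_unimodular_cone[OF A \<psi> B])
    finally show "\<Psi> h = ?\<Phi> ((\<chi> j. h $ \<iota> j) + c)" .
  qed
  show "smooth \<Psi>" unfolding \<Psi> by (rule smooth_pullback[OF sm])
  obtain B' :: nat where B': "\<And>j. B + c $ j \<le> real B'"
  proof -
    obtain B' :: nat where "Max (range (\<lambda>j. B + c $ j)) \<le> real B'" using real_arch_simple by blast
    then show ?thesis using that[of B'] Max_ge[of "range (\<lambda>j. B + c $ j)"] by (meson finite_imageI finite order.trans rangeI)
  qed
  have em: "em_family (range \<iota>) B' (\<lambda>N. \<Psi>)"
    unfolding \<Psi> by (rule em_family_pullback[OF ls \<iota> B'])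
  \<comment> \<open>The coordinates of the cone in the order in which \<open>coord_list\<close>
    meets their facets. This may differ from their own fixed order, so the commutation of
    derivatives is needed.\<close>
  define js where "js = map (inv \<iota>) (filter (\<lambda>i. i \<in> range \<iota>) coord_list)"
  have js1: "map \<iota> js = filter (\<lambda>i. i \<in> range \<iota>) coord_list"
    unfolding js_def map_map by (rule map_idI) (auto simp: \<iota>)
  have "set js = UNIV"
  proof -
    have "\<iota> ` set js = range \<iota>" using js1 coord_list(2) by (metis (no_types, lifting) set_map set_filter Collect_conj_eq Collect_mem_eq UNIV_def inf_top_left UNIV_I Collect_cong)
    then show ?thesis using \<iota> by (simp add: inj_image_eq_iff)
  qed
  moreover have "distinct js"
    using coord_list(1) js1 by (metis distinct_filter distinct_map)
  ultimately have "mset js = mset coord_list"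
    using coord_list by (metis set_eq_iff_mset_eq_distinct)
  then have "iter_deriv js ?\<Phi> = ?X"
    using iter_deriv_perm[OF sm] iter_deriv_foldr_antideriv[OF B] by metis
  then have der: "iter_deriv (filter (\<lambda>i. i \<in> range \<iota>) coord_list) \<Psi> = (\<lambda>h. ?X ((\<chi> j. h $ \<iota> j) + c))"
    unfolding \<Psi> js1[symmetric] iter_deriv_pullback[OF sm \<iota>] by simp
  have sum: "(\<Sum>z\<in>{z. \<forall>i. if i \<in> range \<iota> then z i < N * (B' + 1) else z i = 0}.
        iter_deriv (filter (\<lambda>i. i \<in> range \<iota>) coord_list) \<Psi> (- ((1 / real N) *\<^sub>R (\<chi> i. real (z i)))))
     = (\<Sum>l | l \<in> int_lattice \<and> (\<forall>j. 0 \<le> (A *v ((1 / real N) *\<^sub>R l)) $ j + c $ j) \<and> \<psi> ((1 / real N) *\<^sub>R l) \<noteq> 0. \<psi> ((1 / real N) *\<^sub>R l))"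
    if N: "N \<ge> 1" for N
  proof -
    have "(\<Sum>z\<in>{z. \<forall>i. if i \<in> range \<iota> then z i < N * (B' + 1) else z i = 0}.
        iter_deriv (filter (\<lambda>i. i \<in> range \<iota>) coord_list) \<Psi> (- ((1 / real N) *\<^sub>R (\<chi> i. real (z i)))))
      = (\<Sum>z\<in>{z. \<forall>i. if i \<in> range \<iota> then z i < N * (B' + 1) else z i = 0}.
           \<psi> (A' *v (- (c - (1 / real N) *\<^sub>R (\<chi> j. real (z (\<iota> j)))))))"
    proof (intro sum.cong refl)
      fix z :: "'m \<Rightarrow> nat"
      have "(\<chi> j. (- ((1 / real N) *\<^sub>R (\<chi> i. real (z i)))) $ \<iota> j) + c = c - (1 / real N) *\<^sub>R (\<chi> j. real (z (\<iota> j)))"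
        by (simp add: vec_eq_iff)
      then show "iter_deriv (filter (\<lambda>i. i \<in> range \<iota>) coord_list) \<Psi> (- ((1 / real N) *\<^sub>R (\<chi> i. real (z i))))
         = \<psi> (A' *v (- (c - (1 / real N) *\<^sub>R (\<chi> j. real (z (\<iota> j))))))"
        by (simp only: der)
    qed
    also have "\<dots> = (\<Sum>y | grid_point ?p N y \<in> ?P \<and> \<psi> (grid_point ?p N y) \<noteq> 0. \<psi> (grid_point ?p N y))"
      by (rule cone_sum[OF A \<iota> N _ B']) (use B in \<open>simp only: left_supported_def\<close>)
    also have "\<dots> = (\<Sum>l | l \<in> int_lattice \<and> (\<forall>j. 0 \<le> (A *v ((1 / real N) *\<^sub>R l)) $ j + c $ j) \<and> \<psi> ((1 / real N) *\<^sub>R l) \<noteq> 0. \<psi> ((1 / real N) *\<^sub>R l))"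
    proof (rule sum.reindex_bij_witness[where i = "\<lambda>l i. \<lfloor>(l - real N *\<^sub>R ?p) $ i\<rfloor>" and j = "\<lambda>y. real N *\<^sub>R ?p + (\<chi> i. real_of_int (y i))"])
      \<comment> \<open>Integrality of \<open>c\<close> enters here: the apex is a lattice point, so
        \<open>N\<close> times the grid based at the apex is the lattice itself.\<close>
      have Np: "real N *\<^sub>R ?p \<in> int_lattice"
        by (intro int_lattice_scale int_lattice_minus int_matrix_vector_mult A c)
      have scale: "(1 / real N) *\<^sub>R (real N *\<^sub>R q + w) = q + (1 / real N) *\<^sub>R w" for q w :: "real^'n"
        using N by (simp add: scaleR_add_right del: scaleR_minus_right)
      {
        fix y
        have g: "(1 / real N) *\<^sub>R (real N *\<^sub>R ?p + (\<chi> i. real_of_int (y i))) = grid_point ?p N y"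
          unfolding grid_point_def by (rule scale)
        have "real N *\<^sub>R ?p + (\<chi> i. real_of_int (y i)) \<in> int_lattice"
          by (intro int_lattice_add Np int_lattice_of_int)
        then show "real N *\<^sub>R ?p + (\<chi> i. real_of_int (y i)) \<in> {l. l \<in> int_lattice \<and> (\<forall>j. 0 \<le> (A *v ((1 / real N) *\<^sub>R l)) $ j + c $ j) \<and> \<psi> ((1 / real N) *\<^sub>R l) \<noteq> 0}"
          if "y \<in> {y. grid_point ?p N y \<in> ?P \<and> \<psi> (grid_point ?p N y) \<noteq> 0}"
          using that unfolding mem_Collect_eq g by blast
        show "\<psi> ((1 / real N) *\<^sub>R (real N *\<^sub>R ?p + (\<chi> i. real_of_int (y i)))) = \<psi> (grid_point ?p N y)" by (simp only: g)
        show "(\<lambda>i. \<lfloor>(real N *\<^sub>R ?p + (\<chi> i. real_of_int (y i)) - real N *\<^sub>R ?p) $ i\<rfloor>) = y" by simp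
      }
      fix l assume l: "l \<in> {l. l \<in> int_lattice \<and> (\<forall>j. 0 \<le> (A *v ((1 / real N) *\<^sub>R l)) $ j + c $ j) \<and> \<psi> ((1 / real N) *\<^sub>R l) \<noteq> 0}"
      have lp: "l - real N *\<^sub>R ?p \<in> int_lattice" using l by (intro int_lattice_diff Np) blast
      have eq: "real N *\<^sub>R ?p + (\<chi> i. real_of_int \<lfloor>(l - real N *\<^sub>R ?p) $ i\<rfloor>) = l"
        using int_lattice_floor[OF lp] by simp
      then show "real N *\<^sub>R ?p + (\<chi> i. real_of_int \<lfloor>(l - real N *\<^sub>R ?p) $ i\<rfloor>) = l" .
      have "grid_point ?p N (\<lambda>i. \<lfloor>(l - real N *\<^sub>R ?p) $ i\<rfloor>) = (1 / real N) *\<^sub>R (real N *\<^sub>R ?p + (\<chi> i. real_of_int \<lfloor>(l - real N *\<^sub>R ?p) $ i\<rfloor>))"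
        unfolding grid_point_def by (rule scale[symmetric])
      then have "grid_point ?p N (\<lambda>i. \<lfloor>(l - real N *\<^sub>R ?p) $ i\<rfloor>) = (1 / real N) *\<^sub>R l" by (simp only: eq)
      then show "(\<lambda>i. \<lfloor>(l - real N *\<^sub>R ?p) $ i\<rfloor>) \<in> {y. grid_point ?p N y \<in> ?P \<and> \<psi> (grid_point ?p N y) \<noteq> 0}"
        using l unfolding mem_Collect_eq by (simp only: simp_thms)
    qed
    finally show ?thesis .
  qed
  show "\<exists>C. \<forall>N\<ge>1. norm (
      (\<Sum>\<gamma> | multi_order \<gamma> \<le> M. ((\<Prod>i\<in>UNIV. fps_nth todd_fps (\<gamma> i)) * (1 / real N) ^ multi_order \<gamma>) *\<^sub>R multi_deriv \<gamma> \<Psi> 0)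
    - (1 / real N) ^ CARD('n) *\<^sub>R
      (\<Sum>l | l \<in> int_lattice \<and> (\<forall>j. 0 \<le> (A *v ((1 / real N) *\<^sub>R l)) $ j + c $ j) \<and> \<psi> ((1 / real N) *\<^sub>R l) \<noteq> 0. \<psi> ((1 / real N) *\<^sub>R l)))
    \<le> C * (1 / real N) ^ (M + 1)"
    using euler_maclaurin_orthant[OF em, of M] sum \<iota> by (simp add: card_image)
qed

section \<open>Todd coefficients and cut-off functions\<close>

lemma has_fps_expansion_todd:
  "(\<lambda>x::real. if x = 0 then 1 else x / (1 - exp (- x))) has_fps_expansion todd_fps"
proof -
  have nz: "fps_nth (1 - fps_exp (-1) :: real fps) 1 \<noteq> 0" by simp
  then have 1: "(1 - fps_exp (-1) :: real fps) \<noteq> 0" by (metis fps_zero_nth)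
  have 2: "subdegree (1 - fps_exp (-1) :: real fps) = 1"
    using nz by (intro subdegreeI) auto
  show ?thesis unfolding todd_fps_def
    by (rule has_fps_expansion_divide[OF has_fps_expansion_fps_X has_fps_expansion_diff[OF has_fps_expansion_1 has_fps_expansion_exp_neg1]])
      (use 1 2 in auto)
qed

lemma fps_nth_funpow_deriv: "fps_nth ((fps_deriv ^^ k) F) 0 = fact k * fps_nth (F :: real fps) k"
  by (induction k arbitrary: F) (simp_all add: funpow_swap1[of fps_deriv] algebra_simps del: funpow.simps add: funpow_Suc_right)

lemma fps_conv_radius_funpow_deriv: "fps_conv_radius ((fps_deriv ^^ k) (F :: real fps)) \<ge> fps_conv_radius F"
  by (induction k) (auto intro: order.trans[OF _ fps_conv_radius_deriv])

lemma count_list_concat_replicate: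
  "distinct xs \<Longrightarrow> count_list (concat (map (\<lambda>i. replicate (\<alpha> i) i) xs)) i = (if i \<in> set xs then \<alpha> i else 0)"
proof (induction xs)
  case (Cons x xs)
  have "count_list (replicate n x) i = (if x = i then n else 0)" for n
    by (induction n) auto
  then show ?case using Cons by auto
qed simp

lemma count_multi_list: "count_list (multi_list \<alpha>) i = \<alpha> i"
  by (simp add: multi_list_def count_list_concat_replicate coord_list)

text \<open>Near 0 the function \<open>todd\<close> is a product of convergent power series in
  separate variables, so its derivatives there are products of derivatives of the series; the
  factorials cancel.\<close>

theorem todd_coeff_eq: "todd_coeff \<gamma> = (\<Prod>i\<in>UNIV. fps_nth todd_fps (\<gamma> i))"
proof -
  let ?t = "\<lambda>x::real. if x = 0 then 1 else x / (1 - exp (- x))"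
  let ?D = "\<lambda>k. eval_fps ((fps_deriv ^^ k) todd_fps)"
  have ev: "eventually (\<lambda>x. eval_fps todd_fps x = ?t x) (nhds 0)" and pos: "fps_conv_radius todd_fps > 0"
    using has_fps_expansion_todd by (auto simp: has_fps_expansion_def)
  obtain d where d: "d > 0" "\<And>x. \<bar>x\<bar> < d \<Longrightarrow> eval_fps todd_fps x = ?t x"
    using ev unfolding eventually_nhds_metric by (auto simp: dist_real_def)
  obtain r0 where r0: "r0 > 0" "ereal r0 < fps_conv_radius todd_fps"
    using pos by (metis ereal_dense2 ereal_less(2) less_ereal.simps(1) zero_ereal_def)
  \<comment> \<open>Within this radius the series both converges and agrees with the function given
    by cases.\<close>
  define r where "r = min d r0"
  have r: "r > 0" "\<And>x. \<bar>x\<bar> < r \<Longrightarrow> eval_fps todd_fps x = ?t x"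
    using d r0 by (auto simp: r_def)
  have rad: "ereal (norm x) < fps_conv_radius ((fps_deriv ^^ k) todd_fps)" if "\<bar>x\<bar> < r" for x k
  proof -
    have "ereal (norm x) < ereal r0" using that by (simp add: r_def)
    then show ?thesis using r0(2) fps_conv_radius_funpow_deriv[of todd_fps k] by order
  qed
  define U where "U = {x::real^'a. \<forall>i. \<bar>x $ i\<bar> < r}"
  have oU: "open U"
  proof -
    have "U = (\<Inter>i\<in>UNIV. {x. \<bar>x $ i\<bar> < r})" by (auto simp: U_def)
    moreover have "open {x::real^'a. \<bar>x $ i\<bar> < r}" for i by (intro open_Collect_less continuous_intros)
    ultimately show ?thesis by (simp only:) (rule open_INT, auto)
  qed
  \<comment> \<open>Stated on all of \<open>U\<close>, since the induction differentiates the
    formula; only the number of occurrences of each direction matters.\<close>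
  have main: "\<forall>x\<in>U. iter_deriv ds todd x = (\<Prod>i\<in>UNIV. ?D (count_list ds i) (x $ i))" for ds
  proof (induction ds)
    case Nil
    show ?case
    proof
      fix x assume "x \<in> U"
      then show "iter_deriv [] todd x = (\<Prod>i\<in>UNIV. ?D (count_list [] i) (x $ i))"
        by (auto simp: todd_def U_def r(2) intro!: prod.cong)
    qed
  next
    case (Cons d ds)
    show ?case
    proof
      fix x assume x: "x \<in> U"
      let ?P = "\<lambda>x. \<Prod>i\<in>UNIV. ?D (count_list ds i) (x $ i)"
      have "iter_deriv (d # ds) todd x = partial_deriv d ?P x"
        using partial_deriv_cong_open[OF oU, of "iter_deriv ds todd" ?P x d] Cons.IH x by simp
      also have "\<dots> = ?D (Suc (count_list ds d)) (x $ d) * (\<Prod>i\<in>UNIV - {d}. ?D (count_list ds i) (x $ i))"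
        unfolding partial_deriv_def
      proof (rule vector_derivative_at)
        let ?c = "\<Prod>i\<in>UNIV - {d}. ?D (count_list ds i) (x $ i)"
        have P: "?P (x + s *\<^sub>R axis d 1) = ?D (count_list ds d) (x $ d + s) * ?c" for s
        proof -
          have "?P (x + s *\<^sub>R axis d 1) = ?D (count_list ds d) ((x + s *\<^sub>R axis d 1) $ d) *
              (\<Prod>i\<in>UNIV - {d}. ?D (count_list ds i) ((x + s *\<^sub>R axis d 1) $ i))"
            by (rule prod.remove) auto
          also have "(\<Prod>i\<in>UNIV - {d}. ?D (count_list ds i) ((x + s *\<^sub>R axis d 1) $ i)) = ?c"
            by (intro prod.cong refl) (simp add: axis_def)
          finally show ?thesis by (simp add: axis_def)
        qed
        have "ereal (norm (x $ d + 0)) < fps_conv_radius ((fps_deriv ^^ count_list ds d) todd_fps)"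
          using rad x by (simp add: U_def)
        from has_field_derivative_eval_fps[OF this, of UNIV]
        have "((\<lambda>s. ?D (count_list ds d) (x $ d + s)) has_field_derivative ?D (Suc (count_list ds d)) (x $ d)) (at 0)"
          by (simp add: DERIV_shift[where x = "0::real" and z = "x $ d", symmetric] add.commute)
        then have "((\<lambda>s. ?D (count_list ds d) (x $ d + s) * ?c) has_field_derivative ?D (Suc (count_list ds d)) (x $ d) * ?c) (at 0)"
          by (rule DERIV_cmult_right)
        then show "((\<lambda>s. ?P (x + s *\<^sub>R axis d 1)) has_vector_derivative ?D (Suc (count_list ds d)) (x $ d) * ?c) (at 0)"
          unfolding P by (simp add: has_real_derivative_iff_has_vector_derivative)
      qed
      also have "\<dots> = (\<Prod>i\<in>UNIV. ?D (count_list (d # ds) i) (x $ i))"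
      proof -
        have "(\<Prod>i\<in>UNIV. ?D (count_list (d # ds) i) (x $ i)) = ?D (count_list (d # ds) d) (x $ d) * (\<Prod>i\<in>UNIV - {d}. ?D (count_list (d # ds) i) (x $ i))"
          by (rule prod.remove) auto
        also have "(\<Prod>i\<in>UNIV - {d}. ?D (count_list (d # ds) i) (x $ i)) = (\<Prod>i\<in>UNIV - {d}. ?D (count_list ds i) (x $ i))"
          by (intro prod.cong refl) auto
        finally show ?thesis by simp
      qed
      finally show "iter_deriv (d # ds) todd x = (\<Prod>i\<in>UNIV. ?D (count_list (d # ds) i) (x $ i))" .
    qed
  qed
  have "0 \<in> U" using r(1) by (simp add: U_def)
  then have "multi_deriv \<gamma> todd 0 = (\<Prod>i\<in>UNIV. ?D (\<gamma> i) 0)"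
    using main[of "multi_list \<gamma>"] by (simp add: multi_deriv_eq count_multi_list)
  also have "\<dots> = (\<Prod>i\<in>UNIV. fact (\<gamma> i)) * (\<Prod>i\<in>UNIV. fps_nth todd_fps (\<gamma> i))"
    by (simp add: eval_fps_at_0 fps_nth_funpow_deriv prod.distrib)
  finally show ?thesis by (simp add: todd_coeff_def)
qed

section \<open>Smooth cut-off functions\<close>

fun exp_inv_poly :: "nat \<Rightarrow> real poly" where
  "exp_inv_poly 0 = 1"
| "exp_inv_poly (Suc k) = [:0, 0, 1:] * (exp_inv_poly k - pderiv (exp_inv_poly k))"

text \<open>The \<open>k\<close>-th derivative of \<open>exp (- 1 / x)\<close>, extended by 0. With
  \<open>y = 1 / x\<close> one has \<open>dy / dx = - y\<^sup>2\<close>, so differentiating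
  \<open>p y * exp (- y)\<close> yields \<open>y\<^sup>2 * (p y - p' y) * exp (- y)\<close>, which
  is the recursion of \<open>exp_inv_poly\<close>.\<close>

definition flat_exp :: "nat \<Rightarrow> real \<Rightarrow> real" where
  "flat_exp k x = (if x \<le> 0 then 0 else poly (exp_inv_poly k) (1 / x) * exp (- 1 / x))"

lemma tendsto_poly_times_exp_minus: "((\<lambda>y::real. poly p y * exp (- y)) \<longlongrightarrow> 0) at_top"
proof -
  have "((\<lambda>y. coeff p i * y ^ i * exp (- y)) \<longlongrightarrow> 0) at_top" for i
    using tendsto_mult_right_zero[OF tendsto_power_div_exp_0[of i], of "coeff p i"]
    by (simp add: exp_minus divide_inverse mult.assoc)
  then have "((\<lambda>y. \<Sum>i\<le>degree p. coeff p i * y ^ i * exp (- y)) \<longlongrightarrow> 0) at_top"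
    by (intro tendsto_null_sum)
  then show ?thesis by (simp add: poly_altdef sum_distrib_right)
qed

lemma flat_exp_deriv: "(flat_exp k has_real_derivative flat_exp (Suc k) x) (at x)"
proof -
  consider "x < 0" | "x > 0" | "x = 0" by linarith
  then show ?thesis
  proof cases
    case 1
    have "((\<lambda>x. 0) has_real_derivative 0) (at x)" by simp
    then have "(flat_exp k has_real_derivative 0) (at x)"
      by (rule has_field_derivative_transform_within_open[where S = "{..<0}"]) (use 1 in \<open>auto simp: flat_exp_def\<close>)
    then show ?thesis using 1 by (simp add: flat_exp_def)
  next
    case 2
    let ?p = "exp_inv_poly k"
    have "((\<lambda>x. poly ?p (1 / x) * exp (- 1 / x)) has_real_derivative
        poly (pderiv ?p) (1 / x) * (- (1 / x^2)) * exp (- 1 / x) + poly ?p (1 / x) * (exp (- 1 / x) * (1 / x^2))) (at x)"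
      using 2 by (auto intro!: derivative_eq_intros poly_DERIV[THEN DERIV_chain2] simp: power2_eq_square)
    also have "poly (pderiv ?p) (1 / x) * (- (1 / x^2)) * exp (- 1 / x) + poly ?p (1 / x) * (exp (- 1 / x) * (1 / x^2))
       = flat_exp (Suc k) x"
      using 2 by (simp add: flat_exp_def power2_eq_square algebra_simps)
    finally show ?thesis
      by (rule has_field_derivative_transform_within_open[where S = "{0<..}"]) (use 2 in \<open>auto simp: flat_exp_def\<close>)
  next
    case 3
    have "((\<lambda>h. (flat_exp k (0 + h) - flat_exp k 0) / h) \<longlongrightarrow> 0) (at_left 0)"
      by (rule Lim_transform_eventually[OF tendsto_const])
        (auto simp: flat_exp_def eventually_at_filter)
    \<comment> \<open>From the right, the difference quotient at 0 is a polynomial in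
      \<open>1 / h\<close> times \<open>exp (- 1 / h)\<close>, so the exponential wins.\<close>
    moreover have "((\<lambda>h. (flat_exp k (0 + h) - flat_exp k 0) / h) \<longlongrightarrow> 0) (at_right 0)"
    proof (rule Lim_transform_eventually)
      show "((\<lambda>h. poly ([:0, 1:] * exp_inv_poly k) (inverse h) * exp (- inverse h)) \<longlongrightarrow> 0) (at_right (0::real))"
        by (rule filterlim_compose[OF tendsto_poly_times_exp_minus filterlim_inverse_at_top_right])
      show "\<forall>\<^sub>F h in at_right 0. poly ([:0, 1:] * exp_inv_poly k) (inverse h) * exp (- inverse h) = (flat_exp k (0 + h) - flat_exp k 0) / h"
        by (auto simp: flat_exp_def eventually_at_filter field_simps)
    qed
    ultimately have "((\<lambda>h. (flat_exp k (0 + h) - flat_exp k 0) / h) \<longlongrightarrow> 0) (at 0)"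
      by (simp add: filterlim_split_at)
    then show ?thesis using 3 by (simp add: DERIV_def flat_exp_def)
  qed
qed

text \<open>The chain rule replaces \<open>D j\<close> by \<open>D (Suc j)\<close>, so the induction
  on the order of differentiability runs over all members of the tower at once.\<close>

lemma smooth_compose_real:
  fixes D :: "nat \<Rightarrow> real \<Rightarrow> real" and g :: "real^'n::finite \<Rightarrow> real"
  assumes D: "\<And>k x. (D k has_real_derivative D (Suc k) x) (at x)" and g: "smooth g"
  shows "smooth (\<lambda>x. D j (g x))"
proof -
  have "times_cont_diff k (\<lambda>x. D j (g x))" for k
  proof (induction k arbitrary: j)
    case 0
    have "continuous_on UNIV (D j)"
      using D by (meson DERIV_isCont continuous_at_imp_continuous_on)
    then show ?case
      using continuous_on_compose2[OF _ smooth_imp_continuous_on[OF g]] by auto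
  next
    case (Suc k)
    show ?case
    proof (rule times_cont_diff_SucI)
      fix x
      have "((\<lambda>x. D j (g x)) has_derivative (\<lambda>v. D (Suc j) (g x) * (\<Sum>i\<in>UNIV. v $ i *\<^sub>R partial_deriv i g x))) (at x)"
        using has_derivative_compose[OF smooth_has_derivative[OF g, of x] has_field_derivative_imp_has_derivative[OF D[of j "g x"]]] .
      then show "((\<lambda>x. D j (g x)) has_derivative (\<lambda>v. D (Suc j) (g x) * (\<Sum>i\<in>UNIV. v $ i *\<^sub>R partial_deriv i g x))) (at x)" .
    next
      fix i
      have "times_cont_diff k (\<lambda>x. D (Suc j) (g x) * partial_deriv i g x)"
        using Suc smooth_partial_deriv[OF g] unfolding smooth_def
        by (intro times_cont_diff_bilinear[OF bounded_bilinear_mult]) auto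
      then show "times_cont_diff k (\<lambda>x. D (Suc j) (g x) * (\<Sum>ia\<in>UNIV. axis i 1 $ ia *\<^sub>R partial_deriv ia g x))"
        by (simp only: sum_axis_scaleR)
    qed
  qed
  then show ?thesis by (simp add: smooth_def)
qed

lemma smooth_component: "smooth (\<lambda>x::real^'n::finite. x $ i)"
proof -
  have "times_cont_diff k (\<lambda>x::real^'n. x $ i)" for k
  proof (cases k)
    case (Suc m)
    have "((\<lambda>x::real^'n. x $ i) has_derivative (\<lambda>v. v $ i)) (at x)" for x
      by (rule bounded_linear_imp_has_derivative[OF bounded_linear_vec_nth])
    then show ?thesis unfolding Suc by (rule times_cont_diff_SucI) (rule times_cont_diff_const)
  qed (auto intro: continuous_intros)
  then show ?thesis by (simp add: smooth_def)
qed

text \<open>The inner value \<open>exp (-1) - flat_exp 0 (1 - x)\<close> is nonpositive exactly for \<open>x \<le> 0\<close>, where the outer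
  \<open>flat_exp 0\<close> vanishes, and constant for \<open>x \<ge> 1\<close>.\<close>

definition smooth_step :: "real \<Rightarrow> real" where
  "smooth_step x = flat_exp 0 (exp (- 1) - flat_exp 0 (1 - x)) / flat_exp 0 (exp (- 1))"

lemma smooth_step_0: "x \<le> 0 \<Longrightarrow> smooth_step x = 0"
proof -
  assume "x \<le> 0"
  then have "exp (- 1 / (1 - x)) \<ge> exp (- 1 :: real)" by (simp add: field_simps)
  then show ?thesis using \<open>x \<le> 0\<close> by (simp add: smooth_step_def flat_exp_def)
qed

lemma smooth_step_1: "x \<ge> 1 \<Longrightarrow> smooth_step x = 1"
  by (simp add: smooth_step_def flat_exp_def)

lemma smooth_smooth_step:
  fixes g :: "real^'n::finite \<Rightarrow> real"
  assumes "smooth g"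
  shows "smooth (\<lambda>x. smooth_step (g x))"
proof -
  note comp = smooth_compose_real[where D = flat_exp, OF flat_exp_deriv]
  have "smooth (\<lambda>x. flat_exp 0 (1 - g x))"
    by (rule comp) (intro smooth_diff smooth_const assms)
  then have "smooth (\<lambda>x. exp (- 1) - flat_exp 0 (1 - g x))"
    by (rule smooth_diff[OF smooth_const])
  then have "smooth (\<lambda>x. flat_exp 0 (exp (- 1) - flat_exp 0 (1 - g x)))"
    by (rule comp)
  from smooth_cmult[OF this, of "1 / flat_exp 0 (exp (- 1))"] show ?thesis by (simp add: smooth_step_def)
qed

text \<open>A product of one-dimensional steps: cubes instead of balls make each factor a function
  of a single coordinate.\<close>

lemma smooth_bump_exists:
  fixes p :: "real^'n::finite"
  assumes "\<epsilon> > 0"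
  obtains \<beta> :: "real^'n \<Rightarrow> complex" where "smooth \<beta>" "\<And>x. (\<forall>i. \<bar>x $ i - p $ i\<bar> \<le> \<epsilon>) \<Longrightarrow> \<beta> x = 1"
    "\<And>x i. \<bar>x $ i - p $ i\<bar> \<ge> 2 * \<epsilon> \<Longrightarrow> \<beta> x = 0"
proof -
  define b where "b x = (\<Prod>i\<in>UNIV. smooth_step (2 - (1 / \<epsilon>) * (x $ i - p $ i)) * smooth_step (2 + (1 / \<epsilon>) * (x $ i - p $ i)))" for x
  have "smooth b"
    unfolding b_def
    by (intro smooth_prod smooth_mult smooth_smooth_step smooth_diff smooth_add smooth_const smooth_component smooth_cmult)
  then have "smooth (\<lambda>x. complex_of_real (b x))" by (rule smooth_linear[OF bounded_linear_of_real])
  moreover have "complex_of_real (b x) = 1" if "\<forall>i. \<bar>x $ i - p $ i\<bar> \<le> \<epsilon>" for x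
  proof -
    have "smooth_step (2 - (1 / \<epsilon>) * (x $ i - p $ i)) = 1" "smooth_step (2 + (1 / \<epsilon>) * (x $ i - p $ i)) = 1" for i
      using that[rule_format, of i] assms by (auto intro!: smooth_step_1 simp: abs_le_iff field_simps)
    then show ?thesis by (simp add: b_def)
  qed
  moreover have "complex_of_real (b x) = 0" if "\<bar>x $ i - p $ i\<bar> \<ge> 2 * \<epsilon>" for x i
  proof -
    have "2 - (1 / \<epsilon>) * (x $ i - p $ i) \<le> 0 \<or> 2 + (1 / \<epsilon>) * (x $ i - p $ i) \<le> 0"
      using that assms by (auto simp: abs_real_def field_simps split: if_splits)
    then have "smooth_step (2 - (1 / \<epsilon>) * (x $ i - p $ i)) * smooth_step (2 + (1 / \<epsilon>) * (x $ i - p $ i)) = 0"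
      using smooth_step_0 by auto
    then show ?thesis unfolding b_def of_real_eq_0_iff by (intro prod_zero) auto
  qed
  ultimately show ?thesis using that by blast
qed

section \<open>Regular polytopes\<close>

lemma det_int_matrix:
  fixes M :: "real^'n::finite^'n"
  assumes "\<forall>i j. M $ i $ j \<in> \<int>"
  shows "det M \<in> \<int>"
  unfolding det_def using assms by (intro Ints_sum Ints_mult Ints_of_int Ints_prod) auto

text \<open>Cramer's rule: the entries of the inverse are determinants of integer matrices divided
  by \<open>det M\<close>, which is 1 or -1.\<close>

lemma unimodular_inverse:
  fixes M :: "real^'n::finite^'n"
  assumes "\<forall>i j. M $ i $ j \<in> \<int>" "\<bar>det M\<bar> = 1"
  obtains M' where "\<forall>i j. M' $ i $ j \<in> \<int>" "M ** M' = mat 1" "M' ** M = mat 1"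
proof -
  have d0: "det M \<noteq> 0" using assms(2) by auto
  then obtain M' where M': "M ** M' = mat 1" "M' ** M = mat 1"
    using invertible_det_nz[of M] by (auto simp: invertible_def)
  have "M' $ i $ j \<in> \<int>" for i j
  proof -
    have "M *v (M' *v axis j 1) = axis j 1" by (simp add: matrix_vector_mul_assoc M')
    then have "M' *v axis j 1 = (\<chi> k. det (\<chi> i l. if l = k then axis j 1 $ i else M $ i $ l) / det M)"
      using cramer[OF d0] by blast
    then have "(M' *v axis j 1) $ i = det (\<chi> k l. if l = i then axis j 1 $ k else M $ k $ l) / det M" by simp
    also have "\<dots> \<in> \<int>"
    proof -
      have d: "det (\<chi> k l. if l = i then (axis j 1 :: real^'n) $ k else M $ k $ l) \<in> \<int>"
        using assms(1) by (intro det_int_matrix) (auto simp: axis_def)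
      have "det M = 1 \<or> det M = -1" using assms(2) by linarith
      then show ?thesis using d by auto
    qed
    finally show ?thesis by (simp add: matrix_vector_mult_basis column_def)
  qed
  then show ?thesis using that M' by blast
qed

lemma int_lattice_inner: "x \<in> int_lattice \<Longrightarrow> y \<in> int_lattice \<Longrightarrow> x \<bullet> (y :: real^'n::finite) \<in> \<int>"
  unfolding inner_vec_def int_lattice_def by (auto intro!: Ints_sum Ints_mult)

lemma primitive_vector_multiple:
  assumes "primitive_vector w" "r \<in> int_lattice" "w = c *\<^sub>R r" "c \<in> \<int>" "c > 0"
  shows "c = 1"
proof -
  obtain k where k: "c = of_int k" using assms(4) by (auto elim: Ints_cases)
  then have "\<bar>k\<bar> = 1" using assms unfolding primitive_vector_def by blast
  then show ?thesis using k assms(5) by auto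
qed

lemma primitive_vector_nonzero: "primitive_vector w \<Longrightarrow> w \<noteq> 0"
proof
  assume "primitive_vector w" "w = 0"
  then have "\<bar>0::int\<bar> = 1" unfolding primitive_vector_def by (metis of_int_0 scaleR_zero_left)
  then show False by simp
qed

locale regular_polytope =
  fixes \<Delta> :: "(real^'n::finite) set" and u :: "'m::finite \<Rightarrow> real^'n" and a :: "'m \<Rightarrow> int"
  assumes regular: "regular_lattice_polytope \<Delta>"
    and interior_0: "0 \<in> interior \<Delta>"
    and halfspaces: "\<Delta> = {x. \<forall>i. 0 \<le> x \<bullet> u i + of_int (a i)}"
    and facets: "bij_betw (\<lambda>i. {x \<in> \<Delta>. x \<bullet> u i + of_int (a i) = 0}) UNIV {F. F facet_of \<Delta>}"
    and primitive: "\<forall>i. primitive_vector (u i)"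
    and offsets_pos: "\<forall>i. 0 < a i"
begin

lemma polytope: "polytope \<Delta>"
  using regular by (simp add: regular_lattice_polytope_def)

lemma compact: "compact \<Delta>" and convex: "convex \<Delta>"
  using polytope polytope_imp_compact polytope_imp_convex by blast+

text \<open>Both sides are invariant under positive scaling of \<open>z\<close>, so \<open>z\<close>
  may be shrunk until \<open>v + z\<close> is in the range of \<open>e(2)\<close> and the
  constraints that are strict at \<open>v\<close> stay strict.\<close>

lemma tangent_cone:
  assumes v: "v \<in> \<Delta>" and e: "e > 0" "\<And>z. norm z < e \<Longrightarrow> v + z \<in> \<Delta> \<longleftrightarrow> (\<forall>j. 0 \<le> (M *v z) $ j)"
  shows "(\<forall>i. v \<bullet> u i + of_int (a i) = 0 \<longrightarrow> 0 \<le> z \<bullet> u i) \<longleftrightarrow> (\<forall>j. 0 \<le> (M *v z) $ j)"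
proof -
  have "eventually (\<lambda>t. norm (t *\<^sub>R z) < e) (at_right (0::real))"
  proof (rule order_tendstoD(2)[OF _ e(1)])
    show "((\<lambda>t. norm (t *\<^sub>R z)) \<longlongrightarrow> 0) (at_right 0)"
      by (rule tendsto_eq_intros refl | simp)+
  qed
  moreover have "eventually (\<lambda>t. v \<bullet> u i + of_int (a i) \<noteq> 0 \<longrightarrow> 0 < (v + t *\<^sub>R z) \<bullet> u i + of_int (a i)) (at_right (0::real))" for i
  proof (cases "v \<bullet> u i + of_int (a i) = 0")
    case False
    then have pos: "v \<bullet> u i + of_int (a i) > 0" using v halfspaces by (auto simp: less_le)
    have "((\<lambda>t. (v + t *\<^sub>R z) \<bullet> u i + of_int (a i)) \<longlongrightarrow> (v + 0 *\<^sub>R z) \<bullet> u i + of_int (a i)) (at_right (0::real))"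
      by (intro tendsto_intros)
    from order_tendstoD(1)[OF this] pos show ?thesis by (auto elim: eventually_mono)
  qed simp
  then have "eventually (\<lambda>t. \<forall>i\<in>UNIV. v \<bullet> u i + of_int (a i) \<noteq> 0 \<longrightarrow> 0 < (v + t *\<^sub>R z) \<bullet> u i + of_int (a i)) (at_right (0::real))"
    by (intro eventually_ball_finite) auto
  moreover have "eventually (\<lambda>t::real. t > 0) (at_right 0)" by (simp add: eventually_at_right_less)
  ultimately have "eventually (\<lambda>t. norm (t *\<^sub>R z) < e \<and> t > 0 \<and> (\<forall>i. v \<bullet> u i + of_int (a i) \<noteq> 0 \<longrightarrow> 0 < (v + t *\<^sub>R z) \<bullet> u i + of_int (a i))) (at_right (0::real))"
    by eventually_elim auto
  then obtain t where t: "norm (t *\<^sub>R z) < e" "t > 0"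
    "\<And>i. v \<bullet> u i + of_int (a i) \<noteq> 0 \<Longrightarrow> 0 < (v + t *\<^sub>R z) \<bullet> u i + of_int (a i)"
    using eventually_happens'[OF trivial_limit_at_right_real] by blast
  have "(\<forall>i. v \<bullet> u i + of_int (a i) = 0 \<longrightarrow> 0 \<le> z \<bullet> u i) \<longleftrightarrow> v + t *\<^sub>R z \<in> \<Delta>"
  proof -
    have "0 \<le> (v + t *\<^sub>R z) \<bullet> u i + of_int (a i) \<longleftrightarrow> (v \<bullet> u i + of_int (a i) = 0 \<longrightarrow> 0 \<le> z \<bullet> u i)" for i
    proof (cases "v \<bullet> u i + of_int (a i) = 0")
      case True
      then have "(v + t *\<^sub>R z) \<bullet> u i + of_int (a i) = t * (z \<bullet> u i)" by (simp add: inner_add_left)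
      then show ?thesis using True t(2) by (simp add: zero_le_mult_iff)
    next
      case False
      then show ?thesis using t(3) by (auto simp: less_imp_le)
    qed
    then show ?thesis using halfspaces by auto
  qed
  also have "\<dots> \<longleftrightarrow> (\<forall>j. 0 \<le> (M *v (t *\<^sub>R z)) $ j)" by (rule e(2)[OF t(1)])
  also have "\<dots> \<longleftrightarrow> (\<forall>j. 0 \<le> (M *v z) $ j)"
    using t(2) by (simp add: matrix_vector_mult_scaleR zero_le_mult_iff)
  finally show ?thesis .
qed

text \<open>A facet inside another facet is a face of it; equal dimension forces equality, and
  \<open>facets\<close> says that distinct indices give distinct facets.\<close>

lemma facet_subset_imp_eq:
  assumes "{x \<in> \<Delta>. x \<bullet> u i + of_int (a i) = 0} \<subseteq> {x \<in> \<Delta>. x \<bullet> u k + of_int (a k) = 0}"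
  shows "i = k"
proof -
  let ?F = "\<lambda>i. {x \<in> \<Delta>. x \<bullet> u i + of_int (a i) = 0}"
  have f: "?F i facet_of \<Delta>" for i using facets by (auto simp: bij_betw_def)
  have "?F i face_of ?F k"
    using face_of_subset[OF facet_of_imp_face_of[OF f] assms] facet_of_imp_subset[OF f] by blast
  moreover have "convex (?F k)" using f face_of_imp_convex facet_of_imp_face_of by blast
  ultimately have "?F i = ?F k"
    using face_of_aff_dim_lt[of "?F k" "?F i"] f[of i] f[of k] by (auto simp: facet_of_def)
  then show ?thesis using facets by (auto simp: bij_betw_def inj_on_def)
qed

text \<open>The chart and the active constraints describe the same cone at \<open>v\<close>.
  Comparing them shows that every row of \<open>M\<close> is an active normal, by primitivity with
  factor 1, and that no other normal is active.\<close>

lemma vertex_chart: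
  assumes v: "v extreme_point_of \<Delta>"
  obtains A A' :: "real^'n^'n" and \<iota> :: "'n \<Rightarrow> 'm" where
    "\<forall>i j. A $ i $ j \<in> \<int>" "\<forall>i j. A' $ i $ j \<in> \<int>" "A ** A' = mat 1" "A' ** A = mat 1"
    "inj \<iota>" "\<forall>x j. (A *v x) $ j = x \<bullet> u (\<iota> j)" "range \<iota> = {i. v \<bullet> u i + of_int (a i) = 0}"
proof -
  have vD: "v \<in> \<Delta>" using v by (simp add: extreme_point_of_def)
  obtain T U where T: "unimodular_affine T" "T v = 0" "open U" "v \<in> U"
      "openin (top_of_set orthant) (T ` (\<Delta> \<inter> U))"
    using regular v unfolding regular_lattice_polytope_def by blast
  obtain M b where M: "\<forall>i j. M $ i $ j \<in> \<int>" "\<bar>det M\<bar> = 1" "T = (\<lambda>x. M *v x + b)"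
    using T(1) unfolding unimodular_affine_def by blast
  obtain M' where M': "\<forall>i j. M' $ i $ j \<in> \<int>" "M ** M' = mat 1" "M' ** M = mat 1"
    using unimodular_inverse[OF M(1,2)] by blast
  have inv: "M' *v (M *v x) = x" "M *v (M' *v x) = x" for x
    by (simp_all add: matrix_vector_mul_assoc M')
  have Tv: "T (v + z) = M *v z" for z
    using T(2) by (simp add: M(3) matrix_vector_right_distrib algebra_simps)
  obtain W where W: "open W" "T ` (\<Delta> \<inter> U) = orthant \<inter> W" using T(5) by (auto simp: openin_open)
  have "0 \<in> W" using W(2) T(2,4) vD by (metis IntD2 IntI imageI)
  have cM: "continuous_on UNIV (\<lambda>z. M *v z)" by (intro linear_continuous_on) (simp add: linear_conv_bounded_linear[symmetric])
  have "open ((\<lambda>z. v + z) -` U \<inter> (\<lambda>z. M *v z) -` W)"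
    by (intro open_Int open_vimage T(3) W(1) cM continuous_intros)
  moreover have "0 \<in> (\<lambda>z. v + z) -` U \<inter> (\<lambda>z. M *v z) -` W" using T(4) \<open>0 \<in> W\<close> by simp
  ultimately obtain e where e: "e > 0" "ball 0 e \<subseteq> (\<lambda>z. v + z) -` U \<inter> (\<lambda>z. M *v z) -` W"
    using open_contains_ball by meson
  have loc: "v + z \<in> \<Delta> \<longleftrightarrow> (\<forall>j. 0 \<le> (M *v z) $ j)" if "norm z < e" for z
  proof -
    have zU: "v + z \<in> U" "M *v z \<in> W" using e(2) that by auto
    show ?thesis
    proof
      assume "v + z \<in> \<Delta>"
      then have "T (v + z) \<in> orthant" using W(2) zU(1) by blast
      then show "\<forall>j. 0 \<le> (M *v z) $ j" by (simp add: Tv orthant_def)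
    next
      assume "\<forall>j. 0 \<le> (M *v z) $ j"
      then have "M *v z \<in> T ` (\<Delta> \<inter> U)" using W(2) zU(2) by (auto simp: orthant_def)
      then obtain y where y: "y \<in> \<Delta>" "T y = M *v z" by auto
      have "M *v (y - v) = M *v z" using y(2) Tv[of "y - v"] by simp
      then have "y - v = z" by (metis inv(1))
      then show "v + z \<in> \<Delta>" using y(1) by auto
    qed
  qed
  have cone: "(\<forall>i. v \<bullet> u i + of_int (a i) = 0 \<longrightarrow> 0 \<le> z \<bullet> u i) \<longleftrightarrow> (\<forall>j. 0 \<le> (M *v z) $ j)" for z
    by (rule tangent_cone[OF vD e(1) loc])
  \<comment> \<open>The edge directions of the cone at \<open>v\<close>. For active \<open>i\<close>
    the numbers \<open>c i j\<close> are nonnegative integers, the coordinates of \<open>u i\<close>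
    with respect to the rows of \<open>M\<close>.\<close>
  define w where "w j = M' *v axis j 1" for j
  define c where "c i j = w j \<bullet> u i" for i j
  have Mw: "(M *v w j) $ k = (if k = j then 1 else 0)" for j k
    by (simp add: w_def inv axis_def)
  have wl: "w j \<in> int_lattice" for j
    unfolding w_def by (intro int_matrix_vector_mult M') (auto simp: int_lattice_def axis_def)
  have ul: "u i \<in> int_lattice" for i using primitive by (simp add: primitive_vector_def)
  have c_int: "c i j \<in> \<int>" for i j unfolding c_def by (intro int_lattice_inner wl ul)
  have c_nn: "0 \<le> c i j" if "v \<bullet> u i + of_int (a i) = 0" for i j
  proof -
    have "\<forall>k. 0 \<le> (M *v w j) $ k" by (simp add: Mw)
    then show ?thesis using cone[of "w j"] that unfolding c_def by blast
  qed
  have expand: "x \<bullet> u i = (\<Sum>j\<in>UNIV. (M *v x) $ j * c i j)" for x i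
  proof -
    have "M *v x = (\<Sum>j\<in>UNIV. (M *v x) $ j *\<^sub>R axis j 1)"
      by (metis basis_expansion scalar_mult_eq_scaleR)
    then have "M' *v (M *v x) = M' *v (\<Sum>j\<in>UNIV. (M *v x) $ j *\<^sub>R axis j 1)" by simp
    also have "\<dots> = (\<Sum>j\<in>UNIV. M' *v ((M *v x) $ j *\<^sub>R axis j 1))"
      by (rule linear_sum[OF matrix_vector_mul_linear])
    also have "\<dots> = (\<Sum>j\<in>UNIV. (M *v x) $ j *\<^sub>R w j)"
      by (simp only: matrix_vector_mult_scaleR w_def)
    finally have "x = (\<Sum>j\<in>UNIV. (M *v x) $ j *\<^sub>R w j)" unfolding inv .
    then have "x \<bullet> u i = (\<Sum>j\<in>UNIV. (M *v x) $ j *\<^sub>R w j) \<bullet> u i" by simp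
    then show ?thesis by (simp add: inner_sum_left c_def)
  qed
  have Mi: "M $ j \<in> int_lattice" for j using M(1) by (simp add: int_lattice_def)
  have Mrow: "(M *v x) $ j = x \<bullet> M $ j" for x j by (simp add: matrix_vector_mul_component inner_commute)
  have "\<exists>i. v \<bullet> u i + of_int (a i) = 0 \<and> (\<forall>x. (M *v x) $ j = x \<bullet> u i)" for j
  proof -
    \<comment> \<open>The vector \<open>z\<close> violates only the \<open>j\<close>-th inequality
      of the cone, so some active normal is negative on it. That normal is not known in advance; the
      sum over all \<open>i\<close> makes \<open>t\<close> large enough for each of them.\<close>
    define t where "t = (\<Sum>i\<in>UNIV. \<bar>c i j\<bar>)"
    define z where "z = - w j + t *\<^sub>R (\<Sum>k\<in>UNIV - {j}. w k)"
    have "(M *v z) $ j = -1"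
    proof -
      have "z \<bullet> M $ j = - (w j \<bullet> M $ j) + t * (\<Sum>k\<in>UNIV - {j}. w k \<bullet> M $ j)"
        unfolding z_def inner_add_left inner_minus_left inner_scaleR_left inner_sum_left ..
      also have "(\<Sum>k\<in>UNIV - {j}. w k \<bullet> M $ j) = 0"
        unfolding Mrow[symmetric] Mw by (intro sum.neutral) auto
      finally show ?thesis using Mw[of j j] by (simp add: Mrow)
    qed
    then have "(M *v z) $ j < 0" by simp
    then have "\<not> (\<forall>j. 0 \<le> (M *v z) $ j)" by (meson not_le)
    then have "\<not> (\<forall>i. v \<bullet> u i + of_int (a i) = 0 \<longrightarrow> 0 \<le> z \<bullet> u i)" using cone[of z] by blast
    then obtain i where i: "v \<bullet> u i + of_int (a i) = 0" "z \<bullet> u i < 0" by (meson not_le)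
    have zi: "z \<bullet> u i = - c i j + t * (\<Sum>k\<in>UNIV - {j}. c i k)"
      unfolding z_def c_def inner_add_left inner_minus_left inner_scaleR_left inner_sum_left ..
    have t: "c i j \<le> t" unfolding t_def
      by (rule order.trans[OF abs_ge_self]) (rule member_le_sum, auto)
    \<comment> \<open>Being an integer, a nonzero \<open>c i k\<close> would be at least 1, and
      \<open>t \<ge> c i j\<close> would then make \<open>z \<bullet> u i\<close>
      nonnegative.\<close>
    have zero: "c i k = 0" if "k \<noteq> j" for k
    proof (rule ccontr)
      assume "c i k \<noteq> 0"
      obtain m where m: "c i k = of_int m" using c_int[of i k] by (auto elim: Ints_cases)
      then have "1 \<le> c i k" using \<open>c i k \<noteq> 0\<close> c_nn[OF i(1), of k] by simp
      also have "c i k \<le> (\<Sum>k\<in>UNIV - {j}. c i k)"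
        using that c_nn[OF i(1)] by (intro member_le_sum) auto
      finally have "t * 1 \<le> t * (\<Sum>k\<in>UNIV - {j}. c i k)"
        using t c_nn[OF i(1), of j] by (intro mult_left_mono) auto
      then show False using i(2) zi t by simp
    qed
    have xi: "x \<bullet> u i = (M *v x) $ j * c i j" for x
    proof -
      have "x \<bullet> u i = (M *v x) $ j * c i j + (\<Sum>k\<in>UNIV - {j}. (M *v x) $ k * c i k)"
        unfolding expand by (rule sum.remove) auto
      also have "(\<Sum>k\<in>UNIV - {j}. (M *v x) $ k * c i k) = 0" using zero by (intro sum.neutral) auto
      finally show ?thesis by simp
    qed
    have pos: "c i j > 0" using i(2) zi zero by simp
    have "u i = c i j *\<^sub>R M $ j"
    proof (rule vector_eq_ldot[THEN iffD1, rule_format])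
      fix x show "x \<bullet> u i = x \<bullet> (c i j *\<^sub>R M $ j)" by (simp add: xi Mrow)
    qed
    \<comment> \<open>A primitive vector is no proper multiple of a lattice vector, and the rows of
      \<open>M\<close> are lattice vectors.\<close>
    then have "c i j = 1" using primitive_vector_multiple[OF _ Mi _ c_int pos] primitive by blast
    then have "\<forall>x. (M *v x) $ j = x \<bullet> u i" using xi by simp
    with i(1) show ?thesis by blast
  qed
  then obtain \<iota> where \<iota>: "\<And>j. v \<bullet> u (\<iota> j) + of_int (a (\<iota> j)) = 0" "\<And>j x. (M *v x) $ j = x \<bullet> u (\<iota> j)" by metis
  have "inj \<iota>"
  proof (rule injI)
    fix j k assume "\<iota> j = \<iota> k"
    then have "(M *v w j) $ j = (M *v w j) $ k" by (simp add: \<iota>(2))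
    then show "j = k" by (simp add: Mw split: if_splits)
  qed
  moreover have "range \<iota> = {i. v \<bullet> u i + of_int (a i) = 0}"
  proof
    show "range \<iota> \<subseteq> {i. v \<bullet> u i + of_int (a i) = 0}" using \<iota>(1) by auto
    show "{i. v \<bullet> u i + of_int (a i) = 0} \<subseteq> range \<iota>"
    proof
      fix i assume "i \<in> {i. v \<bullet> u i + of_int (a i) = 0}"
      then have i: "v \<bullet> u i + of_int (a i) = 0" by simp
      have "\<exists>j. c i j \<noteq> 0"
      proof (rule ccontr)
        assume "\<nexists>j. c i j \<noteq> 0"
        then have "u i \<bullet> u i = 0" unfolding expand by simp
        then show False using primitive primitive_vector_nonzero by auto
      qed
      then obtain j where j: "c i j \<noteq> 0" by blast
      \<comment> \<open>On the facet of \<open>i\<close> a sum of nonnegative terms vanishes, hence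
        so does its \<open>j\<close>-th term; with \<open>c i j \<noteq> 0\<close> this puts
        \<open>x\<close> on the facet of \<open>\<iota> j\<close>.\<close>
      have "{x \<in> \<Delta>. x \<bullet> u i + of_int (a i) = 0} \<subseteq> {x \<in> \<Delta>. x \<bullet> u (\<iota> j) + of_int (a (\<iota> j)) = 0}"
      proof clarify
        fix x assume x: "x \<in> \<Delta>" "x \<bullet> u i + of_int (a i) = 0"
        have nn: "0 \<le> (M *v (x - v)) $ k" for k
        proof -
          have "0 \<le> x \<bullet> u (\<iota> k) + of_int (a (\<iota> k))" using x(1) halfspaces by auto
          then show ?thesis unfolding \<iota>(2) inner_diff_left using \<iota>(1)[of k] by linarith
        qed
        have "(x - v) \<bullet> u i = 0" using x(2) i by (simp add: inner_diff_left)
        then have "(\<Sum>k\<in>UNIV. (M *v (x - v)) $ k * c i k) = 0" unfolding expand .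
        moreover have "0 \<le> (M *v (x - v)) $ k * c i k" for k by (intro mult_nonneg_nonneg nn c_nn[OF i])
        ultimately have "(M *v (x - v)) $ j * c i j = 0"
          by (intro sum_nonneg_0[of UNIV "\<lambda>k. (M *v (x - v)) $ k * c i k" j]) auto
        then have "(x - v) \<bullet> u (\<iota> j) = 0" using j by (simp add: \<iota>(2))
        then show "x \<bullet> u (\<iota> j) + of_int (a (\<iota> j)) = 0" using \<iota>(1)[of j] by (simp add: inner_diff_left)
      qed
      from facet_subset_imp_eq[OF this] show "i \<in> range \<iota>" by simp
    qed
  qed
  ultimately show ?thesis using that[OF M(1) M'(1) M'(2,3)] \<iota>(2) by blast
qed

text \<open>The constraints active at \<open>p\<close> cut out a face of the polytope, and an
  extreme point of that face is a vertex.\<close>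

lemma vertex_below:
  assumes p: "p \<in> \<Delta>"
  obtains v where "v extreme_point_of \<Delta>"
    "\<And>i. p \<bullet> u i + of_int (a i) = 0 \<Longrightarrow> v \<bullet> u i + of_int (a i) = 0"
proof -
  define G where "G = {x \<in> \<Delta>. \<forall>i. p \<bullet> u i + of_int (a i) = 0 \<longrightarrow> x \<bullet> u i + of_int (a i) = 0}"
  have hp: "convex {x. x \<bullet> u i + of_int (a i) = 0}" "closed {x. x \<bullet> u i + of_int (a i) = 0}" for i
  proof -
    have "{x. x \<bullet> u i + of_int (a i) = 0} = {x. u i \<bullet> x = - of_int (a i)}"
      by (auto simp: inner_commute eq_neg_iff_add_eq_0)
    then show "convex {x. x \<bullet> u i + of_int (a i) = 0}" "closed {x. x \<bullet> u i + of_int (a i) = 0}"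
      by (simp_all add: convex_hyperplane closed_hyperplane)
  qed
  have G: "G = \<Delta> \<inter> (\<Inter>i\<in>{i. p \<bullet> u i + of_int (a i) = 0}. {x. x \<bullet> u i + of_int (a i) = 0})"
    by (auto simp: G_def)
  have "convex G" unfolding G by (intro convex_Int convex convex_INT hp)
  moreover have "compact G" unfolding G by (intro compact_Int_closed compact closed_INT ballI hp)
  moreover have "G \<noteq> {}" using p by (auto simp: G_def)
  ultimately obtain v where v: "v extreme_point_of G" using extreme_point_exists_convex by blast
  have "G face_of \<Delta>"
    unfolding face_of_def
  proof (intro conjI ballI impI)
    show "G \<subseteq> \<Delta>" by (auto simp: G_def)
    show "convex G" by fact
    fix y z x assume yz: "y \<in> \<Delta>" "z \<in> \<Delta>" "x \<in> G" "x \<in> open_segment y z"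
    then obtain s where s: "0 < s" "s < 1" "x = (1 - s) *\<^sub>R y + s *\<^sub>R z" by (auto simp: in_segment)
    have "y \<bullet> u i + of_int (a i) = 0 \<and> z \<bullet> u i + of_int (a i) = 0" if "p \<bullet> u i + of_int (a i) = 0" for i
    proof -
      have "0 = x \<bullet> u i + of_int (a i)" using yz(3) that by (simp add: G_def)
      also have "\<dots> = (1 - s) * (y \<bullet> u i + of_int (a i)) + s * (z \<bullet> u i + of_int (a i))"
        by (simp add: s(3) inner_add_left algebra_simps)
      finally have eq: "(1 - s) * (y \<bullet> u i + of_int (a i)) + s * (z \<bullet> u i + of_int (a i)) = 0" by simp
      have "0 \<le> y \<bullet> u i + of_int (a i)" "0 \<le> z \<bullet> u i + of_int (a i)" using yz(1,2) halfspaces by auto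
      then have "0 \<le> (1 - s) * (y \<bullet> u i + of_int (a i))" "0 \<le> s * (z \<bullet> u i + of_int (a i))" using s by auto
      then have "(1 - s) * (y \<bullet> u i + of_int (a i)) = 0" "s * (z \<bullet> u i + of_int (a i)) = 0" using eq by linarith+
      then show ?thesis using s by auto
    qed
    then show "y \<in> G" "z \<in> G" using yz(1,2) by (auto simp: G_def)
  qed
  then have "v extreme_point_of \<Delta>" using v by (simp add: extreme_point_of_face)
  moreover have "v \<in> G" using v by (simp add: extreme_point_of_def)
  ultimately show ?thesis using that by (simp add: G_def)
qed

text \<open>The chart of a vertex on the face of \<open>p\<close> serves near \<open>p\<close>:
  constraints inactive at that vertex are strict at \<open>p\<close> and remain so for small
  displacements and shifts. Those active at the vertex but strict at \<open>p\<close> do no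
  harm.\<close>

lemma local_chart:
  assumes p: "p \<in> \<Delta>"
  obtains \<epsilon> \<delta> :: real and A A' :: "real^'n^'n" and \<iota> :: "'n \<Rightarrow> 'm" where "\<epsilon> > 0" "\<delta> > 0"
    "\<forall>i j. A $ i $ j \<in> \<int>" "\<forall>i j. A' $ i $ j \<in> \<int>" "A ** A' = mat 1" "A' ** A = mat 1" "inj \<iota>"
    "\<And>x h. (\<And>i. \<bar>x $ i - p $ i\<bar> \<le> 2 * \<epsilon>) \<Longrightarrow> (\<And>i. \<bar>h $ i\<bar> < \<delta>) \<Longrightarrow>
      x \<in> shifted_polytope u a 1 h \<longleftrightarrow> (\<forall>j. 0 \<le> (A *v x) $ j + of_int (a (\<iota> j)) + h $ \<iota> j)"
proof -
  obtain v where v: "v extreme_point_of \<Delta>"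
    "\<And>i. p \<bullet> u i + of_int (a i) = 0 \<Longrightarrow> v \<bullet> u i + of_int (a i) = 0"
    using vertex_below[OF p] by blast
  obtain A A' :: "real^'n^'n" and \<iota> :: "'n \<Rightarrow> 'm" where A:
    "\<forall>i j. A $ i $ j \<in> \<int>" "\<forall>i j. A' $ i $ j \<in> \<int>" "A ** A' = mat 1" "A' ** A = mat 1"
    "inj \<iota>" "\<forall>x j. (A *v x) $ j = x \<bullet> u (\<iota> j)" "range \<iota> = {i. v \<bullet> u i + of_int (a i) = 0}"
    by (rule vertex_chart[OF v(1)])
  \<comment> \<open>Half the slack at \<open>p\<close>: the other half is left for the displacement
    of \<open>x\<close>. The value 1 on \<open>range \<iota>\<close> is a dummy that keeps the
    minimum positive.\<close>
  define m where "m i = (if i \<in> range \<iota> then 1 else (p \<bullet> u i + of_int (a i)) / 2)" for i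
  have m: "m i > 0" for i
  proof (cases "i \<in> range \<iota>")
    case False
    then have "p \<bullet> u i + of_int (a i) \<noteq> 0" using v(2) A(7) by blast
    moreover have "p \<bullet> u i + of_int (a i) \<ge> 0" using p halfspaces by auto
    ultimately show ?thesis using False by (simp add: m_def)
  qed (simp add: m_def)
  define \<delta> where "\<delta> = Min (range m)"
  have \<delta>: "\<delta> > 0" "\<And>i. \<delta> \<le> m i" using m by (auto simp: \<delta>_def)
  have "open {x. i \<in> range \<iota> \<or> (p \<bullet> u i + of_int (a i)) / 2 < x \<bullet> u i + of_int (a i)}" for i
    by (cases "i \<in> range \<iota>") (auto intro!: open_Collect_less continuous_intros)
  then have "open (\<Inter>i\<in>UNIV. {x. i \<in> range \<iota> \<or> (p \<bullet> u i + of_int (a i)) / 2 < x \<bullet> u i + of_int (a i)})"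
    by (intro open_INT) auto
  moreover have "p \<in> (\<Inter>i\<in>UNIV. {x. i \<in> range \<iota> \<or> (p \<bullet> u i + of_int (a i)) / 2 < x \<bullet> u i + of_int (a i)})"
  proof -
    have "i \<in> range \<iota> \<or> (p \<bullet> u i + of_int (a i)) / 2 < p \<bullet> u i + of_int (a i)" for i
      using m[of i] by (auto simp: m_def split: if_splits)
    then show ?thesis by blast
  qed
  ultimately obtain e where e: "e > 0"
    "ball p e \<subseteq> (\<Inter>i\<in>UNIV. {x. i \<in> range \<iota> \<or> (p \<bullet> u i + of_int (a i)) / 2 < x \<bullet> u i + of_int (a i)})"
    using open_contains_ball by meson
  \<comment> \<open>A cube of half side \<open>2 * \<epsilon>\<close> has \<open>l1\<close>-radius
    \<open>e / 2\<close>, hence lies in the ball of radius \<open>e\<close>.\<close>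
  define \<epsilon> where "\<epsilon> = e / (4 * CARD('n))"
  have \<epsilon>: "\<epsilon> > 0" using e(1) by (simp add: \<epsilon>_def)
  have "x \<in> shifted_polytope u a 1 h \<longleftrightarrow> (\<forall>j. 0 \<le> (A *v x) $ j + of_int (a (\<iota> j)) + h $ \<iota> j)"
    if x: "\<And>i. \<bar>x $ i - p $ i\<bar> \<le> 2 * \<epsilon>" and h: "\<And>i. \<bar>h $ i\<bar> < \<delta>" for x h
  proof -
    have "norm (x - p) \<le> (\<Sum>i\<in>UNIV. \<bar>(x - p) $ i\<bar>)" by (rule norm_le_l1_cart)
    also have "\<dots> \<le> (\<Sum>i\<in>(UNIV::'n set). 2 * \<epsilon>)" using x by (intro sum_mono) simp
    also have "\<dots> = e / 2" by (simp add: \<epsilon>_def)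
    also have "\<dots> < e" using e(1) by simp
    finally have "x \<in> ball p e" by (simp add: dist_norm norm_minus_commute)
    then have xe: "(p \<bullet> u i + of_int (a i)) / 2 < x \<bullet> u i + of_int (a i)" if "i \<notin> range \<iota>" for i
      using e(2) that by blast
    have pos: "0 \<le> x \<bullet> u i + 1 * of_int (a i) + h $ i" if "i \<notin> range \<iota>" for i
      using xe[OF that] h[of i] \<delta>(2)[of i] that by (simp add: m_def abs_less_iff)
    show ?thesis
    proof
      assume "x \<in> shifted_polytope u a 1 h"
      then show "\<forall>j. 0 \<le> (A *v x) $ j + of_int (a (\<iota> j)) + h $ \<iota> j"
        by (auto simp: shifted_polytope_def A(6))
    next
      assume *: "\<forall>j. 0 \<le> (A *v x) $ j + of_int (a (\<iota> j)) + h $ \<iota> j"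
      have "0 \<le> x \<bullet> u i + 1 * of_int (a i) + h $ i" for i
        using * pos by (cases "i \<in> range \<iota>") (auto simp: A(6))
      then show "x \<in> shifted_polytope u a 1 h" by (simp add: shifted_polytope_def)
    qed
  qed
  then show ?thesis using that[OF \<epsilon> \<delta>(1) A(1-5)] by blast
qed

end

section \<open>From cones to the polytope by a partition of unity\<close>

lemma finite_lattice_box: "finite {l \<in> int_lattice. \<forall>i. \<bar>(l::real^'n::finite) $ i\<bar> \<le> K}"
proof -
  have "{l \<in> int_lattice. \<forall>i. \<bar>(l::real^'n) $ i\<bar> \<le> K} \<subseteq> grid_point 0 1 ` {z. \<forall>i. \<bar>grid_point (0::real^'n) 1 z $ i\<bar> \<le> K}"
  proof
    fix l :: "real^'n" assume l: "l \<in> {l \<in> int_lattice. \<forall>i. \<bar>l $ i\<bar> \<le> K}"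
    have "grid_point 0 1 (\<lambda>i. \<lfloor>l $ i\<rfloor>) = l"
      using int_lattice_floor[of l] l by (simp add: grid_point_def)
    then show "l \<in> grid_point 0 1 ` {z. \<forall>i. \<bar>grid_point (0::real^'n) 1 z $ i\<bar> \<le> K}"
      using l by (intro image_eqI[of _ _ "\<lambda>i. \<lfloor>l $ i\<rfloor>"]) auto
  qed
  then show ?thesis by (rule finite_subset) (intro finite_imageI finite_grid, simp)
qed

text \<open>The products on the left add up to 1 wherever some \<open>\<beta> s\<close> equals 1, so
  they form a partition of unity without any division.\<close>

lemma partition_product:
  fixes \<beta> :: "nat \<Rightarrow> 'a::comm_ring_1"
  shows "(\<Sum>s<k. \<beta> s * (\<Prod>t<s. 1 - \<beta> t)) = 1 - (\<Prod>s<k. 1 - \<beta> s)"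
  by (induction k) (auto simp: algebra_simps)

lemma smooth_cone_integrable:
  fixes \<psi> :: "real^'n::finite \<Rightarrow> complex" and A :: "real^'n^'n"
  assumes "smooth \<psi>" "\<And>x. \<psi> x \<noteq> 0 \<Longrightarrow> \<forall>i. \<bar>x $ i\<bar> \<le> K"
  shows "\<psi> integrable_on {x. \<forall>j. 0 \<le> (A *v x) $ j + c $ j}"
  by (rule riemann_sum_convex(2)[OF convex_shifted_cone closed_shifted_cone smooth_imp_continuous_on[OF assms(1)] assms(2)])

context regular_polytope
begin

text \<open>Because \<open>a i \<ge> 1\<close>, a shift below \<open>\<delta>\<close> is at most
  \<open>\<delta> * a i\<close>, so the shifted polytope lies in the dilate of
  \<open>\<Delta>\<close> by \<open>1 + \<delta>\<close>.\<close>

lemma shifted_polytope_subset_open: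
  assumes "open W" "\<Delta> \<subseteq> W"
  obtains \<delta> where "\<delta> > 0" "\<And>h. (\<And>i. \<bar>h $ i\<bar> < \<delta>) \<Longrightarrow> shifted_polytope u a 1 h \<subseteq> W"
proof -
  obtain e where e: "e > 0" "(\<Union>x\<in>\<Delta>. ball x e) \<subseteq> W"
    using compact_subset_open_imp_ball_epsilon_subset[OF compact assms] by blast
  obtain R where R: "R > 0" "\<And>x. x \<in> \<Delta> \<Longrightarrow> norm x \<le> R"
    using compact_imp_bounded[OF compact] bounded_pos by blast
  \<comment> \<open>Dilating by \<open>1 + \<delta>\<close> moves points of \<open>\<Delta>\<close>
    by at most \<open>\<delta> * R = e / 2\<close>.\<close>
  define \<delta> where "\<delta> = e / (2 * R)"
  have \<delta>: "\<delta> > 0" using e R by (simp add: \<delta>_def)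
  have "x \<in> W" if h: "\<And>i. \<bar>h $ i\<bar> < \<delta>" and x: "x \<in> shifted_polytope u a 1 h" for h x
  proof -
    define y where "y = (1 / (1 + \<delta>)) *\<^sub>R x"
    have xy: "x = (1 + \<delta>) *\<^sub>R y" using \<delta> by (simp add: y_def)
    have "y \<in> \<Delta>"
    proof -
      have "0 \<le> y \<bullet> u i + of_int (a i)" for i
      proof -
        have "0 \<le> x \<bullet> u i + of_int (a i) + h $ i" using x by (simp add: shifted_polytope_def)
        also have "\<dots> \<le> x \<bullet> u i + of_int (a i) + \<delta> * of_int (a i)"
        proof -
          have "\<delta> * 1 \<le> \<delta> * of_int (a i)" using \<delta> offsets_pos[rule_format, of i] by (intro mult_left_mono) auto
          then show ?thesis using h[of i] by linarith
        qed
        also have "\<dots> = (1 + \<delta>) * (y \<bullet> u i + of_int (a i))" unfolding xy by (simp add: algebra_simps)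
        finally show ?thesis using \<delta> by (simp add: zero_le_mult_iff)
      qed
      then show ?thesis using halfspaces by auto
    qed
    moreover have "dist y x < e"
    proof -
      have "dist y x = norm (\<delta> *\<^sub>R y)" unfolding xy dist_norm by (simp add: norm_minus_commute scaleR_add_left)
      also have "\<dots> \<le> \<delta> * R" using R(2)[OF \<open>y \<in> \<Delta>\<close>] \<delta> by simp
      also have "\<dots> = e / 2" using R by (simp add: \<delta>_def)
      also have "\<dots> < e" using e by simp
      finally show ?thesis .
    qed
    ultimately have "x \<in> (\<Union>x\<in>\<Delta>. ball x e)" unfolding UN_iff mem_ball by blast
    then show "x \<in> W" using e(2) by blast
  qed
  then show ?thesis using that[OF \<delta>] by blast
qed

lemma shifted_polytope_0: "shifted_polytope u a 1 0 = \<Delta>"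
  using halfspaces by (simp add: shifted_polytope_def)

lemma dilated_lattice_points:
  assumes "N \<ge> 1"
  shows "(\<lambda>x. real N *\<^sub>R x) ` \<Delta> \<inter> int_lattice = {l \<in> int_lattice. (1 / real N) *\<^sub>R l \<in> \<Delta>}"
    and "finite {l \<in> int_lattice. (1 / real N) *\<^sub>R l \<in> \<Delta>}"
proof -
  show "(\<lambda>x. real N *\<^sub>R x) ` \<Delta> \<inter> int_lattice = {l \<in> int_lattice. (1 / real N) *\<^sub>R l \<in> \<Delta>}"
  proof (intro equalityI subsetI)
    fix l assume "l \<in> {l \<in> int_lattice. (1 / real N) *\<^sub>R l \<in> \<Delta>}"
    moreover have "l = real N *\<^sub>R ((1 / real N) *\<^sub>R l)" using assms by simp
    ultimately show "l \<in> (\<lambda>x. real N *\<^sub>R x) ` \<Delta> \<inter> int_lattice" by blast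
  qed (use assms in auto)
  obtain R where R: "R > 0" "\<And>x. x \<in> \<Delta> \<Longrightarrow> norm x \<le> R"
    using compact_imp_bounded[OF compact] bounded_pos by blast
  have "{l \<in> int_lattice. (1 / real N) *\<^sub>R l \<in> \<Delta>} \<subseteq> {l \<in> int_lattice. \<forall>i. \<bar>l $ i\<bar> \<le> real N * R}"
  proof clarify
    fix l i assume "(1 / real N) *\<^sub>R l \<in> \<Delta>"
    from R(2)[OF this] have "norm l \<le> real N * R" using assms by (simp add: field_simps)
    then show "\<bar>l $ i\<bar> \<le> real N * R" using component_le_norm_cart[of l i] by linarith
  qed
  then show "finite {l \<in> int_lattice. (1 / real N) *\<^sub>R l \<in> \<Delta>}"
    by (rule finite_subset[OF _ finite_lattice_box])
qed

definition chart_at :: "real^'n \<Rightarrow> real \<Rightarrow> real \<Rightarrow> real^'n^'n \<Rightarrow> real^'n^'n \<Rightarrow> ('n \<Rightarrow> 'm) \<Rightarrow> bool" where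
  "chart_at p \<epsilon> \<delta> A A' \<iota> \<longleftrightarrow> \<epsilon> > 0 \<and> \<delta> > 0 \<and>
    (\<forall>i j. A $ i $ j \<in> \<int>) \<and> (\<forall>i j. A' $ i $ j \<in> \<int>) \<and> A ** A' = mat 1 \<and> A' ** A = mat 1 \<and> inj \<iota> \<and>
    (\<forall>x h. (\<forall>i. \<bar>x $ i - p $ i\<bar> \<le> 2 * \<epsilon>) \<longrightarrow> (\<forall>i. \<bar>h $ i\<bar> < \<delta>) \<longrightarrow>
      (x \<in> shifted_polytope u a 1 h \<longleftrightarrow> (\<forall>j. 0 \<le> (A *v x) $ j + (\<chi> j. of_int (a (\<iota> j))) $ j + h $ \<iota> j)))"

lemma chart_at_exists: "p \<in> \<Delta> \<Longrightarrow> \<exists>\<epsilon> \<delta> A A' \<iota>. chart_at p \<epsilon> \<delta> A A' \<iota>"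
  using local_chart[of p] unfolding chart_at_def by (metis (no_types, lifting) vec_lambda_beta)

text \<open>On the support of \<open>\<psi>\<close> the polytope and its small shifts coincide with
  a unimodular cone, so integrals and lattice sums are those of
  \<open>euler_maclaurin_cone\<close>.\<close>

theorem euler_maclaurin_local:
  assumes chart: "chart_at p \<epsilon> \<delta> A A' \<iota>"
    and \<psi>: "smooth \<psi>" "\<And>x i. \<bar>x $ i - p $ i\<bar> \<ge> 2 * \<epsilon> \<Longrightarrow> \<psi> x = (0::complex)"
  shows "\<exists>\<Psi>. smooth \<Psi> \<and>
    (\<forall>h. (\<forall>i. \<bar>h $ i\<bar> < \<delta>) \<longrightarrow> (\<psi> has_integral \<Psi> h) (shifted_polytope u a 1 h)) \<and>
    (\<forall>M. \<exists>C. \<forall>N\<ge>1. norm (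
      (\<Sum>\<gamma> | multi_order \<gamma> \<le> M. (todd_coeff \<gamma> * (1 / real N) ^ multi_order \<gamma>) *\<^sub>R multi_deriv \<gamma> \<Psi> 0)
      - (1 / real N) ^ CARD('n) *\<^sub>R lattice_sum \<Delta> N (\<lambda>l. \<psi> ((1 / real N) *\<^sub>R l)))
      \<le> C * (1 / real N) ^ (M + 1))"
proof -
  define c :: "real^'n" where "c = (\<chi> j. of_int (a (\<iota> j)))"
  note ch = chart[unfolded chart_at_def, folded c_def]
  have A: "\<forall>i j. A $ i $ j \<in> \<int>" "\<forall>i j. A' $ i $ j \<in> \<int>" "A ** A' = mat 1" "A' ** A = mat 1" "inj \<iota>"
    using ch by blast+
  have c: "c \<in> int_lattice" by (simp add: c_def int_lattice_def)
  define K where "K = Max (range (\<lambda>i. \<bar>p $ i\<bar>)) + 2 * \<epsilon>"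
  have near: "\<forall>i. \<bar>x $ i - p $ i\<bar> \<le> 2 * \<epsilon>" if "\<psi> x \<noteq> 0" for x
  proof
    fix i show "\<bar>x $ i - p $ i\<bar> \<le> 2 * \<epsilon>"
      by (rule ccontr) (use \<psi>(2)[where x = x and i = i] that in auto)
  qed
  have K: "\<forall>i. \<bar>x $ i\<bar> \<le> K" if "\<psi> x \<noteq> 0" for x
  proof
    fix i
    have "\<bar>p $ i\<bar> \<le> Max (range (\<lambda>i. \<bar>p $ i\<bar>))" by (intro Max_ge) auto
    then show "\<bar>x $ i\<bar> \<le> K" unfolding K_def using near[OF that, rule_format, of i] by linarith
  qed
  define \<Psi> where "\<Psi> = (\<lambda>h::real^'m. integral {x. \<forall>j. 0 \<le> (A *v x) $ j + c $ j + h $ \<iota> j} \<psi>)"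
  have iff: "x \<in> shifted_polytope u a 1 h \<longleftrightarrow> (\<forall>j. 0 \<le> (A *v x) $ j + c $ j + h $ \<iota> j)"
    if "\<psi> x \<noteq> 0" "\<forall>i. \<bar>h $ i\<bar> < \<delta>" for x h
    using ch near[OF that(1)] that(2) by blast
  have int: "(\<psi> has_integral \<Psi> h) (shifted_polytope u a 1 h)" if h: "\<forall>i. \<bar>h $ i\<bar> < \<delta>" for h
  proof -
    have eq: "{x. \<forall>j. 0 \<le> (A *v x) $ j + c $ j + h $ \<iota> j} = {x. \<forall>j. 0 \<le> (A *v x) $ j + (c + (\<chi> j. h $ \<iota> j)) $ j}"
      by (simp add: add.assoc)
    have "(\<psi> has_integral \<Psi> h) {x. \<forall>j. 0 \<le> (A *v x) $ j + c $ j + h $ \<iota> j}"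
      unfolding \<Psi>_def eq by (rule integrable_integral[OF smooth_cone_integrable[OF \<psi>(1) K]])
    then have "((\<lambda>x. if x \<in> {x. \<forall>j. 0 \<le> (A *v x) $ j + c $ j + h $ \<iota> j} then \<psi> x else 0) has_integral \<Psi> h) UNIV"
      by (simp only: has_integral_restrict_UNIV)
    also have "(\<lambda>x. if x \<in> {x. \<forall>j. 0 \<le> (A *v x) $ j + c $ j + h $ \<iota> j} then \<psi> x else 0)
       = (\<lambda>x. if x \<in> shifted_polytope u a 1 h then \<psi> x else 0)"
      using iff[OF _ h] by (auto simp: fun_eq_iff)
    finally show ?thesis by (simp only: has_integral_restrict_UNIV)
  qed
  have ls: "lattice_sum \<Delta> N (\<lambda>l. \<psi> ((1 / real N) *\<^sub>R l)) =
      (\<Sum>l | l \<in> int_lattice \<and> (\<forall>j. 0 \<le> (A *v ((1 / real N) *\<^sub>R l)) $ j + c $ j) \<and> \<psi> ((1 / real N) *\<^sub>R l) \<noteq> 0. \<psi> ((1 / real N) *\<^sub>R l))"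
    if N: "N \<ge> 1" for N
  proof -
    have d: "\<forall>i. \<bar>(0::real^'m) $ i\<bar> < \<delta>" using ch by simp
    have mem: "x \<in> \<Delta> \<longleftrightarrow> (\<forall>j. 0 \<le> (A *v x) $ j + c $ j)" if "\<psi> x \<noteq> 0" for x
      using iff[OF that d] by (simp add: shifted_polytope_0)
    have set: "{l. l \<in> int_lattice \<and> (\<forall>j. 0 \<le> (A *v ((1 / real N) *\<^sub>R l)) $ j + c $ j) \<and> \<psi> ((1 / real N) *\<^sub>R l) \<noteq> 0}
       = {l \<in> {l \<in> int_lattice. (1 / real N) *\<^sub>R l \<in> \<Delta>}. \<psi> ((1 / real N) *\<^sub>R l) \<noteq> 0}"
      using mem by blast
    show ?thesis unfolding lattice_sum_def dilated_lattice_points(1)[OF N] set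
      by (rule sum.mono_neutral_right[OF dilated_lattice_points(2)[OF N]]) auto
  qed
  show ?thesis
  proof (intro exI[of _ \<Psi>] conjI allI impI)
    show "smooth \<Psi>" unfolding \<Psi>_def by (rule euler_maclaurin_cone(1)[OF A(1-4) \<psi>(1) K A(5) c])
    show "(\<psi> has_integral \<Psi> h) (shifted_polytope u a 1 h)" if "\<forall>i. \<bar>h $ i\<bar> < \<delta>" for h by (rule int[OF that])
    fix M
    obtain C where C: "\<forall>N\<ge>1. norm (
      (\<Sum>\<gamma> | multi_order \<gamma> \<le> M. ((\<Prod>i\<in>UNIV. fps_nth todd_fps (\<gamma> i)) * (1 / real N) ^ multi_order \<gamma>) *\<^sub>R multi_deriv \<gamma> \<Psi> 0)
      - (1 / real N) ^ CARD('n) *\<^sub>R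
      (\<Sum>l | l \<in> int_lattice \<and> (\<forall>j. 0 \<le> (A *v ((1 / real N) *\<^sub>R l)) $ j + c $ j) \<and> \<psi> ((1 / real N) *\<^sub>R l) \<noteq> 0. \<psi> ((1 / real N) *\<^sub>R l)))
      \<le> C * (1 / real N) ^ (M + 1)"
      using euler_maclaurin_cone(2)[OF A(1-4) \<psi>(1) K A(5) c, of M] unfolding \<Psi>_def by blast
    show "\<exists>C. \<forall>N\<ge>1. norm (
      (\<Sum>\<gamma> | multi_order \<gamma> \<le> M. (todd_coeff \<gamma> * (1 / real N) ^ multi_order \<gamma>) *\<^sub>R multi_deriv \<gamma> \<Psi> 0)
      - (1 / real N) ^ CARD('n) *\<^sub>R lattice_sum \<Delta> N (\<lambda>l. \<psi> ((1 / real N) *\<^sub>R l)))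
      \<le> C * (1 / real N) ^ (M + 1)"
      unfolding todd_coeff_eq using C ls by (intro exI[of _ C]) simp
  qed
qed

text \<open>All three assertions are additive in \<open>\<psi>\<close>, so \<open>\<psi>\<close> is
  split into finitely many pieces, each supported in one chart.\<close>

theorem euler_maclaurin_polytope:
  assumes \<psi>: "smooth (\<psi> :: real^'n \<Rightarrow> complex)"
  shows "\<exists>I. smooth I \<and>
    (\<exists>\<delta>>0. \<forall>h. (\<forall>i. \<bar>h $ i\<bar> < \<delta>) \<longrightarrow> (\<psi> has_integral I h) (shifted_polytope u a 1 h)) \<and>
    (\<forall>M. \<exists>C. \<forall>N\<ge>1. norm (
      (\<Sum>\<gamma> | multi_order \<gamma> \<le> M. (todd_coeff \<gamma> * (1 / real N) ^ multi_order \<gamma>) *\<^sub>R multi_deriv \<gamma> I 0)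
      - (1 / real N) ^ CARD('n) *\<^sub>R lattice_sum \<Delta> N (\<lambda>l. \<psi> ((1 / real N) *\<^sub>R l)))
      \<le> C * (1 / real N) ^ (M + 1))"
proof -
  obtain \<epsilon> \<delta> A A' \<iota> where chart: "\<And>p. p \<in> \<Delta> \<Longrightarrow> chart_at p (\<epsilon> p) (\<delta> p) (A p) (A' p) (\<iota> p)"
    using chart_at_exists by metis
  have \<epsilon>: "\<epsilon> p > 0" "\<delta> p > 0" if "p \<in> \<Delta>" for p using chart[OF that] unfolding chart_at_def by blast+
  define B where "B p = {x. \<forall>i. \<bar>x $ i - p $ i\<bar> < \<epsilon> p}" for p :: "real^'n"
  have oB: "open (B p)" for p
  proof -
    have "B p = (\<Inter>i\<in>UNIV. {x. \<bar>x $ i - p $ i\<bar> < \<epsilon> p})" by (auto simp: B_def)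
    moreover have "open {x::real^'n. \<bar>x $ i - p $ i\<bar> < \<epsilon> p}" for i by (intro open_Collect_less continuous_intros)
    ultimately show ?thesis by (simp only:) (rule open_INT, auto)
  qed
  have "\<Delta> \<subseteq> (\<Union>p\<in>\<Delta>. B p)" using \<epsilon> by (auto simp: B_def)
  then obtain D where D: "D \<subseteq> \<Delta>" "finite D" "\<Delta> \<subseteq> (\<Union>p\<in>D. B p)"
    using compactE_image[OF compact, of \<Delta> B] oB by blast
  obtain ps where ps: "set ps = D" using finite_list[OF D(2)] by blast
  define k where "k = length ps"
  have q: "ps ! s \<in> \<Delta>" if "s < k" for s using that ps D(1) by (auto simp: k_def)
  have "\<forall>s. \<exists>\<beta>. s < k \<longrightarrow> smooth \<beta> \<and> (\<forall>x. (\<forall>i. \<bar>x $ i - (ps ! s) $ i\<bar> \<le> \<epsilon> (ps ! s)) \<longrightarrow> \<beta> x = (1::complex)) \<and>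
      (\<forall>x i. \<bar>x $ i - (ps ! s) $ i\<bar> \<ge> 2 * \<epsilon> (ps ! s) \<longrightarrow> \<beta> x = 0)"
    using smooth_bump_exists \<epsilon>(1) q by metis
  then obtain \<beta> where \<beta>: "\<And>s. s < k \<Longrightarrow> smooth (\<beta> s)"
      "\<And>s x. s < k \<Longrightarrow> (\<forall>i. \<bar>x $ i - (ps ! s) $ i\<bar> \<le> \<epsilon> (ps ! s)) \<Longrightarrow> \<beta> s x = (1::complex)"
      "\<And>s x i. s < k \<Longrightarrow> \<bar>x $ i - (ps ! s) $ i\<bar> \<ge> 2 * \<epsilon> (ps ! s) \<Longrightarrow> \<beta> s x = 0"
    by metis
  \<comment> \<open>The first factor confines the piece to the chart at \<open>ps ! s\<close>; the
    others remove what earlier pieces have already accounted for.\<close>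
  define \<phi> where "\<phi> s = (\<lambda>x. \<beta> s x * (\<Prod>t<s. 1 - \<beta> t x) * \<psi> x)" for s
  have sm: "smooth (\<phi> s)" if "s < k" for s
    unfolding \<phi>_def using that by (intro smooth_mult smooth_prod smooth_diff smooth_const \<beta>(1) \<psi>) auto
  have sp: "\<phi> s x = 0" if "s < k" "\<bar>x $ i - (ps ! s) $ i\<bar> \<ge> 2 * \<epsilon> (ps ! s)" for s x i
    using \<beta>(3)[OF that] by (simp add: \<phi>_def)
  have part: "(\<Sum>s<k. \<phi> s x) = \<psi> x" if x: "x \<in> (\<Union>p\<in>D. B p)" for x
  proof -
    obtain s where s: "s < k" "x \<in> B (ps ! s)" using x ps by (auto simp: k_def in_set_conv_nth)
    then have "\<beta> s x = 1" by (intro \<beta>(2)) (auto simp: B_def less_imp_le)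
    then have "(\<Prod>s<k. 1 - \<beta> s x) = 0" using s(1) by (intro prod_zero) auto
    moreover have "(\<Sum>s<k. \<phi> s x) = (\<Sum>s<k. \<beta> s x * (\<Prod>t<s. 1 - \<beta> t x)) * \<psi> x"
      by (simp add: \<phi>_def sum_distrib_right)
    ultimately show ?thesis unfolding partition_product by simp
  qed
  define Q where "Q s \<Psi> \<longleftrightarrow> smooth \<Psi> \<and>
    (\<forall>h. (\<forall>i. \<bar>h $ i\<bar> < \<delta> (ps ! s)) \<longrightarrow> (\<phi> s has_integral \<Psi> h) (shifted_polytope u a 1 h)) \<and>
    (\<forall>M. \<exists>C. \<forall>N\<ge>1. norm (
      (\<Sum>\<gamma> | multi_order \<gamma> \<le> M. (todd_coeff \<gamma> * (1 / real N) ^ multi_order \<gamma>) *\<^sub>R multi_deriv \<gamma> \<Psi> 0)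
      - (1 / real N) ^ CARD('n) *\<^sub>R lattice_sum \<Delta> N (\<lambda>l. \<phi> s ((1 / real N) *\<^sub>R l)))
      \<le> C * (1 / real N) ^ (M + 1))" for s \<Psi>
  have "\<exists>\<Psi>. Q s \<Psi>" if "s < k" for s
    unfolding Q_def by (rule euler_maclaurin_local[OF chart[OF q[OF that]] sm[OF that] sp[OF that]])
  then obtain \<Psi> where Q: "\<And>s. s < k \<Longrightarrow> Q s (\<Psi> s)" by metis
  have \<Psi>: "smooth (\<Psi> s)"
    "(\<forall>i. \<bar>h $ i\<bar> < \<delta> (ps ! s)) \<Longrightarrow> (\<phi> s has_integral \<Psi> s h) (shifted_polytope u a 1 h)"
    "\<exists>C. \<forall>N\<ge>1. norm (
      (\<Sum>\<gamma> | multi_order \<gamma> \<le> M. (todd_coeff \<gamma> * (1 / real N) ^ multi_order \<gamma>) *\<^sub>R multi_deriv \<gamma> (\<Psi> s) 0)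
      - (1 / real N) ^ CARD('n) *\<^sub>R lattice_sum \<Delta> N (\<lambda>l. \<phi> s ((1 / real N) *\<^sub>R l)))
      \<le> C * (1 / real N) ^ (M + 1)" if "s < k" for s h M
    using Q[OF that] unfolding Q_def by blast+
  define I where "I h = (\<Sum>s<k. \<Psi> s h)" for h
  \<comment> \<open>The pieces add up to \<open>\<psi>\<close> only on the union of the cubes, so
    the shifts must be small enough to keep the polytope inside it.\<close>
  obtain \<delta>0 where \<delta>0: "\<delta>0 > 0" "\<And>h. (\<And>i. \<bar>h $ i\<bar> < \<delta>0) \<Longrightarrow> shifted_polytope u a 1 h \<subseteq> (\<Union>p\<in>D. B p)"
    using shifted_polytope_subset_open[OF _ D(3)] oB by blast
  define d where "d = Min (insert \<delta>0 (\<delta> ` D))"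
  have d: "d > 0" "d \<le> \<delta>0" "\<And>s. s < k \<Longrightarrow> d \<le> \<delta> (ps ! s)"
    using \<delta>0(1) \<epsilon>(2) D(1,2) ps by (auto simp: d_def k_def intro!: Min_le)
  have "(\<psi> has_integral I h) (shifted_polytope u a 1 h)" if h: "\<forall>i. \<bar>h $ i\<bar> < d" for h
  proof -
    have "((\<lambda>x. \<Sum>s<k. \<phi> s x) has_integral I h) (shifted_polytope u a 1 h)"
      unfolding I_def using h d(3) by (intro has_integral_sum \<Psi>(2)) (auto intro: less_le_trans)
    moreover have "(\<Sum>s<k. \<phi> s x) = \<psi> x" if "x \<in> shifted_polytope u a 1 h" for x
      using part \<delta>0(2)[of h] h d(2) that by (meson less_le_trans subsetD)
    ultimately show ?thesis by (rule has_integral_eq[rotated])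
  qed
  moreover have "\<exists>C. \<forall>N\<ge>1. norm (
      (\<Sum>\<gamma> | multi_order \<gamma> \<le> M. (todd_coeff \<gamma> * (1 / real N) ^ multi_order \<gamma>) *\<^sub>R multi_deriv \<gamma> I 0)
      - (1 / real N) ^ CARD('n) *\<^sub>R lattice_sum \<Delta> N (\<lambda>l. \<psi> ((1 / real N) *\<^sub>R l)))
      \<le> C * (1 / real N) ^ (M + 1)" for M
  proof -
    define E where "E = (\<lambda>s N. (\<Sum>\<gamma> | multi_order \<gamma> \<le> M. (todd_coeff \<gamma> * (1 / real N) ^ multi_order \<gamma>) *\<^sub>R multi_deriv \<gamma> (\<Psi> s) 0)
      - (1 / real N) ^ CARD('n) *\<^sub>R lattice_sum \<Delta> N (\<lambda>l. \<phi> s ((1 / real N) *\<^sub>R l)))"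
    have "\<exists>C. \<forall>N\<ge>1. norm (E s N) \<le> C * (1 / real N) ^ (M + 1)" if "s < k" for s
      using \<Psi>(3)[OF that] unfolding E_def .
    then obtain C where C: "\<And>s N. s < k \<Longrightarrow> N \<ge> 1 \<Longrightarrow> norm (E s N) \<le> C s * (1 / real N) ^ (M + 1)" by metis
    have der: "multi_deriv \<gamma> I 0 = (\<Sum>s<k. multi_deriv \<gamma> (\<Psi> s) 0)" for \<gamma>
      unfolding multi_deriv_eq I_def[abs_def] by (subst iter_deriv_sum) (auto intro: \<Psi>(1))
    have ls: "lattice_sum \<Delta> N (\<lambda>l. \<psi> ((1 / real N) *\<^sub>R l)) = (\<Sum>s<k. lattice_sum \<Delta> N (\<lambda>l. \<phi> s ((1 / real N) *\<^sub>R l)))"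
      if N: "N \<ge> 1" for N
    proof -
      have "lattice_sum \<Delta> N (\<lambda>l. \<psi> ((1 / real N) *\<^sub>R l)) = (\<Sum>l\<in>{l \<in> int_lattice. (1 / real N) *\<^sub>R l \<in> \<Delta>}. \<Sum>s<k. \<phi> s ((1 / real N) *\<^sub>R l))"
        unfolding lattice_sum_def dilated_lattice_points(1)[OF N] using D(3) by (intro sum.cong refl part[symmetric]) auto
      also have "\<dots> = (\<Sum>s<k. \<Sum>l\<in>{l \<in> int_lattice. (1 / real N) *\<^sub>R l \<in> \<Delta>}. \<phi> s ((1 / real N) *\<^sub>R l))"
        by (rule sum.swap)
      finally show ?thesis unfolding lattice_sum_def dilated_lattice_points(1)[OF N] .
    qed
    show ?thesis
    proof (intro exI[of _ "\<Sum>s<k. C s"] allI impI)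
      fix N :: nat assume N: "N \<ge> 1"
      have "(\<Sum>\<gamma> | multi_order \<gamma> \<le> M. (todd_coeff \<gamma> * (1 / real N) ^ multi_order \<gamma>) *\<^sub>R multi_deriv \<gamma> I 0)
        = (\<Sum>s<k. \<Sum>\<gamma> | multi_order \<gamma> \<le> M. (todd_coeff \<gamma> * (1 / real N) ^ multi_order \<gamma>) *\<^sub>R multi_deriv \<gamma> (\<Psi> s) 0)"
        unfolding der scaleR_sum_right by (rule sum.swap)
      then have "(\<Sum>\<gamma> | multi_order \<gamma> \<le> M. (todd_coeff \<gamma> * (1 / real N) ^ multi_order \<gamma>) *\<^sub>R multi_deriv \<gamma> I 0)
        - (1 / real N) ^ CARD('n) *\<^sub>R lattice_sum \<Delta> N (\<lambda>l. \<psi> ((1 / real N) *\<^sub>R l)) = (\<Sum>s<k. E s N)"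
        unfolding ls[OF N] scaleR_sum_right E_def by (simp only: sum_subtractf)
      moreover have "norm (\<Sum>s<k. E s N) \<le> (\<Sum>s<k. C s * (1 / real N) ^ (M + 1))"
        using C N by (intro sum_norm_le) auto
      ultimately show "norm ((\<Sum>\<gamma> | multi_order \<gamma> \<le> M. (todd_coeff \<gamma> * (1 / real N) ^ multi_order \<gamma>) *\<^sub>R multi_deriv \<gamma> I 0)
        - (1 / real N) ^ CARD('n) *\<^sub>R lattice_sum \<Delta> N (\<lambda>l. \<psi> ((1 / real N) *\<^sub>R l))) \<le> (\<Sum>s<k. C s) * (1 / real N) ^ (M + 1)"
        by (simp only: sum_distrib_right)
    qed
  qed
  moreover have "smooth I" unfolding I_def[abs_def] by (intro smooth_sum \<Psi>(1)) auto
  ultimately show ?thesis using d(1) by blast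
qed

end

section \<open>Homogeneous components\<close>

text \<open>For \<open>p = 2\<close> the increments along \<open>N, 2 N, 4 N, ...\<close> decay
  geometrically, which gives a limit \<open>Lim N\<close> together with the rate. The bounds for
  other \<open>p\<close> only serve to show that \<open>Lim\<close> is constant, so their constants
  need not be uniform in \<open>p\<close>.\<close>

lemma dilation_limit:
  fixes c :: "nat \<Rightarrow> complex"
  assumes s: "s > 0"
    and d: "\<And>p. p \<ge> 1 \<Longrightarrow> \<exists>C N0. \<forall>N\<ge>N0. norm (c (p * N) - c N) \<le> C * real N powr (- s)"
  shows "\<exists>L C N0. \<forall>N\<ge>N0. norm (c N - L) \<le> C * real N powr (- s)"
proof -
  obtain C N2' where C': "\<And>N. N \<ge> N2' \<Longrightarrow> norm (c (2 * N) - c N) \<le> C * real N powr (- s)"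
    using d[of 2] by auto
  define N2 where "N2 = max N2' 1"
  have C: "norm (c (2 * N) - c N) \<le> C * real N powr (- s)" if "N \<ge> N2" for N
    using C' that by (simp add: N2_def)
  define r where "r = (2::real) powr (- s)"
  have r: "0 < r" "r < 1" using s by (auto simp: r_def powr_less_one)
  have pw: "real (2 ^ k * N) powr (- s) = real N powr (- s) * r ^ k" if "N \<ge> 1" for k N
    using that by (simp add: powr_mult r_def powr_power powr_realpow[symmetric] powr_powr mult.commute)
  have le2: "N2 \<le> 2 ^ k * N" if "N \<ge> N2" for k N
    using that by (metis mult_le_mono one_le_numeral one_le_power mult_1)
  define D where "D N k = c (2 * (2 ^ k * N)) - c (2 ^ k * N)" for N k
  have Db: "norm (D N k) \<le> C * real N powr (- s) * r ^ k" if N: "N \<ge> N2" for N k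
  proof -
    have "N \<ge> 1" using N by (simp add: N2_def)
    then show ?thesis using C[OF le2[OF N, of k]] unfolding D_def pw[OF \<open>N \<ge> 1\<close>] by (simp only: mult.assoc)
  qed
  have geo: "(\<lambda>k. C * real N powr (- s) * r ^ k) sums (C * real N powr (- s) * (1 / (1 - r)))" for N
    using r by (intro sums_mult geometric_sums) auto
  have sumn: "summable (\<lambda>k. norm (D N k))" if N: "N \<ge> N2" for N
    by (rule summable_comparison_test'[OF sums_summable[OF geo[of N]], of 0]) (use Db[OF N] in simp)
  define Lim where "Lim N = c N + suminf (D N)" for N
  have conv: "(\<lambda>k. c (2 ^ k * N)) \<longlonglongrightarrow> Lim N" if N: "N \<ge> N2" for N
  proof -
    have tel: "(\<Sum>k<K. D N k) = c (2 ^ K * N) - c N" for K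
      by (induction K) (simp_all add: D_def mult.assoc)
    have "(\<lambda>K. \<Sum>k<K. D N k) \<longlonglongrightarrow> suminf (D N)"
      using summable_LIMSEQ[OF summable_norm_cancel[OF sumn[OF N]]] .
    then have "(\<lambda>K. c N + (\<Sum>k<K. D N k)) \<longlonglongrightarrow> Lim N" unfolding Lim_def by (intro tendsto_intros)
    then show ?thesis by (simp add: tel)
  qed
  have bound: "norm (c N - Lim N) \<le> (C * (1 / (1 - r))) * real N powr (- s)" if N: "N \<ge> N2" for N
  proof -
    have "norm (c N - Lim N) = norm (suminf (D N))" by (simp add: Lim_def)
    also have "\<dots> \<le> (\<Sum>k. norm (D N k))" by (rule summable_norm[OF sumn[OF N]])
    also have "\<dots> \<le> (\<Sum>k. C * real N powr (- s) * r ^ k)"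
      by (rule suminf_le[OF Db[OF N] sumn[OF N] sums_summable[OF geo]])
    also have "\<dots> = C * real N powr (- s) * (1 / (1 - r))" by (rule sums_unique[OF geo, symmetric])
    finally show ?thesis by (simp add: mult_ac)
  qed
  \<comment> \<open>The increments from \<open>2 ^ k * N\<close> to its \<open>p\<close>-fold tend
    to 0 as \<open>k\<close> grows, for \<open>p\<close> and \<open>N\<close> fixed.\<close>
  have inv: "Lim (p * N) = Lim N" if N: "N \<ge> N2" and p: "p \<ge> 1" for p N
  proof -
    obtain Cp Np where Cp: "\<And>N. N \<ge> Np \<Longrightarrow> norm (c (p * N) - c N) \<le> Cp * real N powr (- s)"
      using d[OF p] by auto
    have N1: "N \<ge> 1" using N by (simp add: N2_def)
    have pN: "p * N \<ge> N2" using N p by (metis mult_le_mono mult_1)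
    have "(\<lambda>k. c (2 ^ k * (p * N)) - c (2 ^ k * N)) \<longlonglongrightarrow> Lim (p * N) - Lim N"
      by (intro tendsto_diff conv N pN)
    moreover have "(\<lambda>k. c (2 ^ k * (p * N)) - c (2 ^ k * N)) \<longlonglongrightarrow> 0"
    proof (rule Lim_null_comparison)
      have "eventually (\<lambda>k. Np \<le> 2 ^ k * N) sequentially"
        unfolding eventually_sequentially
      proof (intro exI[of _ Np] allI impI)
        fix k assume "Np \<le> k"
        also have "k \<le> 2 ^ k" by (rule less_imp_le[OF less_exp])
        also have "2 ^ k \<le> 2 ^ k * N" using N1 by simp
        finally show "Np \<le> 2 ^ k * N" .
      qed
      then show "\<forall>\<^sub>F k in sequentially. norm (c (2 ^ k * (p * N)) - c (2 ^ k * N)) \<le> Cp * real N powr (- s) * r ^ k"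
      proof (rule eventually_mono)
        fix k assume "Np \<le> 2 ^ k * N"
        from Cp[OF this] show "norm (c (2 ^ k * (p * N)) - c (2 ^ k * N)) \<le> Cp * real N powr (- s) * r ^ k"
          unfolding pw[OF N1] by (simp only: mult.assoc mult.left_commute[of p])
      qed
      show "(\<lambda>k. Cp * real N powr (- s) * r ^ k) \<longlonglongrightarrow> 0"
        using r by (intro tendsto_mult_right_zero LIMSEQ_power_zero) auto
    qed
    ultimately show ?thesis using LIMSEQ_unique by fastforce
  qed
  \<comment> \<open>Both equal the value at the product \<open>N * N2\<close>.\<close>
  have "Lim N = Lim N2" if N: "N \<ge> N2" for N
  proof -
    have "N \<ge> 1" "N2 \<ge> 1" using N by (auto simp: N2_def)
    then show ?thesis using inv[of N2 N] inv[of N N2] N by (simp add: mult.commute)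
  qed
  then show ?thesis using bound by (metis)
qed

lemma has_integral_dilate:
  fixes f :: "'a::euclidean_space \<Rightarrow> 'b::banach"
  assumes f: "(f has_integral I) S" and S: "bounded S" and m: "m > 0"
  shows "((\<lambda>x. f ((1 / m) *\<^sub>R x)) has_integral (m ^ DIM('a) *\<^sub>R I)) ((\<lambda>x. m *\<^sub>R x) ` S)"
proof -
  obtain b where b: "S \<subseteq> cbox (- b) b" using bounded_subset_cbox_symmetric[OF S] by blast
  have "((\<lambda>x. if x \<in> S then f x else 0) has_integral I) (cbox (- b) b)"
    unfolding has_integral_restrict[OF b] by (rule f)
  from has_integral_affinity[OF this, of "1 / m" 0]
  have h: "((\<lambda>x. if (1 / m) *\<^sub>R x \<in> S then f ((1 / m) *\<^sub>R x) else 0) has_integral (m ^ DIM('a) *\<^sub>R I)) ((\<lambda>x. m *\<^sub>R x) ` cbox (- b) b)"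
    using m by (simp add: power_one_over cong: if_cong)
  have eq: "(1 / m) *\<^sub>R x \<in> S \<longleftrightarrow> x \<in> (\<lambda>x. m *\<^sub>R x) ` S" for x
  proof
    assume "(1 / m) *\<^sub>R x \<in> S"
    then have "m *\<^sub>R ((1 / m) *\<^sub>R x) \<in> (\<lambda>x. m *\<^sub>R x) ` S" by blast
    then show "x \<in> (\<lambda>x. m *\<^sub>R x) ` S" using m by simp
  qed (use m in auto)
  have sub: "(\<lambda>x. m *\<^sub>R x) ` S \<subseteq> (\<lambda>x. m *\<^sub>R x) ` cbox (- b) b" using b by blast
  show ?thesis using h unfolding eq has_integral_restrict[OF sub] .
qed

section \<open>Derivatives with respect to the facet shifts\<close>

context regular_polytope
begin

abbreviation h_deriv :: "('m \<Rightarrow> nat) \<Rightarrow> nat \<Rightarrow> (real^'n \<Rightarrow> complex) \<Rightarrow> complex" where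
  "h_deriv \<gamma> N \<phi> \<equiv> multi_deriv \<gamma> (\<lambda>h. polytope_integral u a (real N) h \<phi>) 0"

text \<open>For large \<open>h\<close> the shape of the polytope changes and smoothness may fail. A
  smooth function with the same germ at 0 suffices, as \<open>multi_deriv\<close> depends only on
  the germ.\<close>

definition local_integral :: "nat \<Rightarrow> (real^'n \<Rightarrow> complex) \<Rightarrow> (real^'m \<Rightarrow> complex) \<Rightarrow> bool" where
  "local_integral N \<phi> J \<longleftrightarrow> smooth J \<and>
     (\<exists>\<delta>>0. \<forall>h. (\<forall>i. \<bar>h $ i\<bar> < \<delta>) \<longrightarrow> (\<phi> has_integral J h) (shifted_polytope u a (real N) h))"

lemma open_cube: "open {h::real^'m. \<forall>i. \<bar>h $ i\<bar> < \<delta>}"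
proof -
  have "{h::real^'m. \<forall>i. \<bar>h $ i\<bar> < \<delta>} = (\<Inter>i\<in>UNIV. {h. \<bar>h $ i\<bar> < \<delta>})" by auto
  moreover have "open {h::real^'m. \<bar>h $ i\<bar> < \<delta>}" for i by (intro open_Collect_less continuous_intros)
  ultimately show ?thesis by (simp only:) (rule open_INT, auto)
qed

lemma local_integralD:
  assumes "local_integral N \<phi> J"
  shows "h_deriv \<gamma> N \<phi> = multi_deriv \<gamma> J 0" "polytope_integral u a (real N) 0 \<phi> = J 0"
    "(\<phi> has_integral J 0) (shifted_polytope u a (real N) 0)"
proof -
  obtain \<delta> where \<delta>: "\<delta> > 0" "\<And>h. (\<forall>i. \<bar>h $ i\<bar> < \<delta>) \<Longrightarrow> (\<phi> has_integral J h) (shifted_polytope u a (real N) h)"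
    using assms unfolding local_integral_def by blast
  have eq: "polytope_integral u a (real N) h \<phi> = J h" if "h \<in> {h. \<forall>i. \<bar>h $ i\<bar> < \<delta>}" for h
    using \<delta>(2) that by (simp add: polytope_integral_def integral_unique)
  have 0: "0 \<in> {h::real^'m. \<forall>i. \<bar>h $ i\<bar> < \<delta>}" using \<delta>(1) by simp
  show "h_deriv \<gamma> N \<phi> = multi_deriv \<gamma> J 0" by (rule multi_deriv_cong_open[OF open_cube eq 0])
  show "polytope_integral u a (real N) 0 \<phi> = J 0" by (rule eq[OF 0])
  show "(\<phi> has_integral J 0) (shifted_polytope u a (real N) 0)" using \<delta> by simp
qed

lemma shifted_polytope_dilate:
  assumes "N \<ge> 1"
  shows "shifted_polytope u a (real N) h = (\<lambda>x. real N *\<^sub>R x) ` shifted_polytope u a 1 ((1 / real N) *\<^sub>R h)"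
proof (intro equalityI subsetI)
  have eq: "x \<bullet> u i + real N * of_int (a i) + h $ i = real N * (((1 / real N) *\<^sub>R x) \<bullet> u i + 1 * of_int (a i) + ((1 / real N) *\<^sub>R h) $ i)" for x i
    using assms by (simp add: field_simps)
  fix x assume x: "x \<in> shifted_polytope u a (real N) h"
  have "(1 / real N) *\<^sub>R x \<in> shifted_polytope u a 1 ((1 / real N) *\<^sub>R h)"
    using x assms unfolding shifted_polytope_def mem_Collect_eq eq by (simp add: zero_le_mult_iff)
  then have "real N *\<^sub>R ((1 / real N) *\<^sub>R x) \<in> (\<lambda>x. real N *\<^sub>R x) ` shifted_polytope u a 1 ((1 / real N) *\<^sub>R h)" by blast
  then show "x \<in> (\<lambda>x. real N *\<^sub>R x) ` shifted_polytope u a 1 ((1 / real N) *\<^sub>R h)" using assms by simp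
next
  fix x assume "x \<in> (\<lambda>x. real N *\<^sub>R x) ` shifted_polytope u a 1 ((1 / real N) *\<^sub>R h)"
  then obtain y where y: "x = real N *\<^sub>R y" "y \<in> shifted_polytope u a 1 ((1 / real N) *\<^sub>R h)" by blast
  have "x \<bullet> u i + real N * of_int (a i) + h $ i = real N * (y \<bullet> u i + 1 * of_int (a i) + ((1 / real N) *\<^sub>R h) $ i)" for i
    using assms by (simp add: y(1) field_simps)
  then show "x \<in> shifted_polytope u a (real N) h"
    using y(2) assms unfolding shifted_polytope_def by simp
qed

text \<open>The polytope at level \<open>N\<close> with shift \<open>h\<close> is \<open>N\<close>
  times the polytope at level 1 with shift \<open>h / N\<close>; volume contributes
  \<open>N ^ CARD('n)\<close>.\<close>

lemma local_integral_dilate: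
  assumes J: "smooth J" "\<delta> > 0" "\<And>h. (\<forall>i. \<bar>h $ i\<bar> < \<delta>) \<Longrightarrow> (\<psi> has_integral J h) (shifted_polytope u a 1 h)"
    and N: "N \<ge> 1"
  shows "local_integral N (\<lambda>x. \<psi> ((1 / real N) *\<^sub>R x)) (\<lambda>h. real N ^ CARD('n) *\<^sub>R J ((1 / real N) *\<^sub>R h))"
  unfolding local_integral_def
proof (intro conjI)
  show "smooth (\<lambda>h. real N ^ CARD('n) *\<^sub>R J ((1 / real N) *\<^sub>R h))" by (intro smooth_scaleR smooth_scale J(1))
  obtain R where R: "\<Delta> \<subseteq> ball 0 R" using compact_imp_bounded[OF compact] bounded_subset_ballD by blast
  obtain d where d: "d > 0" "\<And>h. (\<And>i. \<bar>h $ i\<bar> < d) \<Longrightarrow> shifted_polytope u a 1 h \<subseteq> ball 0 R"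
    using shifted_polytope_subset_open[OF open_ball R] by blast
  show "\<exists>\<delta>>0. \<forall>h. (\<forall>i. \<bar>h $ i\<bar> < \<delta>) \<longrightarrow> ((\<lambda>x. \<psi> ((1 / real N) *\<^sub>R x)) has_integral real N ^ CARD('n) *\<^sub>R J ((1 / real N) *\<^sub>R h)) (shifted_polytope u a (real N) h)"
  proof (intro exI[of _ "min \<delta> d"] conjI allI impI)
    fix h :: "real^'m" assume h: "\<forall>i. \<bar>h $ i\<bar> < min \<delta> d"
    have h': "\<bar>((1 / real N) *\<^sub>R h) $ i\<bar> < min \<delta> d" for i
    proof -
      have "\<bar>((1 / real N) *\<^sub>R h) $ i\<bar> = \<bar>h $ i\<bar> / real N" by simp
      also have "\<dots> \<le> \<bar>h $ i\<bar> / 1" using N by (intro divide_left_mono) auto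
      also have "\<dots> < min \<delta> d" using h by simp
      finally show ?thesis .
    qed
    have "bounded (shifted_polytope u a 1 ((1 / real N) *\<^sub>R h))"
      using d(2)[of "(1 / real N) *\<^sub>R h"] h' bounded_subset[OF bounded_ball] by (meson min_less_iff_conj)
    moreover have "(\<psi> has_integral J ((1 / real N) *\<^sub>R h)) (shifted_polytope u a 1 ((1 / real N) *\<^sub>R h))"
      using J(3) h' by (meson min_less_iff_conj)
    ultimately have "((\<lambda>x. \<psi> ((1 / real N) *\<^sub>R x)) has_integral (real N ^ DIM(real^'n) *\<^sub>R J ((1 / real N) *\<^sub>R h)))
        ((\<lambda>x. real N *\<^sub>R x) ` shifted_polytope u a 1 ((1 / real N) *\<^sub>R h))"
      using N by (intro has_integral_dilate) auto
    then show "((\<lambda>x. \<psi> ((1 / real N) *\<^sub>R x)) has_integral real N ^ CARD('n) *\<^sub>R J ((1 / real N) *\<^sub>R h)) (shifted_polytope u a (real N) h)"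
      by (simp add: shifted_polytope_dilate[OF N])
  qed (use d(1) J(2) in auto)
qed

text \<open>Every smooth function is the dilate by \<open>N\<close> of a smooth function, so level 1
  suffices. Existence of a smooth germ is what makes the shift derivatives linear in the
  integrand.\<close>

lemma local_integral_exists:
  assumes "smooth \<phi>" "N \<ge> 1"
  shows "\<exists>J. local_integral N \<phi> J"
proof -
  have sm: "smooth (\<lambda>x. \<phi> (real N *\<^sub>R x))" by (rule smooth_scale[OF assms(1)])
  obtain J \<delta> where J: "smooth J" "\<delta> > 0" "\<And>h. (\<forall>i. \<bar>h $ i\<bar> < \<delta>) \<Longrightarrow> ((\<lambda>x. \<phi> (real N *\<^sub>R x)) has_integral J h) (shifted_polytope u a 1 h)"
    using euler_maclaurin_polytope[OF sm] by blast
  have "(\<lambda>x. \<phi> (real N *\<^sub>R ((1 / real N) *\<^sub>R x))) = \<phi>" using assms(2) by simp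
  then show ?thesis using local_integral_dilate[OF J assms(2)] by metis
qed

lemma local_integral_add:
  assumes "local_integral N \<phi> J" "local_integral N \<psi> J'"
  shows "local_integral N (\<lambda>x. \<phi> x + \<psi> x) (\<lambda>h. J h + J' h)"
proof -
  obtain \<delta> \<delta>' where "\<delta> > 0" "\<delta>' > 0" "\<And>h. (\<forall>i. \<bar>h $ i\<bar> < \<delta>) \<Longrightarrow> (\<phi> has_integral J h) (shifted_polytope u a (real N) h)"
    "\<And>h. (\<forall>i. \<bar>h $ i\<bar> < \<delta>') \<Longrightarrow> (\<psi> has_integral J' h) (shifted_polytope u a (real N) h)"
    using assms unfolding local_integral_def by blast
  then have "\<forall>h. (\<forall>i. \<bar>h $ i\<bar> < min \<delta> \<delta>') \<longrightarrow> ((\<lambda>x. \<phi> x + \<psi> x) has_integral (J h + J' h)) (shifted_polytope u a (real N) h)"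
    by (intro allI impI has_integral_add) auto
  then show ?thesis using assms \<open>\<delta> > 0\<close> \<open>\<delta>' > 0\<close> unfolding local_integral_def
    by (intro conjI smooth_add exI[of _ "min \<delta> \<delta>'"]) auto
qed

lemma local_integral_cmult:
  assumes "local_integral N \<phi> J"
  shows "local_integral N (\<lambda>x. c * \<phi> x) (\<lambda>h. c * J h)"
proof -
  obtain \<delta> where "\<delta> > 0" "\<forall>h. (\<forall>i. \<bar>h $ i\<bar> < \<delta>) \<longrightarrow> (\<phi> has_integral J h) (shifted_polytope u a (real N) h)" "smooth J"
    using assms unfolding local_integral_def by blast
  then show ?thesis unfolding local_integral_def
    by (intro conjI smooth_cmult exI[of _ \<delta>] allI impI has_integral_mult_right) auto
qed

lemma h_deriv_add:
  assumes "smooth \<phi>" "smooth \<psi>" "N \<ge> 1"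
  shows "h_deriv \<gamma> N (\<lambda>x. \<phi> x + \<psi> x) = h_deriv \<gamma> N \<phi> + h_deriv \<gamma> N \<psi>"
    "polytope_integral u a (real N) 0 (\<lambda>x. \<phi> x + \<psi> x) = polytope_integral u a (real N) 0 \<phi> + polytope_integral u a (real N) 0 \<psi>"
proof -
  obtain J J' where J: "local_integral N \<phi> J" "local_integral N \<psi> J'" using local_integral_exists assms by metis
  have "smooth J" "smooth J'" using J by (auto simp: local_integral_def)
  then show "h_deriv \<gamma> N (\<lambda>x. \<phi> x + \<psi> x) = h_deriv \<gamma> N \<phi> + h_deriv \<gamma> N \<psi>"
    unfolding local_integralD(1)[OF local_integral_add[OF J]] local_integralD(1)[OF J(1)] local_integralD(1)[OF J(2)]
    by (simp add: multi_deriv_eq iter_deriv_add)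
  show "polytope_integral u a (real N) 0 (\<lambda>x. \<phi> x + \<psi> x) = polytope_integral u a (real N) 0 \<phi> + polytope_integral u a (real N) 0 \<psi>"
    unfolding local_integralD(2)[OF local_integral_add[OF J]] local_integralD(2)[OF J(1)] local_integralD(2)[OF J(2)] ..
qed

lemma h_deriv_cmult:
  assumes "smooth \<phi>" "N \<ge> 1"
  shows "h_deriv \<gamma> N (\<lambda>x. c * \<phi> x) = c * h_deriv \<gamma> N \<phi>"
    "polytope_integral u a (real N) 0 (\<lambda>x. c * \<phi> x) = c * polytope_integral u a (real N) 0 \<phi>"
proof -
  obtain J where J: "local_integral N \<phi> J" using local_integral_exists assms by metis
  have "smooth J" using J by (auto simp: local_integral_def)
  then show "h_deriv \<gamma> N (\<lambda>x. c * \<phi> x) = c * h_deriv \<gamma> N \<phi>"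
    unfolding local_integralD(1)[OF local_integral_cmult[OF J]] local_integralD(1)[OF J(1)]
    by (simp add: multi_deriv_eq iter_deriv_linear[OF bounded_linear_mult_right])
  show "polytope_integral u a (real N) 0 (\<lambda>x. c * \<phi> x) = c * polytope_integral u a (real N) 0 \<phi>"
    unfolding local_integralD(2)[OF local_integral_cmult[OF J]] local_integralD(2)[OF J(1)] ..
qed

lemma h_deriv_sum:
  assumes "finite S" "\<And>k. k \<in> S \<Longrightarrow> smooth (\<phi> k)" "N \<ge> 1"
  shows "h_deriv \<gamma> N (\<lambda>x. \<Sum>k\<in>S. \<phi> k x) = (\<Sum>k\<in>S. h_deriv \<gamma> N (\<phi> k))"
    "polytope_integral u a (real N) 0 (\<lambda>x. \<Sum>k\<in>S. \<phi> k x) = (\<Sum>k\<in>S. polytope_integral u a (real N) 0 (\<phi> k))"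
proof -
  have "polytope_integral u a (real N) h (\<lambda>x. 0) = 0" for h by (simp add: polytope_integral_def)
  then have z: "h_deriv \<gamma> N (\<lambda>x. 0) = 0" by (simp add: multi_deriv_eq)
  show "h_deriv \<gamma> N (\<lambda>x. \<Sum>k\<in>S. \<phi> k x) = (\<Sum>k\<in>S. h_deriv \<gamma> N (\<phi> k))"
    using assms(1,2)
  proof (induction S rule: finite_induct)
    case (insert k S)
    have "smooth (\<lambda>x. \<Sum>k\<in>S. \<phi> k x)" using insert by (intro smooth_sum) auto
    then show ?case using insert h_deriv_add(1)[OF _ _ assms(3), of "\<phi> k" "\<lambda>x. \<Sum>k\<in>S. \<phi> k x" \<gamma>] by simp
  qed (simp add: z)
  show "polytope_integral u a (real N) 0 (\<lambda>x. \<Sum>k\<in>S. \<phi> k x) = (\<Sum>k\<in>S. polytope_integral u a (real N) 0 (\<phi> k))"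
    using assms(1,2)
  proof (induction S rule: finite_induct)
    case (insert k S)
    have "smooth (\<lambda>x. \<Sum>k\<in>S. \<phi> k x)" using insert by (intro smooth_sum) auto
    then show ?case using insert h_deriv_add(2)[OF _ _ assms(3), of "\<phi> k" "\<lambda>x. \<Sum>k\<in>S. \<phi> k x"] by simp
  qed (simp add: polytope_integral_def)
qed

text \<open>The bound 1/2 is half of the least possible offset: points of this ball satisfy all
  constraints with room to spare.\<close>

lemma inner_radius: obtains \<rho> :: real where "\<rho> > 0" "\<And>x i. norm x \<le> \<rho> \<Longrightarrow> \<bar>x \<bullet> u i\<bar> \<le> 1 / 2"
proof -
  define m where "m = Max (range (\<lambda>i. norm (u i))) + 1"
  have m: "norm (u i) \<le> m" for i
  proof -
    have "norm (u i) \<le> Max (range (\<lambda>i. norm (u i)))" by (intro Max_ge) auto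
    then show ?thesis unfolding m_def by linarith
  qed
  have "m > 0"
  proof -
    have "0 \<le> Max (range (\<lambda>i. norm (u i)))"
      by (rule order.trans[OF norm_ge_zero Max_ge[of _ "norm (u undefined)"]]) auto
    then show ?thesis unfolding m_def by linarith
  qed
  have "\<bar>x \<bullet> u i\<bar> \<le> 1 / 2" if "norm x \<le> 1 / (2 * m)" for x i
  proof -
    have "\<bar>x \<bullet> u i\<bar> \<le> norm x * norm (u i)" by (rule Cauchy_Schwarz_ineq2)
    also have "\<dots> \<le> 1 / (2 * m) * m" using that m \<open>m > 0\<close> by (intro mult_mono) auto
    also have "\<dots> = 1 / 2" using \<open>m > 0\<close> by simp
    finally show ?thesis .
  qed
  then show ?thesis using that[of "1 / (2 * m)"] \<open>m > 0\<close> by auto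
qed

text \<open>The offset \<open>N * a i\<close> is at least \<open>N\<close>; half of it covers the
  inner product, and the remaining \<open>N / 2 \<ge> 1 / 2\<close> covers the shift.\<close>

lemma inner_support_member:
  assumes "\<bar>x \<bullet> u i\<bar> \<le> real N / 2" "N \<ge> 1" "\<bar>h $ i\<bar> < 1 / 2"
  shows "0 \<le> x \<bullet> u i + real N * of_int (a i) + h $ i"
proof -
  have "real N * 1 \<le> real N * of_int (a i)" using offsets_pos[rule_format, of i] by (intro mult_left_mono) auto
  moreover have "real N \<ge> 1" using assms(2) by simp
  ultimately show ?thesis using assms by linarith
qed

lemma inner_support_integral:
  assumes \<kappa>: "smooth \<kappa>" "\<And>x i. \<kappa> x \<noteq> 0 \<Longrightarrow> \<bar>x \<bullet> u i\<bar> \<le> real N / 2" and N: "N \<ge> 1"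
  obtains c where "local_integral N \<kappa> (\<lambda>h. c)" "(\<kappa> has_integral c) UNIV"
proof -
  obtain J where J: "local_integral N \<kappa> J" using local_integral_exists[OF \<kappa>(1) N] by blast
  have eq: "(\<lambda>x. if x \<in> shifted_polytope u a (real N) h then \<kappa> x else 0) = \<kappa>" if "\<forall>i. \<bar>h $ i\<bar> < 1 / 2" for h
  proof
    fix x
    have "x \<in> shifted_polytope u a (real N) h" if "\<kappa> x \<noteq> 0"
      unfolding shifted_polytope_def using inner_support_member[OF \<kappa>(2)[OF that] N] \<open>\<forall>i. \<bar>h $ i\<bar> < 1 / 2\<close> by simp
    then show "(if x \<in> shifted_polytope u a (real N) h then \<kappa> x else 0) = \<kappa> x" by auto
  qed
  have iff: "(\<kappa> has_integral y) (shifted_polytope u a (real N) h) \<longleftrightarrow> (\<kappa> has_integral y) UNIV" if "\<forall>i. \<bar>h $ i\<bar> < 1 / 2" for h y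
    using has_integral_restrict_UNIV[of "shifted_polytope u a (real N) h" \<kappa> y] unfolding eq[OF that] by simp
  have U: "(\<kappa> has_integral J 0) UNIV" using local_integralD(3)[OF J] iff[of 0] by simp
  have "local_integral N \<kappa> (\<lambda>h. J 0)"
    unfolding local_integral_def using iff U by (intro conjI smooth_const exI[of _ "1 / 2"]) auto
  then show ?thesis using that U by blast
qed

text \<open>Small shifts of the facets do not reach the support, so the integral is constant in
  \<open>h\<close>.\<close>

lemma h_deriv_inner_support:
  assumes \<kappa>: "smooth \<kappa>" "\<And>x i. \<kappa> x \<noteq> 0 \<Longrightarrow> \<bar>x \<bullet> u i\<bar> \<le> real N / 2" and N: "N \<ge> 1" and \<gamma>: "multi_order \<gamma> > 0"
  shows "h_deriv \<gamma> N \<kappa> = 0"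
proof -
  obtain c where c: "local_integral N \<kappa> (\<lambda>h. c)" using inner_support_integral[OF \<kappa> N] by blast
  have "iter_deriv ds (\<lambda>h::real^'m. c) 0 = 0" if "ds \<noteq> []" for ds
  proof -
    obtain ds' d where "ds = ds' @ [d]" using \<open>ds \<noteq> []\<close> by (metis rev_exhaust)
    then show ?thesis by simp
  qed
  moreover have "multi_list \<gamma> \<noteq> []" using \<gamma> length_multi_list[of \<gamma>] by auto
  ultimately show ?thesis unfolding local_integralD(1)[OF c] unfolding multi_deriv_eq by blast
qed

lemma lattice_sum_eq:
  assumes "N \<ge> 1"
  shows "lattice_sum \<Delta> N \<phi> = (\<Sum>l | l \<in> int_lattice \<and> (1 / real N) *\<^sub>R l \<in> \<Delta>. \<phi> l)"
  unfolding lattice_sum_def dilated_lattice_points(1)[OF assms] ..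

lemma scaled_mem_polytope:
  assumes "N \<ge> 1"
  shows "(1 / real N) *\<^sub>R x \<in> \<Delta> \<longleftrightarrow> (\<forall>i. 0 \<le> x \<bullet> u i + real N * of_int (a i))"
proof -
  have "((1 / real N) *\<^sub>R x) \<bullet> u i + of_int (a i) = (1 / real N) * (x \<bullet> u i + real N * of_int (a i))" for i
    using assms by (simp add: field_simps)
  moreover have "(1 / real N) *\<^sub>R x \<in> \<Delta> \<longleftrightarrow> (\<forall>i. 0 \<le> ((1 / real N) *\<^sub>R x) \<bullet> u i + of_int (a i))"
    using halfspaces by blast
  ultimately show ?thesis using assms by (simp add: zero_le_divide_iff)
qed

text \<open>Both polytopes contain the whole support, so sum and integral run over all of space.
  This invariance is what makes the inner defects at different levels comparable.\<close>

lemma inner_support_dilate: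
  assumes \<kappa>: "smooth \<kappa>" "\<And>x i. \<kappa> x \<noteq> 0 \<Longrightarrow> \<bar>x \<bullet> u i\<bar> \<le> real N / 2" and N: "N \<ge> 1" "N' \<ge> N"
  shows "lattice_sum \<Delta> N' \<kappa> = lattice_sum \<Delta> N \<kappa>"
    "polytope_integral u a (real N') 0 \<kappa> = polytope_integral u a (real N) 0 \<kappa>"
proof -
  have N': "N' \<ge> 1" using N by simp
  have \<kappa>': "\<bar>x \<bullet> u i\<bar> \<le> real N' / 2" if "\<kappa> x \<noteq> 0" for x i using \<kappa>(2)[OF that, of i] N(2) by linarith
  have mem: "(1 / real N) *\<^sub>R x \<in> \<Delta>" "(1 / real N') *\<^sub>R x \<in> \<Delta>" if "\<kappa> x \<noteq> 0" for x
    using inner_support_member[OF \<kappa>(2)[OF that] N(1), of 0] inner_support_member[OF \<kappa>'[OF that] N', of 0]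
    unfolding scaled_mem_polytope[OF N(1)] scaled_mem_polytope[OF N'] by auto
  have "lattice_sum \<Delta> M \<kappa> = (\<Sum>l | l \<in> int_lattice \<and> \<kappa> l \<noteq> 0. \<kappa> l)" if "M = N \<or> M = N'" for M
  proof -
    have M: "M \<ge> 1" using that N(1) N' by auto
    have "{l. l \<in> int_lattice \<and> \<kappa> l \<noteq> 0} \<subseteq> {l. l \<in> int_lattice \<and> (1 / real M) *\<^sub>R l \<in> \<Delta>}" using mem that by blast
    then show ?thesis unfolding lattice_sum_eq[OF M]
      by (intro sum.mono_neutral_right dilated_lattice_points(2)[OF M]) auto
  qed
  then show "lattice_sum \<Delta> N' \<kappa> = lattice_sum \<Delta> N \<kappa>" by simp
  obtain c where c: "local_integral N \<kappa> (\<lambda>h. c)" "(\<kappa> has_integral c) UNIV" using inner_support_integral[OF \<kappa> N(1)] by blast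
  obtain c' where c': "local_integral N' \<kappa> (\<lambda>h. c')" "(\<kappa> has_integral c') UNIV" using inner_support_integral[OF \<kappa>(1) \<kappa>' N'] by blast
  show "polytope_integral u a (real N') 0 \<kappa> = polytope_integral u a (real N) 0 \<kappa>"
    unfolding local_integralD(2)[OF c(1)] local_integralD(2)[OF c'(1)] using has_integral_unique[OF c(2) c'(2)] by simp
qed

text \<open>Dilation contributes \<open>N ^ CARD('n)\<close> through the volume, and each shift
  derivative a factor \<open>1 / N\<close>.\<close>

lemma h_deriv_dilate:
  assumes J: "smooth J" "\<delta> > 0" "\<And>h. (\<forall>i. \<bar>h $ i\<bar> < \<delta>) \<Longrightarrow> (\<psi> has_integral J h) (shifted_polytope u a 1 h)"
    and N: "N \<ge> 1"
  shows "h_deriv \<gamma> N (\<lambda>x. \<psi> ((1 / real N) *\<^sub>R x)) = (real N ^ CARD('n) * (1 / real N) ^ multi_order \<gamma>) *\<^sub>R multi_deriv \<gamma> J 0"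
proof -
  have sc: "iter_deriv ds (\<lambda>h. J (c *\<^sub>R h)) = (\<lambda>h. c ^ length ds *\<^sub>R iter_deriv ds J (c *\<^sub>R h))" for ds c
  proof (induction ds)
    case (Cons d ds)
    have "partial_deriv d (\<lambda>h. c ^ length ds *\<^sub>R iter_deriv ds J (c *\<^sub>R h)) = (\<lambda>h. c ^ length ds *\<^sub>R (c *\<^sub>R partial_deriv d (iter_deriv ds J) (c *\<^sub>R h)))"
      by (simp add: partial_deriv_linear[OF bounded_linear_scaleR_right] smooth_scale smooth_iter_deriv J(1) partial_deriv_scale)
    then show ?case using Cons.IH by (simp add: mult.commute)
  qed simp
  have "h_deriv \<gamma> N (\<lambda>x. \<psi> ((1 / real N) *\<^sub>R x)) = multi_deriv \<gamma> (\<lambda>h. real N ^ CARD('n) *\<^sub>R J ((1 / real N) *\<^sub>R h)) 0"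
    by (rule local_integralD(1)[OF local_integral_dilate[OF J N]])
  also have "\<dots> = (real N ^ CARD('n) * (1 / real N) ^ multi_order \<gamma>) *\<^sub>R multi_deriv \<gamma> J 0"
    unfolding multi_deriv_eq
    by (simp add: iter_deriv_scaleR smooth_scale J(1) sc length_multi_list)
  finally show ?thesis .
qed

end

text \<open>The constant Todd coefficient is 1 and cancels against the identity.\<close>

lemma todd_minus_id_coeff_eq: "todd_minus_id_coeff \<gamma> = (if multi_order \<gamma> = 0 then 0 else todd_coeff \<gamma>)"
proof -
  have "multi_order \<gamma> = 0 \<longleftrightarrow> \<gamma> = (\<lambda>_. 0)" by (auto simp: fun_eq_iff)
  then show ?thesis by (auto simp: todd_minus_id_coeff_def todd_coeff_eq todd_fps_0)
qed

lemma card_lattice_box: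
  assumes "K \<ge> 0"
  shows "real (card {l \<in> int_lattice. \<forall>i. \<bar>(l::real^'n::finite) $ i\<bar> \<le> K}) \<le> (2 * K + 1) ^ CARD('n)"
proof -
  let ?S = "{l \<in> int_lattice. \<forall>i. \<bar>(l::real^'n) $ i\<bar> \<le> K}"
  let ?P = "Pi\<^sub>E UNIV (\<lambda>_::'n. {- \<lfloor>K\<rfloor>..\<lfloor>K\<rfloor>})"
  let ?f = "\<lambda>l::real^'n. \<lambda>i. \<lfloor>l $ i\<rfloor>"
  have "inj_on ?f ?S"
  proof (rule inj_onI)
    fix x y assume xy: "x \<in> ?S" "y \<in> ?S" "?f x = ?f y"
    have eq: "\<lfloor>x $ i\<rfloor> = \<lfloor>y $ i\<rfloor>" for i by (rule fun_cong[OF xy(3)])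
    have "x = (\<chi> i. real_of_int \<lfloor>x $ i\<rfloor>)" using int_lattice_floor[of x] xy(1) by simp
    also have "\<dots> = y" unfolding eq using int_lattice_floor[of y] xy(2) by simp
    finally show "x = y" .
  qed
  moreover have "?f ` ?S \<subseteq> ?P"
  proof (rule image_subsetI)
    fix l assume l: "l \<in> ?S"
    have "- \<lfloor>K\<rfloor> \<le> \<lfloor>l $ i\<rfloor> \<and> \<lfloor>l $ i\<rfloor> \<le> \<lfloor>K\<rfloor>" for i
    proof -
      have "l $ i \<in> \<int>" using l by (simp add: int_lattice_def)
      then obtain m where m: "l $ i = of_int m" by (rule Ints_cases)
      have "\<bar>of_int m\<bar> \<le> K" using l m by (metis (mono_tags, lifting) mem_Collect_eq)
      then have "of_int m \<le> K" "of_int (- m) \<le> K" by linarith+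
      then have "m \<le> \<lfloor>K\<rfloor>" "- m \<le> \<lfloor>K\<rfloor>" by (simp_all only: le_floor_iff)
      then show ?thesis by (simp add: m)
    qed
    then show "?f l \<in> ?P" by (simp add: PiE_UNIV_domain)
  qed
  ultimately have "card ?S \<le> card ?P"
    by (intro card_inj_on_le) (auto intro: finite_PiE)
  also have "card ?P = nat (2 * \<lfloor>K\<rfloor> + 1) ^ CARD('n)"
    by (simp add: card_PiE)
  finally have "real (card ?S) \<le> real (nat (2 * \<lfloor>K\<rfloor> + 1)) ^ CARD('n)"
    by (simp flip: of_nat_power)
  also have "\<dots> \<le> (2 * K + 1) ^ CARD('n)"
  proof (rule power_mono)
    have "0 \<le> \<lfloor>K\<rfloor>" using assms by simp
    then have "real (nat (2 * \<lfloor>K\<rfloor> + 1)) = 2 * of_int \<lfloor>K\<rfloor> + 1" by simp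
    also have "\<dots> \<le> 2 * K + 1" by simp
    finally show "real (nat (2 * \<lfloor>K\<rfloor> + 1)) \<le> 2 * K + 1" .
  qed simp
  finally show ?thesis .
qed

lemma powr_scale_limit: "s < 0 \<Longrightarrow> (\<lambda>N. C * real N powr s) \<longlonglongrightarrow> 0"
  by (intro tendsto_mult_right_zero tendsto_neg_powr[OF _ filterlim_real_sequentially])

section \<open>The defect of the truncated Todd formula\<close>

context regular_polytope
begin

text \<open>The truncation is by total order of \<open>\<gamma>\<close>. The term of order 0 has
  coefficient 0 here, since the integral itself is subtracted separately.\<close>

definition em_defect :: "nat \<Rightarrow> nat \<Rightarrow> (real^'n \<Rightarrow> complex) \<Rightarrow> complex" where
  "em_defect M N \<phi> = lattice_sum \<Delta> N \<phi> - polytope_integral u a (real N) 0 \<phi>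
     - (\<Sum>\<gamma> | multi_order \<gamma> \<le> M. of_real (todd_minus_id_coeff \<gamma>) * h_deriv \<gamma> N \<phi>)"

lemma em_defect_add:
  assumes "smooth \<phi>" "smooth \<psi>" "N \<ge> 1"
  shows "em_defect M N (\<lambda>x. \<phi> x + \<psi> x) = em_defect M N \<phi> + em_defect M N \<psi>"
  unfolding em_defect_def h_deriv_add[OF assms] lattice_sum_def
  by (simp add: sum.distrib algebra_simps)

lemma em_defect_cmult:
  assumes "smooth \<phi>" "N \<ge> 1"
  shows "em_defect M N (\<lambda>x. c * \<phi> x) = c * em_defect M N \<phi>"
  unfolding em_defect_def h_deriv_cmult[OF assms] lattice_sum_def
  by (simp add: sum_distrib_left algebra_simps)

lemma em_defect_diff:
  assumes "smooth \<phi>" "smooth \<psi>" "N \<ge> 1"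
  shows "em_defect M N (\<lambda>x. \<phi> x - \<psi> x) = em_defect M N \<phi> - em_defect M N \<psi>"
  using em_defect_add[OF assms(1) smooth_cmult[OF assms(2), of "-1"] assms(3), of M] em_defect_cmult[OF assms(2,3), of M "-1"]
  by simp

lemma em_defect_inner_support:
  assumes \<kappa>: "smooth \<kappa>" "\<And>x i. \<kappa> x \<noteq> 0 \<Longrightarrow> \<bar>x \<bullet> u i\<bar> \<le> real N / 2" and N: "N \<ge> 1"
  shows "em_defect M N \<kappa> = lattice_sum \<Delta> N \<kappa> - polytope_integral u a (real N) 0 \<kappa>"
proof -
  have "of_real (todd_minus_id_coeff \<gamma>) * h_deriv \<gamma> N \<kappa> = 0" for \<gamma>
    using h_deriv_inner_support[OF \<kappa> N, of \<gamma>] by (cases "multi_order \<gamma> = 0") (auto simp: todd_minus_id_coeff_eq)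
  then show ?thesis unfolding em_defect_def by (simp only: sum.neutral_const diff_zero)
qed

text \<open>The smooth Euler-Maclaurin formula multiplied by \<open>N ^ CARD('n)\<close>; its term
  of order 0 is the integral.\<close>

lemma em_defect_dilate:
  assumes "smooth \<psi>"
  shows "\<exists>C. \<forall>N\<ge>1. norm (em_defect M N (\<lambda>x. \<psi> ((1 / real N) *\<^sub>R x))) \<le> C * real N powr (real CARD('n) - real (M + 1))"
proof -
  obtain J where J: "smooth J" "\<exists>\<delta>>0. \<forall>h. (\<forall>i. \<bar>h $ i\<bar> < \<delta>) \<longrightarrow> (\<psi> has_integral J h) (shifted_polytope u a 1 h)"
    and EM: "\<And>M. \<exists>C. \<forall>N\<ge>1. norm (
      (\<Sum>\<gamma> | multi_order \<gamma> \<le> M. (todd_coeff \<gamma> * (1 / real N) ^ multi_order \<gamma>) *\<^sub>R multi_deriv \<gamma> J 0)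
      - (1 / real N) ^ CARD('n) *\<^sub>R lattice_sum \<Delta> N (\<lambda>l. \<psi> ((1 / real N) *\<^sub>R l)))
      \<le> C * (1 / real N) ^ (M + 1)"
    using euler_maclaurin_polytope[OF assms] by auto
  obtain \<delta> where \<delta>: "\<delta> > 0" "\<And>h. (\<forall>i. \<bar>h $ i\<bar> < \<delta>) \<Longrightarrow> (\<psi> has_integral J h) (shifted_polytope u a 1 h)"
    using J(2) by blast
  obtain C where C: "\<And>N. N \<ge> 1 \<Longrightarrow> norm (
      (\<Sum>\<gamma> | multi_order \<gamma> \<le> M. (todd_coeff \<gamma> * (1 / real N) ^ multi_order \<gamma>) *\<^sub>R multi_deriv \<gamma> J 0)
      - (1 / real N) ^ CARD('n) *\<^sub>R lattice_sum \<Delta> N (\<lambda>l. \<psi> ((1 / real N) *\<^sub>R l)))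
      \<le> C * (1 / real N) ^ (M + 1)"
    using EM[of M] by blast
  show ?thesis
  proof (intro exI[of _ C] allI impI)
    fix N :: nat assume N: "N \<ge> 1"
    let ?G = "{\<gamma>::'m \<Rightarrow> nat. multi_order \<gamma> \<le> M}"
    let ?D = "\<lambda>\<gamma>. (todd_coeff \<gamma> * (1 / real N) ^ multi_order \<gamma>) *\<^sub>R multi_deriv \<gamma> J 0"
    let ?LS = "lattice_sum \<Delta> N (\<lambda>l. \<psi> ((1 / real N) *\<^sub>R l))"
    have zero: "(\<lambda>_. 0) \<in> ?G" by simp
    have md0: "multi_deriv (\<lambda>_. 0) J 0 = J 0"
      using length_multi_list[of "\<lambda>_::'m. 0"] by (simp add: multi_deriv_eq)
    have PI: "polytope_integral u a (real N) 0 (\<lambda>x. \<psi> ((1 / real N) *\<^sub>R x)) = real N ^ CARD('n) *\<^sub>R J 0"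
      using local_integralD(2)[OF local_integral_dilate[OF J(1) \<delta> N]] by simp
    have summand: "of_real (todd_minus_id_coeff \<gamma>) * h_deriv \<gamma> N (\<lambda>x. \<psi> ((1 / real N) *\<^sub>R x)) =
        real N ^ CARD('n) *\<^sub>R (if \<gamma> = (\<lambda>_. 0) then 0 else ?D \<gamma>)" for \<gamma>
    proof -
      have z: "multi_order \<gamma> = 0 \<longleftrightarrow> \<gamma> = (\<lambda>_. 0)" by (auto simp: fun_eq_iff)
      have "h_deriv \<gamma> N (\<lambda>x. \<psi> ((1 / real N) *\<^sub>R x)) = (real N ^ CARD('n) * (1 / real N) ^ multi_order \<gamma>) *\<^sub>R multi_deriv \<gamma> J 0"
        by (rule h_deriv_dilate[OF J(1) \<delta> N])
      then show ?thesis unfolding todd_minus_id_coeff_eq z by (simp add: scaleR_conv_of_real)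
    qed
    have "(\<Sum>\<gamma>\<in>?G. ?D \<gamma>) = ?D (\<lambda>_. 0) + (\<Sum>\<gamma>\<in>?G - {\<lambda>_. 0}. ?D \<gamma>)"
      by (rule sum.remove[OF finite_multi_order_le zero])
    also have "?D (\<lambda>_. 0) = J 0" by (simp add: md0 todd_coeff_eq todd_fps_0)
    also have "(\<Sum>\<gamma>\<in>?G - {\<lambda>_. 0}. ?D \<gamma>) = (\<Sum>\<gamma>\<in>?G. if \<gamma> = (\<lambda>_. 0) then 0 else ?D \<gamma>)"
      using finite_multi_order_le by (intro sum.mono_neutral_cong_left) auto
    finally have split: "(\<Sum>\<gamma>\<in>?G. ?D \<gamma>) = J 0 + (\<Sum>\<gamma>\<in>?G. if \<gamma> = (\<lambda>_. 0) then 0 else ?D \<gamma>)" .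
    have "em_defect M N (\<lambda>x. \<psi> ((1 / real N) *\<^sub>R x)) =
       real N ^ CARD('n) *\<^sub>R ((1 / real N) ^ CARD('n) *\<^sub>R ?LS - (\<Sum>\<gamma>\<in>?G. ?D \<gamma>))"
      unfolding em_defect_def PI summand split scaleR_sum_right[symmetric] using N
      by (simp add: scaleR_diff_right scaleR_add_right power_one_over)
    also have "norm \<dots> = real N ^ CARD('n) * norm ((\<Sum>\<gamma>\<in>?G. ?D \<gamma>) - (1 / real N) ^ CARD('n) *\<^sub>R ?LS)"
      by (simp add: norm_minus_commute)
    also have "\<dots> \<le> real N ^ CARD('n) * (C * (1 / real N) ^ (M + 1))"
      by (intro mult_left_mono C N) simp
    also have "\<dots> = C * real N powr (real CARD('n) - real (M + 1))"
      using N by (simp add: powr_diff powr_realpow power_one_over field_simps del: of_nat_Suc of_nat_add)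
    finally show "norm (em_defect M N (\<lambda>x. \<psi> ((1 / real N) *\<^sub>R x))) \<le> C * real N powr (real CARD('n) - real (M + 1))" .
  qed
qed

text \<open>A bump in \<open>x / N\<close> separates the inner part, confined by its support, from
  the outer part. On the outer part homogeneity expresses \<open>F x\<close> through
  \<open>x / N\<close> alone, so one function \<open>\<psi>\<close> serves all large
  \<open>N\<close>.\<close>

lemma homogeneous_split:
  assumes F: "smooth F" "\<And>x t. R \<le> norm x \<Longrightarrow> 1 \<le> t \<Longrightarrow> F (t *\<^sub>R x) = of_real (t powr l) * F x"
  obtains \<psi> \<kappa> N0 where "smooth \<psi>" "N0 \<ge> 1" "\<And>N. N \<ge> N0 \<Longrightarrow> smooth (\<kappa> N)"
    "\<And>N x. N \<ge> N0 \<Longrightarrow> F x = \<kappa> N x + of_real (real N powr l) * \<psi> ((1 / real N) *\<^sub>R x)"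
    "\<And>N x i. N \<ge> N0 \<Longrightarrow> \<kappa> N x \<noteq> (0::complex) \<Longrightarrow> \<bar>x \<bullet> u i\<bar> \<le> real N / 2"
proof -
  obtain \<rho> where \<rho>: "\<rho> > 0" "\<And>x i. norm x \<le> \<rho> \<Longrightarrow> \<bar>x \<bullet> u i\<bar> \<le> 1 / 2" using inner_radius by blast
  \<comment> \<open>Chosen so that the support of the bump, a cube of half side
    \<open>2 * \<epsilon>\<close>, lies in the ball of radius \<open>\<rho>\<close>.\<close>
  define \<epsilon> where "\<epsilon> = \<rho> / (2 * CARD('n))"
  have \<epsilon>: "\<epsilon> > 0" using \<rho>(1) by (simp add: \<epsilon>_def)
  obtain \<beta> :: "real^'n \<Rightarrow> complex" where \<beta>: "smooth \<beta>" "\<And>x. (\<forall>i. \<bar>x $ i - 0 $ i\<bar> \<le> \<epsilon>) \<Longrightarrow> \<beta> x = 1"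
    "\<And>x i. \<bar>x $ i - 0 $ i\<bar> \<ge> 2 * \<epsilon> \<Longrightarrow> \<beta> x = 0"
    using smooth_bump_exists[OF \<epsilon>, of 0] by blast
  \<comment> \<open>At scale \<open>N0\<close> all points outside the cube of half side
    \<open>\<epsilon>\<close> have norm at least \<open>R\<close>, where homogeneity holds.\<close>
  obtain N0' :: nat where N0': "R / \<epsilon> \<le> real N0'" using real_arch_simple by blast
  define N0 where "N0 = max N0' 1"
  have N0: "N0 \<ge> 1" "R \<le> \<epsilon> * real N0"
  proof -
    have "R / \<epsilon> \<le> real N0" using N0' by (simp add: N0_def)
    then show "R \<le> \<epsilon> * real N0" using \<epsilon> by (simp add: field_simps)
  qed (simp add: N0_def)
  \<comment> \<open>Outside the cube, \<open>F (N y) = (N / N0) powr l * F (N0 y)\<close>, which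
    explains the reference scale \<open>N0\<close>. Inside it the factor
    \<open>1 - \<beta> y\<close> vanishes, so the failure of homogeneity there is harmless.\<close>
  define \<psi> where "\<psi> y = (1 - \<beta> y) * (of_real (real N0 powr (- l)) * F (real N0 *\<^sub>R y))" for y
  define \<kappa> where "\<kappa> N x = \<beta> ((1 / real N) *\<^sub>R x) * F x" for N :: nat and x
  have "smooth \<psi>" unfolding \<psi>_def by (intro smooth_mult smooth_diff smooth_const smooth_scale F(1) \<beta>(1))
  moreover have "smooth (\<kappa> N)" for N unfolding \<kappa>_def by (intro smooth_mult smooth_scale F(1) \<beta>(1))
  moreover have "F x = \<kappa> N x + of_real (real N powr l) * \<psi> ((1 / real N) *\<^sub>R x)" if N: "N \<ge> N0" for N x
  proof (cases "\<forall>i. \<bar>((1 / real N) *\<^sub>R x) $ i - 0 $ i\<bar> \<le> \<epsilon>")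
    case True
    then show ?thesis using \<beta>(2)[of "(1 / real N) *\<^sub>R x"] by (simp add: \<psi>_def \<kappa>_def)
  next
    case False
    then obtain i where i: "\<epsilon> < \<bar>((1 / real N) *\<^sub>R x) $ i\<bar>" by (auto simp: not_le)
    let ?y = "(1 / real N) *\<^sub>R x"
    have Np: "real N0 > 0" "real N > 0" using N0(1) N by auto
    have "\<epsilon> \<le> norm ?y" using i component_le_norm_cart[of ?y i] by linarith
    then have "\<epsilon> * real N0 \<le> norm (real N0 *\<^sub>R ?y)"
      using mult_left_mono[of \<epsilon> "norm ?y" "real N0"] unfolding norm_scaleR[of "real N0"] by (simp only: abs_of_nat mult.commute[of \<epsilon>] of_nat_0_le_iff)
    then have "R \<le> norm (real N0 *\<^sub>R ?y)" using N0(2) by linarith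
    moreover have "1 \<le> real N / real N0" using N Np by simp
    ultimately have "F ((real N / real N0) *\<^sub>R (real N0 *\<^sub>R ?y)) = of_real ((real N / real N0) powr l) * F (real N0 *\<^sub>R ?y)"
      by (rule F(2))
    moreover have "(real N / real N0) *\<^sub>R (real N0 *\<^sub>R ?y) = x" using Np by simp
    moreover have "(real N / real N0) powr l = real N powr l * real N0 powr (- l)"
      using Np by (simp add: powr_divide powr_minus_divide)
    ultimately have "F x = of_real (real N powr l) * (of_real (real N0 powr (- l)) * F (real N0 *\<^sub>R ?y))" by simp
    then show ?thesis unfolding \<psi>_def \<kappa>_def by (simp add: algebra_simps)
  qed
  moreover have "\<bar>x \<bullet> u i\<bar> \<le> real N / 2" if N: "N \<ge> N0" and nz: "\<kappa> N x \<noteq> 0" for N x i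
  proof -
    let ?y = "(1 / real N) *\<^sub>R x"
    have Np: "real N > 0" using N0(1) N by auto
    have "\<beta> ?y \<noteq> 0" using nz by (auto simp: \<kappa>_def)
    then have lt: "\<bar>?y $ k\<bar> \<le> 2 * \<epsilon>" for k using \<beta>(3)[of ?y k] by fastforce
    have "norm ?y \<le> (\<Sum>k\<in>UNIV. \<bar>?y $ k\<bar>)" by (rule norm_le_l1_cart)
    also have "\<dots> \<le> (\<Sum>k\<in>(UNIV::'n set). 2 * \<epsilon>)" by (intro sum_mono lt)
    also have "\<dots> = \<rho>" by (simp add: \<epsilon>_def)
    finally have "\<bar>?y \<bullet> u i\<bar> \<le> 1 / 2" by (rule \<rho>(2))
    then show ?thesis using Np by (simp add: field_simps)
  qed
  ultimately show ?thesis using that[of \<psi> N0 \<kappa>] N0(1) by blast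
qed

text \<open>The inner part of the splitting contributes nothing to a shift derivative, and the outer
  part is an exact multiple of a dilate; hence an exact power of \<open>N\<close> for large
  \<open>N\<close>.\<close>

lemma homogeneous_h_deriv:
  assumes F: "smooth F" "\<And>x t. R \<le> norm x \<Longrightarrow> 1 \<le> t \<Longrightarrow> F (t *\<^sub>R x) = of_real (t powr l) * F x"
  shows "\<exists>c N0. \<forall>N\<ge>N0. \<forall>\<gamma>. multi_order \<gamma> > 0 \<longrightarrow>
    h_deriv \<gamma> N F = of_real (real N powr (l + real CARD('n) - real (multi_order \<gamma>))) * c \<gamma>"
proof -
  obtain \<psi> \<kappa> N0 where s: "smooth \<psi>" "N0 \<ge> 1" "\<And>N. N \<ge> N0 \<Longrightarrow> smooth (\<kappa> N)"
    "\<And>N x. N \<ge> N0 \<Longrightarrow> F x = \<kappa> N x + of_real (real N powr l) * \<psi> ((1 / real N) *\<^sub>R x)"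
    "\<And>N x i. N \<ge> N0 \<Longrightarrow> \<kappa> N x \<noteq> (0::complex) \<Longrightarrow> \<bar>x \<bullet> u i\<bar> \<le> real N / 2"
    using homogeneous_split[OF F] by metis
  obtain J \<delta> where J: "smooth J" "\<delta> > 0" "\<And>h. (\<forall>i. \<bar>h $ i\<bar> < \<delta>) \<Longrightarrow> (\<psi> has_integral J h) (shifted_polytope u a 1 h)"
    using euler_maclaurin_polytope[OF s(1)] by blast
  show ?thesis
  proof (intro exI[of _ "\<lambda>\<gamma>. multi_deriv \<gamma> J 0"] exI[of _ N0] allI impI)
    fix N :: nat and \<gamma> :: "'m \<Rightarrow> nat" assume N: "N0 \<le> N" and \<gamma>: "0 < multi_order \<gamma>"
    have N1: "N \<ge> 1" using N s(2) by simp
    let ?\<psi> = "\<lambda>x. \<psi> ((1 / real N) *\<^sub>R x)"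
    have sm: "smooth ?\<psi>" by (rule smooth_scale[OF s(1)])
    have "F = (\<lambda>x. \<kappa> N x + of_real (real N powr l) * ?\<psi> x)" using s(4)[OF N] by blast
    then have "h_deriv \<gamma> N F = h_deriv \<gamma> N (\<kappa> N) + of_real (real N powr l) * h_deriv \<gamma> N ?\<psi>"
      using h_deriv_add(1)[OF s(3)[OF N] smooth_cmult[OF sm, of "of_real (real N powr l)"] N1] h_deriv_cmult(1)[OF sm N1] by simp
    also have "h_deriv \<gamma> N (\<kappa> N) = 0" by (rule h_deriv_inner_support[OF s(3)[OF N] s(5)[OF N] N1 \<gamma>])
    also have "h_deriv \<gamma> N ?\<psi> = (real N ^ CARD('n) * (1 / real N) ^ multi_order \<gamma>) *\<^sub>R multi_deriv \<gamma> J 0"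
      by (rule h_deriv_dilate[OF J N1])
    also have "0 + of_real (real N powr l) * ((real N ^ CARD('n) * (1 / real N) ^ multi_order \<gamma>) *\<^sub>R multi_deriv \<gamma> J 0)
      = of_real (real N powr l * (real N ^ CARD('n) * (1 / real N) ^ multi_order \<gamma>)) * multi_deriv \<gamma> J 0"
      by (simp add: scaleR_conv_of_real)
    also have "real N powr l * (real N ^ CARD('n) * (1 / real N) ^ multi_order \<gamma>) = real N powr (l + real CARD('n) - real (multi_order \<gamma>))"
    proof -
      have "real N ^ CARD('n) = real N powr real CARD('n)" "real N ^ multi_order \<gamma> = real N powr real (multi_order \<gamma>)"
        using N1 by (simp_all only: powr_realpow of_nat_0_less_iff less_eq_Suc_le One_nat_def)
      then show ?thesis by (simp only: powr_diff powr_add power_one_over) (simp add: divide_inverse)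
    qed
    finally show "h_deriv \<gamma> N F = of_real (real N powr (l + real CARD('n) - real (multi_order \<gamma>))) * multi_deriv \<gamma> J 0" .
  qed
qed

text \<open>The outer part contributes an error of the required size directly; for the inner part
  \<open>dilation_limit\<close> supplies the limit \<open>L\<close>.\<close>

lemma homogeneous_em_defect:
  assumes F: "smooth F" "\<And>x t. R \<le> norm x \<Longrightarrow> 1 \<le> t \<Longrightarrow> F (t *\<^sub>R x) = of_real (t powr l) * F x"
    and M: "l + real CARD('n) - real (M + 1) < 0"
  shows "\<exists>L C N0. \<forall>N\<ge>N0. norm (em_defect M N F - L) \<le> C * real N powr (l + real CARD('n) - real (M + 1))"
proof -
  let ?s = "l + real CARD('n) - real (M + 1)"
  obtain \<psi> \<kappa> N0 where s: "smooth \<psi>" "N0 \<ge> 1" "\<And>N. N \<ge> N0 \<Longrightarrow> smooth (\<kappa> N)"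
    "\<And>N x. N \<ge> N0 \<Longrightarrow> F x = \<kappa> N x + of_real (real N powr l) * \<psi> ((1 / real N) *\<^sub>R x)"
    "\<And>N x i. N \<ge> N0 \<Longrightarrow> \<kappa> N x \<noteq> (0::complex) \<Longrightarrow> \<bar>x \<bullet> u i\<bar> \<le> real N / 2"
    using homogeneous_split[OF F(1,2)] by metis
  define c where "c N = em_defect M N (\<kappa> N)" for N
  have pw: "real N powr l * (C * real N powr (real CARD('n) - real (M + 1))) = C * real N powr ?s" for N C
  proof -
    have "?s = l + (real CARD('n) - real (M + 1))" by simp
    then show ?thesis by (simp only: powr_add mult.left_commute)
  qed
  obtain C1 where C1: "\<And>N. N \<ge> 1 \<Longrightarrow> norm (em_defect M N (\<lambda>x. \<psi> ((1 / real N) *\<^sub>R x))) \<le> C1 * real N powr (real CARD('n) - real (M + 1))"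
    using em_defect_dilate[OF s(1), of M] by blast
  have near: "norm (em_defect M N F - c N) \<le> C1 * real N powr ?s" if N: "N \<ge> N0" for N
  proof -
    have N1: "N \<ge> 1" using N s(2) by simp
    let ?\<psi> = "\<lambda>x. \<psi> ((1 / real N) *\<^sub>R x)"
    have sm: "smooth ?\<psi>" by (rule smooth_scale[OF s(1)])
    have "F = (\<lambda>x. \<kappa> N x + of_real (real N powr l) * ?\<psi> x)" using s(4)[OF N] by blast
    then have "em_defect M N F = c N + of_real (real N powr l) * em_defect M N ?\<psi>"
      using em_defect_add[OF s(3)[OF N] smooth_cmult[OF sm, of "of_real (real N powr l)"] N1] em_defect_cmult[OF sm N1] by (simp add: c_def)
    then have "norm (em_defect M N F - c N) = real N powr l * norm (em_defect M N ?\<psi>)" by (simp add: norm_mult)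
    also have "\<dots> \<le> real N powr l * (C1 * real N powr (real CARD('n) - real (M + 1)))"
      by (intro mult_left_mono C1 N1) simp
    finally show ?thesis unfolding pw .
  qed
  have "\<exists>L C N1. \<forall>N\<ge>N1. norm (c N - L) \<le> C * real N powr (- (- ?s))"
  proof (rule dilation_limit)
    show "0 < - ?s" using M by simp
    fix p :: nat assume p: "p \<ge> 1"
    have smp: "smooth (\<lambda>y. \<psi> (real p *\<^sub>R y))" by (rule smooth_scale[OF s(1)])
    obtain C2 where C2: "\<And>N. N \<ge> 1 \<Longrightarrow> norm (em_defect M N (\<lambda>x. \<psi> (real p *\<^sub>R ((1 / real N) *\<^sub>R x)))) \<le> C2 * real N powr (real CARD('n) - real (M + 1))"
      using em_defect_dilate[OF smp, of M] by blast
    show "\<exists>C N1. \<forall>N\<ge>N1. norm (c (p * N) - c N) \<le> C * real N powr (- (- ?s))"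
    proof (intro exI[of _ "(real p powr (- l) * C2 + C1) * real p powr ?s"] exI[of _ N0] allI impI)
      fix N assume N: "N0 \<le> N"
      have N1: "N \<ge> 1" using N s(2) by simp
      have NpN: "N \<le> p * N" using p by simp
      have pN: "p * N \<ge> N0" "p * N \<ge> 1" using order.trans[OF N NpN] order.trans[OF N1 NpN] by blast+
      let ?K = "p * N"
      let ?a = "\<lambda>x. of_real (real N powr l) * \<psi> (real p *\<^sub>R ((1 / real ?K) *\<^sub>R x))"
      let ?b = "\<lambda>x. of_real (real ?K powr l) * \<psi> ((1 / real ?K) *\<^sub>R x)"
      have supp: "\<bar>x \<bullet> u i\<bar> \<le> real ?K / 2" if "\<kappa> N x \<noteq> 0" for x i
      proof -
        have "real N \<le> real ?K" using NpN by (simp only: of_nat_le_iff)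
        then show ?thesis using s(5)[OF N that, of i] by linarith
      qed
      \<comment> \<open>The inner part belonging to \<open>N\<close> is unaffected by passing to
        level \<open>p * N\<close>: its defect is lattice sum minus integral, and its support is
        still far inside.\<close>
      have "c N = em_defect M ?K (\<kappa> N)"
      proof -
        have "em_defect M N (\<kappa> N) = lattice_sum \<Delta> N (\<kappa> N) - polytope_integral u a (real N) 0 (\<kappa> N)"
          by (rule em_defect_inner_support[OF s(3)[OF N] s(5)[OF N] N1])
        also have "\<dots> = lattice_sum \<Delta> ?K (\<kappa> N) - polytope_integral u a (real ?K) 0 (\<kappa> N)"
        proof -
          have "lattice_sum \<Delta> ?K (\<kappa> N) = lattice_sum \<Delta> N (\<kappa> N)"
            by (rule inner_support_dilate(1)[OF s(3)[OF N] s(5)[OF N] N1 NpN])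
          moreover have "polytope_integral u a (real ?K) 0 (\<kappa> N) = polytope_integral u a (real N) 0 (\<kappa> N)"
            by (rule inner_support_dilate(2)[OF s(3)[OF N] s(5)[OF N] N1 NpN])
          ultimately show ?thesis by (simp only:)
        qed
        also have "\<dots> = em_defect M ?K (\<kappa> N)"
          by (rule em_defect_inner_support[OF s(3)[OF N] supp pN(2), symmetric])
        finally show ?thesis unfolding c_def .
      qed
      then have "c ?K - c N = em_defect M ?K (\<lambda>x. \<kappa> ?K x - \<kappa> N x)"
        unfolding c_def by (simp only: em_defect_diff[OF s(3)[OF pN(1)] s(3)[OF N] pN(2)])
      \<comment> \<open>Both splittings represent the same \<open>F\<close>, so the inner parts
        differ by the outer ones. At level \<open>p * N\<close> these are dilates of
        \<open>\<psi>\<close> and of \<open>y \<mapsto> \<psi> (p y)\<close>, to which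
        \<open>em_defect_dilate\<close> applies.\<close>
      also have "(\<lambda>x. \<kappa> ?K x - \<kappa> N x) = (\<lambda>x. ?a x - ?b x)"
      proof
        fix x :: "real^'n"
        have "real p * (1 / real ?K) = 1 / real N" using p N1 by simp
        then have e: "real p *\<^sub>R ((1 / real ?K) *\<^sub>R x) = (1 / real N) *\<^sub>R x" by (simp only: scaleR_scaleR)
        have "\<kappa> ?K x + of_real (real ?K powr l) * \<psi> ((1 / real ?K) *\<^sub>R x) = \<kappa> N x + of_real (real N powr l) * \<psi> ((1 / real N) *\<^sub>R x)"
          using s(4)[OF pN(1), of x] s(4)[OF N, of x] by simp
        then show "\<kappa> ?K x - \<kappa> N x = ?a x - ?b x" unfolding e by (simp add: algebra_simps)
      qed
      also have "em_defect M ?K (\<lambda>x. ?a x - ?b x) = of_real (real N powr l) * em_defect M ?K (\<lambda>x. \<psi> (real p *\<^sub>R ((1 / real ?K) *\<^sub>R x)))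
          - of_real (real ?K powr l) * em_defect M ?K (\<lambda>x. \<psi> ((1 / real ?K) *\<^sub>R x))"
      proof -
        have sa: "smooth (\<lambda>x. \<psi> (real p *\<^sub>R ((1 / real ?K) *\<^sub>R x)))" by (rule smooth_scale[OF smp])
        have sb: "smooth (\<lambda>x. \<psi> ((1 / real ?K) *\<^sub>R x))" by (rule smooth_scale[OF s(1)])
        show ?thesis
          unfolding em_defect_diff[OF smooth_cmult[OF sa] smooth_cmult[OF sb] pN(2)] em_defect_cmult[OF sa pN(2)] em_defect_cmult[OF sb pN(2)] ..
      qed
      finally have eq: "c ?K - c N = of_real (real N powr l) * em_defect M ?K (\<lambda>x. \<psi> (real p *\<^sub>R ((1 / real ?K) *\<^sub>R x)))
          - of_real (real ?K powr l) * em_defect M ?K (\<lambda>x. \<psi> ((1 / real ?K) *\<^sub>R x))" .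
      have Nl: "real N powr l = real p powr (- l) * real ?K powr l"
        using p by (simp add: powr_mult powr_minus)
      have "norm (of_real (real N powr l) * em_defect M ?K (\<lambda>x. \<psi> (real p *\<^sub>R ((1 / real ?K) *\<^sub>R x))))
          = real p powr (- l) * (real ?K powr l * norm (em_defect M ?K (\<lambda>x. \<psi> (real p *\<^sub>R ((1 / real ?K) *\<^sub>R x)))))"
        unfolding Nl norm_mult norm_of_real by simp
      also have "\<dots> \<le> real p powr (- l) * (real ?K powr l * (C2 * real ?K powr (real CARD('n) - real (M + 1))))"
        by (intro mult_left_mono C2 pN(2)) simp_all
      also have "\<dots> = real p powr (- l) * (C2 * real ?K powr ?s)" unfolding pw ..
      finally have t1: "norm (of_real (real N powr l) * em_defect M ?K (\<lambda>x. \<psi> (real p *\<^sub>R ((1 / real ?K) *\<^sub>R x))))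
          \<le> real p powr (- l) * (C2 * real ?K powr ?s)" .
      have "norm (of_real (real ?K powr l) * em_defect M ?K (\<lambda>x. \<psi> ((1 / real ?K) *\<^sub>R x)))
          = real ?K powr l * norm (em_defect M ?K (\<lambda>x. \<psi> ((1 / real ?K) *\<^sub>R x)))"
        unfolding norm_mult norm_of_real by simp
      also have "\<dots> \<le> real ?K powr l * (C1 * real ?K powr (real CARD('n) - real (M + 1)))"
        by (intro mult_left_mono C1 pN(2)) simp
      also have "\<dots> = C1 * real ?K powr ?s" unfolding pw ..
      finally have t2: "norm (of_real (real ?K powr l) * em_defect M ?K (\<lambda>x. \<psi> ((1 / real ?K) *\<^sub>R x))) \<le> C1 * real ?K powr ?s" .
      have "norm (c ?K - c N) \<le> real p powr (- l) * (C2 * real ?K powr ?s) + C1 * real ?K powr ?s"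
        unfolding eq by (rule order.trans[OF norm_triangle_ineq4 add_mono[OF t1 t2]])
      also have "\<dots> = (real p powr (- l) * C2 + C1) * real p powr ?s * real N powr ?s"
        by (simp add: powr_mult algebra_simps)
      finally show "norm (c (p * N) - c N) \<le> (real p powr (- l) * C2 + C1) * real p powr ?s * real N powr (- (- ?s))"
        by (simp only: minus_minus)
    qed
  qed
  then obtain L C N1 where L: "\<And>N. N \<ge> N1 \<Longrightarrow> norm (c N - L) \<le> C * real N powr ?s" by auto
  show ?thesis
  proof (intro exI[of _ L] exI[of _ "C1 + C"] exI[of _ "max N0 N1"] allI impI)
    fix N assume "max N0 N1 \<le> N"
    then have "norm (em_defect M N F - c N) \<le> C1 * real N powr ?s" "norm (c N - L) \<le> C * real N powr ?s" using near L by auto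
    then show "norm (em_defect M N F - L) \<le> (C1 + C) * real N powr ?s"
      using norm_triangle_ineq[of "em_defect M N F - c N" "c N - L"] by (simp add: distrib_right)
  qed
qed

end

section \<open>Uniqueness and remainder of the expansion\<close>

lemma rate_smallo:
  fixes g :: "nat \<Rightarrow> complex"
  assumes "s < K" "\<And>N. N \<ge> N0 \<Longrightarrow> norm (g N) \<le> C * real N powr s"
  shows "g \<in> o[sequentially](\<lambda>N. of_real (real N powr K))"
proof (rule smalloI_tendsto)
  show "\<forall>\<^sub>F N in sequentially. complex_of_real (real N powr K) \<noteq> 0"
    using eventually_gt_at_top[of 0] by eventually_elim auto
  show "((\<lambda>N. g N / complex_of_real (real N powr K)) \<longlongrightarrow> 0) sequentially"
  proof (rule Lim_null_comparison)
    show "\<forall>\<^sub>F N in sequentially. norm (g N / complex_of_real (real N powr K)) \<le> C * real N powr (s - K)"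
      using eventually_ge_at_top[of N0] eventually_gt_at_top[of 0]
    proof eventually_elim
      case (elim N)
      have "norm (g N / complex_of_real (real N powr K)) = norm (g N) / real N powr K" by (simp add: norm_divide)
      also have "\<dots> \<le> C * real N powr s / real N powr K" using assms(2)[OF elim(1)] by (intro divide_right_mono) auto
      finally show ?case by (simp add: powr_diff)
    qed
    show "(\<lambda>N. C * real N powr (s - K)) \<longlonglongrightarrow> 0" using assms(1) by (intro powr_scale_limit) simp
  qed
qed

text \<open>The term with the largest exponent \<open>m\<close> dominates: after division by
  \<open>t powr m\<close> everything else tends to 0, so its coefficient vanishes, and induction
  removes the rest. All exponents being at least \<open>j\<close> makes \<open>o(t powr j)\<close>
  strong enough.\<close>

lemma power_sum_coeffs_zero:
  fixes E :: "real set" and c :: "real \<Rightarrow> complex"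
  assumes "finite E"
  shows "(\<forall>\<epsilon>\<in>E. j \<le> \<epsilon>) \<Longrightarrow> ((\<lambda>t. (\<Sum>\<epsilon>\<in>E. of_real (t powr \<epsilon>) * c \<epsilon>) / of_real (t powr j)) \<longlongrightarrow> 0) at_top
    \<Longrightarrow> \<forall>\<epsilon>\<in>E. c \<epsilon> = 0"
  using assms
proof (induction E rule: finite_linorder_max_induct)
  case (insert m E)
  let ?S = "\<lambda>E t. \<Sum>\<epsilon>\<in>E. complex_of_real (t powr \<epsilon>) * c \<epsilon>"
  have fin: "finite E" and m: "m \<notin> E" using insert.hyps by auto
  have l1: "((\<lambda>t. (?S (insert m E) t / of_real (t powr j)) * of_real (t powr (j - m))) \<longlongrightarrow> 0) at_top"
  proof (cases "j = m")
    case True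
    have "((\<lambda>t. (?S (insert m E) t / of_real (t powr j)) * 1) \<longlongrightarrow> 0) at_top" using insert.prems(2) by simp
    then show ?thesis
      by (rule Lim_transform_eventually) (use eventually_gt_at_top[of 0] in eventually_elim, simp add: True)
  next
    case False
    then have "j - m < 0" using insert.prems(1) by auto
    then have "((\<lambda>t. complex_of_real (t powr (j - m))) \<longlongrightarrow> of_real 0) at_top"
      by (intro tendsto_of_real tendsto_neg_powr filterlim_ident)
    from tendsto_mult[OF insert.prems(2) this] show ?thesis by simp
  qed
  have "((\<lambda>t. ?S E t * of_real (t powr (- m)) + c m) \<longlongrightarrow> 0) at_top"
  proof (rule Lim_transform_eventually[OF l1])
    show "\<forall>\<^sub>F t in at_top. ?S (insert m E) t / of_real (t powr j) * of_real (t powr (j - m)) = ?S E t * of_real (t powr (- m)) + c m"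
      using eventually_gt_at_top[of "0::real"]
    proof eventually_elim
      case (elim t)
      have "?S (insert m E) t = of_real (t powr m) * c m + ?S E t" using fin m by simp
      moreover have "t powr (j - m) = t powr j * t powr (- m)" by (metis add.commute powr_add uminus_add_conv_diff)
      moreover have "complex_of_real (t powr m) * of_real (t powr (- m)) = 1"
        using elim by (simp flip: of_real_mult powr_add)
      moreover have "complex_of_real (t powr j) \<noteq> 0" using elim by simp
      ultimately show ?case by (simp add: field_simps)
    qed
  qed
  moreover have "((\<lambda>t. ?S E t * of_real (t powr (- m)) + c m) \<longlongrightarrow> 0 + c m) at_top"
  proof (intro tendsto_add tendsto_const)
    have "((\<lambda>t. \<Sum>\<epsilon>\<in>E. complex_of_real (t powr (\<epsilon> - m)) * c \<epsilon>) \<longlongrightarrow> 0) at_top"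
    proof (rule tendsto_null_sum)
      fix \<epsilon> assume "\<epsilon> \<in> E"
      then have "\<epsilon> - m < 0" using insert.hyps by auto
      then have "((\<lambda>t. complex_of_real (t powr (\<epsilon> - m))) \<longlongrightarrow> of_real 0) at_top"
        by (intro tendsto_of_real tendsto_neg_powr filterlim_ident)
      from tendsto_mult_left_zero[OF this[unfolded of_real_0]] show "((\<lambda>t. complex_of_real (t powr (\<epsilon> - m)) * c \<epsilon>) \<longlongrightarrow> 0) at_top" .
    qed
    moreover have "(\<lambda>t. \<Sum>\<epsilon>\<in>E. complex_of_real (t powr (\<epsilon> - m)) * c \<epsilon>) = (\<lambda>t. ?S E t * of_real (t powr (- m)))"
    proof
      fix t
      have "t powr (\<epsilon> - m) = t powr \<epsilon> * t powr (- m)" for \<epsilon> by (metis powr_add uminus_add_conv_diff add.commute)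
      then show "(\<Sum>\<epsilon>\<in>E. complex_of_real (t powr (\<epsilon> - m)) * c \<epsilon>) = ?S E t * of_real (t powr (- m))"
        unfolding sum_distrib_right by (intro sum.cong refl) (simp add: mult_ac)
    qed
    ultimately show "((\<lambda>t. ?S E t * of_real (t powr (- m))) \<longlongrightarrow> 0) at_top" by simp
  qed
  ultimately have cm: "c m = 0" using tendsto_unique[OF trivial_limit_at_top_linorder] by fastforce
  have "?S (insert m E) t = ?S E t" for t using fin m cm by auto
  have "\<forall>\<epsilon>\<in>E. c \<epsilon> = 0"
    by (rule insert.IH) (use insert.prems \<open>\<And>t. ?S (insert m E) t = ?S E t\<close> in auto)
  then show ?case using cm by simp
qed simp

text \<open>Exponents may coincide here, as happens when two expansions are compared; grouping equal
  ones reduces to \<open>power_sum_coeffs_zero\<close>.\<close>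

lemma power_sum_zero:
  fixes \<epsilon> :: "'i \<Rightarrow> real" and c :: "'i \<Rightarrow> complex"
  assumes "finite A" "\<And>i. i \<in> A \<Longrightarrow> j \<le> \<epsilon> i"
    "((\<lambda>t. (\<Sum>i\<in>A. of_real (t powr \<epsilon> i) * c i) / of_real (t powr j)) \<longlongrightarrow> 0) at_top"
  shows "(\<Sum>i\<in>A. c i) = 0"
proof -
  define C where "C e = (\<Sum>i\<in>{i \<in> A. \<epsilon> i = e}. c i)" for e
  have "(\<Sum>i\<in>A. of_real (t powr \<epsilon> i) * c i) = (\<Sum>e\<in>\<epsilon> ` A. of_real (t powr e) * C e)" for t
  proof -
    have "(\<Sum>i\<in>A. of_real (t powr \<epsilon> i) * c i) = (\<Sum>e\<in>\<epsilon> ` A. \<Sum>i\<in>{i \<in> A. \<epsilon> i = e}. of_real (t powr \<epsilon> i) * c i)"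
      by (rule sum.image_gen[OF assms(1)])
    also have "\<dots> = (\<Sum>e\<in>\<epsilon> ` A. of_real (t powr e) * C e)"
      unfolding C_def sum_distrib_left by (intro sum.cong refl) auto
    finally show ?thesis .
  qed
  then have "((\<lambda>t. (\<Sum>e\<in>\<epsilon> ` A. of_real (t powr e) * C e) / of_real (t powr j)) \<longlongrightarrow> 0) at_top" using assms(3) by simp
  then have "\<forall>e\<in>\<epsilon> ` A. C e = 0" using assms(1,2) by (intro power_sum_coeffs_zero) auto
  moreover have "(\<Sum>i\<in>A. c i) = (\<Sum>e\<in>\<epsilon> ` A. C e)" unfolding C_def by (rule sum.image_gen[OF assms(1)])
  moreover have "(\<Sum>e\<in>\<epsilon> ` A. C e) = 0" using \<open>\<forall>e\<in>\<epsilon> ` A. C e = 0\<close> by (intro sum.neutral)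
  ultimately show ?thesis by simp
qed

lemma expansion_finite:
  assumes "polyhomogeneous_expansion r f e F"
  shows "finite {k. j \<le> e k}"
proof -
  have "filterlim e at_bot sequentially" using assms by (simp add: polyhomogeneous_expansion_def)
  then have "eventually (\<lambda>k. e k < j) sequentially" by (simp add: filterlim_at_bot_dense)
  then obtain k0 where "\<And>k. k \<ge> k0 \<Longrightarrow> e k < j" by (auto simp: eventually_sequentially)
  then have "{k. j \<le> e k} \<subseteq> {..<k0}" by (auto simp: not_le[symmetric])
  then show ?thesis by (rule finite_subset) simp
qed

lemma expansion_le_first:
  assumes "polyhomogeneous_expansion r f e F"
  shows "e k \<le> e 0"
proof (induction k)
  case (Suc k)
  have "e (Suc k) < e k" using assms by (simp add: polyhomogeneous_expansion_def)
  then show ?case using Suc by simp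
qed simp

lemma expansion_component:
  assumes "polyhomogeneous_expansion r f e F"
  shows "smooth (F k)" "\<exists>R. \<forall>x t. R \<le> norm x \<longrightarrow> 1 \<le> t \<longrightarrow> F k (t *\<^sub>R x) = of_real (t powr e k) * F k x"
  using assms by (auto simp: polyhomogeneous_expansion_def homogeneous_symbol_def symbol_def)

lemma expansion_remainder:
  assumes "polyhomogeneous_expansion r f e F"
  shows "(\<lambda>x. f x - (\<Sum>k\<in>{k. j \<le> e k}. F k x)) \<in> o[at_infinity](\<lambda>x. of_real (norm x powr j))"
  using assms by (simp add: polyhomogeneous_expansion_def)

text \<open>Along a ray both truncations are finite sums of powers of \<open>t\<close> with
  exponents at least \<open>j\<close>, and their difference is \<open>o(t powr j)\<close>; so the
  coefficients cancel in total. Comparing whole truncations avoids matching the two exponent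
  sequences, which may differ by vanishing components.\<close>

lemma expansion_unique:
  fixes f :: "real^'n::finite \<Rightarrow> complex"
  assumes E: "polyhomogeneous_expansion r f e F" and E': "polyhomogeneous_expansion r f e' F'"
  shows "\<exists>R. \<forall>x. R \<le> norm x \<longrightarrow> (\<Sum>k\<in>{k. j \<le> e k}. F k x) = (\<Sum>k\<in>{k. j \<le> e' k}. F' k x)"
proof -
  let ?S = "{k. j \<le> e k}" and ?S' = "{k. j \<le> e' k}"
  have fin: "finite ?S" "finite ?S'" using expansion_finite E E' by blast+
  obtain R where R: "\<And>k x t. R k \<le> norm x \<Longrightarrow> 1 \<le> t \<Longrightarrow> F k (t *\<^sub>R x) = of_real (t powr e k) * F k x"
    using expansion_component(2)[OF E] by metis
  obtain R' where R': "\<And>k x t. R' k \<le> norm x \<Longrightarrow> 1 \<le> t \<Longrightarrow> F' k (t *\<^sub>R x) = of_real (t powr e' k) * F' k x"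
    using expansion_component(2)[OF E'] by metis
  define B where "B = Max (insert 1 (R ` ?S \<union> R' ` ?S'))"
  have B: "1 \<le> B" "\<And>k. k \<in> ?S \<Longrightarrow> R k \<le> B" "\<And>k. k \<in> ?S' \<Longrightarrow> R' k \<le> B"
    unfolding B_def using fin by (auto intro!: Max_ge)
  have "(\<Sum>k\<in>?S. F k x) = (\<Sum>k\<in>?S'. F' k x)" if x: "B \<le> norm x" for x
  proof -
    have x0: "norm x > 0" using x B(1) by linarith
    \<comment> \<open>Joins both expansions into one family of powers, the second with negative
      sign; the sum of the coefficients is the difference of the truncations at \<open>x\<close>
      itself.\<close>
    let ?\<epsilon> = "case_sum e e'" and ?c = "case_sum (\<lambda>k. F k x) (\<lambda>k. - F' k x)"
    have sum_eq: "(\<Sum>i\<in>?S <+> ?S'. of_real (t powr ?\<epsilon> i) * ?c i) = (\<Sum>k\<in>?S. F k (t *\<^sub>R x)) - (\<Sum>k\<in>?S'. F' k (t *\<^sub>R x))" if t: "1 \<le> t" for t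
    proof -
      have "(\<Sum>k\<in>?S. F k (t *\<^sub>R x)) = (\<Sum>k\<in>?S. of_real (t powr e k) * F k x)"
        using B(2) x t by (intro sum.cong refl R) (auto intro: order.trans)
      moreover have "(\<Sum>k\<in>?S'. F' k (t *\<^sub>R x)) = (\<Sum>k\<in>?S'. of_real (t powr e' k) * F' k x)"
        using B(3) x t by (intro sum.cong refl R') (auto intro: order.trans)
      ultimately show ?thesis using fin by (simp add: sum.Plus sum_negf)
    qed
    have "(\<Sum>i\<in>?S <+> ?S'. ?c i) = 0"
    proof (rule power_sum_zero)
      show "finite (?S <+> ?S')" using fin by simp
      show "j \<le> ?\<epsilon> i" if "i \<in> ?S <+> ?S'" for i using that by auto
      have "(\<lambda>x. (f x - (\<Sum>k\<in>?S'. F' k x)) - (f x - (\<Sum>k\<in>?S. F k x))) \<in> o[at_infinity](\<lambda>x. of_real (norm x powr j))"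
        by (intro sum_in_smallo(2) expansion_remainder[OF E] expansion_remainder[OF E'])
      then have lim: "((\<lambda>y. ((\<Sum>k\<in>?S. F k y) - (\<Sum>k\<in>?S'. F' k y)) / of_real (norm y powr j)) \<longlongrightarrow> 0) at_infinity"
        by (auto dest!: smalloD_tendsto)
      have "filterlim (\<lambda>t. t *\<^sub>R x) at_infinity at_top"
      proof (rule filterlim_at_infinity_conv_norm_at_top[THEN iffD2])
        have "filterlim (\<lambda>t. norm x * \<bar>t\<bar>) at_top (at_top :: real filter)"
          by (intro filterlim_tendsto_pos_mult_at_top[OF tendsto_const x0] filterlim_abs_real)
        then show "filterlim (\<lambda>t. norm (t *\<^sub>R x)) at_top at_top" by (simp add: mult.commute)
      qed
      from filterlim_compose[OF lim this]
      have "((\<lambda>t. ((\<Sum>k\<in>?S. F k (t *\<^sub>R x)) - (\<Sum>k\<in>?S'. F' k (t *\<^sub>R x))) / of_real (norm (t *\<^sub>R x) powr j)) \<longlongrightarrow> 0) at_top" .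
      from tendsto_mult_left_zero[OF this, of "of_real (norm x powr j)"]
      show "((\<lambda>t. (\<Sum>i\<in>?S <+> ?S'. of_real (t powr ?\<epsilon> i) * ?c i) / of_real (t powr j)) \<longlongrightarrow> 0) at_top"
      proof (rule Lim_transform_eventually)
        show "\<forall>\<^sub>F t in at_top. ((\<Sum>k\<in>?S. F k (t *\<^sub>R x)) - (\<Sum>k\<in>?S'. F' k (t *\<^sub>R x))) / of_real (norm (t *\<^sub>R x) powr j) * of_real (norm x powr j)
          = (\<Sum>i\<in>?S <+> ?S'. of_real (t powr ?\<epsilon> i) * ?c i) / of_real (t powr j)"
          using eventually_ge_at_top[of "1::real"]
        proof eventually_elim
          case (elim t)
          have "norm (t *\<^sub>R x) powr j = t powr j * norm x powr j" using elim by (simp add: powr_mult)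
          moreover have "norm x powr j \<noteq> 0" using x0 by simp
          ultimately show ?case unfolding sum_eq[OF elim] by simp
        qed
      qed
    qed
    then show ?thesis using fin by (simp add: sum.Plus sum_negf)
  qed
  then show ?thesis by blast
qed

section \<open>Compactly supported changes and decaying remainders\<close>

context regular_polytope
begin

lemma outside_dilated:
  obtains \<rho> where "\<rho> > 0" "\<And>N x i. N \<ge> 1 \<Longrightarrow> norm x \<le> \<rho> * real N \<Longrightarrow> \<bar>x \<bullet> u i\<bar> \<le> real N / 2"
proof -
  obtain \<rho> where \<rho>: "\<rho> > 0" "\<And>x i. norm x \<le> \<rho> \<Longrightarrow> \<bar>x \<bullet> u i\<bar> \<le> 1 / 2" using inner_radius by blast
  have "\<bar>x \<bullet> u i\<bar> \<le> real N / 2" if "N \<ge> 1" "norm x \<le> \<rho> * real N" for N x i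
  proof -
    have "norm ((1 / real N) *\<^sub>R x) \<le> \<rho>" using that by (simp add: field_simps)
    from \<rho>(2)[OF this, of i] show ?thesis using that by (simp add: field_simps)
  qed
  then show ?thesis using that \<rho>(1) by blast
qed

text \<open>The difference has bounded support, which for large \<open>N\<close> lies well inside
  the dilated polytope.\<close>

lemma h_deriv_eventually_eq:
  assumes "smooth \<phi>" "smooth \<phi>'" "\<And>x. R \<le> norm x \<Longrightarrow> \<phi> x = \<phi>' x" "multi_order \<gamma> > 0"
  shows "eventually (\<lambda>N. h_deriv \<gamma> N \<phi> = h_deriv \<gamma> N \<phi>') sequentially"
proof -
  obtain \<rho> where \<rho>: "\<rho> > 0" "\<And>N x i. N \<ge> 1 \<Longrightarrow> norm x \<le> \<rho> * real N \<Longrightarrow> \<bar>x \<bullet> u i\<bar> \<le> real N / 2"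
    using outside_dilated by blast
  obtain N0 :: nat where N0: "R / \<rho> \<le> real N0" using real_arch_simple by blast
  show ?thesis unfolding eventually_sequentially
  proof (intro exI[of _ "max N0 1"] allI impI)
    fix N assume N: "max N0 1 \<le> N"
    have N1: "N \<ge> 1" using N by simp
    have sm: "smooth (\<lambda>x. \<phi> x - \<phi>' x)" by (intro smooth_diff assms)
    have "\<bar>x \<bullet> u i\<bar> \<le> real N / 2" if "\<phi> x - \<phi>' x \<noteq> 0" for x i
    proof (rule \<rho>(2)[OF N1])
      have "norm x < R" using assms(3)[of x] that by (cases "R \<le> norm x") auto
      also have "R \<le> \<rho> * real N0" using N0 \<rho>(1) by (simp add: field_simps)
      also have "\<dots> \<le> \<rho> * real N" using N \<rho>(1) by simp
      finally show "norm x \<le> \<rho> * real N" by simp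
    qed
    then have "h_deriv \<gamma> N (\<lambda>x. \<phi> x - \<phi>' x) = 0" by (rule h_deriv_inner_support[OF sm _ N1 assms(4)])
    moreover have "h_deriv \<gamma> N (\<lambda>x. (\<phi> x - \<phi>' x) + \<phi>' x) = h_deriv \<gamma> N (\<lambda>x. \<phi> x - \<phi>' x) + h_deriv \<gamma> N \<phi>'"
      by (rule h_deriv_add(1)[OF sm assms(2) N1])
    ultimately show "h_deriv \<gamma> N \<phi> = h_deriv \<gamma> N \<phi>'" by simp
  qed
qed

text \<open>Between levels \<open>N\<close> and \<open>p * N\<close>, sum and integral change only
  by contributions from points of norm above \<open>\<rho> * N\<close>. There \<open>q\<close> is of
  size \<open>N powr j\<close>, and the region has size of order \<open>N ^ CARD('n)\<close>; then
  \<open>dilation_limit\<close> applies.\<close>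

lemma remainder_rate:
  assumes q: "smooth q" "\<And>x. R \<le> norm x \<Longrightarrow> norm (q x) \<le> C0 * norm x powr j" and j: "j + real CARD('n) < 0"
  shows "\<exists>L C N0. \<forall>N\<ge>N0. norm (lattice_sum \<Delta> N q - polytope_integral u a (real N) 0 q - L) \<le> C * real N powr (j + real CARD('n))"
proof -
  obtain \<rho> where \<rho>: "\<rho> > 0" "\<And>N x i. N \<ge> 1 \<Longrightarrow> norm x \<le> \<rho> * real N \<Longrightarrow> \<bar>x \<bullet> u i\<bar> \<le> real N / 2"
    using outside_dilated by blast
  obtain B where B: "B > 0" "\<And>x. x \<in> \<Delta> \<Longrightarrow> norm x \<le> B"
    using compact_imp_bounded[OF compact] bounded_pos by blast
  obtain N0' :: nat where N0': "R / \<rho> \<le> real N0'" using real_arch_simple by blast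
  define N0 where "N0 = max N0' 1"
  \<comment> \<open>As \<open>j \<le> 0\<close>, the decay bound at norm above
    \<open>\<rho> * N\<close> is at most its value at \<open>\<rho> * N\<close>.\<close>
  define C1 where "C1 = \<bar>C0\<bar> * \<rho> powr j"
  have C1: "C1 \<ge> 0" by (simp add: C1_def)
  have jneg: "j \<le> 0" using j by simp
  have small: "norm (q x) \<le> C1 * real N powr j" if N: "N \<ge> N0" and x: "(1 / real N) *\<^sub>R x \<notin> \<Delta>" for N x
  proof -
    have N1: "N \<ge> 1" using N by (simp add: N0_def)
    have "\<not> norm x \<le> \<rho> * real N"
    proof
      assume "norm x \<le> \<rho> * real N"
      then have "\<bar>x \<bullet> u i\<bar> \<le> real N / 2" for i using \<rho>(2)[OF N1] by blast
      then have "0 \<le> x \<bullet> u i + real N * of_int (a i) + (0::real^'m) $ i" for i using N1 by (intro inner_support_member) auto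
      then show False using x unfolding scaled_mem_polytope[OF N1] by simp
    qed
    then have lt: "\<rho> * real N < norm x" by simp
    have "R \<le> \<rho> * real N0'" using N0' \<rho>(1) by (simp add: field_simps)
    also have "\<dots> \<le> \<rho> * real N" using N \<rho>(1) by (simp add: N0_def)
    finally have "R \<le> norm x" using lt by simp
    then have "norm (q x) \<le> C0 * norm x powr j" by (rule q(2))
    also have "\<dots> \<le> \<bar>C0\<bar> * norm x powr j" by (intro mult_right_mono) auto
    also have "\<dots> \<le> \<bar>C0\<bar> * (\<rho> * real N) powr j"
      using lt \<rho>(1) N1 jneg by (intro mult_left_mono powr_mono2') auto
    also have "\<dots> = C1 * real N powr j" using \<rho>(1) by (simp add: C1_def powr_mult)
    finally show ?thesis .
  qed
  define c where "c N = lattice_sum \<Delta> N q - polytope_integral u a (real N) 0 q" for N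
  have "\<exists>L C N0. \<forall>N\<ge>N0. norm (c N - L) \<le> C * real N powr (- (- (j + real CARD('n))))"
  proof (rule dilation_limit)
    show "0 < - (j + real CARD('n))" using j by simp
    fix p :: nat assume p: "p \<ge> 1"
    \<comment> \<open>The first summand counts lattice points in a cube of half side
      \<open>p * N * B\<close> containing the region, the second is the volume of that cube, with
      the power of \<open>N\<close> taken out.\<close>
    define A where "A = (2 * (real p * B) + 1) ^ CARD('n) * C1 + (2 * (real p * B)) ^ CARD('n) * C1"
    show "\<exists>C N0. \<forall>N\<ge>N0. norm (c (p * N) - c N) \<le> C * real N powr (- (- (j + real CARD('n))))"
    proof (intro exI[of _ A] exI[of _ N0] allI impI)
      fix N assume N: "N0 \<le> N"
      let ?K = "p * N"
      have N1: "N \<ge> 1" using N by (simp add: N0_def)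
      have NK: "N \<le> ?K" using p by simp
      then have K1: "?K \<ge> 1" using N1 by linarith
      define K where "K = real ?K * B"
      have K: "K \<ge> 0" using B by (simp add: K_def)
      have pwN: "real N ^ CARD('n) * real N powr j = real N powr (j + real CARD('n))"
      proof -
        have "real N ^ CARD('n) = real N powr real CARD('n)" using N1 by (simp only: powr_realpow of_nat_0_less_iff less_eq_Suc_le One_nat_def)
        then show ?thesis by (simp only: powr_add mult.commute)
      qed
      have sub: "(1 / real ?K) *\<^sub>R x \<in> \<Delta>" if "(1 / real N) *\<^sub>R x \<in> \<Delta>" for x
      proof -
        have "real N * of_int (a i) \<le> real ?K * of_int (a i)" for i
          using NK offsets_pos[rule_format, of i] by (intro mult_right_mono) (simp_all only: of_nat_le_iff of_int_0_le_iff less_imp_le)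
        moreover have "0 \<le> x \<bullet> u i + real N * of_int (a i)" for i using that unfolding scaled_mem_polytope[OF N1] by blast
        ultimately show ?thesis unfolding scaled_mem_polytope[OF K1] by (meson add_left_mono order.trans)
      qed
      have comp: "\<bar>x $ i\<bar> \<le> K" if "(1 / real ?K) *\<^sub>R x \<in> \<Delta>" for x i
      proof -
        have "norm ((1 / real ?K) *\<^sub>R x) \<le> B" by (rule B(2)[OF that])
        then have "norm x \<le> K" using K1 by (simp add: K_def field_simps)
        then show ?thesis using component_le_norm_cart[of x i] by linarith
      qed
      let ?L = "\<lambda>N. {l. l \<in> int_lattice \<and> (1 / real N) *\<^sub>R l \<in> \<Delta>}"
      have sum1: "norm (lattice_sum \<Delta> ?K q - lattice_sum \<Delta> N q) \<le> (2 * (real p * B) + 1) ^ CARD('n) * C1 * real N powr (j + real CARD('n))"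
      proof -
        have "lattice_sum \<Delta> ?K q - lattice_sum \<Delta> N q = (\<Sum>l\<in>?L ?K - ?L N. q l)"
          unfolding lattice_sum_eq[OF K1] lattice_sum_eq[OF N1]
          using sub by (intro sum_diff[symmetric] dilated_lattice_points(2)[OF K1]) blast
        also have "norm \<dots> \<le> (\<Sum>l\<in>?L ?K - ?L N. C1 * real N powr j)"
          using small[OF N] by (intro sum_norm_le) blast
        also have "\<dots> = real (card (?L ?K - ?L N)) * (C1 * real N powr j)" by simp
        also have "\<dots> \<le> (2 * K + 1) ^ CARD('n) * (C1 * real N powr j)"
        proof (rule mult_right_mono)
          have "?L ?K - ?L N \<subseteq> {l \<in> int_lattice. \<forall>i. \<bar>l $ i\<bar> \<le> K}" using comp by blast
          then have "card (?L ?K - ?L N) \<le> card {l \<in> int_lattice. \<forall>i. \<bar>(l::real^'n) $ i\<bar> \<le> K}" by (intro card_mono finite_lattice_box)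
          then show "real (card (?L ?K - ?L N)) \<le> (2 * K + 1) ^ CARD('n)" using card_lattice_box[OF K, where 'n = 'n] by linarith
        qed (use C1 in simp)
        also have "\<dots> \<le> ((2 * (real p * B) + 1) * real N) ^ CARD('n) * (C1 * real N powr j)"
        proof (intro mult_right_mono power_mono)
          have "1 \<le> real N" using N1 by simp
          then show "2 * K + 1 \<le> (2 * (real p * B) + 1) * real N" by (simp add: K_def algebra_simps)
        qed (use C1 K in auto)
        also have "\<dots> = (2 * (real p * B) + 1) ^ CARD('n) * C1 * (real N ^ CARD('n) * real N powr j)"
          by (simp add: power_mult_distrib mult_ac)
        finally show ?thesis unfolding pwN .
      qed
      have sum2: "norm (polytope_integral u a (real ?K) 0 q - polytope_integral u a (real N) 0 q) \<le> (2 * (real p * B)) ^ CARD('n) * C1 * real N powr (j + real CARD('n))"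
      proof -
        obtain J J' where J: "local_integral ?K q J" "local_integral N q J'" using local_integral_exists[OF q(1)] K1 N1 by metis
        have mem: "x \<in> shifted_polytope u a (real M) 0 \<longleftrightarrow> (1 / real M) *\<^sub>R x \<in> \<Delta>" if "M \<ge> 1" for M x
          unfolding scaled_mem_polytope[OF that] shifted_polytope_def by simp
        let ?f = "\<lambda>x. if (1 / real ?K) *\<^sub>R x \<in> \<Delta> \<and> (1 / real N) *\<^sub>R x \<notin> \<Delta> then q x else 0"
        let ?b = "(\<chi> i. K) :: real^'n"
        have "((\<lambda>x. (if x \<in> shifted_polytope u a (real ?K) 0 then q x else 0) - (if x \<in> shifted_polytope u a (real N) 0 then q x else 0)) has_integral (J 0 - J' 0)) UNIV"
          by (intro has_integral_diff) (simp_all only: has_integral_restrict_UNIV local_integralD(3)[OF J(1)] local_integralD(3)[OF J(2)])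
        also have "(\<lambda>x. (if x \<in> shifted_polytope u a (real ?K) 0 then q x else 0) - (if x \<in> shifted_polytope u a (real N) 0 then q x else 0))
          = (\<lambda>x. if x \<in> cbox (- ?b) ?b then ?f x else 0)"
        proof
          fix x
          have "x \<in> cbox (- ?b) ?b" if "(1 / real ?K) *\<^sub>R x \<in> \<Delta>"
            using comp[OF that] by (auto simp: mem_box_cart abs_le_iff minus_le_iff)
          then show "(if x \<in> shifted_polytope u a (real ?K) 0 then q x else 0) - (if x \<in> shifted_polytope u a (real N) 0 then q x else 0)
            = (if x \<in> cbox (- ?b) ?b then ?f x else 0)"
            unfolding mem[OF K1] mem[OF N1] using sub by auto
        qed
        finally have "(?f has_integral (J 0 - J' 0)) (cbox (- ?b) ?b)" by (simp only: has_integral_restrict_UNIV)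
        then have "norm (J 0 - J' 0) \<le> C1 * real N powr j * measure lborel (cbox (- ?b) ?b)"
          by (rule has_integral_bound[rotated]) (use C1 small[OF N] in auto)
        also have "measure lborel (cbox (- ?b) ?b) = (2 * K) ^ CARD('n)"
        proof -
          have ne: "cbox (- ?b) ?b \<noteq> {}" using K by (auto simp: interval_ne_empty_cart)
          show ?thesis unfolding content_cbox_cart[OF ne] by simp
        qed
        also have "C1 * real N powr j * (2 * K) ^ CARD('n) = (2 * (real p * B)) ^ CARD('n) * C1 * (real N ^ CARD('n) * real N powr j)"
          by (simp add: K_def power_mult_distrib mult_ac)
        finally show ?thesis unfolding pwN local_integralD(2)[OF J(1)] local_integralD(2)[OF J(2)] .
      qed
      have "c ?K - c N = (lattice_sum \<Delta> ?K q - lattice_sum \<Delta> N q) - (polytope_integral u a (real ?K) 0 q - polytope_integral u a (real N) 0 q)"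
        by (simp add: c_def)
      then have "norm (c ?K - c N) \<le> (2 * (real p * B) + 1) ^ CARD('n) * C1 * real N powr (j + real CARD('n)) + (2 * (real p * B)) ^ CARD('n) * C1 * real N powr (j + real CARD('n))"
        by (simp only:) (rule order.trans[OF norm_triangle_ineq4 add_mono[OF sum1 sum2]])
      then show "norm (c ?K - c N) \<le> A * real N powr (- (- (j + real CARD('n))))"
        by (simp only: A_def distrib_right minus_minus)
    qed
  qed
  then show ?thesis unfolding c_def minus_minus .
qed

end

section \<open>Convergence rates and expansions in powers of N\<close>

definition converges_at_rate :: "real \<Rightarrow> (nat \<Rightarrow> complex) \<Rightarrow> bool" where
  "converges_at_rate s g \<longleftrightarrow> (\<exists>L C N0. \<forall>N\<ge>N0. norm (g N - L) \<le> C * real N powr s)"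

lemma converges_at_rate_mono:
  assumes "converges_at_rate s g" "s \<le> s'"
  shows "converges_at_rate s' g"
proof -
  obtain L C N0 where *: "\<And>N. N \<ge> N0 \<Longrightarrow> norm (g N - L) \<le> C * real N powr s"
    using assms(1) unfolding converges_at_rate_def by blast
  have "norm (g N - L) \<le> \<bar>C\<bar> * real N powr s'" if "N \<ge> max N0 1" for N
  proof -
    have "norm (g N - L) \<le> C * real N powr s" using that by (intro *) simp
    also have "\<dots> \<le> \<bar>C\<bar> * real N powr s" by (intro mult_right_mono) auto
    also have "\<dots> \<le> \<bar>C\<bar> * real N powr s'" using that assms(2) by (intro mult_left_mono powr_mono) auto
    finally show ?thesis .
  qed
  then show ?thesis unfolding converges_at_rate_def by blast
qed

lemma converges_at_rate_add:
  assumes "converges_at_rate s g" "converges_at_rate s h"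
  shows "converges_at_rate s (\<lambda>N. g N + h N)"
proof -
  obtain L C N0 where 1: "\<And>N. N \<ge> N0 \<Longrightarrow> norm (g N - L) \<le> C * real N powr s"
    using assms(1) unfolding converges_at_rate_def by blast
  obtain L' C' N0' where 2: "\<And>N. N \<ge> N0' \<Longrightarrow> norm (h N - L') \<le> C' * real N powr s"
    using assms(2) unfolding converges_at_rate_def by blast
  have "norm (g N + h N - (L + L')) \<le> (C + C') * real N powr s" if "N \<ge> max N0 N0'" for N
  proof -
    have "norm (g N + h N - (L + L')) \<le> norm (g N - L) + norm (h N - L')" by (rule norm_diff_triangle_ineq)
    also have "\<dots> \<le> C * real N powr s + C' * real N powr s" using that by (intro add_mono 1 2) auto
    finally show ?thesis by (simp add: distrib_right)
  qed
  then show ?thesis unfolding converges_at_rate_def by blast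
qed

lemma converges_at_rate_sum:
  assumes "finite S" "\<And>k. k \<in> S \<Longrightarrow> converges_at_rate s (g k)"
  shows "converges_at_rate s (\<lambda>N. \<Sum>k\<in>S. g k N)"
  using assms
proof (induction S rule: finite_induct)
  case empty
  have "\<forall>N\<ge>0. norm ((\<Sum>k\<in>{}. g k N) - 0) \<le> 0 * real N powr s" by simp
  then show ?case unfolding converges_at_rate_def by blast
next
  case (insert k S)
  have "converges_at_rate s (\<lambda>N. g k N + (\<Sum>k\<in>S. g k N))"
    using insert by (intro converges_at_rate_add) auto
  then show ?case using insert.hyps by simp
qed

lemma converges_at_rate_cong:
  assumes "converges_at_rate s g" "eventually (\<lambda>N. g N = h N) sequentially"
  shows "converges_at_rate s h"
proof -
  obtain L C N0 where 1: "\<And>N. N \<ge> N0 \<Longrightarrow> norm (g N - L) \<le> C * real N powr s"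
    using assms(1) unfolding converges_at_rate_def by blast
  obtain N1 where 2: "\<And>N. N \<ge> N1 \<Longrightarrow> g N = h N" using assms(2) unfolding eventually_sequentially by blast
  have "norm (h N - L) \<le> C * real N powr s" if "N \<ge> max N0 N1" for N
    using 1[of N] 2[of N] that by simp
  then show ?thesis unfolding converges_at_rate_def by blast
qed

text \<open>Indexed by an arbitrary type because different pairs of component and multi-index can
  give the same exponent.\<close>

definition power_partial_sum :: "('i \<Rightarrow> real) \<Rightarrow> ('i \<Rightarrow> complex) \<Rightarrow> real \<Rightarrow> real \<Rightarrow> complex" where
  "power_partial_sum \<epsilon> c K t = (\<Sum>i | K \<le> \<epsilon> i. of_real (t powr \<epsilon> i) * c i)"

lemma power_partial_sum_diff:
  assumes fin: "\<And>K. finite {i. K \<le> \<epsilon> i}" and K: "K' \<le> K"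
  shows "power_partial_sum \<epsilon> c K' t - power_partial_sum \<epsilon> c K t = (\<Sum>i | K' \<le> \<epsilon> i \<and> \<epsilon> i < K. of_real (t powr \<epsilon> i) * c i)"
proof -
  have "power_partial_sum \<epsilon> c K' t - power_partial_sum \<epsilon> c K t = (\<Sum>i\<in>{i. K' \<le> \<epsilon> i} - {i. K \<le> \<epsilon> i}. of_real (t powr \<epsilon> i) * c i)"
    unfolding power_partial_sum_def using K by (intro sum_diff[symmetric] fin) auto
  also have "{i. K' \<le> \<epsilon> i} - {i. K \<le> \<epsilon> i} = {i. K' \<le> \<epsilon> i \<and> \<epsilon> i < K}" by auto
  finally show ?thesis .
qed

lemma power_partial_sum_smallo:
  assumes fin: "\<And>K. finite {i. K \<le> \<epsilon> i}" and K: "K' \<le> K"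
  shows "(\<lambda>N. power_partial_sum \<epsilon> c K' (real N) - power_partial_sum \<epsilon> c K (real N)) \<in> o[sequentially](\<lambda>N. of_real (real N powr K))"
  unfolding power_partial_sum_diff[OF fin K]
proof (rule big_sum_in_smallo)
  fix i assume "i \<in> {i. K' \<le> \<epsilon> i \<and> \<epsilon> i < K}"
  then have "\<epsilon> i < K" by simp
  then show "(\<lambda>N. of_real (real N powr \<epsilon> i) * c i) \<in> o[sequentially](\<lambda>N. of_real (real N powr K))"
    by (rule rate_smallo[where ?N0.0 = 0 and C = "norm (c i)"]) (simp add: norm_mult)
qed

text \<open>Each negative threshold yields its own constant. They all agree, because each is the
  limit of \<open>g\<close> minus its partial sum at threshold 0.\<close>

lemma power_expansion_constant:
  assumes fin: "\<And>K. finite {i. K \<le> \<epsilon> i}"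
    and rate: "\<And>K. K < 0 \<Longrightarrow> converges_at_rate K (\<lambda>N. g N - power_partial_sum \<epsilon> c K (real N))"
  shows "\<exists>C. \<forall>K. (\<lambda>N. g N - (power_partial_sum \<epsilon> c K (real N) + C)) \<in> o[sequentially](\<lambda>N. of_real (real N powr K))"
proof -
  let ?P = "\<lambda>K N. power_partial_sum \<epsilon> c K (real N)"
  have "\<exists>L. \<forall>K'>K. (\<lambda>N. g N - (?P K' N + L)) \<in> o[sequentially](\<lambda>N. of_real (real N powr K'))" if K0: "K < 0" for K
  proof -
    obtain L C N0 where L: "\<And>N. N \<ge> N0 \<Longrightarrow> norm (g N - ?P K N - L) \<le> C * real N powr K"
      using rate[OF K0] unfolding converges_at_rate_def by blast
    have "(\<lambda>N. g N - (?P K' N + L)) \<in> o[sequentially](\<lambda>N. of_real (real N powr K'))" if "K < K'" for K'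
    proof -
      have "(\<lambda>N. (g N - ?P K N - L) + (?P K N - ?P K' N)) \<in> o[sequentially](\<lambda>N. of_real (real N powr K'))"
        using that by (intro sum_in_smallo(1) rate_smallo[OF that L] power_partial_sum_smallo fin) auto
      then show ?thesis by (simp add: algebra_simps)
    qed
    then show ?thesis by blast
  qed
  then obtain L where L: "\<And>K K'. K < 0 \<Longrightarrow> K < K' \<Longrightarrow> (\<lambda>N. g N - (?P K' N + L K)) \<in> o[sequentially](\<lambda>N. of_real (real N powr K'))"
    by metis
  have lim: "(\<lambda>N. g N - ?P 0 N) \<longlonglongrightarrow> L K" if "K < 0" for K
  proof -
    have "(\<lambda>N. (g N - (?P 0 N + L K)) / of_real (real N powr 0)) \<longlonglongrightarrow> 0" using L[OF that that] by (rule smalloD_tendsto)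
    then have "(\<lambda>N. (g N - (?P 0 N + L K)) / of_real (real N powr 0) + L K) \<longlonglongrightarrow> 0 + L K" by (intro tendsto_add tendsto_const)
    then have "(\<lambda>N. (g N - (?P 0 N + L K)) / of_real (real N powr 0) + L K) \<longlonglongrightarrow> L K" by simp
    then show ?thesis
      by (rule Lim_transform_eventually) (use eventually_gt_at_top[of 0] in eventually_elim, simp)
  qed
  have "(\<lambda>N. g N - (?P K N + L (- 1))) \<in> o[sequentially](\<lambda>N. of_real (real N powr K))" for K
  proof -
    \<comment> \<open>A threshold that is negative and strictly below \<open>K\<close>, so that a
      bound of order \<open>O\<close> there is of order \<open>o\<close> at
      \<open>K\<close>.\<close>
    have K: "min (K - 1) (- 1) < 0" "min (K - 1) (- 1) < K" by auto
    have "L (min (K - 1) (- 1)) = L (- 1)" by (rule LIMSEQ_unique[OF lim lim]) auto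
    then show ?thesis using L[OF K] by simp
  qed
  then show ?thesis by blast
qed

section \<open>The Todd expansion and the uniqueness of its constant\<close>

context regular_polytope
begin

text \<open>Component by component, the cut at \<open>K\<close> is a truncation by total order, with
  a truncation order that depends on the degree \<open>e k\<close>. This matches the form of
  \<open>em_defect\<close>.\<close>

lemma todd_terms_eq:
  "todd_terms TYPE('n) e K = Sigma {k. K - real CARD('n) \<le> e k} (\<lambda>k. {\<gamma>::'m \<Rightarrow> nat. multi_order \<gamma> \<le> nat \<lfloor>e k + real CARD('n) - K\<rfloor>})"
proof -
  have "K \<le> e k + real CARD('n) - real m \<longleftrightarrow> K - real CARD('n) \<le> e k \<and> m \<le> nat \<lfloor>e k + real CARD('n) - K\<rfloor>" for k m
  proof
    assume *: "K \<le> e k + real CARD('n) - real m"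
    then have "real m \<le> e k + real CARD('n) - K" by simp
    then have "m \<le> nat \<lfloor>e k + real CARD('n) - K\<rfloor>" by (rule le_nat_floor)
    then show "K - real CARD('n) \<le> e k \<and> m \<le> nat \<lfloor>e k + real CARD('n) - K\<rfloor>" using * by simp
  next
    assume *: "K - real CARD('n) \<le> e k \<and> m \<le> nat \<lfloor>e k + real CARD('n) - K\<rfloor>"
    then have "real m \<le> real (nat \<lfloor>e k + real CARD('n) - K\<rfloor>)" unfolding of_nat_le_iff by blast
    also have "\<dots> \<le> e k + real CARD('n) - K" using * by (intro of_nat_floor) simp
    finally show "K \<le> e k + real CARD('n) - real m" by simp
  qed
  then show ?thesis unfolding todd_terms_def by (simp only: Sigma_def) blast
qed

lemma finite_todd_terms:
  assumes "polyhomogeneous_expansion r f e F"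
  shows "finite (todd_terms TYPE('n) e K :: (nat \<times> ('m \<Rightarrow> nat)) set)"
  unfolding todd_terms_eq by (intro finite_SigmaI expansion_finite[OF assms] finite_multi_order_le)

text \<open>Linearity: \<open>f\<close> is split into the components of degree at least
  \<open>K - n\<close> and a remainder, and each component takes the Todd terms that belong to
  it.\<close>

lemma todd_partial_sum_defect:
  fixes f :: "real^'n \<Rightarrow> complex" and K :: real
  assumes f: "smooth f" and E: "polyhomogeneous_expansion r f e F" and N: "N \<ge> 1"
  defines "S \<equiv> {k. K - real CARD('n) \<le> e k}"
  defines "q \<equiv> (\<lambda>x. f x - (\<Sum>k\<in>S. F k x))"
  shows "lattice_sum \<Delta> N f - polytope_integral u a (real N) 0 f - todd_partial_sum u a e F K N =
    (lattice_sum \<Delta> N q - polytope_integral u a (real N) 0 q) + (\<Sum>k\<in>S. em_defect (nat \<lfloor>e k + real CARD('n) - K\<rfloor>) N (F k))"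
proof -
  have fin: "finite S" unfolding S_def by (rule expansion_finite[OF E])
  have smF: "smooth (F k)" for k by (rule expansion_component[OF E])
  have smS: "smooth (\<lambda>x. \<Sum>k\<in>S. F k x)" using fin by (intro smooth_sum smF)
  have smq: "smooth q" unfolding q_def by (intro smooth_diff f smS)
  have "lattice_sum \<Delta> N q = lattice_sum \<Delta> N f - (\<Sum>k\<in>S. lattice_sum \<Delta> N (F k))"
    unfolding lattice_sum_def q_def sum_subtractf by (simp add: sum.swap[of _ S])
  moreover have "polytope_integral u a (real N) 0 (\<lambda>x. q x + (\<Sum>k\<in>S. F k x)) = polytope_integral u a (real N) 0 q + polytope_integral u a (real N) 0 (\<lambda>x. \<Sum>k\<in>S. F k x)"
    by (rule h_deriv_add(2)[OF smq smS N])
  then have "polytope_integral u a (real N) 0 f = polytope_integral u a (real N) 0 q + (\<Sum>k\<in>S. polytope_integral u a (real N) 0 (F k))"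
    unfolding h_deriv_sum(2)[OF fin smF N] by (simp add: q_def)
  moreover have "todd_partial_sum u a e F K N = (\<Sum>k\<in>S. \<Sum>\<gamma> | multi_order \<gamma> \<le> nat \<lfloor>e k + real CARD('n) - K\<rfloor>. of_real (todd_minus_id_coeff \<gamma>) * h_deriv \<gamma> N (F k))"
    unfolding todd_partial_sum_def todd_terms_eq S_def
    by (subst sum.Sigma) (auto intro!: expansion_finite[OF E] finite_multi_order_le)
  ultimately show ?thesis unfolding em_defect_def by (simp add: sum_subtractf)
qed

text \<open>The remainder is \<open>o\<close> of \<open>norm x\<close> to the power
  \<open>K - n\<close>, which is summable enough for the rate \<open>K\<close>; the finitely many
  components are covered by \<open>homogeneous_em_defect\<close>.\<close>

lemma todd_partial_sum_rate:
  fixes f :: "real^'n \<Rightarrow> complex"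
  assumes f: "smooth f" and E: "polyhomogeneous_expansion r f e F" and K: "K < 0"
  shows "converges_at_rate K (\<lambda>N. lattice_sum \<Delta> N f - polytope_integral u a (real N) 0 f - todd_partial_sum u a e F K N)"
proof -
  define S where "S = {k. K - real CARD('n) \<le> e k}"
  define q where "q = (\<lambda>x. f x - (\<Sum>k\<in>S. F k x))"
  have fin: "finite S" unfolding S_def by (rule expansion_finite[OF E])
  have smF: "smooth (F k)" for k by (rule expansion_component[OF E])
  have smq: "smooth q" unfolding q_def using fin by (intro smooth_diff f smooth_sum smF)
  have "q \<in> o[at_infinity](\<lambda>x. of_real (norm x powr (K - real CARD('n))))"
    unfolding q_def S_def by (rule expansion_remainder[OF E])
  then have "eventually (\<lambda>x. norm (q x) \<le> 1 * norm (complex_of_real (norm x powr (K - real CARD('n))))) at_infinity"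
    by (rule landau_o.smallD) simp
  then obtain R where "\<And>x. R \<le> norm x \<Longrightarrow> norm (q x) \<le> 1 * norm x powr (K - real CARD('n))"
    unfolding eventually_at_infinity by auto
  from remainder_rate[OF smq this] K
  have 1: "converges_at_rate K (\<lambda>N. lattice_sum \<Delta> N q - polytope_integral u a (real N) 0 q)"
    unfolding converges_at_rate_def by simp
  have 2: "converges_at_rate K (\<lambda>N. em_defect (nat \<lfloor>e k + real CARD('n) - K\<rfloor>) N (F k))" if "k \<in> S" for k
  proof -
    obtain R where R: "\<And>x t. R \<le> norm x \<Longrightarrow> 1 \<le> t \<Longrightarrow> F k (t *\<^sub>R x) = of_real (t powr e k) * F k x"
      using expansion_component(2)[OF E] by blast
    have "0 \<le> e k + real CARD('n) - K" using that by (simp add: S_def)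
    \<comment> \<open>The floor plus one exceeds \<open>e k + n - K\<close>, so the first omitted
      order lies strictly below \<open>K\<close>.\<close>
    then have less: "e k + real CARD('n) - real (nat \<lfloor>e k + real CARD('n) - K\<rfloor> + 1) < K" by linarith
    then have "e k + real CARD('n) - real (nat \<lfloor>e k + real CARD('n) - K\<rfloor> + 1) < 0" using K by linarith
    from homogeneous_em_defect[OF smF R this]
    have "converges_at_rate (e k + real CARD('n) - real (nat \<lfloor>e k + real CARD('n) - K\<rfloor> + 1)) (\<lambda>N. em_defect (nat \<lfloor>e k + real CARD('n) - K\<rfloor>) N (F k))"
      unfolding converges_at_rate_def .
    then show ?thesis by (rule converges_at_rate_mono) (use less in simp)
  qed
  have "converges_at_rate K (\<lambda>N. (lattice_sum \<Delta> N q - polytope_integral u a (real N) 0 q) + (\<Sum>k\<in>S. em_defect (nat \<lfloor>e k + real CARD('n) - K\<rfloor>) N (F k)))"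
    by (intro converges_at_rate_add 1 converges_at_rate_sum fin 2)
  then show ?thesis
    by (rule converges_at_rate_cong)
      (use eventually_ge_at_top[of 1] in eventually_elim, simp only: todd_partial_sum_defect[OF f E] q_def S_def)
qed

text \<open>Every component has its own threshold beyond which its shift derivatives are exact
  powers. For fixed \<open>K\<close> only finitely many components enter, hence equality for all
  large \<open>N\<close>.\<close>

lemma todd_terms_power:
  fixes f :: "real^'n \<Rightarrow> complex"
  assumes E: "polyhomogeneous_expansion r f e F"
  shows "\<exists>c. \<forall>K. eventually (\<lambda>N. todd_partial_sum u a e F K N =
    power_partial_sum (\<lambda>(k, \<gamma>::'m \<Rightarrow> nat). e k + real CARD('n) - real (multi_order \<gamma>)) c K (real N)) sequentially"
proof -
  have "\<exists>c N0. \<forall>N\<ge>N0. \<forall>\<gamma>. multi_order \<gamma> > 0 \<longrightarrow>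
     h_deriv \<gamma> N (F k) = of_real (real N powr (e k + real CARD('n) - real (multi_order \<gamma>))) * c \<gamma>" for k
    using homogeneous_h_deriv[OF expansion_component(1)[OF E]] expansion_component(2)[OF E, of k] by blast
  then obtain c N0 where c: "\<And>k N \<gamma>. N \<ge> N0 k \<Longrightarrow> multi_order \<gamma> > 0 \<Longrightarrow>
     h_deriv \<gamma> N (F k) = of_real (real N powr (e k + real CARD('n) - real (multi_order \<gamma>))) * c k \<gamma>"
    by metis
  define d where "d = (\<lambda>(k, \<gamma>). complex_of_real (todd_minus_id_coeff \<gamma>) * c k \<gamma>)"
  have "eventually (\<lambda>N. todd_partial_sum u a e F K N =
    power_partial_sum (\<lambda>(k, \<gamma>::'m \<Rightarrow> nat). e k + real CARD('n) - real (multi_order \<gamma>)) d K (real N)) sequentially" for K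
  proof -
    have "eventually (\<lambda>N. \<forall>k\<in>{k. K - real CARD('n) \<le> e k}. N0 k \<le> N) sequentially"
      by (intro eventually_ball_finite expansion_finite[OF E] ballI eventually_ge_at_top)
    then show ?thesis
    proof eventually_elim
      case (elim N)
      have set_eq: "{i. K \<le> (case i of (k, \<gamma>::'m \<Rightarrow> nat) \<Rightarrow> e k + real CARD('n) - real (multi_order \<gamma>))} = todd_terms TYPE('n) e K"
        unfolding todd_terms_def by auto
      show ?case unfolding todd_partial_sum_def power_partial_sum_def set_eq
      proof (intro sum.cong refl, clarify)
        fix k and \<gamma> :: "'m \<Rightarrow> nat" assume mem: "(k, \<gamma>) \<in> todd_terms TYPE('n) e K"
        then have k: "K - real CARD('n) \<le> e k" unfolding todd_terms_eq by simp
        show "of_real (todd_minus_id_coeff \<gamma>) * h_deriv \<gamma> N (F k) =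
          of_real (real N powr (e k + real CARD('n) - real (multi_order \<gamma>))) * d (k, \<gamma>)"
        proof (cases "multi_order \<gamma> = 0")
          case True
          then show ?thesis by (simp only: d_def todd_minus_id_coeff_eq) simp
        next
          case False
          have "N \<ge> N0 k" using elim k by blast
          from c[OF this, of \<gamma>] False show ?thesis by (simp add: d_def mult_ac)
        qed
      qed
    qed
  qed
  then show ?thesis by blast
qed

lemma power_expansion:
  fixes f :: "real^'n \<Rightarrow> complex"
  assumes f: "smooth f" and E: "polyhomogeneous_expansion r f e F"
  defines "g \<equiv> (\<lambda>N. lattice_sum \<Delta> N f - polytope_integral u a (real N) 0 f)"
    and "\<epsilon> \<equiv> (\<lambda>(k, \<gamma>::'m \<Rightarrow> nat). e k + real CARD('n) - real (multi_order \<gamma>))"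
  obtains c C where "\<And>K. (\<lambda>N. g N - (power_partial_sum \<epsilon> c K (real N) + C)) \<in> o[sequentially](\<lambda>N. of_real (real N powr K))"
    "\<And>K. finite {i. K \<le> \<epsilon> i}" "has_todd_expansion g u a e F C"
proof -
  obtain c where c: "\<And>K. eventually (\<lambda>N. todd_partial_sum u a e F K N = power_partial_sum \<epsilon> c K (real N)) sequentially"
    using todd_terms_power[OF E] unfolding \<epsilon>_def by blast
  have fin: "finite {i. K \<le> \<epsilon> i}" for K
  proof -
    have "{i. K \<le> \<epsilon> i} = todd_terms TYPE('n) e K" unfolding todd_terms_def \<epsilon>_def by auto
    then show ?thesis using finite_todd_terms[OF E] by simp
  qed
  have "converges_at_rate K (\<lambda>N. g N - power_partial_sum \<epsilon> c K (real N))" if "K < 0" for K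
  proof (rule converges_at_rate_cong)
    show "converges_at_rate K (\<lambda>N. g N - todd_partial_sum u a e F K N)"
      unfolding g_def by (rule todd_partial_sum_rate[OF f E that])
    show "\<forall>\<^sub>F N in sequentially. g N - todd_partial_sum u a e F K N = g N - power_partial_sum \<epsilon> c K (real N)"
      using c[of K] by eventually_elim simp
  qed
  from power_expansion_constant[of \<epsilon> g c, OF fin this] obtain C where
    C: "\<And>K. (\<lambda>N. g N - (power_partial_sum \<epsilon> c K (real N) + C)) \<in> o[sequentially](\<lambda>N. of_real (real N powr K))"
    by blast
  have "(\<lambda>N. g N - (todd_partial_sum u a e F K N + C)) \<in> o[sequentially](\<lambda>N. of_real (real N powr K))" for K
  proof -
    have "eventually (\<lambda>N. g N - (power_partial_sum \<epsilon> c K (real N) + C) = g N - (todd_partial_sum u a e F K N + C)) sequentially"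
      using c[of K] by eventually_elim simp
    from landau_o.small.in_cong[OF this] show ?thesis using C by blast
  qed
  then have "has_todd_expansion g u a e F C" unfolding has_todd_expansion_def by blast
  then show ?thesis using that C fin by blast
qed

text \<open>Summing over components first puts a truncation of the expansion under each
  \<open>\<gamma>\<close>, the form in which \<open>expansion_unique\<close> applies. The bound
  \<open>M\<close> covers all occurring orders since \<open>e 0\<close> is the largest
  exponent.\<close>

lemma todd_partial_sum_swap:
  fixes f :: "real^'n \<Rightarrow> complex"
  assumes E: "polyhomogeneous_expansion r f e F" and N: "N \<ge> 1" and M: "e 0 + real CARD('n) \<le> real M"
  shows "todd_partial_sum u a e F 0 N = (\<Sum>\<gamma> | multi_order \<gamma> \<le> M. of_real (todd_minus_id_coeff \<gamma>) *
    h_deriv \<gamma> N (\<lambda>x. \<Sum>k\<in>{k. real (multi_order \<gamma>) - real CARD('n) \<le> e k}. F k x))"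
proof -
  let ?T = "Sigma {\<gamma>::'m \<Rightarrow> nat. multi_order \<gamma> \<le> M} (\<lambda>\<gamma>. {k. real (multi_order \<gamma>) - real CARD('n) \<le> e k})"
  have fin: "finite {k. j \<le> e k}" for j by (rule expansion_finite[OF E])
  have eq: "todd_terms TYPE('n) e 0 = prod.swap ` ?T"
  proof -
    have "multi_order \<gamma> \<le> M" if "0 \<le> e k + real CARD('n) - real (multi_order \<gamma>)" for k and \<gamma> :: "'m \<Rightarrow> nat"
    proof -
      have "real (multi_order \<gamma>) \<le> real M" using that M expansion_le_first[OF E, of k] by linarith
      then show ?thesis by (simp only: of_nat_le_iff)
    qed
    then show ?thesis unfolding todd_terms_def by (force simp: image_iff)
  qed
  have "todd_partial_sum u a e F 0 N = (\<Sum>(\<gamma>, k)\<in>?T. of_real (todd_minus_id_coeff \<gamma>) * h_deriv \<gamma> N (F k))"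
    unfolding todd_partial_sum_def eq by (subst sum.reindex) (auto intro: inj_onI simp: o_def split_beta)
  also have "\<dots> = (\<Sum>\<gamma> | multi_order \<gamma> \<le> M. \<Sum>k\<in>{k. real (multi_order \<gamma>) - real CARD('n) \<le> e k}. of_real (todd_minus_id_coeff \<gamma>) * h_deriv \<gamma> N (F k))"
    by (rule sum.Sigma[symmetric]) (auto intro!: finite_multi_order_le fin)
  also have "\<dots> = (\<Sum>\<gamma> | multi_order \<gamma> \<le> M. of_real (todd_minus_id_coeff \<gamma>) *
    h_deriv \<gamma> N (\<lambda>x. \<Sum>k\<in>{k. real (multi_order \<gamma>) - real CARD('n) \<le> e k}. F k x))"
    unfolding h_deriv_sum(1)[OF fin expansion_component(1)[OF E] N] sum_distrib_left ..
  finally show ?thesis .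
qed

text \<open>The truncations agree near infinity, and shift derivatives of positive order see nothing
  else for large \<open>N\<close>; order 0 has coefficient 0.\<close>

lemma todd_partial_sum_unique:
  fixes f :: "real^'n \<Rightarrow> complex"
  assumes E: "polyhomogeneous_expansion r f e F" and E': "polyhomogeneous_expansion r f e' F'"
  shows "eventually (\<lambda>N. todd_partial_sum u a e F 0 N = todd_partial_sum u a e' F' 0 N) sequentially"
proof -
  obtain M :: nat where M0: "max (e 0 + real CARD('n)) (e' 0 + real CARD('n)) \<le> real M" using real_arch_simple by blast
  then have M: "e 0 + real CARD('n) \<le> real M" "e' 0 + real CARD('n) \<le> real M" by auto
  let ?G = "\<lambda>e F (\<gamma>::'m \<Rightarrow> nat) x. \<Sum>k\<in>{k. real (multi_order \<gamma>) - real CARD('n) \<le> e k}. F k x"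
  have sm: "smooth (?G e F \<gamma>)" "smooth (?G e' F' \<gamma>)" for \<gamma>
    by (intro smooth_sum expansion_finite[OF E] expansion_component(1)[OF E] expansion_finite[OF E'] expansion_component(1)[OF E'])+
  have "eventually (\<lambda>N. \<forall>\<gamma>\<in>{\<gamma>. multi_order \<gamma> \<le> M} \<inter> {\<gamma>. multi_order \<gamma> > 0}. h_deriv \<gamma> N (?G e F \<gamma>) = h_deriv \<gamma> N (?G e' F' \<gamma>)) sequentially"
  proof (intro eventually_ball_finite finite_Int disjI1 finite_multi_order_le ballI)
    fix \<gamma> :: "'m \<Rightarrow> nat" assume "\<gamma> \<in> {\<gamma>. multi_order \<gamma> \<le> M} \<inter> {\<gamma>. multi_order \<gamma> > 0}"
    then have pos: "multi_order \<gamma> > 0" by blast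
    obtain R where "\<And>x. R \<le> norm x \<Longrightarrow> ?G e F \<gamma> x = ?G e' F' \<gamma> x" using expansion_unique[OF E E'] by blast
    from h_deriv_eventually_eq[OF sm this pos]
    show "eventually (\<lambda>N. h_deriv \<gamma> N (?G e F \<gamma>) = h_deriv \<gamma> N (?G e' F' \<gamma>)) sequentially" .
  qed
  then show ?thesis using eventually_ge_at_top[of 1]
  proof eventually_elim
    case (elim N)
    have "of_real (todd_minus_id_coeff \<gamma>) * h_deriv \<gamma> N (?G e F \<gamma>) = of_real (todd_minus_id_coeff \<gamma>) * h_deriv \<gamma> N (?G e' F' \<gamma>)"
      if "multi_order \<gamma> \<le> M" for \<gamma>
    proof (cases "multi_order \<gamma> = 0")
      case True
      then show ?thesis by (simp only: todd_minus_id_coeff_eq) simp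
    next
      case False
      then have "multi_order \<gamma> > 0" by (simp only: neq0_conv)
      then have "h_deriv \<gamma> N (?G e F \<gamma>) = h_deriv \<gamma> N (?G e' F' \<gamma>)" using elim(1) that by blast
      then show ?thesis by (rule arg_cong)
    qed
    then show ?case unfolding todd_partial_sum_swap[OF E elim(2) M(1)] todd_partial_sum_swap[OF E' elim(2) M(2)]
      by (intro sum.cong refl) blast
  qed
qed

text \<open>At \<open>K = 0\<close> the constant is the limit of \<open>g\<close> minus the partial
  sum, and the partial sums of both expansions eventually coincide.\<close>

lemma todd_constant_unique:
  fixes f :: "real^'n \<Rightarrow> complex"
  assumes E: "polyhomogeneous_expansion r f e F" and E': "polyhomogeneous_expansion r f e' F'"
    and C: "has_todd_expansion g u a e F C" and C': "has_todd_expansion g u a e' F' C'"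
  shows "C = C'"
proof -
  have lim: "(\<lambda>N. g N - todd_partial_sum u a e F 0 N) \<longlonglongrightarrow> C" if "has_todd_expansion g u a e F C" for e F C
  proof -
    have "(\<lambda>N. g N - (todd_partial_sum u a e F 0 N + C)) \<in> o[sequentially](\<lambda>N. of_real (real N powr 0))"
      using that unfolding has_todd_expansion_def by blast
    then have "(\<lambda>N. (g N - (todd_partial_sum u a e F 0 N + C)) / of_real (real N powr 0)) \<longlonglongrightarrow> 0" by (rule smalloD_tendsto)
    then have "(\<lambda>N. (g N - (todd_partial_sum u a e F 0 N + C)) / of_real (real N powr 0) + C) \<longlonglongrightarrow> 0 + C" by (intro tendsto_add tendsto_const)
    then have "(\<lambda>N. (g N - (todd_partial_sum u a e F 0 N + C)) / of_real (real N powr 0) + C) \<longlonglongrightarrow> C" by simp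
    then show ?thesis
      by (rule Lim_transform_eventually) (use eventually_gt_at_top[of 0] in eventually_elim, simp)
  qed
  have "(\<lambda>N. g N - todd_partial_sum u a e F 0 N) \<longlonglongrightarrow> C'"
    by (rule Lim_transform_eventually[OF lim[OF C']]) (use todd_partial_sum_unique[OF E E'] in eventually_elim, simp)
  then show ?thesis by (rule LIMSEQ_unique[OF lim[OF C]])
qed

end

section \<open>Borel summation\<close>

text \<open>A function with all its derivatives as explicit data, so that rescaling, translation and
  locally finite sums act on every derivative at once; \<open>symbol_system_symbol\<close> passes to
  \<open>real^1\<close>.\<close>

definition deriv_system :: "(nat \<Rightarrow> real \<Rightarrow> complex) \<Rightarrow> bool" where
  "deriv_system X \<longleftrightarrow> (\<forall>k t. (X k has_vector_derivative X (Suc k) t) (at t))"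

definition symbol_system :: "real \<Rightarrow> (nat \<Rightarrow> real \<Rightarrow> complex) \<Rightarrow> bool" where
  "symbol_system s X \<longleftrightarrow> deriv_system X \<and> (\<forall>k. \<exists>C. \<forall>t. norm (X k t) \<le> C * (1 + \<bar>t\<bar>) powr (s - real k))"

lemma deriv_systemD: "deriv_system X \<Longrightarrow> (X k has_vector_derivative X (Suc k) t) (at t)"
  by (simp add: deriv_system_def)

lemma deriv_system_cmult: "deriv_system X \<Longrightarrow> deriv_system (\<lambda>k t. c * X k t)"
  unfolding deriv_system_def by (auto intro!: has_vector_derivative_mult_right)

lemma deriv_system_sum: "(\<And>i. i \<in> A \<Longrightarrow> deriv_system (X i)) \<Longrightarrow> deriv_system (\<lambda>k t. \<Sum>i\<in>A. X i k t)"
  unfolding deriv_system_def by (auto intro!: has_vector_derivative_sum)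

lemma deriv_system_affine:
  assumes "deriv_system X"
  shows "deriv_system (\<lambda>k t. of_real (\<mu> ^ k) * X k (\<mu> * t + \<nu>))"
  unfolding deriv_system_def
proof (intro allI)
  fix k t
  have "((X k \<circ> (\<lambda>t. \<mu> * t + \<nu>)) has_vector_derivative \<mu> *\<^sub>R X (Suc k) (\<mu> * t + \<nu>)) (at t)"
    by (rule vector_diff_chain_at) (auto intro!: derivative_eq_intros deriv_systemD[OF assms] simp: has_real_derivative_iff_has_vector_derivative[symmetric])
  then have "((\<lambda>t. of_real (\<mu> ^ k) * X k (\<mu> * t + \<nu>)) has_vector_derivative of_real (\<mu> ^ k) * (\<mu> *\<^sub>R X (Suc k) (\<mu> * t + \<nu>))) (at t)"
    unfolding o_def by (rule has_vector_derivative_mult_right)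
  then show "((\<lambda>t. of_real (\<mu> ^ k) * X k (\<mu> * t + \<nu>)) has_vector_derivative of_real (\<mu> ^ Suc k) * X (Suc k) (\<mu> * t + \<nu>)) (at t)"
    by (simp add: scaleR_conv_of_real mult_ac)
qed

lemma deriv_system_continuous: "deriv_system X \<Longrightarrow> continuous_on S (X k)"
  by (meson deriv_systemD continuous_at_imp_continuous_on has_vector_derivative_continuous)

lemma locally_finite_sum_eq:
  fixes X :: "nat \<Rightarrow> real \<Rightarrow> complex"
  assumes "\<And>j. t \<le> real j \<Longrightarrow> X j t = 0" "t \<le> real n"
  shows "(\<Sum>j | real j < t. X j t) = (\<Sum>j<n. X j t)"
proof (rule sum.mono_neutral_left)
  show "{j. real j < t} \<subseteq> {..<n}" using assms(2) by auto
  show "\<forall>j\<in>{..<n} - {j. real j < t}. X j t = 0" using assms(1) by auto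
qed simp

lemma deriv_system_locally_finite:
  assumes "\<And>j. deriv_system (X j)" "\<And>j k t. t \<le> real j \<Longrightarrow> X j k t = 0"
  shows "deriv_system (\<lambda>k t. \<Sum>j | real j < t. X j k t)"
  unfolding deriv_system_def
proof (intro allI)
  fix k t
  obtain n :: nat where n: "t + 1 \<le> real n" using real_arch_simple by blast
  have eq: "(\<Sum>j | real j < t'. X j k t') = (\<Sum>j<n. X j k t')" if "t' < t + 1" for t' k
    using that n assms(2) by (intro locally_finite_sum_eq) auto
  have "((\<lambda>t. \<Sum>j<n. X j k t) has_vector_derivative (\<Sum>j<n. X j (Suc k) t)) (at t)"
    by (intro has_vector_derivative_sum deriv_systemD assms)
  then have "((\<lambda>t. \<Sum>j | real j < t. X j k t) has_vector_derivative (\<Sum>j<n. X j (Suc k) t)) (at t)"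
    by (rule has_vector_derivative_transform_within_open[where S = "{..<t + 1}"]) (auto simp: eq)
  then show "((\<lambda>t. \<Sum>j | real j < t. X j k t) has_vector_derivative (\<Sum>j | real j < t. X j (Suc k) t)) (at t)"
    by (simp add: eq)
qed

lemma symbol_system_add:
  assumes "symbol_system s X" "symbol_system s Y"
  shows "symbol_system s (\<lambda>k t. X k t + Y k t)"
  unfolding symbol_system_def
proof (intro conjI allI)
  show "deriv_system (\<lambda>k t. X k t + Y k t)"
    using assms unfolding symbol_system_def deriv_system_def by (auto intro!: has_vector_derivative_add)
  fix k
  obtain C C' where C: "\<And>t. norm (X k t) \<le> C * (1 + \<bar>t\<bar>) powr (s - real k)" "\<And>t. norm (Y k t) \<le> C' * (1 + \<bar>t\<bar>) powr (s - real k)"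
    using assms unfolding symbol_system_def by metis
  have "norm (X k t + Y k t) \<le> (C + C') * (1 + \<bar>t\<bar>) powr (s - real k)" for t
    using norm_triangle_mono[OF C] by (simp add: distrib_right)
  then show "\<exists>C. \<forall>t. norm (X k t + Y k t) \<le> C * (1 + \<bar>t\<bar>) powr (s - real k)" by blast
qed

lemma symbol_system_const:
  assumes "s \<ge> 0"
  shows "symbol_system s (\<lambda>k t. if k = 0 then C else 0)"
  unfolding symbol_system_def
proof (intro conjI allI)
  show "deriv_system (\<lambda>k t. if k = 0 then C else 0)" unfolding deriv_system_def by (auto intro: derivative_eq_intros)
  fix k
  have "1 \<le> (1 + \<bar>t\<bar>) powr s" for t using assms by (intro ge_one_powr_ge_zero) auto
  then have "norm C * 1 \<le> norm C * (1 + \<bar>t\<bar>) powr s" for t by (intro mult_left_mono) auto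
  then have "norm (if k = 0 then C else 0) \<le> norm C * (1 + \<bar>t\<bar>) powr (s - real k)" for t by auto
  then show "\<exists>A. \<forall>t. norm (if k = 0 then C else 0) \<le> A * (1 + \<bar>t\<bar>) powr (s - real k)" by blast
qed

text \<open>The two inequalities between \<open>x\<close> and \<open>y\<close> serve the two signs
  of \<open>p\<close>.\<close>

lemma powr_comparable:
  fixes x y L :: real
  assumes "0 < x" "0 < y" "x \<le> L * y" "y \<le> L * x"
  shows "x powr p \<le> L powr \<bar>p\<bar> * y powr p"
proof -
  have L: "L > 0" using assms by (meson less_le_trans zero_less_mult_pos2)
  show ?thesis
  proof (cases "p \<ge> 0")
    case True
    have "x powr p \<le> (L * y) powr p" using assms True by (intro powr_mono2) auto
    then show ?thesis using True assms L by (simp add: powr_mult)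
  next
    case False
    have "x powr p \<le> (y / L) powr p" using assms False L by (intro powr_mono2') (auto simp: field_simps)
    also have "\<dots> = y powr p / L powr p" using assms L by (simp add: powr_divide)
    also have "\<dots> = L powr \<bar>p\<bar> * y powr p" using False L by (simp add: powr_minus_divide)
    finally show ?thesis .
  qed
qed

text \<open>For \<open>t \<ge> 1 / 2\<close> the numbers \<open>t\<close> and \<open>1 + t\<close>
  agree up to the factor 3, so bounds by powers of \<open>t\<close> suffice once the system vanishes
  to the left.\<close>

lemma symbol_systemI:
  assumes X: "deriv_system X" "\<And>k t. t \<le> 1 / 2 \<Longrightarrow> X k t = 0"
    and B: "\<And>k. \<exists>C. \<forall>t\<ge>1 / 2. norm (X k t) \<le> C * t powr (s - real k)"
  shows "symbol_system s X"
  unfolding symbol_system_def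
proof (intro conjI allI X)
  fix k
  obtain C where C: "\<And>t. t \<ge> 1 / 2 \<Longrightarrow> norm (X k t) \<le> C * t powr (s - real k)" using B by blast
  define p where "p = s - real k"
  have "norm (X k t) \<le> (\<bar>C\<bar> * 3 powr \<bar>p\<bar>) * (1 + \<bar>t\<bar>) powr p" for t
  proof (cases "t \<ge> 1 / 2")
    case True
    then have "t powr p \<le> 3 powr \<bar>p\<bar> * (1 + t) powr p" by (intro powr_comparable) auto
    then have "\<bar>C\<bar> * t powr p \<le> \<bar>C\<bar> * (3 powr \<bar>p\<bar> * (1 + t) powr p)" by (intro mult_left_mono) auto
    moreover have "C * t powr p \<le> \<bar>C\<bar> * t powr p" by (intro mult_right_mono) auto
    ultimately have "norm (X k t) \<le> \<bar>C\<bar> * (3 powr \<bar>p\<bar> * (1 + t) powr p)" using C[OF True] unfolding p_def by linarith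
    then show ?thesis using True by (simp add: mult_ac)
  qed (use X(2)[of t k] in simp)
  then show "\<exists>C. \<forall>t. norm (X k t) \<le> C * (1 + \<bar>t\<bar>) powr (s - real k)" unfolding p_def by blast
qed

lemma partial_deriv_system:
  assumes "deriv_system X"
  shows "((\<lambda>x::real^1. X k (x $ 1)) has_derivative (\<lambda>v. (v $ 1) *\<^sub>R X (Suc k) (x $ 1))) (at x)"
    and "partial_deriv i (\<lambda>x::real^1. X k (x $ 1)) = (\<lambda>x. X (Suc k) (x $ 1))"
proof -
  have D: "((\<lambda>x::real^1. X k (x $ 1)) has_derivative (\<lambda>v. (v $ 1) *\<^sub>R X (Suc k) (x $ 1))) (at x)" for x
    by (rule has_derivative_compose[OF bounded_linear_imp_has_derivative[OF bounded_linear_vec_nth]])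
      (rule deriv_systemD[OF assms, unfolded has_vector_derivative_def])
  show "((\<lambda>x::real^1. X k (x $ 1)) has_derivative (\<lambda>v. (v $ 1) *\<^sub>R X (Suc k) (x $ 1))) (at x)" by (rule D)
  have "i = 1" by (simp add: num1_eq_iff)
  then show "partial_deriv i (\<lambda>x::real^1. X k (x $ 1)) = (\<lambda>x. X (Suc k) (x $ 1))"
    by (auto simp: partial_deriv_eq[OF D] axis_def)
qed

lemma multi_deriv_real1: "multi_deriv \<alpha> (f :: real^1 \<Rightarrow> 'b::real_normed_vector) = (partial_deriv 1 ^^ \<alpha> 1) f"
proof -
  have "\<exists>xs::1 list. distinct xs \<and> set xs = UNIV" by (rule exI[of _ "[1]"]) auto
  then have *: "distinct (SOME xs::1 list. distinct xs \<and> set xs = UNIV) \<and> set (SOME xs::1 list. distinct xs \<and> set xs = UNIV) = UNIV"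
    by (rule someI_ex)
  then have "length (SOME xs::1 list. distinct xs \<and> set xs = UNIV) = 1"
    using distinct_card by fastforce
  then obtain y where "(SOME xs::1 list. distinct xs \<and> set xs = UNIV) = [y]" by (auto simp: length_Suc_conv)
  moreover have "y = 1" by (simp add: num1_eq_iff)
  ultimately show ?thesis unfolding multi_deriv_def by simp
qed

lemma symbol_system_symbol:
  assumes "symbol_system s X"
  shows "symbol s (\<lambda>x::real^1. X 0 (x $ 1))"
  unfolding symbol_def
proof (intro conjI allI)
  have X: "deriv_system X" using assms by (simp add: symbol_system_def)
  show "smooth (\<lambda>x::real^1. X 0 (x $ 1))"
  proof (rule smooth_coinduct[where S = "range (\<lambda>k x. X k (x $ 1))"])
    fix g :: "real^1 \<Rightarrow> complex" assume "g \<in> range (\<lambda>k x. X k (x $ 1))"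
    then obtain k where g: "g = (\<lambda>x. X k (x $ 1))" by blast
    show "g differentiable_on UNIV \<and> (\<forall>i. partial_deriv i g \<in> range (\<lambda>k x. X k (x $ 1)))"
      unfolding g partial_deriv_system(2)[OF X] using partial_deriv_system(1)[OF X]
      by (auto simp: differentiable_on_def differentiable_def)
  qed auto
  have iter: "(partial_deriv 1 ^^ k) (\<lambda>x::real^1. X 0 (x $ 1)) = (\<lambda>x. X k (x $ 1))" for k
    by (induction k) (simp_all add: partial_deriv_system(2)[OF X])
  fix \<alpha> :: "1 \<Rightarrow> nat"
  obtain C where "\<And>t. norm (X (\<alpha> 1) t) \<le> C * (1 + \<bar>t\<bar>) powr (s - real (\<alpha> 1))"
    using assms unfolding symbol_system_def by blast
  then have "norm (multi_deriv \<alpha> (\<lambda>x::real^1. X 0 (x $ 1)) x) \<le> C * (1 + norm x) powr (s - real (multi_order \<alpha>))" for x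
    unfolding multi_deriv_real1 iter by (simp add: norm_real sum_1)
  then show "\<exists>C. \<forall>x. norm (multi_deriv \<alpha> (\<lambda>x::real^1. X 0 (x $ 1)) x) \<le> C * (1 + norm x) powr (s - real (multi_order \<alpha>))" by blast
qed

lemma smooth_deriv_system:
  fixes f :: "real^1 \<Rightarrow> complex"
  assumes "smooth f"
  shows "deriv_system (\<lambda>k t. (partial_deriv 1 ^^ k) f (vec t))"
  unfolding deriv_system_def
proof (intro allI)
  fix k t
  have sm: "smooth ((partial_deriv 1 ^^ k) f)" for k by (induction k) (use assms smooth_partial_deriv in auto)
  have v: "vec t = 0 + t *\<^sub>R axis (1::1) (1::real)" for t by (simp add: vec_eq_iff axis_def num1_eq_iff)
  have "((partial_deriv 1 ^^ k) f) differentiable (at (0 + t *\<^sub>R axis 1 1))"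
    using smooth_has_derivative[OF sm[of k]] unfolding differentiable_def by blast
  from partial_deriv_line[OF this]
  show "((\<lambda>t. (partial_deriv 1 ^^ k) f (vec t)) has_vector_derivative (partial_deriv 1 ^^ Suc k) f (vec t)) (at t)"
    unfolding v by simp
qed

section \<open>Cut-off powers and their sums\<close>

lemma deriv_system_unique_on:
  assumes X: "deriv_system X" and S: "open S" and Y: "\<And>t. t \<in> S \<Longrightarrow> X 0 t = Y 0 t"
    "\<And>k t. t \<in> S \<Longrightarrow> (Y k has_vector_derivative Y (Suc k) t) (at t)"
  shows "t \<in> S \<Longrightarrow> X k t = Y k t"
proof (induction k arbitrary: t)
  case (Suc k)
  have "(Y k has_vector_derivative X (Suc k) t) (at t)"
    by (rule has_vector_derivative_transform_within_open[OF deriv_systemD[OF X] S Suc.prems]) (use Suc.IH in auto)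
  from vector_derivative_unique_at[OF this Y(2)[OF Suc.prems]] show ?case .
qed (use Y(1) in auto)

text \<open>Differentiation lowers the exponent by 1 and changes the smooth factor, so the family
  with arbitrary \<open>p\<close> and \<open>\<eta>\<close> is closed under partial
  derivatives.\<close>

lemma smooth_powr:
  fixes m :: "real^'n::finite \<Rightarrow> real"
  assumes m: "smooth m" "\<And>x. m x > 0" and p: "smooth p"
  shows "smooth (\<lambda>x. p x * m x powr \<eta>)"
proof (rule smooth_coinduct[where S = "{\<lambda>x. p x * m x powr \<eta> | p \<eta>. smooth p}"])
  fix g assume "g \<in> {\<lambda>x. p x * m x powr \<eta> | p \<eta>. smooth p}"
  then obtain p \<eta> where g: "g = (\<lambda>x. p x * m x powr \<eta>)" and p: "smooth p" by blast
  define m' where "m' x v = (\<Sum>i\<in>UNIV. v $ i *\<^sub>R partial_deriv i m x)" for x v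
  define p' where "p' x v = (\<Sum>i\<in>UNIV. v $ i *\<^sub>R partial_deriv i p x)" for x v
  have m': "(m has_derivative m' x) (at x)" and p': "(p has_derivative p' x) (at x)" for x
    unfolding m'_def p'_def by (intro smooth_has_derivative m p)+
  have D: "(g has_derivative (\<lambda>v. p x * (m x powr \<eta> * (0 * ln (m x) + m' x v * \<eta> / m x)) + p' x v * m x powr \<eta>)) (at x)" for x
    unfolding g by (intro has_derivative_mult has_derivative_powr p' m' m has_derivative_const) auto
  have "partial_deriv i g = (\<lambda>x. (partial_deriv i p x * m x + p x * (\<eta> * partial_deriv i m x)) * m x powr (\<eta> - 1))" for i
  proof
    fix x
    have "partial_deriv i g x = p x * (m x powr \<eta> * (0 * ln (m x) + partial_deriv i m x * \<eta> / m x)) + partial_deriv i p x * m x powr \<eta>"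
      unfolding partial_deriv_eq[OF D] partial_deriv_eq[OF p'] partial_deriv_eq[OF m'] ..
    then show "partial_deriv i g x = (partial_deriv i p x * m x + p x * (\<eta> * partial_deriv i m x)) * m x powr (\<eta> - 1)"
      using m(2)[of x] by (simp add: powr_diff field_simps)
  qed
  moreover have "smooth (\<lambda>x. partial_deriv i p x * m x + p x * (\<eta> * partial_deriv i m x))" for i
    by (intro smooth_add smooth_mult smooth_const smooth_partial_deriv p m)
  ultimately show "g differentiable_on UNIV \<and> (\<forall>i. partial_deriv i g \<in> {\<lambda>x. p x * m x powr \<eta> | p \<eta>. smooth p})"
    using D by (auto simp: differentiable_on_def differentiable_def)
qed (use p in auto)

text \<open>A smooth function equal to the power from 2 on and vanishing up to 1. Its derivatives
  obey the bounds of a pure power, exactly beyond 2 and by compactness between 1 and 2.\<close>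

lemma power_system:
  fixes \<eta> :: real
  obtains X B where "deriv_system X" "\<And>k t. t \<le> 1 \<Longrightarrow> X k t = 0" "\<And>t. t \<ge> 2 \<Longrightarrow> X 0 t = of_real (t powr \<eta>)"
    "\<And>k t. t \<ge> 1 \<Longrightarrow> norm (X k t) \<le> B k * t powr (\<eta> - real k)"
proof -
  let ?s = "\<lambda>x::real^1. smooth_step (x $ 1 - 1)"
  have s: "smooth ?s" by (intro smooth_smooth_step smooth_diff smooth_component smooth_const)
  have s0: "?s x \<ge> 0" for x unfolding smooth_step_def flat_exp_def by simp
  \<comment> \<open>A positive smooth replacement for \<open>t\<close>: it equals 1 up to 1 and
    \<open>t\<close> from 2 on, so its real powers are smooth everywhere.\<close>
  define m where "m = (\<lambda>x::real^1. 1 + ?s x * (x $ 1 - 1))"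
  have m: "smooth m" unfolding m_def by (intro smooth_add smooth_mult smooth_diff smooth_component smooth_const s)
  have mpos: "m x > 0" for x
  proof (cases "x $ 1 \<le> 1")
    case True
    then show ?thesis by (simp add: m_def smooth_step_0)
  next
    case False
    then have "?s x * (x $ 1 - 1) \<ge> 0" using s0[of x] by simp
    then show ?thesis by (simp add: m_def)
  qed
  define f where "f = (\<lambda>x. complex_of_real (?s x * m x powr \<eta>))"
  have f: "smooth f" unfolding f_def by (intro smooth_linear[OF bounded_linear_of_real] smooth_powr m mpos s)
  define X where "X k t = (partial_deriv 1 ^^ k) f (vec t)" for k t
  have X: "deriv_system X" unfolding X_def by (rule smooth_deriv_system[OF f])
  have X0: "X 0 t = (if t \<le> 1 then 0 else of_real (?s (vec t) * m (vec t) powr \<eta>))" for t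
    by (simp add: X_def f_def smooth_step_0)
  have neg: "X k t = 0" if "t < 1" for k t
    using deriv_system_unique_on[OF X, of "{..<1}" "\<lambda>k t. 0" t k] that by (auto simp: X0)
  have zero: "X k t = 0" if "t \<le> 1" for k t
  proof (cases "t < 1")
    case False
    then have t: "t = 1" using that by simp
    have "(X k \<longlongrightarrow> X k 1) (at_left 1)"
      using deriv_system_continuous[OF X, of UNIV k] by (simp add: continuous_on_eq_continuous_at continuous_at_imp_continuous_at_within continuous_within[symmetric])
    moreover have "(X k \<longlongrightarrow> 0) (at_left 1)"
      by (rule tendsto_eventually) (auto simp: eventually_at_left_field neg intro!: exI[of _ 0])
    ultimately show ?thesis unfolding t by (intro tendsto_unique[of "at_left (1::real)"]) auto
  qed (rule neg)
  have big: "X 0 t = of_real (t powr \<eta>)" if "t \<ge> 2" for t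
    using that by (simp add: X0 m_def smooth_step_1)
  \<comment> \<open>The falling factorials produced by differentiating \<open>t powr \<eta>\<close>
    repeatedly.\<close>
  define a where "a k = (\<Prod>i<k. \<eta> - real i)" for k
  have form: "X k t = of_real (a k * t powr (\<eta> - real k))" if "t > 2" for k t
  proof (rule deriv_system_unique_on[OF X, of "{2<..}" "\<lambda>k t. of_real (a k * t powr (\<eta> - real k))"])
    fix k and t :: real assume t: "t \<in> {2<..}"
    have "((\<lambda>t. a k * t powr (\<eta> - real k)) has_real_derivative a (Suc k) * t powr (\<eta> - real (Suc k))) (at t)"
      using t by (auto intro!: derivative_eq_intros simp: a_def algebra_simps)
    then show "((\<lambda>t. complex_of_real (a k * t powr (\<eta> - real k))) has_vector_derivative of_real (a (Suc k) * t powr (\<eta> - real (Suc k)))) (at t)"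
      by (rule has_vector_derivative_of_real)
  qed (use big that in \<open>auto simp: a_def\<close>)
  have "\<exists>B. \<forall>t\<ge>1. norm (X k t) \<le> B * t powr (\<eta> - real k)" for k
  proof -
    have "continuous_on {1..2} (\<lambda>t. norm (X k t) / t powr (\<eta> - real k))"
      by (intro continuous_intros deriv_system_continuous[OF X]) auto
    then have "bounded ((\<lambda>t. norm (X k t) / t powr (\<eta> - real k)) ` {1..2})"
      by (intro compact_imp_bounded compact_continuous_image) auto
    then obtain A where A: "\<And>t. t \<in> {1..2} \<Longrightarrow> \<bar>norm (X k t) / t powr (\<eta> - real k)\<bar> \<le> A"
      unfolding bounded_real by (meson imageI)
    have "norm (X k t) \<le> (\<bar>A\<bar> + \<bar>a k\<bar>) * t powr (\<eta> - real k)" if "t \<ge> 1" for t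
    proof (cases "t \<le> 2")
      case True
      then have "norm (X k t) / t powr (\<eta> - real k) \<le> \<bar>A\<bar> + \<bar>a k\<bar>" using A[of t] that by force
      then show ?thesis using that by (simp add: field_simps)
    next
      case False
      then have "norm (X k t) = \<bar>a k\<bar> * t powr (\<eta> - real k)" using form[of t k] by (simp add: norm_mult)
      also have "\<dots> \<le> (\<bar>A\<bar> + \<bar>a k\<bar>) * t powr (\<eta> - real k)" by (intro mult_right_mono) auto
      finally show ?thesis .
    qed
    then show ?thesis by blast
  qed
  then obtain B where "\<And>k t. t \<ge> 1 \<Longrightarrow> norm (X k t) \<le> B k * t powr (\<eta> - real k)" by metis
  then show ?thesis using that X zero big by blast
qed

text \<open>Measured against the larger power \<open>\<sigma>\<close>, a term of exponent below
  \<open>\<sigma>\<close> becomes arbitrarily small when it is cut off far enough out. Finitely many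
  derivatives can be controlled by one cut-off \<open>R\<close>; the higher ones only keep some
  bound.\<close>

lemma power_block:
  fixes \<epsilon> :: "'i \<Rightarrow> real" and c :: "'i \<Rightarrow> complex"
  assumes A: "finite A" "\<And>i. i \<in> A \<Longrightarrow> \<epsilon> i < \<sigma>" and \<delta>: "\<delta> > 0"
  shows "\<exists>Q R. deriv_system Q \<and> (\<forall>k t. t \<le> \<rho> \<longrightarrow> Q k t = 0) \<and> (\<forall>t\<ge>R. Q 0 t = (\<Sum>i\<in>A. of_real (t powr \<epsilon> i) * c i)) \<and>
    (\<forall>k\<le>m. \<forall>t\<ge>1. norm (Q k t) \<le> \<delta> * t powr (\<sigma> - real k)) \<and> (\<forall>k. \<exists>D. \<forall>t\<ge>1. norm (Q k t) \<le> D * t powr (\<sigma> - real k))"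
proof -
  have "\<exists>X B. deriv_system X \<and> (\<forall>k t. t \<le> 1 \<longrightarrow> X k t = 0) \<and> (\<forall>t\<ge>2. X 0 t = of_real (t powr \<eta>)) \<and>
    (\<forall>k. \<forall>t\<ge>1. norm (X k t) \<le> B k * t powr (\<eta> - real k))" for \<eta>
    by (rule power_system[of \<eta>]) blast
  then obtain X B where X: "\<And>\<eta>. deriv_system (X \<eta>)" "\<And>\<eta> k t. t \<le> 1 \<Longrightarrow> X \<eta> k t = 0" "\<And>\<eta> t. t \<ge> 2 \<Longrightarrow> X \<eta> 0 t = of_real (t powr \<eta>)"
    and B: "\<And>\<eta> k t. t \<ge> 1 \<Longrightarrow> norm (X \<eta> k t) \<le> B \<eta> k * t powr (\<eta> - real k)"
    by metis
  \<comment> \<open>The bound for the \<open>k\<close>-th derivative when the cut-off is at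
    \<open>R\<close>; it tends to 0 since all exponents lie below \<open>\<sigma>\<close>.\<close>
  define E where "E k R = (\<Sum>i\<in>A. norm (c i) * \<bar>B (\<epsilon> i) k\<bar> * R powr (\<epsilon> i - \<sigma>))" for k R
  have "(E k \<longlongrightarrow> 0) at_top" for k
    unfolding E_def
  proof (rule tendsto_null_sum)
    fix i assume "i \<in> A"
    then have "((\<lambda>R. R powr (\<epsilon> i - \<sigma>)) \<longlongrightarrow> 0) at_top" using A(2) by (intro tendsto_neg_powr filterlim_ident) auto
    then show "((\<lambda>R. norm (c i) * \<bar>B (\<epsilon> i) k\<bar> * R powr (\<epsilon> i - \<sigma>)) \<longlongrightarrow> 0) at_top" by (rule tendsto_mult_right_zero)
  qed
  then have "eventually (\<lambda>R. E k R < \<delta>) at_top" for k using \<delta> by (rule order_tendstoD)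
  then have "eventually (\<lambda>R. \<forall>k\<in>{..m}. E k R < \<delta>) at_top" by (intro eventually_ball_finite) auto
  then have "eventually (\<lambda>R. (\<forall>k\<in>{..m}. E k R < \<delta>) \<and> R \<ge> max 1 \<rho>) at_top"
    by (intro eventually_conj eventually_ge_at_top)
  then obtain R where R: "\<And>k. k \<le> m \<Longrightarrow> E k R < \<delta>" "R \<ge> 1" "R \<ge> \<rho>"
    by (auto simp: eventually_at_top_linorder)
  \<comment> \<open>Rescaling moves the transition of the cut-off power to the interval from
    \<open>R\<close> to \<open>2 * R\<close>, and the factor \<open>R powr \<epsilon> i\<close>
    restores the power itself beyond it.\<close>
  define Q where "Q k t = (\<Sum>i\<in>A. (c i * of_real (R powr \<epsilon> i)) * (of_real ((1 / R) ^ k) * X (\<epsilon> i) k ((1 / R) * t + 0)))" for k t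
  have Q: "deriv_system Q"
    unfolding Q_def by (intro deriv_system_sum deriv_system_cmult deriv_system_affine X)
  have zero: "Q k t = 0" if "t \<le> R" for k t
    using that R(2) by (simp add: Q_def X(2))
  have exact: "Q 0 t = (\<Sum>i\<in>A. of_real (t powr \<epsilon> i) * c i)" if "t \<ge> 2 * R" for t
    unfolding Q_def
  proof (rule sum.cong)
    fix i
    have "t powr \<epsilon> i = R powr \<epsilon> i * (t / R) powr \<epsilon> i" using that R(2) by (simp add: powr_divide)
    then show "(c i * of_real (R powr \<epsilon> i)) * (of_real ((1 / R) ^ 0) * X (\<epsilon> i) 0 ((1 / R) * t + 0)) = of_real (t powr \<epsilon> i) * c i"
      using that R(2) X(3)[of "t / R" "\<epsilon> i"] by (simp add: field_simps)
  qed simp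
  have bound: "norm (Q k t) \<le> E k R * t powr (\<sigma> - real k)" if t: "t \<ge> 1" for k t
  proof (cases "t \<le> R")
    case True
    have "E k R \<ge> 0" unfolding E_def by (intro sum_nonneg) auto
    then show ?thesis using zero[OF True] by simp
  next
    case False
    have "norm ((c i * of_real (R powr \<epsilon> i)) * (of_real ((1 / R) ^ k) * X (\<epsilon> i) k ((1 / R) * t + 0)))
      \<le> norm (c i) * \<bar>B (\<epsilon> i) k\<bar> * R powr (\<epsilon> i - \<sigma>) * t powr (\<sigma> - real k)" if i: "i \<in> A" for i
    proof -
      let ?p = "\<epsilon> i - real k"
      have "norm (X (\<epsilon> i) k (t / R)) \<le> B (\<epsilon> i) k * (t / R) powr ?p" using False R(2) by (intro B) simp
      also have "\<dots> \<le> \<bar>B (\<epsilon> i) k\<bar> * (t / R) powr ?p" by (intro mult_right_mono) auto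
      finally have 1: "norm (X (\<epsilon> i) k (t / R)) \<le> \<bar>B (\<epsilon> i) k\<bar> * (t / R) powr ?p" .
      have 2: "R powr \<epsilon> i * (1 / R) ^ k * (t / R) powr ?p = t powr ?p"
      proof -
        have "(1 / R) ^ k = R powr (- real k)" using R(2) by (simp add: powr_minus powr_realpow power_one_over inverse_eq_divide)
        then have "R powr \<epsilon> i * (1 / R) ^ k = R powr ?p" by (simp flip: powr_add)
        then show ?thesis using R(2) t by (simp add: powr_divide)
      qed
      have "t powr ?p = t powr (\<epsilon> i - \<sigma>) * t powr (\<sigma> - real k)" by (simp flip: powr_add)
      also have "\<dots> \<le> R powr (\<epsilon> i - \<sigma>) * t powr (\<sigma> - real k)"
        using False R(2) A(2)[OF i] by (intro mult_right_mono powr_mono2') auto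
      finally have 3: "t powr ?p \<le> R powr (\<epsilon> i - \<sigma>) * t powr (\<sigma> - real k)" .
      have "norm ((c i * of_real (R powr \<epsilon> i)) * (of_real ((1 / R) ^ k) * X (\<epsilon> i) k ((1 / R) * t + 0)))
        = norm (c i) * (R powr \<epsilon> i * (1 / R) ^ k) * norm (X (\<epsilon> i) k (t / R))"
        using R(2) by (simp add: norm_mult norm_divide norm_power)
      also have "\<dots> \<le> norm (c i) * (R powr \<epsilon> i * (1 / R) ^ k) * (\<bar>B (\<epsilon> i) k\<bar> * (t / R) powr ?p)"
        using R(2) by (intro mult_left_mono 1) auto
      also have "\<dots> = norm (c i) * \<bar>B (\<epsilon> i) k\<bar> * (R powr \<epsilon> i * (1 / R) ^ k * (t / R) powr ?p)" by (simp only: mult_ac)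
      also have "\<dots> \<le> norm (c i) * \<bar>B (\<epsilon> i) k\<bar> * (R powr (\<epsilon> i - \<sigma>) * t powr (\<sigma> - real k))"
        unfolding 2 by (intro mult_left_mono 3) auto
      finally show ?thesis by (simp only: mult.assoc)
    qed
    then show ?thesis unfolding Q_def E_def sum_distrib_right by (rule sum_norm_le)
  qed
  have small: "norm (Q k t) \<le> \<delta> * t powr (\<sigma> - real k)" if "k \<le> m" "t \<ge> 1" for k t
    using bound[OF that(2), of k] mult_right_mono[OF less_imp_le[OF R(1)[OF that(1)]], of "t powr (\<sigma> - real k)"] by simp
  have zero': "Q k t = 0" if "t \<le> \<rho>" for k t using that R(3) by (intro zero) simp
  have "\<exists>D. \<forall>t\<ge>1. norm (Q k t) \<le> D * t powr (\<sigma> - real k)" for k using bound by blast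
  then show ?thesis using Q zero' exact small by blast
qed

lemma power_partial_sum_blocks:
  assumes "\<And>K. finite {i. K \<le> \<epsilon> i}"
  shows "power_partial_sum \<epsilon> c (- real J) t = (\<Sum>i | 0 \<le> \<epsilon> i. of_real (t powr \<epsilon> i) * c i) +
    (\<Sum>j<J. \<Sum>i | - real (Suc j) \<le> \<epsilon> i \<and> \<epsilon> i < - real j. of_real (t powr \<epsilon> i) * c i)"
proof (induction J)
  case (Suc J)
  have "power_partial_sum \<epsilon> c (- real (Suc J)) t - power_partial_sum \<epsilon> c (- real J) t =
    (\<Sum>i | - real (Suc J) \<le> \<epsilon> i \<and> \<epsilon> i < - real J. of_real (t powr \<epsilon> i) * c i)"
    by (rule power_partial_sum_diff[OF assms]) simp
  then show ?case using Suc by (simp add: algebra_simps)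
qed (simp add: power_partial_sum_def)

lemma sum_half_powers: "finite S \<Longrightarrow> (\<Sum>j\<in>S. (1 / 2) ^ j) \<le> (2::real)"
proof -
  assume "finite S"
  then have "(\<Sum>j\<in>S. (1 / 2) ^ j) \<le> (\<Sum>j. (1 / 2 :: real) ^ j)" by (intro sum_le_suminf) auto
  also have "\<dots> = 2" by (simp add: suminf_geometric)
  finally show ?thesis .
qed

text \<open>Borel summation: the blocks of terms with exponents in \<open>[-(j+1), -j)\<close> are cut off so far out
  that, together with their first \<open>j\<close> derivatives, they are dominated by a geometric series.\<close>

lemma borel_sum:
  fixes \<epsilon> :: "'i \<Rightarrow> real" and c :: "'i \<Rightarrow> complex"
  assumes fin: "\<And>K. finite {i. K \<le> \<epsilon> i}" and s: "s \<ge> 0" "\<And>i. \<epsilon> i < s"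
  obtains Y where "symbol_system s Y"
    "\<And>J. \<exists>T. \<forall>t\<ge>T. norm (Y 0 t - power_partial_sum \<epsilon> c (- real J) t) \<le> 2 * t powr (- real J)"
proof -
  define A where "A j = {i. - real (Suc j) \<le> \<epsilon> i \<and> \<epsilon> i < - real j}" for j
  have finA: "finite (A j)" for j unfolding A_def by (rule finite_subset[OF _ fin[of "- real (Suc j)"]]) auto
  obtain G R0 where G: "deriv_system G" "\<And>k t. t \<le> 1 \<Longrightarrow> G k t = 0"
    "\<And>t. t \<ge> R0 \<Longrightarrow> G 0 t = (\<Sum>i | 0 \<le> \<epsilon> i. of_real (t powr \<epsilon> i) * c i)"
    "\<And>k. \<exists>D. \<forall>t\<ge>1. norm (G k t) \<le> D * t powr (s - real k)"
    using power_block[of "{i. 0 \<le> \<epsilon> i}" \<epsilon> s 1 1 c 0, OF fin s(2)] by auto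
  \<comment> \<open>Block \<open>j\<close> vanishes up to \<open>j + 1\<close>, which makes the sum
    locally finite, and has weight \<open>(1 / 2) ^ j\<close> for its derivatives up to order
    \<open>j\<close>.\<close>
  define P where "P j Q R \<longleftrightarrow> deriv_system Q \<and> (\<forall>k t. t \<le> real (Suc j) \<longrightarrow> Q k t = 0) \<and> (\<forall>t\<ge>R. Q 0 t = (\<Sum>i\<in>A j. of_real (t powr \<epsilon> i) * c i)) \<and>
    (\<forall>k\<le>j. \<forall>t\<ge>1. norm (Q k t) \<le> (1 / 2) ^ j * t powr (- real j - real k)) \<and> (\<forall>k. \<exists>D. \<forall>t\<ge>1. norm (Q k t) \<le> D * t powr (- real j - real k))" for j Q and R :: real
  have "\<exists>Q R. P j Q R" for j
    unfolding P_def by (rule power_block[OF finA]) (auto simp: A_def)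
  then obtain Q R where P: "\<And>j. P j (Q j) (R j)" by metis
  then have Q: "\<And>j. deriv_system (Q j)" "\<And>j k t. t \<le> real (Suc j) \<Longrightarrow> Q j k t = 0"
    "\<And>j t. t \<ge> R j \<Longrightarrow> Q j 0 t = (\<Sum>i\<in>A j. of_real (t powr \<epsilon> i) * c i)"
    "\<And>j k t. k \<le> j \<Longrightarrow> t \<ge> 1 \<Longrightarrow> norm (Q j k t) \<le> (1 / 2) ^ j * t powr (- real j - real k)"
    "\<And>j k. \<exists>D. \<forall>t\<ge>1. norm (Q j k t) \<le> D * t powr (- real j - real k)"
    unfolding P_def by blast+
  have Q0: "Q j k t = 0" if "t \<le> real j" for j k t using that by (intro Q(2)) simp
  define S where "S k t = (\<Sum>j | real j < t. Q j k t)" for k t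
  have S_eq: "S k t = (\<Sum>j<n. Q j k t)" if "t \<le> real n" for k t n
    unfolding S_def by (rule locally_finite_sum_eq) (use Q0 that in auto)
  have S: "deriv_system S" unfolding S_def by (rule deriv_system_locally_finite) (use Q(1) Q0 in auto)
  have S_zero: "S k t = 0" if "t \<le> 1" for k t
    unfolding S_def using that by (intro sum.neutral ballI Q(2)) auto
  have symG: "symbol_system s G"
  proof (rule symbol_systemI[OF G(1)])
    fix k
    obtain D where D: "\<And>t. t \<ge> 1 \<Longrightarrow> norm (G k t) \<le> D * t powr (s - real k)" using G(4) by blast
    have "norm (G k t) \<le> \<bar>D\<bar> * t powr (s - real k)" for t
    proof (cases "t \<ge> 1")
      case True
      have "D * t powr (s - real k) \<le> \<bar>D\<bar> * t powr (s - real k)" by (intro mult_right_mono) auto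
      then show ?thesis using D[OF True] by simp
    qed (use G(2)[of t k] in simp)
    then show "\<exists>C. \<forall>t\<ge>1 / 2. norm (G k t) \<le> C * t powr (s - real k)" by blast
  qed (use G(2) in simp)
  have symS: "symbol_system s S"
  proof (rule symbol_systemI[OF S])
    fix k
    have "\<forall>j. \<exists>D. \<forall>t\<ge>1. norm (Q j k t) \<le> D * t powr (- real j - real k)" using Q(5) by blast
    from choice[OF this] obtain D where D: "\<And>j t. t \<ge> 1 \<Longrightarrow> norm (Q j k t) \<le> D j * t powr (- real j - real k)" by blast
    \<comment> \<open>For the \<open>k\<close>-th derivative the blocks below \<open>k\<close> have
      no small weight, so their own constants enter; the remaining blocks are dominated by the
      geometric series with sum 2.\<close>
    define W where "W = (\<Sum>j<k. \<bar>D j\<bar>) + 2"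
    have W: "W \<ge> 0" unfolding W_def by (intro add_nonneg_nonneg sum_nonneg) auto
    have "norm (S k t) \<le> W * t powr (s - real k)" for t
    proof (cases "t \<ge> 1")
      case True
      obtain n0 :: nat where n0: "t \<le> real n0" using real_arch_simple by blast
      define n where "n = max n0 k"
      have n: "t \<le> real n" "k \<le> n" using n0 by (auto simp: n_def)
      have tail: "norm (Q j k t) \<le> (if j < k then \<bar>D j\<bar> else (1 / 2) ^ j) * t powr (s - real k)" for j
      proof -
        have "norm (Q j k t) \<le> (if j < k then \<bar>D j\<bar> else (1 / 2) ^ j) * t powr (- real j - real k)"
        proof (cases "j < k")
          case True
          have "D j * t powr (- real j - real k) \<le> \<bar>D j\<bar> * t powr (- real j - real k)" by (intro mult_right_mono) auto
          then show ?thesis using D[OF \<open>t \<ge> 1\<close>, of j] True by simp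
        qed (use Q(4)[of k j t] \<open>t \<ge> 1\<close> in simp)
        also have "\<dots> \<le> (if j < k then \<bar>D j\<bar> else (1 / 2) ^ j) * t powr (s - real k)"
          using True s(1) by (intro mult_left_mono powr_mono) auto
        finally show ?thesis .
      qed
      have "norm (S k t) \<le> (\<Sum>j<n. (if j < k then \<bar>D j\<bar> else (1 / 2) ^ j) * t powr (s - real k))"
        unfolding S_eq[OF n(1)] by (intro sum_norm_le tail)
      also have "\<dots> = (\<Sum>j<n. (if j < k then \<bar>D j\<bar> else (1 / 2) ^ j)) * t powr (s - real k)" by (simp only: sum_distrib_right)
      also have "\<dots> \<le> W * t powr (s - real k)"
      proof (rule mult_right_mono)
        have "(\<Sum>j<n. (if j < k then \<bar>D j\<bar> else (1 / 2) ^ j)) \<le> (\<Sum>j<n. (if j < k then \<bar>D j\<bar> else 0) + (1 / 2) ^ j)"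
          by (intro sum_mono) auto
        also have "\<dots> = (\<Sum>j<k. \<bar>D j\<bar>) + (\<Sum>j<n. (1 / 2) ^ j)"
        proof -
          have "(\<Sum>j<n. (if j < k then \<bar>D j\<bar> else 0)) = (\<Sum>j\<in>{j \<in> {..<n}. j < k}. \<bar>D j\<bar>)" by (rule sum.inter_filter[symmetric]) simp
          moreover have "{j \<in> {..<n}. j < k} = {..<k}" using n(2) by auto
          ultimately show ?thesis by (simp only: sum.distrib)
        qed
        also have "\<dots> \<le> W" unfolding W_def by (intro add_left_mono sum_half_powers) simp
        finally show "(\<Sum>j<n. (if j < k then \<bar>D j\<bar> else (1 / 2) ^ j)) \<le> W" .
      qed simp
      finally show ?thesis .
    qed (use S_zero[of t k] W in simp)
    then show "\<exists>C. \<forall>t\<ge>1 / 2. norm (S k t) \<le> C * t powr (s - real k)" by blast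
  qed (use S_zero in simp)
  have "\<exists>T. \<forall>t\<ge>T. norm (G 0 t + S 0 t - power_partial_sum \<epsilon> c (- real J) t) \<le> 2 * t powr (- real J)" for J
  proof -
    \<comment> \<open>Beyond \<open>T\<close> the function \<open>G\<close> and the first
      \<open>J\<close> blocks equal their power sums exactly, so only the blocks from
      \<open>J\<close> on remain in the difference.\<close>
    define T where "T = Max (insert 1 (insert R0 (R ` {..<J})))"
    have T: "1 \<le> T" "R0 \<le> T" "\<And>j. j < J \<Longrightarrow> R j \<le> T" unfolding T_def by (intro Max_ge; simp)+
    have "norm (G 0 t + S 0 t - power_partial_sum \<epsilon> c (- real J) t) \<le> 2 * t powr (- real J)" if t: "t \<ge> T" for t
    proof -
      obtain n0 :: nat where n0: "t \<le> real n0" using real_arch_simple by blast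
      define n where "n = max n0 J"
      have n: "t \<le> real n" "J \<le> n" using n0 by (auto simp: n_def)
      have t1: "t \<ge> 1" using t T(1) by simp
      have "{..<n} = {..<J} \<union> {J..<n}" using n(2) by auto
      then have "S 0 t = (\<Sum>j<J. Q j 0 t) + (\<Sum>j\<in>{J..<n}. Q j 0 t)"
        unfolding S_eq[OF n(1)] by (simp add: sum.union_disjoint ivl_disj_int)
      moreover have "(\<Sum>j<J. Q j 0 t) = (\<Sum>j<J. \<Sum>i\<in>A j. of_real (t powr \<epsilon> i) * c i)"
        using T(3) t by (intro sum.cong refl Q(3)) (meson lessThan_iff order.trans)
      moreover have "G 0 t = (\<Sum>i | 0 \<le> \<epsilon> i. of_real (t powr \<epsilon> i) * c i)" using T(2) t by (intro G(3)) simp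
      ultimately have "G 0 t + S 0 t - power_partial_sum \<epsilon> c (- real J) t = (\<Sum>j\<in>{J..<n}. Q j 0 t)"
        unfolding power_partial_sum_blocks[OF fin] A_def by simp
      also have "norm \<dots> \<le> (\<Sum>j\<in>{J..<n}. (1 / 2) ^ j * t powr (- real J))"
      proof (rule sum_norm_le)
        fix j assume j: "j \<in> {J..<n}"
        have "norm (Q j 0 t) \<le> (1 / 2) ^ j * t powr (- real j - real 0)" using t1 by (intro Q(4)) auto
        also have "\<dots> \<le> (1 / 2) ^ j * t powr (- real J)" using t1 j by (intro mult_left_mono powr_mono) auto
        finally show "norm (Q j 0 t) \<le> (1 / 2) ^ j * t powr (- real J)" .
      qed
      also have "\<dots> = (\<Sum>j\<in>{J..<n}. (1 / 2) ^ j) * t powr (- real J)" by (simp only: sum_distrib_right)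
      also have "\<dots> \<le> 2 * t powr (- real J)" by (intro mult_right_mono sum_half_powers) auto
      finally show ?thesis .
    qed
    then show ?thesis by blast
  qed
  with symbol_system_add[OF symG symS] show ?thesis by (rule that)
qed

text \<open>The translated bumps have disjoint supports, so near an integer only one summand counts.
  Derivatives do not decay by themselves, but the coefficients fall faster than any power, which
  gives every symbol order \<open>s\<close>.\<close>

lemma interpolating_symbol:
  fixes d :: "nat \<Rightarrow> complex"
  assumes d: "\<And>J. \<exists>A. \<forall>N\<ge>1. norm (d N) \<le> A * real N powr (- real J)"
  obtains T where "symbol_system s T" "\<And>N. N \<ge> 1 \<Longrightarrow> T 0 (real N) = d N"
proof -
  obtain \<beta> :: "real^1 \<Rightarrow> complex" where \<beta>: "smooth \<beta>" "\<And>x. (\<forall>i. \<bar>x $ i - 0 $ i\<bar> \<le> 1 / 8) \<Longrightarrow> \<beta> x = 1"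
    "\<And>x i. \<bar>x $ i - 0 $ i\<bar> \<ge> 2 * (1 / 8) \<Longrightarrow> \<beta> x = 0"
    by (rule smooth_bump_exists[of "1 / 8" 0]) (simp, blast)
  define b where "b k t = (partial_deriv 1 ^^ k) \<beta> (vec t)" for k t
  have b: "deriv_system b" unfolding b_def by (rule smooth_deriv_system[OF \<beta>(1)])
  have b0: "b 0 0 = 1" unfolding b_def by (simp add: \<beta>(2))
  have bz: "b k t = 0" if "\<bar>t\<bar> \<ge> 1 / 2" for k t
  proof (rule deriv_system_unique_on[OF b, of "{t. 1 / 4 < \<bar>t\<bar>}" "\<lambda>k t. 0"])
    show "open {t::real. 1 / 4 < \<bar>t\<bar>}" by (intro open_Collect_less continuous_intros)
    show "b 0 t = 0" if "t \<in> {t. 1 / 4 < \<bar>t\<bar>}" for t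
      unfolding b_def using that by (simp add: \<beta>(3)[of _ 1])
  qed (use that in auto)
  have "\<exists>M. \<forall>t. norm (b k t) \<le> M" for k
  proof -
    have "bounded (b k ` {- 1..1})" by (intro compact_imp_bounded compact_continuous_image deriv_system_continuous[OF b]) auto
    then obtain M where M: "\<And>t. t \<in> {- 1..1} \<Longrightarrow> norm (b k t) \<le> M" unfolding bounded_iff by (meson imageI)
    have "norm (b k t) \<le> \<bar>M\<bar>" for t
    proof (cases "t \<in> {- 1..1}")
      case False
      then show ?thesis using bz[of t k] by auto
    qed (use M[of t] in linarith)
    then show ?thesis by blast
  qed
  then obtain M where M: "\<And>k t. norm (b k t) \<le> M k" by metis
  \<comment> \<open>The bump at the integer \<open>j + 1\<close>: the index shift makes it vanish up
    to \<open>j\<close>, as needed for the locally finite sum.\<close>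
  define W where "W j k t = d (Suc j) * (of_real (1 ^ k) * b k (1 * t + (- real (Suc j))))" for j k t
  have W: "deriv_system (W j)" for j unfolding W_def by (intro deriv_system_cmult deriv_system_affine b)
  have Wz: "W j k t = 0" if "\<bar>t - real (Suc j)\<bar> \<ge> 1 / 2" for j k t
  proof -
    have "b k (1 * t + (- real (Suc j))) = 0" by (rule bz) (use that in linarith)
    then show ?thesis unfolding W_def by simp
  qed
  have Wz': "W j k t = 0" if "t \<le> real j" for j k t using that by (intro Wz) simp
  define T where "T k t = (\<Sum>j | real j < t. W j k t)" for k t
  have T: "deriv_system T" unfolding T_def by (rule deriv_system_locally_finite) (use W Wz' in auto)
  have fin: "finite {j. real j < t}" for t
  proof -
    obtain n :: nat where "t \<le> real n" using real_arch_simple by blast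
    then have "{j. real j < t} \<subseteq> {..<n}" by auto
    then show ?thesis by (rule finite_subset) simp
  qed
  have T_eq: "T k t = W j k t" if j: "\<bar>t - real (Suc j)\<bar> < 1 / 2" for j k t
  proof -
    have "W i k t = 0" if "i \<noteq> j" for i
    proof (rule Wz)
      have "\<bar>real (Suc i) - real (Suc j)\<bar> \<ge> 1" using that by linarith
      then show "1 / 2 \<le> \<bar>t - real (Suc i)\<bar>" using j by linarith
    qed
    moreover have "real j < t" using j by linarith
    ultimately have "T k t = (\<Sum>i\<in>{j}. W i k t)"
      unfolding T_def by (intro sum.mono_neutral_right fin) auto
    then show ?thesis by simp
  qed
  have T_zero: "T k t = 0" if "\<And>j. \<bar>t - real (Suc j)\<bar> \<ge> 1 / 2" for k t
    unfolding T_def by (intro sum.neutral ballI Wz that)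
  have "symbol_system s T"
  proof (rule symbol_systemI[OF T])
    fix k and t :: real assume "t \<le> 1 / 2"
    then show "T k t = 0" by (intro T_zero) simp
  next
    fix k
    define p where "p = s - real k"
    \<comment> \<open>Large enough that the decay \<open>- J\<close> of the coefficients lies below
      the exponent \<open>p\<close> wanted for the \<open>k\<close>-th derivative, whatever its
      sign.\<close>
    obtain J :: nat where J: "- p \<le> real J" using real_arch_simple by blast
    obtain A where A: "\<And>N. N \<ge> 1 \<Longrightarrow> norm (d N) \<le> A * real N powr (- real J)" using d by blast
    have "norm (T k t) \<le> (\<bar>A\<bar> * 2 powr \<bar>p\<bar> * \<bar>M k\<bar>) * t powr p" if t: "t \<ge> 1 / 2" for t
    proof (cases "\<forall>j. \<bar>t - real (Suc j)\<bar> \<ge> 1 / 2")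
      case True
      then have "T k t = 0" by (intro T_zero) blast
      then show ?thesis by simp
    next
      case False
      then obtain j where j: "\<bar>t - real (Suc j)\<bar> < 1 / 2" by (auto simp only: not_all not_le)
      have "t < real (Suc j) + 1 / 2" using j by linarith
      also have "\<dots> \<le> 2 * real (Suc j)" by simp
      finally have j1: "t \<le> 2 * real (Suc j)" by simp
      have "norm (d (Suc j)) \<le> A * real (Suc j) powr (- real J)" by (rule A) simp
      also have "\<dots> \<le> \<bar>A\<bar> * real (Suc j) powr (- real J)" by (intro mult_right_mono) auto
      also have "\<dots> \<le> \<bar>A\<bar> * real (Suc j) powr p" using J by (intro mult_left_mono powr_mono) auto
      also have "\<dots> \<le> \<bar>A\<bar> * (2 powr \<bar>p\<bar> * t powr p)"
      proof (intro mult_left_mono powr_comparable)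
        show "real (Suc j) \<le> 2 * t" using j t by linarith
        show "t \<le> 2 * real (Suc j)" by (rule j1)
      qed (use t in auto)
      finally have 1: "norm (d (Suc j)) \<le> \<bar>A\<bar> * (2 powr \<bar>p\<bar> * t powr p)" .
      have "norm (T k t) = norm (d (Suc j)) * norm (b k (1 * t + (- real (Suc j))))"
        unfolding T_eq[OF j] by (simp add: W_def norm_mult)
      also have "\<dots> \<le> \<bar>A\<bar> * (2 powr \<bar>p\<bar> * t powr p) * \<bar>M k\<bar>"
      proof (intro mult_mono 1)
        show "norm (b k (1 * t + (- real (Suc j)))) \<le> \<bar>M k\<bar>" using M[of k "1 * t + (- real (Suc j))"] by linarith
      qed auto
      finally show ?thesis by (simp only: mult_ac)
    qed
    then show "\<exists>C. \<forall>t\<ge>1 / 2. norm (T k t) \<le> C * t powr (s - real k)" unfolding p_def by blast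
  qed
  moreover have "T 0 (real N) = d N" if N: "N \<ge> 1" for N
  proof -
    obtain j where j: "N = Suc j" using N by (cases N) auto
    have "T 0 (real N) = W j 0 (real N)" by (rule T_eq) (simp add: j)
    then show ?thesis by (simp add: W_def j b0)
  qed
  ultimately show ?thesis by (rule that)
qed

text \<open>The Borel sum \<open>Y\<close> realises the powers, and \<open>g - C - Y\<close> at the
  integers decays faster than any power; interpolating it makes the agreement with \<open>g\<close>
  exact.\<close>

lemma symbol_of_power_expansion:
  fixes \<epsilon> :: "'i \<Rightarrow> real" and c :: "'i \<Rightarrow> complex" and g :: "nat \<Rightarrow> complex"
  assumes fin: "\<And>K. finite {i. K \<le> \<epsilon> i}"
    and g: "\<And>K. (\<lambda>N. g N - (power_partial_sum \<epsilon> c K (real N) + C)) \<in> o[sequentially](\<lambda>N. of_real (real N powr K))"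
  shows "symbol_in_N g"
proof -
  \<comment> \<open>Above every exponent, as the nonnegative ones are finitely many, and at least 1,
    so that the constant \<open>C\<close> is a symbol of this order too.\<close>
  define s where "s = Max (insert 0 (\<epsilon> ` {i. 0 \<le> \<epsilon> i})) + 1"
  have s0: "s \<ge> 1" unfolding s_def using fin[of 0] by (simp add: Max_ge)
  have s: "\<epsilon> i < s" for i
  proof (cases "0 \<le> \<epsilon> i")
    case True
    then have "\<epsilon> i \<le> Max (insert 0 (\<epsilon> ` {i. 0 \<le> \<epsilon> i}))" using fin[of 0] by (intro Max_ge) auto
    then show ?thesis by (simp add: s_def)
  qed (use s0 in linarith)
  obtain Y where Y: "symbol_system s Y"
    "\<And>J. \<exists>T. \<forall>t\<ge>T. norm (Y 0 t - power_partial_sum \<epsilon> c (- real J) t) \<le> 2 * t powr (- real J)"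
    using borel_sum[of \<epsilon> s c, OF fin _ s] s0 by auto
  define d where "d N = g N - C - Y 0 (real N)" for N
  have "\<exists>A. \<forall>N\<ge>1. norm (d N) \<le> A * real N powr (- real J)" for J
  proof -
    let ?w = "\<lambda>N. real N powr (- real J)"
    obtain T where T: "\<And>t. t \<ge> T \<Longrightarrow> norm (Y 0 t - power_partial_sum \<epsilon> c (- real J) t) \<le> 2 * t powr (- real J)" using Y(2) by blast
    have "eventually (\<lambda>N. norm (g N - (power_partial_sum \<epsilon> c (- real J) (real N) + C)) \<le> 1 * norm (complex_of_real (?w N))) sequentially"
      by (rule landau_o.smallD[OF g]) simp
    then have "eventually (\<lambda>N. norm (d N) \<le> 3 * ?w N) sequentially"
      using eventually_ge_at_top[of "nat \<lceil>T\<rceil>"]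
    proof eventually_elim
      case (elim N)
      let ?P = "power_partial_sum \<epsilon> c (- real J) (real N)"
      have "d N = (g N - (?P + C)) - (Y 0 (real N) - ?P)" by (simp add: d_def)
      then have "norm (d N) \<le> norm (g N - (?P + C)) + norm (Y 0 (real N) - ?P)" by (simp only: norm_triangle_ineq4)
      moreover have "norm (Y 0 (real N) - ?P) \<le> 2 * ?w N" using elim(2) by (intro T) linarith
      ultimately show ?case using elim(1) by simp
    qed
    then obtain N0 where N0: "\<And>N. N \<ge> N0 \<Longrightarrow> norm (d N) \<le> 3 * ?w N" unfolding eventually_sequentially by blast
    \<comment> \<open>The asymptotic bound holds from \<open>N0\<close> on; the sum takes care of
      the finitely many smaller \<open>N\<close>.\<close>
    define A where "A = 3 + (\<Sum>N<N0. norm (d N) * real N powr real J)"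
    have sum0: "(\<Sum>N<N0. norm (d N) * real N powr real J) \<ge> 0" by (intro sum_nonneg) auto
    have "norm (d N) \<le> A * ?w N" if N: "N \<ge> 1" for N
    proof (cases "N \<ge> N0")
      case True
      have "3 * ?w N \<le> A * ?w N" using sum0 by (intro mult_right_mono) (auto simp: A_def)
      then show ?thesis using N0[OF True] by simp
    next
      case False
      then have "norm (d N) * real N powr real J \<le> (\<Sum>N<N0. norm (d N) * real N powr real J)"
        by (intro member_le_sum) auto
      then have "norm (d N) * real N powr real J \<le> A" by (simp add: A_def)
      then have "norm (d N) * real N powr real J * ?w N \<le> A * ?w N" by (intro mult_right_mono) auto
      moreover have "real N powr real J * ?w N = 1" using N by (simp flip: powr_add)
      ultimately show ?thesis by (simp add: mult.assoc)
    qed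
    then show ?thesis by blast
  qed
  then obtain T where T: "symbol_system s T" "\<And>N. N \<ge> 1 \<Longrightarrow> T 0 (real N) = d N"
    using interpolating_symbol[of d s] by blast
  define Z where "Z = (\<lambda>k t. (Y k t + T k t) + (if k = 0 then C else 0))"
  have "symbol_system s Z" unfolding Z_def using s0 by (intro symbol_system_add symbol_system_const Y T) simp
  then have "symbol s (\<lambda>x::real^1. Z 0 (x $ 1))" by (rule symbol_system_symbol)
  moreover have "Z 0 (vec (real N) $ (1::1)) = g N" if "N > 0" for N
    using that T(2)[of N] by (simp add: Z_def d_def)
  ultimately show ?thesis unfolding symbol_in_N_def by blast
qed

theorem theorem1:
  fixes \<Delta> :: "(real^'n) set"
    and u :: "'m::finite \<Rightarrow> real^'n"
    and a :: "'m \<Rightarrow> int"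
    and r :: real
    and f :: "real^'n \<Rightarrow> complex"
  assumes "regular_lattice_polytope \<Delta>"
    and "0 \<in> interior \<Delta>"
    and "\<Delta> = {x. \<forall>i. 0 \<le> x \<bullet> u i + of_int (a i)}"
    and "bij_betw (\<lambda>i. {x \<in> \<Delta>. x \<bullet> u i + of_int (a i) = 0}) UNIV {F. F facet_of \<Delta>}"
    and "\<forall>i. primitive_vector (u i)"
    and "\<forall>i. 0 < a i"
    and "f \<in> polyhomogeneous r"
  shows "symbol_in_N (\<lambda>N. lattice_sum \<Delta> N f - polytope_integral u a (real N) 0 f) \<and>
    (\<exists>C. \<forall>e F. polyhomogeneous_expansion r f e F \<longrightarrow>
       has_todd_expansion (\<lambda>N. lattice_sum \<Delta> N f - polytope_integral u a (real N) 0 f)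
         u a e F C)"
proof -
  interpret regular_polytope \<Delta> u a by (rule regular_polytope.intro) (rule assms)+
  define g where "g = (\<lambda>N. lattice_sum \<Delta> N f - polytope_integral u a (real N) 0 f)"
  obtain e F where f: "smooth f" and E: "polyhomogeneous_expansion r f e F"
    using assms(7) unfolding polyhomogeneous_def by blast
  obtain c C where *: "\<And>K. (\<lambda>N. g N - (power_partial_sum (\<lambda>(k, \<gamma>::'m \<Rightarrow> nat). e k + real CARD('n) - real (multi_order \<gamma>)) c K (real N) + C)) \<in> o[sequentially](\<lambda>N. of_real (real N powr K))"
    "\<And>K. finite {i. K \<le> (case i of (k, \<gamma>::'m \<Rightarrow> nat) \<Rightarrow> e k + real CARD('n) - real (multi_order \<gamma>))}"
    and C: "has_todd_expansion g u a e F C"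
    unfolding g_def by (rule power_expansion[OF f E]) blast
  have "symbol_in_N g" by (rule symbol_of_power_expansion[OF *(2,1)])
  \<comment> \<open>Each expansion of \<open>f\<close> has some constant by the existence argument,
    and uniqueness identifies it with the one already fixed.\<close>
  moreover have "has_todd_expansion g u a e' F' C" if E': "polyhomogeneous_expansion r f e' F'" for e' F'
  proof -
    obtain C' where "has_todd_expansion g u a e' F' C'"
      unfolding g_def by (rule power_expansion[OF f E']) blast
    then show ?thesis using todd_constant_unique[OF E E' C] by simp
  qed
  ultimately show ?thesis unfolding g_def by blast
qed

end
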